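(* Let $\mathcal{G}=(X,Y,A,B,\lambda)$ be an imitation game and let $p$ be a non-signalling correlation on $(X,Y,A,B)$. The following statements are equivalent: (i) $p\in\mathcal{C}_{\rm qs}(\mathcal{G})$; (ii) $p\in\mathcal{C}_{\rm q}(\mathcal{G})$; (iii) $p\in\mathcal{C}_{\rm qm}(\mathcal{G})$; (iv) the game C*-algebra $C^*(\mathcal{G})$ is nonzero, and there exist a finite-dimensional C*-algebra $\mathcal{F}$ with a tracial state $\tau$ and a unital *-homomorphism $\pi:C^*(\mathcal{G})\to\mathcal{F}$ such that $p(a,b|x,y)=(\tau\circ\pi)(p_{x,a}q_{y,b})$ for all $(x,y,a,b)\in X\times Y\times A\times B$.
   Context: $X,Y,A,B$ are finite non-empty sets. A non-signalling game is a tuple $\mathcal{G}=(X,Y,A,B,\lambda)$ with $\lambda:X\times Y\times A\times B\to\{0,1\}$. It is an imitation game if: (1) for every $x\in X$ and $a,a'\in A$ with $a\ne a'$ there is $y\in Y$ with $\sum_{b\in B}\lambda(x,y,a,b)\lambda(x,y,a',b)=0$; and (2) for every $y\in Y$ and $b,b'\in B$ with $b\neq b'$ there is $x\in X$ with $\sum_{a\in A}\lambda(x,y,a,b)\lambda(x,y,a,b')=0$. The game C*-algebra $C^*(\mathcal{G})$ is the universal unital C*-algebra generated by projections $(p_{x,a})_{x\in X,a\in A}$ and $(q_{y,b})_{y\in Y,b\in B}$ satisfying $\sum_{a}p_{x,a}=1$ for every $x$, $\sum_{b}q_{y,b}=1$ for every $y$, and $p_{x,a}q_{y,b}=0$ whenever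 $\lambda(x,y,a,b)=0$. The zero C*-algebra is regarded as a unital C*-algebra, so $C^*(\mathcal{G})=\{0\}$ is possible. A non-signalling correlation on $(X,Y,A,B)$ is a family $p=\{p(a,b|x,y)\}$ such that each $p(\cdot,\cdot|x,y)$ is a probability distribution on $A\times B$, $\sum_{b}p(a,b|x,y)=\sum_b p(a,b|x,y')$ for all $x,y,y',a$, and $\sum_a p(a,b|x,y)=\sum_a p(a,b|x',y)$ for all $x,x',y,b$. A PVM is a finite tuple of projections on a Hilbert space summing to the identity. - $\mathcal{C}_{\rm qs}$: the correlations $p(a,b|x,y)=\langle\xi|P_{x,a}\otimes Q_{y,b}|\xi\rangle$ with $\mathcal{H}$ a Hilbert space, $\xi\in\mathcal{H}\otimes\mathcal{H}$ a unit vector, $(P_{x,a})_{a\in A}$, $(Q_{y,b})_{b\in B}$ PVMs on $\mathcal{H}$ for all $x,y$. - $\mathcal{C}_{\rm q}$: as $\mathcal{C}_{\rm qs}$ but with $\mathcal{H}$ finite-dimensional. - $\mathcal{C}_{\rm qm}$: the convex hull of the correlations of the form $p(a,b|x,y)=\langle\eta|P_{x,a}\otimes Q_{y,b}|\eta\rangle$ with $\mathcal{H}$ finite-dimensional with fixed orthonormal basis $|1\rangle,\dots,|d\rangle$, $\eta=d^{-1/2}\sum_{i=1}^d|i\rangle\otimes|i\rangle$ the maximally entangled vector, and $(P_{x,a})_a$, $(Q_{y,b})_b$ PVMs on $\mathcal{H}$. For each class, $\mathcal{C}_{\rm x}(\mathcal{G})=\{p\in\mathcal{C}_{\rm x}:\lambda(x,y,a,b)=0\Rightarrow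 p(a,b|x,y)=0\}$. *)

theory Defs
  imports
    "HOL-Analysis.Analysis"
    "HOL-Algebra.Module"
    "HOL-Library.Poly_Mapping"
begin

section \<open>Hilbert spaces\<close>

text \<open>
  Hilbert spaces and C*-algebras are records with an explicit carrier, because HOL cannot quantify
  existentially over types.  The linear structure is that of \<^locale>\<open>Module.module\<close>;
  for Hilbert spaces the multiplicative fields of the module record are unused.
\<close>

definition complex_ring :: "complex ring" where
  "complex_ring = \<lparr>carrier = UNIV, monoid.mult = (*), one = 1, zero = 0, add = (+)\<rparr>"

definition fin_dim :: "(complex, 'v, 'm) module_scheme \<Rightarrow> bool" where
  "fin_dim M \<longleftrightarrow> (\<exists>S. finite S \<and> S \<subseteq> carrier M \<and>
     (\<forall>v\<in>carrier M. \<exists>c. v = (\<Oplus>\<^bsub>M\<^esub>s\<in>S. c s \<odot>\<^bsub>M\<^esub> s)))"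

record 'v hilbert = "(complex, 'v) module" +
  ip :: "'v \<Rightarrow> 'v \<Rightarrow> complex"

definition hnorm :: "('v, 'm) hilbert_scheme \<Rightarrow> 'v \<Rightarrow> real" where
  "hnorm H v = sqrt (Re (ip H v v))"

text \<open>Inner products are linear in the second argument, as in the bra-ket convention.\<close>

locale hilbert_space = Module.module complex_ring H for H (structure) +
  assumes ip_add: "\<lbrakk>u \<in> carrier H; v \<in> carrier H; w \<in> carrier H\<rbrakk>
      \<Longrightarrow> ip H u (v \<oplus> w) = ip H u v + ip H u w"
    and ip_smult: "\<lbrakk>u \<in> carrier H; v \<in> carrier H\<rbrakk> \<Longrightarrow> ip H u (c \<odot> v) = c * ip H u v"
    and ip_cnj: "\<lbrakk>u \<in> carrier H; v \<in> carrier H\<rbrakk> \<Longrightarrow> ip H v u = cnj (ip H u v)"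
    and ip_pos: "\<lbrakk>v \<in> carrier H; v \<noteq> \<zero>\<rbrakk> \<Longrightarrow> 0 < Re (ip H v v)"
    and hilbert_complete:
      "\<lbrakk>\<And>n::nat. F n \<in> carrier H; \<forall>\<epsilon>>0. \<exists>N. \<forall>m\<ge>N. \<forall>n\<ge>N. hnorm H (F m \<ominus> F n) < \<epsilon>\<rbrakk>
      \<Longrightarrow> \<exists>l\<in>carrier H. (\<lambda>n. hnorm H (F n \<ominus> l)) \<longlonglongrightarrow> 0"

definition bounded_op :: "('v, 'm) hilbert_scheme \<Rightarrow> ('v \<Rightarrow> 'v) \<Rightarrow> bool" where
  "bounded_op H T \<longleftrightarrow> T \<in> carrier H \<rightarrow> carrier H \<and>
     (\<forall>u\<in>carrier H. \<forall>v\<in>carrier H. T (u \<oplus>\<^bsub>H\<^esub> v) = T u \<oplus>\<^bsub>H\<^esub> T v) \<and>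
     (\<forall>c. \<forall>v\<in>carrier H. T (c \<odot>\<^bsub>H\<^esub> v) = c \<odot>\<^bsub>H\<^esub> T v) \<and>
     (\<exists>C. \<forall>v\<in>carrier H. hnorm H (T v) \<le> C * hnorm H v)"

definition projection :: "('v, 'm) hilbert_scheme \<Rightarrow> ('v \<Rightarrow> 'v) \<Rightarrow> bool" where
  "projection H P \<longleftrightarrow> bounded_op H P \<and> (\<forall>v\<in>carrier H. P (P v) = P v) \<and>
     (\<forall>u\<in>carrier H. \<forall>v\<in>carrier H. ip H (P u) v = ip H u (P v))"

definition pvm :: "('v, 'm) hilbert_scheme \<Rightarrow> ('a::finite \<Rightarrow> 'v \<Rightarrow> 'v) \<Rightarrow> bool" where
  "pvm H P \<longleftrightarrow> (\<forall>a. projection H (P a)) \<and> (\<forall>v\<in>carrier H. (\<Oplus>\<^bsub>H\<^esub>a\<in>UNIV. P a v) = v)"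

text \<open>
  \<open>hilbert_tensor H K t\<close>: the Hilbert space \<open>K\<close>, with \<open>t u v\<close> in the role of \<open>u \<otimes> v\<close>, is the Hilbert
  space tensor product of \<open>H\<close> with itself.  This determines \<open>(K, t)\<close> up to a unique unitary.
\<close>

definition hilbert_tensor ::
  "('v, 'm) hilbert_scheme \<Rightarrow> ('w, 'n) hilbert_scheme \<Rightarrow> ('v \<Rightarrow> 'v \<Rightarrow> 'w) \<Rightarrow> bool" where
  "hilbert_tensor H K t \<longleftrightarrow> hilbert_space H \<and> hilbert_space K \<and>
     (\<forall>u\<in>carrier H. \<forall>v\<in>carrier H. t u v \<in> carrier K) \<and>
     (\<forall>u\<in>carrier H. \<forall>u'\<in>carrier H. \<forall>v\<in>carrier H.
        t (u \<oplus>\<^bsub>H\<^esub> u') v = t u v \<oplus>\<^bsub>K\<^esub> t u' v \<and> t v (u \<oplus>\<^bsub>H\<^esub> u') = t v u \<oplus>\<^bsub>K\<^esub> t v u') \<and>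
     (\<forall>c. \<forall>u\<in>carrier H. \<forall>v\<in>carrier H.
        t (c \<odot>\<^bsub>H\<^esub> u) v = c \<odot>\<^bsub>K\<^esub> t u v \<and> t u (c \<odot>\<^bsub>H\<^esub> v) = c \<odot>\<^bsub>K\<^esub> t u v) \<and>
     (\<forall>u\<in>carrier H. \<forall>v\<in>carrier H. \<forall>u'\<in>carrier H. \<forall>v'\<in>carrier H.
        ip K (t u v) (t u' v') = ip H u u' * ip H v v') \<and>
     (\<forall>k\<in>carrier K. \<forall>\<epsilon>>0. \<exists>(n::nat) u v. (\<forall>i<n. u i \<in> carrier H \<and> v i \<in> carrier H) \<and>
        hnorm K (k \<ominus>\<^bsub>K\<^esub> (\<Oplus>\<^bsub>K\<^esub>i\<in>{..<n}. t (u i) (v i))) < \<epsilon>)"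

text \<open>\<open>T\<close> is (on the carrier of \<open>K\<close>) the operator \<open>P \<otimes> Q\<close>.\<close>

definition op_tensor ::
  "('v, 'm) hilbert_scheme \<Rightarrow> ('w, 'n) hilbert_scheme \<Rightarrow> ('v \<Rightarrow> 'v \<Rightarrow> 'w) \<Rightarrow>
   ('v \<Rightarrow> 'v) \<Rightarrow> ('v \<Rightarrow> 'v) \<Rightarrow> ('w \<Rightarrow> 'w) \<Rightarrow> bool" where
  "op_tensor H K t P Q T \<longleftrightarrow> bounded_op K T \<and>
     (\<forall>u\<in>carrier H. \<forall>v\<in>carrier H. T (t u v) = t (P u) (Q v))"

section \<open>Games and correlations\<close>

text \<open>
  The finite non-empty sets \<open>X, Y, A, B\<close> are types of class \<^class>\<open>finite\<close>.  A correlation is a vector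
  indexed by \<open>X \<times> Y \<times> A \<times> B\<close>, with \<open>p $ (x, y, a, b)\<close> standing for \<open>p(a, b | x, y)\<close>.
\<close>

definition imitation_game ::
  "('x::finite \<Rightarrow> 'y::finite \<Rightarrow> 'a::finite \<Rightarrow> 'b::finite \<Rightarrow> nat) \<Rightarrow> bool" where
  "imitation_game lam \<longleftrightarrow>
     (\<forall>x y a b. lam x y a b \<in> {0, 1}) \<and>
     (\<forall>x a a'. a \<noteq> a' \<longrightarrow> (\<exists>y. (\<Sum>b\<in>UNIV. lam x y a b * lam x y a' b) = 0)) \<and>
     (\<forall>y b b'. b \<noteq> b' \<longrightarrow> (\<exists>x. (\<Sum>a\<in>UNIV. lam x y a b * lam x y a b') = 0))"

definition nonsignalling :: "real ^ ('x::finite \<times> 'y::finite \<times> 'a::finite \<times> 'b::finite) \<Rightarrow> bool" where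
  "nonsignalling p \<longleftrightarrow>
     (\<forall>x y a b. 0 \<le> p $ (x, y, a, b)) \<and>
     (\<forall>x y. (\<Sum>a\<in>UNIV. \<Sum>b\<in>UNIV. p $ (x, y, a, b)) = 1) \<and>
     (\<forall>x y y' a. (\<Sum>b\<in>UNIV. p $ (x, y, a, b)) = (\<Sum>b\<in>UNIV. p $ (x, y', a, b))) \<and>
     (\<forall>x x' y b. (\<Sum>a\<in>UNIV. p $ (x, y, a, b)) = (\<Sum>a\<in>UNIV. p $ (x', y, a, b)))"

text \<open>\<open>p(a, b | x, y) = \<langle>\<xi>| P x a \<otimes> Q y b |\<xi>\<rangle>\<close>, with \<open>\<xi>\<close> in \<open>K = H \<otimes> H\<close>:\<close>

definition tensor_correlation ::
  "'v hilbert \<Rightarrow> 'w hilbert \<Rightarrow> ('v \<Rightarrow> 'v \<Rightarrow> 'w) \<Rightarrow> 'w \<Rightarrow>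
   ('x \<Rightarrow> 'a \<Rightarrow> 'v \<Rightarrow> 'v) \<Rightarrow> ('y \<Rightarrow> 'b \<Rightarrow> 'v \<Rightarrow> 'v) \<Rightarrow>
   real ^ ('x::finite \<times> 'y::finite \<times> 'a::finite \<times> 'b::finite) \<Rightarrow> bool" where
  "tensor_correlation H K t \<xi> P Q p \<longleftrightarrow>
     (\<forall>x. pvm H (P x)) \<and> (\<forall>y. pvm H (Q y)) \<and>
     (\<forall>x y a b. \<exists>T. op_tensor H K t (P x a) (Q y b) T \<and>
        complex_of_real (p $ (x, y, a, b)) = ip K \<xi> (T \<xi>))"

text \<open>
  The type argument of the correlation classes is the type in which the vectors of the Hilbert
  spaces \<open>H\<close> and \<open>H \<otimes> H\<close> live.  An infinite-dimensional \<open>H\<close> has the same cardinality as \<open>H \<otimes> H\<close>,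
  and all nonzero finite-dimensional spaces have that of the continuum, so using one type for both
  is no restriction once it has at least the cardinality of the continuum.  The types to use are
  \<open>'i + nat \<Rightarrow> complex\<close> with \<open>'i\<close> a free type variable: they are always that large, and every complex
  Hilbert space is isomorphic to one carried by such a type (take for \<open>'i\<close> an orthonormal basis).
\<close>

definition C_qs ::
  "'v itself \<Rightarrow> (real ^ ('x::finite \<times> 'y::finite \<times> 'a::finite \<times> 'b::finite)) set" where
  "C_qs _ = {p. \<exists>(H :: 'v hilbert) (K :: 'v hilbert) t \<xi> P Q. hilbert_tensor H K t \<and>
     \<xi> \<in> carrier K \<and> hnorm K \<xi> = 1 \<and> tensor_correlation H K t \<xi> P Q p}"

definition C_q ::
  "'v itself \<Rightarrow> (real ^ ('x::finite \<times> 'y::finite \<times> 'a::finite \<times> 'b::finite)) set" where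
  "C_q _ = {p. \<exists>(H :: 'v hilbert) (K :: 'v hilbert) t \<xi> P Q. hilbert_tensor H K t \<and> fin_dim H \<and>
     \<xi> \<in> carrier K \<and> hnorm K \<xi> = 1 \<and> tensor_correlation H K t \<xi> P Q p}"

definition orthonormal_basis :: "('v, 'm) hilbert_scheme \<Rightarrow> nat \<Rightarrow> (nat \<Rightarrow> 'v) \<Rightarrow> bool" where
  "orthonormal_basis H d e \<longleftrightarrow> (\<forall>i<d. e i \<in> carrier H) \<and>
     (\<forall>i<d. \<forall>j<d. ip H (e i) (e j) = (if i = j then 1 else 0)) \<and>
     (\<forall>v\<in>carrier H. \<exists>c. v = (\<Oplus>\<^bsub>H\<^esub>i\<in>{..<d}. c i \<odot>\<^bsub>H\<^esub> e i))"

definition max_entangled ::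
  "('w, 'n) hilbert_scheme \<Rightarrow> ('v \<Rightarrow> 'v \<Rightarrow> 'w) \<Rightarrow> nat \<Rightarrow> (nat \<Rightarrow> 'v) \<Rightarrow> 'w" where
  "max_entangled K t d e =
     complex_of_real (1 / sqrt (real d)) \<odot>\<^bsub>K\<^esub> (\<Oplus>\<^bsub>K\<^esub>i\<in>{..<d}. t (e i) (e i))"

definition C_qm ::
  "'v itself \<Rightarrow> (real ^ ('x::finite \<times> 'y::finite \<times> 'a::finite \<times> 'b::finite)) set" where
  "C_qm _ = convex hull {p. \<exists>(H :: 'v hilbert) (K :: 'v hilbert) t d e P Q. hilbert_tensor H K t \<and>
     0 < d \<and> orthonormal_basis H d e \<and> tensor_correlation H K t (max_entangled K t d e) P Q p}"

definition perfect ::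
  "('x::finite \<Rightarrow> 'y::finite \<Rightarrow> 'a::finite \<Rightarrow> 'b::finite \<Rightarrow> nat) \<Rightarrow>
   (real ^ ('x \<times> 'y \<times> 'a \<times> 'b)) set \<Rightarrow> (real ^ ('x \<times> 'y \<times> 'a \<times> 'b)) set" where
  "perfect lam C = {p \<in> C. \<forall>x y a b. lam x y a b = 0 \<longrightarrow> p $ (x, y, a, b) = 0}"

section \<open>C*-algebras\<close>

record 'c cstar = "(complex, 'c) module" +
  star :: "'c \<Rightarrow> 'c"
  cnorm :: "'c \<Rightarrow> real"

text \<open>Unital C*-algebras, the zero algebra included.\<close>

locale cstar_algebra = ring F + Module.module complex_ring F for F (structure) +
  assumes smult_mult_left: "\<lbrakk>u \<in> carrier F; v \<in> carrier F\<rbrakk> \<Longrightarrow> (c \<odot> u) \<otimes> v = c \<odot> (u \<otimes> v)"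
    and smult_mult_right: "\<lbrakk>u \<in> carrier F; v \<in> carrier F\<rbrakk> \<Longrightarrow> u \<otimes> (c \<odot> v) = c \<odot> (u \<otimes> v)"
    and star_closed: "u \<in> carrier F \<Longrightarrow> star F u \<in> carrier F"
    and star_star: "u \<in> carrier F \<Longrightarrow> star F (star F u) = u"
    and star_add: "\<lbrakk>u \<in> carrier F; v \<in> carrier F\<rbrakk> \<Longrightarrow> star F (u \<oplus> v) = star F u \<oplus> star F v"
    and star_smult: "u \<in> carrier F \<Longrightarrow> star F (c \<odot> u) = cnj c \<odot> star F u"
    and star_mult: "\<lbrakk>u \<in> carrier F; v \<in> carrier F\<rbrakk> \<Longrightarrow> star F (u \<otimes> v) = star F v \<otimes> star F u"
    and cnorm_pos: "\<lbrakk>u \<in> carrier F; u \<noteq> \<zero>\<rbrakk> \<Longrightarrow> 0 < cnorm F u"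
    and cnorm_add: "\<lbrakk>u \<in> carrier F; v \<in> carrier F\<rbrakk> \<Longrightarrow> cnorm F (u \<oplus> v) \<le> cnorm F u + cnorm F v"
    and cnorm_smult: "u \<in> carrier F \<Longrightarrow> cnorm F (c \<odot> u) = cmod c * cnorm F u"
    and cnorm_mult: "\<lbrakk>u \<in> carrier F; v \<in> carrier F\<rbrakk> \<Longrightarrow> cnorm F (u \<otimes> v) \<le> cnorm F u * cnorm F v"
    and cstar_identity: "u \<in> carrier F \<Longrightarrow> cnorm F (star F u \<otimes> u) = (cnorm F u)\<^sup>2"
    and cstar_complete:
      "\<lbrakk>\<And>n::nat. f n \<in> carrier F; \<forall>\<epsilon>>0. \<exists>N. \<forall>m\<ge>N. \<forall>n\<ge>N. cnorm F (f m \<ominus> f n) < \<epsilon>\<rbrakk>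
      \<Longrightarrow> \<exists>l\<in>carrier F. (\<lambda>n. cnorm F (f n \<ominus> l)) \<longlonglongrightarrow> 0"

definition tracial_state :: "('c, 'm) cstar_scheme \<Rightarrow> ('c \<Rightarrow> complex) \<Rightarrow> bool" where
  "tracial_state F \<tau> \<longleftrightarrow>
     (\<forall>u\<in>carrier F. \<forall>v\<in>carrier F. \<tau> (u \<oplus>\<^bsub>F\<^esub> v) = \<tau> u + \<tau> v) \<and>
     (\<forall>c. \<forall>u\<in>carrier F. \<tau> (c \<odot>\<^bsub>F\<^esub> u) = c * \<tau> u) \<and>
     (\<forall>u\<in>carrier F. \<tau> (star F u \<otimes>\<^bsub>F\<^esub> u) \<in> \<real>\<^sub>\<ge>\<^sub>0) \<and>
     \<tau> \<one>\<^bsub>F\<^esub> = 1 \<and>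
     (\<forall>u\<in>carrier F. \<forall>v\<in>carrier F. \<tau> (u \<otimes>\<^bsub>F\<^esub> v) = \<tau> (v \<otimes>\<^bsub>F\<^esub> u))"

definition unital_star_hom ::
  "('c, 'm) cstar_scheme \<Rightarrow> ('d, 'n) cstar_scheme \<Rightarrow> ('c \<Rightarrow> 'd) \<Rightarrow> bool" where
  "unital_star_hom E F \<pi> \<longleftrightarrow> \<pi> \<in> ring_hom E F \<and>
     (\<forall>c. \<forall>u\<in>carrier E. \<pi> (c \<odot>\<^bsub>E\<^esub> u) = c \<odot>\<^bsub>F\<^esub> \<pi> u) \<and>
     (\<forall>u\<in>carrier E. \<pi> (star E u) = star F (\<pi> u))"

section \<open>The game C*-algebra\<close>

text \<open>
  The universal C*-algebra is constructed in the usual way: take the free unital *-algebra on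
  self-adjoint generators, the supremum of all its C*-seminorms that vanish on the relations, and
  the Hausdorff completion with respect to this supremum.
  The free algebra consists of the finitely supported functions on words, with the convolution
  product of \<^theory>\<open>HOL-Library.Poly_Mapping\<close>; the involution reverses words and conjugates
  coefficients.
\<close>

datatype ('x, 'y, 'a, 'b) generator = Pgen 'x 'a | Qgen 'y 'b

datatype 'g word = Word (letters: "'g list")

instantiation word :: (type) monoid_add
begin

definition zero_word :: "'g word" where
  "zero_word = Word []"

definition plus_word :: "'g word \<Rightarrow> 'g word \<Rightarrow> 'g word" where
  "plus_word v w = Word (letters v @ letters w)"

instance
  by standard (simp_all add: zero_word_def plus_word_def)

end

type_synonym 'g free_alg = "'g word \<Rightarrow>\<^sub>0 complex"

definition gen :: "'g \<Rightarrow> 'g free_alg" where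
  "gen g = Poly_Mapping.single (Word [g]) 1"

definition free_smult :: "complex \<Rightarrow> 'g free_alg \<Rightarrow> 'g free_alg" where
  "free_smult c f = Poly_Mapping.map ((*) c) f"

definition free_star :: "'g free_alg \<Rightarrow> 'g free_alg" where
  "free_star f = Poly_Mapping.map_key (\<lambda>w. Word (rev (letters w))) (Poly_Mapping.map cnj f)"

definition game_relators ::
  "('x::finite \<Rightarrow> 'y::finite \<Rightarrow> 'a::finite \<Rightarrow> 'b::finite \<Rightarrow> nat) \<Rightarrow>
   ('x, 'y, 'a, 'b) generator free_alg set" where
  "game_relators lam =
     range (\<lambda>g. gen g * gen g - gen g) \<union>
     range (\<lambda>x. (\<Sum>a\<in>UNIV. gen (Pgen x a)) - 1) \<union>
     range (\<lambda>y. (\<Sum>b\<in>UNIV. gen (Qgen y b)) - 1) \<union>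
     {gen (Pgen x a) * gen (Qgen y b) | x y a b. lam x y a b = 0}"

definition cstar_seminorm :: "('g free_alg \<Rightarrow> real) \<Rightarrow> bool" where
  "cstar_seminorm s \<longleftrightarrow>
     (\<forall>f h. s (f + h) \<le> s f + s h) \<and>
     (\<forall>c f. s (free_smult c f) = cmod c * s f) \<and>
     (\<forall>f h. s (f * h) \<le> s f * s h) \<and>
     (\<forall>f. s (free_star f * f) = (s f)\<^sup>2)"

text \<open>
  The supremum is over a non-empty set (it contains the zero seminorm), and it is finite since
  a C*-seminorm is at most 1 on projections.
\<close>

definition game_seminorm ::
  "('x::finite \<Rightarrow> 'y::finite \<Rightarrow> 'a::finite \<Rightarrow> 'b::finite \<Rightarrow> nat) \<Rightarrow>
   ('x, 'y, 'a, 'b) generator free_alg \<Rightarrow> real" where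
  "game_seminorm lam f =
     (SUP s\<in>{s. cstar_seminorm s \<and> (\<forall>r\<in>game_relators lam. s r = 0)}. s f)"

definition game_cauchy ::
  "('x::finite \<Rightarrow> 'y::finite \<Rightarrow> 'a::finite \<Rightarrow> 'b::finite \<Rightarrow> nat) \<Rightarrow>
   (nat \<Rightarrow> ('x, 'y, 'a, 'b) generator free_alg) set" where
  "game_cauchy lam =
     {F. \<forall>\<epsilon>>0. \<exists>N. \<forall>m\<ge>N. \<forall>n\<ge>N. game_seminorm lam (F m - F n) < \<epsilon>}"

definition game_rel ::
  "('x::finite \<Rightarrow> 'y::finite \<Rightarrow> 'a::finite \<Rightarrow> 'b::finite \<Rightarrow> nat) \<Rightarrow>
   (nat \<Rightarrow> ('x, 'y, 'a, 'b) generator free_alg) rel" where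
  "game_rel lam = {(F, F'). F \<in> game_cauchy lam \<and> F' \<in> game_cauchy lam \<and>
     (\<lambda>n. game_seminorm lam (F n - F' n)) \<longlonglongrightarrow> 0}"

definition game_cstar ::
  "('x::finite \<Rightarrow> 'y::finite \<Rightarrow> 'a::finite \<Rightarrow> 'b::finite \<Rightarrow> nat) \<Rightarrow>
   (nat \<Rightarrow> ('x, 'y, 'a, 'b) generator free_alg) set cstar" where
  "game_cstar lam = \<lparr>
     carrier = game_cauchy lam // game_rel lam,
     monoid.mult = (\<lambda>U V. \<Union>F\<in>U. \<Union>F'\<in>V. game_rel lam `` {\<lambda>n. F n * F' n}),
     one = game_rel lam `` {\<lambda>_. 1},
     zero = game_rel lam `` {\<lambda>_. 0},
     add = (\<lambda>U V. \<Union>F\<in>U. \<Union>F'\<in>V. game_rel lam `` {\<lambda>n. F n + F' n}),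
     smult = (\<lambda>c U. \<Union>F\<in>U. game_rel lam `` {\<lambda>n. free_smult c (F n)}),
     star = (\<lambda>U. \<Union>F\<in>U. game_rel lam `` {\<lambda>n. free_star (F n)}),
     cnorm = (\<lambda>U. THE r. \<exists>F\<in>U. (\<lambda>n. game_seminorm lam (F n)) \<longlonglongrightarrow> r)\<rparr>"

definition game_gen ::
  "('x::finite \<Rightarrow> 'y::finite \<Rightarrow> 'a::finite \<Rightarrow> 'b::finite \<Rightarrow> nat) \<Rightarrow> ('x, 'y, 'a, 'b) generator \<Rightarrow>
   (nat \<Rightarrow> ('x, 'y, 'a, 'b) generator free_alg) set" where
  "game_gen lam g = game_rel lam `` {\<lambda>_. gen g}"

end

theory Submission
  imports Defs "HOL-Library.Diagonal_Subsequence"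
begin

text \<open>
  Each of the four conditions says that \<open>p\<close> is perfect for the game and lies in the convex hull of the
  tracial correlations, the correlations \<open>tr (P Q\<^sup>T) / n\<close> of \<open>n \<times> n\<close> matrix PVMs.  (A maximally
  entangled vector turns \<open>P \<otimes> Q\<close> into \<open>P Q\<^sup>T\<close>, whence the transpose.)

  From a perfect strategy on \<open>H \<otimes> H\<close> to the hull.  A vector \<open>z\<close> of \<open>H \<otimes> H\<close> defines an antilinear
  map \<open>Z\<close> on \<open>H\<close> by \<open>\<langle>y, Z u\<rangle> = \<langle>u \<otimes> y, z\<rangle>\<close>.  If \<open>p(a, b | x, y) = 0\<close>, then \<open>P x a \<otimes> Q y b\<close> kills \<open>z\<close>,
  which says that \<open>Q y b\<close> kills all vectors \<open>Z (P x a u)\<close>.  Given \<open>a \<noteq> a'\<close>, the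
  imitation property provides a \<open>y\<close> for which no \<open>b\<close> is a winning answer to both, so inserting
  \<open>\<Sum>b. Q y b = 1\<close> between them shows that \<open>Z (P x a u)\<close> and \<open>Z (P x a' u')\<close> are orthogonal.  Hence
  \<open>P x a\<close> commutes with the reduced state \<open>Z\<^sup>* Z\<close>, and by symmetry so does \<open>Q y b\<close> on the other side.
  They preserve its eigenspaces, which are finite-dimensional except for the kernel, and on each
  of them \<open>z\<close> is a multiple of a maximally entangled vector.  So \<open>p\<close> is a countable convex combination
  of tracial correlations (\<open>schmidt_blocks\<close>, \<open>tensor_correlation_in_hull\<close>).  Such a combination stays
  in the convex hull, although the hull need not be closed (\<open>has_sum_in_convex\<close>); this is the step
  from infinite to finite dimension.  A perfect element of \<open>C_qm\<close> is a combination of perfect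
  correlations, since probabilities are non-negative (\<open>perfect_C_qm_in_hull\<close>).

  From the hull to strategies.  Direct sums realise a convex combination by block-diagonal
  matrices and the trace weighted by some \<open>w\<close> that is constant on blocks, so that
  \<open>\<Sum>i. sqrt (w i) e\<^sub>i \<otimes> e\<^sub>i\<close> implements it in finite dimension (\<open>diagonal_correlation\<close>).  The weighted
  trace is a faithful tracial state on the block-diagonal matrices; for a perfect correlation
  faithfulness turns \<open>p(a, b | x, y) = 0\<close> into \<open>P x a (Q y b)\<^sup>T = 0\<close>, so \<open>P\<close> and \<open>Q\<^sup>T\<close> satisfy the
  relations of the game algebra and define a representation of it
  (\<open>transposed_strategy_representation\<close>).

  From a finite-dimensional algebra with a tracial state \<open>\<tau>\<close> to the hull.  Take a basis \<open>e\<^sub>i\<close> that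
  contains the unit and is orthonormal for \<open>\<tau> (u\<^sup>* v)\<close>, and let \<open>L\<close> be the left regular representation.
  The element \<open>c = \<Sum>i. e\<^sub>i e\<^sub>i\<^sup>*\<close> satisfies \<open>tr L\<^sub>a = \<tau> (a c)\<close>; it is therefore central, and it is at
  least 1.  So \<open>\<tau> a = tr (L\<^sub>a L\<^sub>c\<^sup>-\<^sup>1)\<close>, and splitting along the eigenspaces of \<open>L\<^sub>c\<close> exhibits \<open>p\<close> as a
  convex combination of tracial correlations (\<open>tracial_projections_in_hull\<close>).
\<close>

section \<open>Tracial correlations and countable convex combinations\<close>

definition mat_pvm :: "nat set \<Rightarrow> ('a::finite \<Rightarrow> nat \<Rightarrow> nat \<Rightarrow> complex) \<Rightarrow> bool" where
  "mat_pvm B P \<longleftrightarrow>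
     (\<forall>a. \<forall>i\<in>B. \<forall>j\<in>B. P a j i = cnj (P a i j) \<and> (\<Sum>k\<in>B. P a i k * P a k j) = P a i j) \<and>
     (\<forall>i\<in>B. \<forall>j\<in>B. (\<Sum>a\<in>UNIV. P a i j) = (if i = j then 1 else 0))"

text \<open>
  The formula is \<open>tr (D P Q\<^sup>T)\<close> for the density matrix \<open>D = diag w\<close>; the
  condition for \<open>w i \<noteq> w j\<close> says that \<open>P\<close> and \<open>Q\<close> commute with \<open>D\<close>.
\<close>

definition weighted_correlation ::
  "nat set \<Rightarrow> (nat \<Rightarrow> real) \<Rightarrow> ('x \<Rightarrow> 'a \<Rightarrow> nat \<Rightarrow> nat \<Rightarrow> complex) \<Rightarrow>
   ('y \<Rightarrow> 'b \<Rightarrow> nat \<Rightarrow> nat \<Rightarrow> complex) \<Rightarrow>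
   real ^ ('x::finite \<times> 'y::finite \<times> 'a::finite \<times> 'b::finite) \<Rightarrow> bool" where
  "weighted_correlation B w P Q p \<longleftrightarrow>
     finite B \<and> (\<forall>i\<in>B. 0 < w i) \<and> sum w B = 1 \<and>
     (\<forall>x. mat_pvm B (P x)) \<and> (\<forall>y. mat_pvm B (Q y)) \<and>
     (\<forall>i\<in>B. \<forall>j\<in>B. w i \<noteq> w j \<longrightarrow> (\<forall>x a. P x a i j = 0) \<and> (\<forall>y b. Q y b i j = 0)) \<and>
     (\<forall>x y a b. complex_of_real (p $ (x, y, a, b)) =
        (\<Sum>i\<in>B. \<Sum>j\<in>B. of_real (w i) * P x a i j * Q y b i j))"

definition tracial_correlations ::
  "(real ^ ('x::finite \<times> 'y::finite \<times> 'a::finite \<times> 'b::finite)) set" where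
  "tracial_correlations = {p. \<exists>B P Q. weighted_correlation B (\<lambda>_. 1 / real (card B)) P Q p}"

text \<open>
  For closed \<open>C\<close> this is the separation theorem.  Otherwise \<open>p\<close> is at least a point of the closure.
  If it is outside the relative interior, there is a supporting hyperplane through \<open>p\<close>, and as all
  weights are positive, all the points \<open>c l\<close> lie on it; so \<open>C\<close> can be replaced by its intersection
  with this hyperplane, which has smaller dimension.
\<close>

lemma has_sum_in_convex:
  fixes C :: "'e::euclidean_space set"
  assumes "convex C" and "\<And>l. l \<in> L \<Longrightarrow> 0 < w l" and "\<And>l. l \<in> L \<Longrightarrow> c l \<in> C"
    and "(w has_sum 1) L" and "((\<lambda>l. w l *\<^sub>R c l) has_sum p) L"
  shows "p \<in> C"
  using assms(1,3)
proof (induction "nat (aff_dim C + 1)" arbitrary: C rule: less_induct)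
  case less
  have lin: "((\<lambda>l. w l * (u \<bullet> c l)) has_sum (u \<bullet> p)) L" for u
    using has_sum_bounded_linear[OF bounded_linear_inner_right[of u] assms(5)] by simp
  have const: "((\<lambda>l. w l * b) has_sum b) L" for b
    using has_sum_cmult_left[OF assms(4), of b] by simp
  have pcl: "p \<in> closure C"
  proof (rule ccontr)
    assume "p \<notin> closure C"
    then obtain u b where ub: "u \<bullet> p < b" "\<forall>x\<in>closure C. b < u \<bullet> x"
      using separating_hyperplane_closed_point[of "closure C" p] less.prems(1) by auto
    have "b \<le> u \<bullet> p"
      by (rule has_sum_mono[OF const lin])
        (use ub(2) less.prems(2) closure_subset assms(2) in \<open>fastforce intro: mult_left_mono less_imp_le\<close>)
    with ub(1) show False by simp
  qed
  show ?case
  proof (cases "p \<in> rel_interior C")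
    case True
    then show ?thesis using rel_interior_subset by blast
  next
    case False
    then have nri: "p \<notin> rel_interior (closure C)"
      using less.prems(1) by (simp add: convex_rel_interior_closure)
    from supporting_hyperplane_rel_boundary[OF convex_closure[OF less.prems(1)] pcl nri]
    obtain u where u: "\<And>y. y \<in> closure C \<Longrightarrow> u \<bullet> p \<le> u \<bullet> y"
      "\<And>y. y \<in> rel_interior (closure C) \<Longrightarrow> u \<bullet> p < u \<bullet> y" by metis
    have u1: "u \<bullet> p \<le> u \<bullet> c l" if "l \<in> L" for l
      using u(1) less.prems(2)[OF that] closure_subset by blast
    have zero: "((\<lambda>l. w l * (u \<bullet> c l) + - (w l * (u \<bullet> p))) has_sum (u \<bullet> p + - (u \<bullet> p))) L"
      by (intro has_sum_add lin has_sum_uminusI const)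
    have eq: "u \<bullet> c l = u \<bullet> p" if "l \<in> L" for l
    proof -
      have "w l * (u \<bullet> c l) + - (w l * (u \<bullet> p)) = 0"
        by (rule nonneg_has_sum_le_0D[OF _ _ _ that])
          (use zero u1 assms(2) in \<open>auto intro: mult_left_mono less_imp_le\<close>)
      then show ?thesis using assms(2)[OF that] by simp
    qed
    define D where "D = C \<inter> {y. u \<bullet> y = u \<bullet> p}"
    have "C \<noteq> {}" using pcl by auto
    then obtain y where y: "y \<in> rel_interior C"
      using less.prems(1) rel_interior_eq_empty by blast
    have yC: "y \<in> C" using y rel_interior_subset by blast
    have uy: "u \<bullet> p < u \<bullet> y" using u(2) y less.prems(1) convex_rel_interior_closure by blast
    have "affine {y. u \<bullet> y = u \<bullet> p}" by (rule affine_hyperplane)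
    then have "affine hull D \<subseteq> {y. u \<bullet> y = u \<bullet> p}"
      unfolding D_def by (intro hull_minimal) auto
    then have "y \<notin> affine hull D" using uy by auto
    moreover have "affine hull D \<subseteq> affine hull C" unfolding D_def by (intro hull_mono) auto
    moreover have "y \<in> affine hull C" using yC hull_subset by fast
    ultimately have "aff_dim D < aff_dim C" by (intro aff_dim_psubset) auto
    moreover have "-1 \<le> aff_dim D" using aff_dim_geq by blast
    ultimately have "nat (aff_dim D + 1) < nat (aff_dim C + 1)" by linarith
    moreover have "convex D"
      unfolding D_def by (intro convex_Int less.prems(1) convex_hyperplane)
    moreover have "c l \<in> D" if "l \<in> L" for l
      using eq[OF that] less.prems(2)[OF that] by (simp add: D_def)
    ultimately have "p \<in> D" using less.hyps by blast
    then show ?thesis by (simp add: D_def)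
  qed
qed

lemma mat_pvm_herm: "mat_pvm B P \<Longrightarrow> i \<in> B \<Longrightarrow> j \<in> B \<Longrightarrow> P a j i = cnj (P a i j)"
  unfolding mat_pvm_def by blast

lemma mat_pvm_idem:
  "mat_pvm B P \<Longrightarrow> i \<in> B \<Longrightarrow> j \<in> B \<Longrightarrow> (\<Sum>k\<in>B. P a i k * P a k j) = P a i j"
  unfolding mat_pvm_def by blast

lemma mat_pvm_sum:
  "mat_pvm B P \<Longrightarrow> i \<in> B \<Longrightarrow> j \<in> B \<Longrightarrow> (\<Sum>a\<in>UNIV. P a i j) = (if i = j then 1 else 0)"
  unfolding mat_pvm_def by blast

text \<open>
  Row \<open>i\<close> of a projection has squared norm equal to its diagonal entry, and the diagonal entries of
  a PVM at a fixed place add up to 1.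
\<close>

lemma mat_pvm_row:
  assumes "mat_pvm B P" "i \<in> B"
  shows "P a i i = of_real (\<Sum>k\<in>B. (cmod (P a i k))\<^sup>2)" "(\<Sum>k\<in>B. (cmod (P a i k))\<^sup>2) \<le> 1"
proof -
  have *: "P a i i = of_real (\<Sum>k\<in>B. (cmod (P a i k))\<^sup>2)" for a
  proof -
    have "P a i i = (\<Sum>k\<in>B. P a i k * P a k i)"
      using mat_pvm_idem[OF assms(1,2,2), of a] by simp
    also have "\<dots> = (\<Sum>k\<in>B. P a i k * cnj (P a i k))"
      by (intro sum.cong refl arg_cong2[where f = "(*)"] mat_pvm_herm[OF assms(1,2)])
    also have "\<dots> = of_real (\<Sum>k\<in>B. (cmod (P a i k))\<^sup>2)"
      by (simp only: of_real_sum complex_norm_square)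
    finally show ?thesis .
  qed
  show "P a i i = of_real (\<Sum>k\<in>B. (cmod (P a i k))\<^sup>2)" by (rule *)
  have "complex_of_real (\<Sum>a\<in>UNIV. \<Sum>k\<in>B. (cmod (P a i k))\<^sup>2) = (\<Sum>a\<in>UNIV. P a i i)"
    by (simp only: * of_real_sum)
  also have "\<dots> = 1" using mat_pvm_sum[OF assms(1,2,2)] by simp
  finally have "(\<Sum>a\<in>UNIV. \<Sum>k\<in>B. (cmod (P a i k))\<^sup>2) = 1" using of_real_eq_1_iff by blast
  moreover have "(\<Sum>k\<in>B. (cmod (P a i k))\<^sup>2) \<le> (\<Sum>a\<in>UNIV. \<Sum>k\<in>B. (cmod (P a i k))\<^sup>2)"
    by (rule member_le_sum) (auto intro: sum_nonneg)
  ultimately show "(\<Sum>k\<in>B. (cmod (P a i k))\<^sup>2) \<le> 1" by simp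
qed

text \<open>
  This bound is what makes the series in \<open>weighted_blocks_in_hull\<close> absolutely convergent.
\<close>

lemma mat_pvm_pairing_le:
  assumes "mat_pvm B P" "mat_pvm B Q" "i \<in> B"
  shows "cmod (\<Sum>k\<in>B. P a i k * Q b i k) \<le> 1"
proof -
  have "cmod (\<Sum>k\<in>B. P a i k * Q b i k) \<le> (\<Sum>k\<in>B. ((cmod (P a i k))\<^sup>2 + (cmod (Q b i k))\<^sup>2) / 2)"
  proof (rule sum_norm_le)
    fix k
    have "2 * (cmod (P a i k) * cmod (Q b i k)) \<le> (cmod (P a i k))\<^sup>2 + (cmod (Q b i k))\<^sup>2"
      using sum_squares_bound[of "cmod (P a i k)" "cmod (Q b i k)"] by (simp add: mult.assoc)
    then show "cmod (P a i k * Q b i k) \<le> ((cmod (P a i k))\<^sup>2 + (cmod (Q b i k))\<^sup>2) / 2"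
      by (simp add: norm_mult)
  qed
  also have "\<dots> = ((\<Sum>k\<in>B. (cmod (P a i k))\<^sup>2) + (\<Sum>k\<in>B. (cmod (Q b i k))\<^sup>2)) / 2"
    by (simp add: sum.distrib sum_divide_distrib add_divide_distrib)
  also have "\<dots> \<le> 1"
    using mat_pvm_row(2)[OF assms(1,3), of a] mat_pvm_row(2)[OF assms(2,3), of b] by simp
  finally show ?thesis .
qed

lemma mat_pvm_trace_real:
  assumes "mat_pvm B P" "mat_pvm B Q"
  shows "(\<Sum>i\<in>B. \<Sum>j\<in>B. P a i j * Q b i j) = of_real (Re (\<Sum>i\<in>B. \<Sum>j\<in>B. P a i j * Q b i j))"
proof -
  let ?S = "\<Sum>i\<in>B. \<Sum>j\<in>B. P a i j * Q b i j"
  have "cnj ?S = (\<Sum>i\<in>B. \<Sum>j\<in>B. P a j i * Q b j i)"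
    unfolding cnj_sum complex_cnj_mult
    by (intro sum.cong refl arg_cong2[where f = "(*)"])
      (use mat_pvm_herm[OF assms(1), of _ _ a] mat_pvm_herm[OF assms(2), of _ _ b] in metis)+
  also have "\<dots> = ?S" by (rule sum.swap)
  finally have "?S \<in> \<real>" by (simp add: Reals_cnj_iff)
  then show ?thesis by (rule of_real_Re[symmetric])
qed

text \<open>
  The weights tend to 0, so the indices with a given positive weight \<open>c\<close> form a finite block.  If it
  has \<open>n\<close> elements, its contribution is \<open>c * n\<close> times a tracial correlation, and
  the numbers \<open>c * n\<close> add up to 1.
\<close>

lemma weighted_blocks_in_hull:
  fixes p :: "real ^ ('x::finite \<times> 'y::finite \<times> 'a::finite \<times> 'b::finite)"
  assumes w: "\<And>k. 0 \<le> w k" "w sums 1"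
    and P: "\<And>c x. 0 < c \<Longrightarrow> mat_pvm {k. w k = c} (P x)"
    and Q: "\<And>c y. 0 < c \<Longrightarrow> mat_pvm {k. w k = c} (Q y)"
    and p: "\<And>x y a b. (\<lambda>k. of_real (w k) * (\<Sum>l\<in>{l. w l = w k}. P x a k l * Q y b k l))
              sums complex_of_real (p $ (x, y, a, b))"
  shows "p \<in> convex hull tracial_correlations"
proof -
  define B where "B c = {k. w k = c}" for c
  define L where "L = w ` {k. 0 < w k}"
  have Lpos: "0 < c" if "c \<in> L" for c using that by (auto simp: L_def)
  have fin: "finite (B c)" if "0 < c" for c
  proof -
    have "w \<longlonglongrightarrow> 0" using w(2) sums_summable summable_LIMSEQ_zero by blast
    then have "\<forall>\<^sub>F k in sequentially. w k < c" using that order_tendstoD(2) by blast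
    then obtain N where "\<And>k. k \<ge> N \<Longrightarrow> w k < c" by (auto simp: eventually_sequentially)
    then have "B c \<subseteq> {..<N}" unfolding B_def by (force simp: not_less[symmetric])
    then show ?thesis using finite_subset by blast
  qed
  have card: "0 < card (B c)" if "c \<in> L" for c
    using fin[OF Lpos[OF that]] that by (auto simp: card_gt_0_iff L_def B_def)
  have bij: "bij_betw snd (Sigma L B) {k. 0 < w k}"
    unfolding bij_betw_def by (auto simp: inj_on_def L_def B_def image_iff)
  have regroup: "((\<lambda>c. \<Sum>k\<in>B c. f k) has_sum s) L"
    if "(f has_sum s) UNIV" "\<And>k. w k = 0 \<Longrightarrow> f k = 0" for f :: "nat \<Rightarrow> complex" and s
  proof -
    have "(f has_sum s) {k. 0 < w k}"
      using that(1) by (rule has_sum_cong_neutral[THEN iffD1, rotated -1])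
        (use that(2) w(1) in \<open>force simp: order.order_iff_strict\<close>)+
    then have "((\<lambda>z. f (snd z)) has_sum s) (Sigma L B)"
      using has_sum_reindex_bij_betw[OF bij] by blast
    then show ?thesis
      by (rule has_sum_SigmaD) (auto intro!: has_sum_finiteI fin Lpos)
  qed
  define W where "W c = c * card (B c)" for c
  have Wpos: "0 < W c" if "c \<in> L" for c
    using Lpos[OF that] card[OF that] by (simp add: W_def)
  have "(w has_sum 1) UNIV" using w sums_nonneg_imp_has_sum by blast
  then have "((\<lambda>k. complex_of_real (w k)) has_sum 1) UNIV"
    using has_sum_of_real_iff[where ?f = w and ?c = 1] by (metis of_real_1)
  from regroup[OF this] have "((\<lambda>c. \<Sum>k\<in>B c. complex_of_real (w k)) has_sum 1) L" by simp
  moreover have "(\<Sum>k\<in>B c. complex_of_real (w k)) = of_real (W c)" for c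
    by (simp add: B_def W_def)
  ultimately have "((\<lambda>c. complex_of_real (W c)) has_sum of_real 1) L" by simp
  then have W1: "(W has_sum 1) L" by (simp only: has_sum_of_real_iff)
  define S where "S c x y a b = (\<Sum>i\<in>B c. \<Sum>j\<in>B c. P x a i j * Q y b i j)" for c x y a b
  define q :: "real \<Rightarrow> real ^ ('x \<times> 'y \<times> 'a \<times> 'b)"
    where "q c = (\<chi> i. case i of (x, y, a, b) \<Rightarrow> Re (S c x y a b) / card (B c))" for c
  have Sreal: "S c x y a b = of_real (Re (S c x y a b))" if "c \<in> L" for c x y a b
    unfolding S_def by (rule mat_pvm_trace_real) (use P Q Lpos[OF that] in \<open>auto simp: B_def\<close>)
  have q: "q c \<in> convex hull tracial_correlations" if "c \<in> L" for c
  proof -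
    have "weighted_correlation (B c) (\<lambda>_. 1 / real (card (B c))) P Q (q c)"
      unfolding weighted_correlation_def
    proof (intro conjI allI ballI impI)
      fix x y a b
      have "complex_of_real (q c $ (x, y, a, b)) = S c x y a b / of_nat (card (B c))"
        using Sreal[OF that, of x y a b] by (simp add: q_def)
      then show "complex_of_real (q c $ (x, y, a, b)) =
          (\<Sum>i\<in>B c. \<Sum>j\<in>B c. of_real (1 / real (card (B c))) * P x a i j * Q y b i j)"
        by (simp add: S_def sum_divide_distrib)
    qed (use fin[OF Lpos[OF that]] card[OF that] P[OF Lpos[OF that]] Q[OF Lpos[OF that]]
        in \<open>auto simp: B_def[symmetric]\<close>)
    then show ?thesis unfolding tracial_correlations_def by (intro hull_inc) auto
  qed
  have "((\<lambda>c. (W c *\<^sub>R q c) $ (x, y, a, b)) has_sum (p $ (x, y, a, b))) L" for x y a b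
  proof -
    define f where "f k = of_real (w k) * (\<Sum>l\<in>B (w k). P x a k l * Q y b k l)" for k
    have le: "cmod (f k) \<le> w k" for k
    proof (cases "w k = 0")
      case False
      then have "0 < w k" using w(1)[of k] by linarith
      then have "cmod (\<Sum>l\<in>B (w k). P x a k l * Q y b k l) \<le> 1"
        using mat_pvm_pairing_le[OF P[of "w k" x] Q[of "w k" y]] by (simp add: B_def)
      then show ?thesis using \<open>0 < w k\<close> by (simp add: f_def norm_mult)
    qed (simp add: f_def)
    have "summable (\<lambda>k. cmod (f k))"
      by (rule summable_comparison_test[OF _ sums_summable[OF w(2)]]) (use le in auto)
    moreover have "f sums complex_of_real (p $ (x, y, a, b))"
      using p[of x a y b] by (simp add: f_def[abs_def] B_def)
    ultimately have "(f has_sum complex_of_real (p $ (x, y, a, b))) UNIV"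
      by (rule norm_summable_imp_has_sum)
    from regroup[OF this] have "((\<lambda>c. \<Sum>k\<in>B c. f k) has_sum complex_of_real (p $ (x, y, a, b))) L"
      by (simp add: f_def)
    moreover have "(\<Sum>k\<in>B c. f k) = of_real ((W c *\<^sub>R q c) $ (x, y, a, b))" if "c \<in> L" for c
    proof -
      have "(\<Sum>k\<in>B c. f k) = of_real c * S c x y a b"
        unfolding S_def sum_distrib_left by (rule sum.cong) (auto simp: f_def B_def sum_distrib_left)
      also have "\<dots> = of_real c * of_real (Re (S c x y a b))" using Sreal[OF that] by simp
      finally show ?thesis using card[OF that] by (simp add: W_def q_def)
    qed
    ultimately have "((\<lambda>c. complex_of_real ((W c *\<^sub>R q c) $ (x, y, a, b)))
        has_sum complex_of_real (p $ (x, y, a, b))) L"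
      by (simp cong: has_sum_cong)
    then show ?thesis by (simp only: has_sum_of_real_iff)
  qed
  then have comp: "((\<lambda>c. (W c *\<^sub>R q c) $ i) has_sum (p $ i)) L" for i
    by (cases i) auto
  have "((\<lambda>c. W c *\<^sub>R q c) has_sum p) L"
    unfolding has_sum_def
    by (rule vec_tendstoI) (use comp in \<open>simp only: has_sum_def sum_component\<close>)
  from has_sum_in_convex[OF convex_convex_hull Wpos q W1 this] show ?thesis by simp
qed

section \<open>Semi-inner products\<close>

lemma complex_ring_simps [simp]:
  "carrier complex_ring = UNIV" "\<zero>\<^bsub>complex_ring\<^esub> = 0" "\<one>\<^bsub>complex_ring\<^esub> = 1"
  "a \<oplus>\<^bsub>complex_ring\<^esub> b = a + b" "a \<otimes>\<^bsub>complex_ring\<^esub> b = a * b"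
  by (simp_all add: complex_ring_def)

lemma cring_complex_ring: "cring complex_ring"
proof (rule cringI)
  have "\<exists>y\<in>carrier complex_ring. y \<oplus>\<^bsub>complex_ring\<^esub> x = \<zero>\<^bsub>complex_ring\<^esub>" for x
    by (simp add: exI[of _ "- x"])
  then show "abelian_group complex_ring"
    by (intro abelian_groupI) auto
  show "Group.comm_monoid complex_ring"
    by (rule comm_monoidI) auto
qed (auto simp: algebra_simps)

locale semi_inner = Module.module complex_ring M for M (structure) +
  fixes g :: "'v \<Rightarrow> 'v \<Rightarrow> complex"
  assumes g_add: "\<lbrakk>u \<in> carrier M; v \<in> carrier M; w \<in> carrier M\<rbrakk> \<Longrightarrow> g u (v \<oplus> w) = g u v + g u w"
    and g_smult: "\<lbrakk>u \<in> carrier M; v \<in> carrier M\<rbrakk> \<Longrightarrow> g u (c \<odot> v) = c * g u v"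
    and g_cnj: "\<lbrakk>u \<in> carrier M; v \<in> carrier M\<rbrakk> \<Longrightarrow> g v u = cnj (g u v)"
    and g_nonneg: "v \<in> carrier M \<Longrightarrow> 0 \<le> Re (g v v)"
begin

definition nrm :: "'v \<Rightarrow> real" where
  "nrm v = sqrt (Re (g v v))"

lemma smult_in [simp]: "v \<in> carrier M \<Longrightarrow> c \<odot> v \<in> carrier M"
  by simp

lemma smult_smult [simp]: "v \<in> carrier M \<Longrightarrow> c \<odot> (d \<odot> v) = (c * d) \<odot> v"
  using smult_assoc1[of c d v] by simp

lemma smult_1 [simp]: "v \<in> carrier M \<Longrightarrow> 1 \<odot> v = v"
  using smult_one[of v] by simp

lemma smult_0 [simp]: "v \<in> carrier M \<Longrightarrow> 0 \<odot> v = \<zero>"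
  using smult_l_null[of v] by simp

lemma lin_comb_in [simp]:
  "(\<And>i. i \<in> A \<Longrightarrow> f i \<in> carrier M) \<Longrightarrow> (\<Oplus>i\<in>A. f i) \<in> carrier M"
  by (intro M.finsum_closed) auto

lemma diff_zero [simp]: "v \<in> carrier M \<Longrightarrow> v \<ominus> \<zero> = v"
  using M.minus_equality[of \<zero> \<zero>] by (simp add: a_minus_def)

lemma diff_self [simp]: "v \<in> carrier M \<Longrightarrow> v \<ominus> v = \<zero>"
  by (simp add: a_minus_def M.r_neg)

lemma g_zero [simp]: "u \<in> carrier M \<Longrightarrow> g u \<zero> = 0"
  using g_add[of u \<zero> \<zero>] by simp

lemma g_minus: "u \<in> carrier M \<Longrightarrow> v \<in> carrier M \<Longrightarrow> g u (\<ominus> v) = - g u v"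
  using g_add[of u v "\<ominus> v"] by (simp add: M.r_neg eq_neg_iff_add_eq_0 add.commute)

lemma g_diff:
  "u \<in> carrier M \<Longrightarrow> v \<in> carrier M \<Longrightarrow> w \<in> carrier M \<Longrightarrow> g u (v \<ominus> w) = g u v - g u w"
  by (simp add: a_minus_def g_add g_minus)

lemma g_sum:
  assumes "finite A" "u \<in> carrier M" "\<And>i. i \<in> A \<Longrightarrow> f i \<in> carrier M"
  shows "g u (\<Oplus>i\<in>A. f i) = (\<Sum>i\<in>A. g u (f i))"
  using assms(1,3)
proof (induction A rule: finite_induct)
  case (insert x F)
  then have "(\<Oplus>i\<in>insert x F. f i) = f x \<oplus> (\<Oplus>i\<in>F. f i)"
    by (intro M.finsum_insert) auto
  with insert show ?case using assms(2) by (simp add: g_add)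
qed (simp add: assms(2))

lemma g_add_left:
  "u \<in> carrier M \<Longrightarrow> v \<in> carrier M \<Longrightarrow> w \<in> carrier M \<Longrightarrow> g (v \<oplus> w) u = g v u + g w u"
  using g_cnj[of u "v \<oplus> w"] g_cnj[of u v] g_cnj[of u w] by (simp add: g_add)

lemma g_smult_left: "u \<in> carrier M \<Longrightarrow> v \<in> carrier M \<Longrightarrow> g (c \<odot> v) u = cnj c * g v u"
  using g_cnj[of u "c \<odot> v"] g_cnj[of u v] by (simp add: g_smult)

lemma g_zero_left [simp]: "u \<in> carrier M \<Longrightarrow> g \<zero> u = 0"
  using g_cnj[of u \<zero>] by simp

lemma g_diff_left:
  "u \<in> carrier M \<Longrightarrow> v \<in> carrier M \<Longrightarrow> w \<in> carrier M \<Longrightarrow> g (v \<ominus> w) u = g v u - g w u"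
  using g_cnj[of u "v \<ominus> w"] g_cnj[of u v] g_cnj[of u w] by (simp add: g_diff)

lemma g_sum_left:
  assumes "finite A" "u \<in> carrier M" "\<And>i. i \<in> A \<Longrightarrow> f i \<in> carrier M"
  shows "g (\<Oplus>i\<in>A. f i) u = (\<Sum>i\<in>A. g (f i) u)"
proof -
  have "g (\<Oplus>i\<in>A. f i) u = cnj (\<Sum>i\<in>A. g u (f i))"
    using g_cnj[of u "\<Oplus>i\<in>A. f i"] g_sum[OF assms] assms by simp
  also have "\<dots> = (\<Sum>i\<in>A. g (f i) u)"
    unfolding cnj_sum using assms by (intro sum.cong refl g_cnj[symmetric]) auto
  finally show ?thesis .
qed

lemma nrm_nonneg [simp]: "v \<in> carrier M \<Longrightarrow> 0 \<le> nrm v"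
  by (simp add: nrm_def g_nonneg)

lemma nrm_sq: "v \<in> carrier M \<Longrightarrow> (nrm v)\<^sup>2 = Re (g v v)"
  by (simp add: nrm_def g_nonneg)

lemma g_self: "v \<in> carrier M \<Longrightarrow> g v v = of_real ((nrm v)\<^sup>2)"
  using arg_cong[OF g_cnj[of v v], of Im] by (simp add: nrm_sq complex_eq_iff)

lemma nrm_diff_sq:
  assumes "u \<in> carrier M" "v \<in> carrier M"
  shows "(nrm (u \<ominus> v))\<^sup>2 = (nrm u)\<^sup>2 + (nrm v)\<^sup>2 - 2 * Re (g u v)"
proof -
  have "Re (g v u) = Re (g u v)" using g_cnj[OF assms] by simp
  then show ?thesis using assms by (simp add: nrm_sq g_diff g_diff_left)
qed

lemma nrm_add_sq:
  assumes "u \<in> carrier M" "v \<in> carrier M"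
  shows "(nrm (u \<oplus> v))\<^sup>2 = (nrm u)\<^sup>2 + (nrm v)\<^sup>2 + 2 * Re (g u v)"
proof -
  have "Re (g v u) = Re (g u v)" using g_cnj[OF assms] by simp
  then show ?thesis using assms by (simp add: nrm_sq g_add g_add_left)
qed

lemma nrm_smult:
  assumes "v \<in> carrier M"
  shows "nrm (c \<odot> v) = cmod c * nrm v"
proof -
  have "g (c \<odot> v) (c \<odot> v) = (c * cnj c) * g v v"
    using assms by (simp add: g_smult g_smult_left)
  also have "\<dots> = of_real ((cmod c * nrm v)\<^sup>2)"
    using assms by (simp add: g_self complex_norm_square[symmetric] power_mult_distrib)
  finally have "Re (g (c \<odot> v) (c \<odot> v)) = (cmod c * nrm v)\<^sup>2" by (simp only: Re_complex_of_real)
  then have "nrm (c \<odot> v) = sqrt ((cmod c * nrm v)\<^sup>2)" by (simp only: nrm_def)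
  then show ?thesis using assms by simp
qed

lemma cauchy_schwarz:
  assumes u: "u \<in> carrier M" and v: "v \<in> carrier M"
  shows "cmod (g u v) \<le> nrm u * nrm v"
proof -
  let ?m = "cmod (g u v)"
  have key: "2 * r * ?m\<^sup>2 \<le> (nrm v)\<^sup>2 + r\<^sup>2 * ?m\<^sup>2 * (nrm u)\<^sup>2" for r :: real
  proof -
    define c where "c = of_real r * g u v"
    have "Re (g v (c \<odot> u)) = Re (of_real r * (g u v * cnj (g u v)))"
      using g_cnj[OF u v] u v by (simp add: c_def g_smult mult.assoc)
    also have "\<dots> = r * ?m\<^sup>2" by (simp only: complex_norm_square[symmetric] of_real_mult[symmetric] Re_complex_of_real)
    finally have "(nrm (v \<ominus> c \<odot> u))\<^sup>2 = (nrm v)\<^sup>2 + (nrm (c \<odot> u))\<^sup>2 - 2 * (r * ?m\<^sup>2)"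
      using u v by (simp add: nrm_diff_sq)
    moreover have "(nrm (c \<odot> u))\<^sup>2 = r\<^sup>2 * ?m\<^sup>2 * (nrm u)\<^sup>2"
      using u by (simp add: nrm_smult c_def norm_mult power_mult_distrib)
    moreover have "0 \<le> (nrm (v \<ominus> c \<odot> u))\<^sup>2" by simp
    ultimately show ?thesis by linarith
  qed
  show ?thesis
  proof (cases "nrm u = 0")
    case True
    have "?m = 0"
    proof (rule ccontr)
      assume "?m \<noteq> 0"
      then have "0 < ?m\<^sup>2" by simp
      with key[of "((nrm v)\<^sup>2 + 1) / (2 * ?m\<^sup>2)"] True show False by (simp add: field_simps)
    qed
    then show ?thesis using True by simp
  next
    case False
    then have pos: "0 < (nrm u)\<^sup>2" by simp
    have "(1 / (nrm u)\<^sup>2)\<^sup>2 * ?m\<^sup>2 * (nrm u)\<^sup>2 = ?m\<^sup>2 / (nrm u)\<^sup>2"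
      using False by (simp add: power2_eq_square)
    with key[of "1 / (nrm u)\<^sup>2"] have "?m\<^sup>2 / (nrm u)\<^sup>2 \<le> (nrm v)\<^sup>2" by simp
    then have "?m\<^sup>2 \<le> (nrm u * nrm v)\<^sup>2"
      unfolding pos_divide_le_eq[OF pos] by (simp add: power_mult_distrib mult.commute)
    then show ?thesis by (rule power2_le_imp_le) (use u v in simp)
  qed
qed

lemma nrm_triangle:
  assumes "u \<in> carrier M" "v \<in> carrier M"
  shows "nrm (u \<oplus> v) \<le> nrm u + nrm v"
proof (rule power2_le_imp_le)
  have "Re (g u v) \<le> nrm u * nrm v"
    using cauchy_schwarz[OF assms] complex_Re_le_cmod[of "g u v"] by linarith
  then show "(nrm (u \<oplus> v))\<^sup>2 \<le> (nrm u + nrm v)\<^sup>2"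
    using assms by (simp add: nrm_add_sq power2_sum)
qed (use assms in simp)

lemma g_null: "u \<in> carrier M \<Longrightarrow> v \<in> carrier M \<Longrightarrow> nrm u = 0 \<Longrightarrow> g u v = 0 \<and> g v u = 0"
  using cauchy_schwarz[of u v] g_cnj[of u v] by simp

text \<open>
  Null vectors are admitted so that the result of orthogonalising any sequence can be indexed by
  the natural numbers, whatever the dimension.
\<close>

definition quasi_orthonormal :: "(nat \<Rightarrow> 'v) \<Rightarrow> bool" where
  "quasi_orthonormal e \<longleftrightarrow> (\<forall>i. e i \<in> carrier M) \<and> (\<forall>i j. i \<noteq> j \<longrightarrow> g (e i) (e j) = 0) \<and>
     (\<forall>i. g (e i) (e i) = 0 \<or> g (e i) (e i) = 1)"

lemma quasi_orthonormal_coeff: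
  assumes "quasi_orthonormal e" "v \<in> carrier M" "g (e i) (e i) \<noteq> 1"
  shows "g (e i) v = 0"
proof -
  have "e i \<in> carrier M" "g (e i) (e i) = 0"
    using assms(1,3) unfolding quasi_orthonormal_def by blast+
  then show ?thesis using g_null[of "e i" v] assms(2) by (simp add: nrm_def)
qed

lemma quasi_orthonormal_comb:
  assumes e: "quasi_orthonormal e" and A: "finite A"
    and c: "\<And>i. g (e i) (e i) \<noteq> 1 \<Longrightarrow> c i = 0"
  shows "g (e j) (\<Oplus>i\<in>A. c i \<odot> e i) = (if j \<in> A then c j else 0)"
    and "(nrm (\<Oplus>i\<in>A. c i \<odot> e i))\<^sup>2 = (\<Sum>i\<in>A. (cmod (c i))\<^sup>2)"
proof -
  have ec: "e i \<in> carrier M" for i using e by (simp add: quasi_orthonormal_def)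
  have orth: "g (e i) (e j) = 0" if "i \<noteq> j" for i j
    using e that unfolding quasi_orthonormal_def by blast
  have *: "g (e j) (\<Oplus>i\<in>A. c i \<odot> e i) = (if j \<in> A then c j else 0)" for j
  proof -
    have "g (e j) (\<Oplus>i\<in>A. c i \<odot> e i) = (\<Sum>i\<in>A. c i * g (e j) (e i))"
      using A ec by (simp add: g_sum g_smult)
    also have "\<dots> = (\<Sum>i\<in>A. if i = j then c j else 0)"
      using orth c by (intro sum.cong refl) (metis mult.right_neutral mult_zero_left mult_zero_right)
    finally show ?thesis using A by simp
  qed
  show "g (e j) (\<Oplus>i\<in>A. c i \<odot> e i) = (if j \<in> A then c j else 0)" by (rule *)
  let ?x = "\<Oplus>i\<in>A. c i \<odot> e i"
  have "g ?x ?x = (\<Sum>i\<in>A. cnj (c i) * g (e i) ?x)"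
    using A ec by (subst g_sum_left) (auto simp: g_smult_left)
  also have "\<dots> = (\<Sum>i\<in>A. of_real ((cmod (c i))\<^sup>2))"
    using * by (intro sum.cong refl) (simp only: complex_norm_square if_True mult.commute)
  finally have "Re (g ?x ?x) = (\<Sum>i\<in>A. (cmod (c i))\<^sup>2)"
    by (simp only: of_real_sum[symmetric] Re_complex_of_real)
  then show "(nrm ?x)\<^sup>2 = (\<Sum>i\<in>A. (cmod (c i))\<^sup>2)" using ec by (simp add: nrm_sq)
qed

lemma bessel:
  assumes e: "quasi_orthonormal e" and A: "finite A" and v: "v \<in> carrier M"
  shows "(\<Sum>i\<in>A. (cmod (g (e i) v))\<^sup>2) \<le> (nrm v)\<^sup>2"
proof -
  let ?x = "\<Oplus>i\<in>A. g (e i) v \<odot> e i"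
  have ec: "e i \<in> carrier M" for i using e by (simp add: quasi_orthonormal_def)
  have n: "(nrm ?x)\<^sup>2 = (\<Sum>i\<in>A. (cmod (g (e i) v))\<^sup>2)"
    by (rule quasi_orthonormal_comb(2)[OF e A]) (rule quasi_orthonormal_coeff[OF e v])
  have "g ?x v = (\<Sum>i\<in>A. cnj (g (e i) v) * g (e i) v)"
    using A ec v by (subst g_sum_left) (auto simp: g_smult_left)
  also have "\<dots> = (\<Sum>i\<in>A. of_real ((cmod (g (e i) v))\<^sup>2))"
    by (intro sum.cong refl) (simp only: complex_norm_square mult.commute)
  finally have "Re (g ?x v) = (\<Sum>i\<in>A. (cmod (g (e i) v))\<^sup>2)"
    by (simp only: of_real_sum[symmetric] Re_complex_of_real)
  moreover have "0 \<le> (nrm (?x \<ominus> v))\<^sup>2" by simp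
  ultimately show ?thesis using n ec v by (simp add: nrm_diff_sq)
qed

text \<open>
  As \<open>g\<close> may be degenerate, a vector is recovered from its expansion only up to a null vector.  The
  last conclusion keeps a first vector that is already normalised, such as the unit of an algebra.
\<close>

lemma gram_schmidt:
  assumes s: "\<And>n. s n \<in> carrier M"
  obtains e where "quasi_orthonormal e"
    and "\<And>n. nrm (s n \<ominus> (\<Oplus>i\<in>{..n}. g (e i) (s n) \<odot> e i)) = 0"
    and "g (s 0) (s 0) = 1 \<Longrightarrow> e 0 = s 0"
proof -
  define P where "P f n r \<longleftrightarrow>
    (\<forall>m<n. f m \<in> carrier M \<and> (g (f m) (f m) = 0 \<or> g (f m) (f m) = 1) \<and> (\<forall>k<m. g (f k) (f m) = 0)) \<longrightarrow>
    (r \<in> carrier M \<and> (g r r = 0 \<or> g r r = 1) \<and> (\<forall>m<n. g (f m) r = 0) \<and>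
     nrm ((s n \<ominus> (\<Oplus>i\<in>{..<n}. g (f i) (s n) \<odot> f i)) \<ominus> g r (s n) \<odot> r) = 0 \<and>
     (n = 0 \<longrightarrow> g (s 0) (s 0) = 1 \<longrightarrow> r = s 0))"
    for f :: "nat \<Rightarrow> 'v" and n r
  \<comment> \<open>\<open>P f n r\<close> says that \<open>r\<close> is a possible \<open>n\<close>-th vector after \<open>f 0, \<dots>, f (n - 1)\<close>.\<close>
  have "\<exists>f. \<forall>n. P f n (f n)"
  proof (rule dependent_wellorder_choice)
    fix r :: 'v and f h :: "nat \<Rightarrow> 'v" and n :: nat
    assume eq: "\<And>m. m < n \<Longrightarrow> f m = h m"
    show "P f n r = P h n r"
    proof (cases "\<forall>m<n. f m \<in> carrier M")
      case True
      then have "(\<Oplus>i\<in>{..<n}. g (f i) (s n) \<odot> f i) = (\<Oplus>i\<in>{..<n}. g (h i) (s n) \<odot> h i)"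
        using eq by (intro M.finsum_cong') auto
      then show ?thesis unfolding P_def using eq by (simp cong: conj_cong)
    next
      case False
      then have "\<not> (\<forall>m<n. f m \<in> carrier M \<and> (g (f m) (f m) = 0 \<or> g (f m) (f m) = 1) \<and> (\<forall>k<m. g (f k) (f m) = 0))"
        and "\<not> (\<forall>m<n. h m \<in> carrier M \<and> (g (h m) (h m) = 0 \<or> g (h m) (h m) = 1) \<and> (\<forall>k<m. g (h k) (h m) = 0))"
        using eq by auto
      then show ?thesis unfolding P_def by blast
    qed
  next
    fix n f assume "\<And>m. m < n \<Longrightarrow> P f m (f m)"
    show "\<exists>r. P f n r"
    proof (cases "\<forall>m<n. f m \<in> carrier M \<and> (g (f m) (f m) = 0 \<or> g (f m) (f m) = 1) \<and> (\<forall>k<m. g (f k) (f m) = 0)")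
      case True
      define h where "h m = (if m < n then f m else \<zero>)" for m
      have hq: "quasi_orthonormal h"
        unfolding quasi_orthonormal_def
      proof (intro conjI allI impI)
        show hc: "h i \<in> carrier M" for i using True by (simp add: h_def)
        show "g (h i) (h i) = 0 \<or> g (h i) (h i) = 1" for i using True by (simp add: h_def)
        have *: "g (h i) (h j) = 0" if "i < j" for i j using True that by (simp add: h_def)
        show "g (h i) (h j) = 0" if "i \<noteq> j" for i j
        proof (cases "i < j")
          case False
          then have "j < i" using that by simp
          then show ?thesis using *[of j i] g_cnj[OF hc hc, of i j] by simp
        qed (rule *)
      qed
      define r0 where "r0 = s n \<ominus> (\<Oplus>i\<in>{..<n}. g (f i) (s n) \<odot> f i)"
      have sumeq: "(\<Oplus>i\<in>{..<n}. g (f i) (s n) \<odot> f i) = (\<Oplus>i\<in>{..<n}. g (h i) (s n) \<odot> h i)"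
        using True by (intro M.finsum_cong') (auto simp: h_def)
      have r0c: "r0 \<in> carrier M" using s True by (simp add: r0_def)
      have orth: "g (f m) r0 = 0" if "m < n" for m
      proof -
        have "g (h m) (\<Oplus>i\<in>{..<n}. g (h i) (s n) \<odot> h i) = g (h m) (s n)"
          using quasi_orthonormal_comb(1)[OF hq, of "{..<n}" "\<lambda>i. g (h i) (s n)" m]
            quasi_orthonormal_coeff[OF hq s] that by simp
        moreover have "h m = f m" using that by (simp add: h_def)
        ultimately show ?thesis
          unfolding r0_def sumeq using s True that
          by (subst g_diff) (auto simp: h_def)
      qed
      define r where "r = (if nrm r0 = 0 then \<zero> else of_real (1 / nrm r0) \<odot> r0)"
      have rc: "r \<in> carrier M" using r0c by (simp add: r_def)
      have gr: "g r r = 0 \<or> g r r = 1"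
      proof (cases "nrm r0 = 0")
        case False
        then have "nrm r = 1" using r0c by (simp add: r_def nrm_smult norm_divide)
        then show ?thesis using g_self[OF rc] by simp
      qed (simp add: r_def)
      have rs: "g r (s n) = g r r0"
      proof -
        have "g r (\<Oplus>i\<in>{..<n}. g (f i) (s n) \<odot> f i) = (\<Sum>i\<in>{..<n}. g (f i) (s n) * g r (f i))"
          using rc True by (subst g_sum) (auto simp: g_smult)
        also have "\<dots> = 0"
        proof (rule sum.neutral, rule ballI)
          fix i assume "i \<in> {..<n}"
          then have i: "i < n" by simp
          then have fi: "f i \<in> carrier M" using True by blast
          have "g (f i) r = 0" using orth[OF i] fi r0c by (simp add: r_def g_smult)
          then show "g (f i) (s n) * g r (f i) = 0" using g_cnj[OF fi rc] by simp
        qed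
        finally show ?thesis using s rc True by (simp add: r0_def g_diff)
      qed
      have "nrm (r0 \<ominus> g r (s n) \<odot> r) = 0"
      proof (cases "nrm r0 = 0")
        case True
        then show ?thesis using r0c by (simp add: rs r_def)
      next
        case False
        have "g r r0 = of_real (nrm r0)"
          using False r0c by (simp add: r_def g_smult_left g_self power2_eq_square)
        then have "g r (s n) \<odot> r = of_real (nrm r0) \<odot> r" by (simp only: rs)
        also have "\<dots> = r0" using False r0c by (simp add: r_def)
        finally have "g r (s n) \<odot> r = r0" .
        then show ?thesis using r0c by (simp add: nrm_def)
      qed
      moreover have "\<forall>m<n. g (f m) r = 0"
        using orth True r0c by (simp add: r_def g_smult)
      moreover have "r = s 0" if "n = 0" "g (s 0) (s 0) = 1"
      proof -
        have "r0 = s 0" using that(1) s by (simp add: r0_def)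
        moreover have "nrm (s 0) = 1" using that(2) by (simp add: nrm_def)
        ultimately show ?thesis using s by (simp add: r_def)
      qed
      ultimately have "P f n r"
        unfolding P_def r0_def[symmetric] using rc gr by blast
      then show ?thesis ..
    next
      case False
      then show ?thesis unfolding P_def by blast
    qed
  qed
  then obtain e where e: "\<And>n. P e n (e n)" by blast
  have base: "e n \<in> carrier M \<and> (g (e n) (e n) = 0 \<or> g (e n) (e n) = 1) \<and> (\<forall>k<n. g (e k) (e n) = 0)" for n
  proof (induction n rule: less_induct)
    case (less n)
    then show ?case using e[of n] unfolding P_def by blast
  qed
  then have ec: "e n \<in> carrier M" for n by blast
  show thesis
  proof (rule that)
    show "quasi_orthonormal e"
      unfolding quasi_orthonormal_def
    proof (intro conjI allI impI)
      show "g (e i) (e j) = 0" if "i \<noteq> j" for i j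
      proof (cases "i < j")
        case True
        then show ?thesis using base by blast
      next
        case False
        then have "g (e j) (e i) = 0" using base that by (metis linorder_neqE_nat)
        then show ?thesis using g_cnj[OF ec ec, of j i] by simp
      qed
    qed (use base in blast)+
    have full: "nrm ((s n \<ominus> (\<Oplus>i\<in>{..<n}. g (e i) (s n) \<odot> e i)) \<ominus> g (e n) (s n) \<odot> e n) = 0"
      "n = 0 \<Longrightarrow> g (s 0) (s 0) = 1 \<Longrightarrow> e n = s 0" for n
      using e[of n] base unfolding P_def by blast+
    show "nrm (s n \<ominus> (\<Oplus>i\<in>{..n}. g (e i) (s n) \<odot> e i)) = 0" for n
    proof -
      let ?S = "\<Oplus>i\<in>{..<n}. g (e i) (s n) \<odot> e i"
      have "(\<Oplus>i\<in>{..n}. g (e i) (s n) \<odot> e i) = g (e n) (s n) \<odot> e n \<oplus> ?S"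
        using M.finsum_insert[of "{..<n}" n "\<lambda>i. g (e i) (s n) \<odot> e i"] ec
        by (simp add: lessThan_Suc_atMost[symmetric] lessThan_Suc Pi_def)
      moreover have "s n \<ominus> (g (e n) (s n) \<odot> e n \<oplus> ?S) = (s n \<ominus> ?S) \<ominus> g (e n) (s n) \<odot> e n"
        using s ec by (simp add: a_minus_def M.minus_add M.a_ac)
      ultimately show ?thesis using full(1)[of n] by simp
    qed
    show "g (s 0) (s 0) = 1 \<Longrightarrow> e 0 = s 0" by (rule full(2)) simp_all
  qed
qed

end

section \<open>Hilbert spaces\<close>

context semi_inner
begin

lemma diff_add_cancel [simp]: "u \<in> carrier M \<Longrightarrow> v \<in> carrier M \<Longrightarrow> u \<ominus> v \<oplus> v = u"
  by (simp add: a_minus_def M.a_assoc M.l_neg)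

lemma nrm_diff_commute:
  assumes "u \<in> carrier M" "v \<in> carrier M"
  shows "nrm (u \<ominus> v) = nrm (v \<ominus> u)"
proof -
  have "Re (g u v) = Re (g v u)" using g_cnj[OF assms] by simp
  then have "(nrm (u \<ominus> v))\<^sup>2 = (nrm (v \<ominus> u))\<^sup>2" using assms by (simp add: nrm_diff_sq)
  then show ?thesis using assms by simp
qed

text \<open>
  A functional that attains its norm at a unit vector \<open>v\<close> is a multiple of the inner product with
  \<open>v\<close>.  If it did not vanish on some \<open>u0\<close> orthogonal to \<open>v\<close>, then moving from \<open>v\<close> into a suitable
  multiple of \<open>u0\<close> would increase its value to first order and the norm only to second order.
\<close>

lemma attained_functional:
  assumes add: "\<And>x y. x \<in> carrier M \<Longrightarrow> y \<in> carrier M \<Longrightarrow> phi (x \<oplus> y) = phi x + phi y"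
    and smult: "\<And>c x. x \<in> carrier M \<Longrightarrow> phi (c \<odot> x) = cnj c * phi x"
    and bound: "\<And>x. x \<in> carrier M \<Longrightarrow> cmod (phi x) \<le> s * nrm x"
    and v: "v \<in> carrier M" "nrm v = 1" "phi v = of_real s" and s: "0 < s"
    and u: "u \<in> carrier M"
  shows "phi u = of_real s * g u v"
proof -
  define u0 where "u0 = u \<ominus> g v u \<odot> v"
  have u0: "u0 \<in> carrier M" using u v by (simp add: u0_def)
  have gvv: "g v v = 1" using v g_self[of v] by simp
  have vu0: "g v u0 = 0" using u v gvv by (simp add: u0_def g_diff g_smult)
  define x where "x = phi u0"
  have "x = 0"
  proof (rule ccontr)
    assume x: "x \<noteq> 0"
    define N where "N = (nrm u0)\<^sup>2"
    \<comment> \<open>Any step with \<open>0 < r\<close> and \<open>s * N * r < 2\<close> contradicts the bound.\<close>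
    define r where "r = 1 / (s * N + 1)"
    have N: "0 \<le> N" by (simp add: N_def)
    have den: "0 < s * N + 1" using N s by (simp add: add_nonneg_pos)
    have r: "0 < r" using den by (simp add: r_def)
    define y where "y = v \<oplus> (of_real r * x) \<odot> u0"
    have yc: "y \<in> carrier M" using u0 v by (simp add: y_def)
    have "phi y = of_real s + of_real r * (x * cnj x)"
      using u0 v by (simp add: y_def add smult x_def)
    also have "\<dots> = of_real (s + r * (cmod x)\<^sup>2)"
      by (simp only: complex_norm_square[symmetric] of_real_mult of_real_add)
    finally have 1: "s + r * (cmod x)\<^sup>2 \<le> s * nrm y"
      using bound[OF yc] s r by (simp add: norm_of_real abs_of_nonneg del: of_real_add of_real_mult)
    have ny: "(nrm y)\<^sup>2 = 1 + r\<^sup>2 * (cmod x)\<^sup>2 * N"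
      using u0 v r by (simp add: y_def nrm_add_sq g_smult vu0 nrm_smult norm_mult power_mult_distrib N_def)
    have "(s + r * (cmod x)\<^sup>2)\<^sup>2 \<le> (s * nrm y)\<^sup>2"
      using 1 s r by (intro power_mono) auto
    also have "\<dots> = s\<^sup>2 + s\<^sup>2 * (r\<^sup>2 * (cmod x)\<^sup>2 * N)"
      by (simp add: power_mult_distrib ny distrib_left)
    finally have "2 * s * (r * (cmod x)\<^sup>2) + (r * (cmod x)\<^sup>2)\<^sup>2 \<le> s\<^sup>2 * (r\<^sup>2 * (cmod x)\<^sup>2 * N)"
      by (simp add: power2_sum)
    then have "2 * s * (r * (cmod x)\<^sup>2) \<le> s\<^sup>2 * (r\<^sup>2 * (cmod x)\<^sup>2 * N)"
      using zero_le_power2[of "r * (cmod x)\<^sup>2"] by linarith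
    also have "\<dots> = (s * (s * N * r)) * (r * (cmod x)\<^sup>2)" by (simp add: power2_eq_square)
    finally have "2 * s \<le> s * (s * N * r)"
      using r x by (simp add: mult_le_cancel_right)
    then have "2 \<le> s * N * r" using s by simp
    moreover have "s * N * r \<le> 1" using den by (simp add: r_def field_simps)
    ultimately show False by simp
  qed
  then have "phi u0 = 0" by (simp add: x_def)
  moreover have "u = u0 \<oplus> g v u \<odot> v"
    using u v by (simp add: u0_def a_minus_def M.a_assoc M.l_neg)
  ultimately have "phi u = cnj (g v u) * of_real s"
    using add[of u0 "g v u \<odot> v"] u0 u v smult[of v "g v u"] by simp
  then show ?thesis using g_cnj[OF v(1) u] by simp
qed

end

context hilbert_space
begin

sublocale semi_inner H "ip H"
proof
  show "0 \<le> Re (ip H v v)" if "v \<in> carrier H" for v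
  proof (cases "v = \<zero>")
    case True
    have "ip H \<zero> (0 \<odot> \<zero>) = 0 * ip H \<zero> \<zero>" by (rule ip_smult) simp_all
    then show ?thesis using True smult_l_null[of \<zero>] by simp
  qed (use ip_pos[OF that] in simp)
qed (simp_all add: ip_add ip_smult, rule ip_cnj)

lemma hnorm_nrm: "hnorm H v = nrm v"
  by (simp add: hnorm_def nrm_def)

lemma nrm_eq_0: "v \<in> carrier H \<Longrightarrow> nrm v = 0 \<Longrightarrow> v = \<zero>"
  using ip_pos[of v] by (force simp: nrm_def)

lemma diff_eq_0D: "u \<in> carrier H \<Longrightarrow> v \<in> carrier H \<Longrightarrow> nrm (u \<ominus> v) = 0 \<Longrightarrow> u = v"
  using nrm_eq_0[of "u \<ominus> v"] diff_add_cancel[of u v] by simp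

lemma ip_ext:
  assumes "u \<in> carrier H" "v \<in> carrier H" "\<And>w. w \<in> carrier H \<Longrightarrow> ip H w u = ip H w v"
  shows "u = v"
proof (rule diff_eq_0D)
  have "ip H (u \<ominus> v) (u \<ominus> v) = 0"
    using assms(1,2) assms(3)[of "u \<ominus> v"] by (simp add: g_diff)
  then show "nrm (u \<ominus> v) = 0" by (simp add: nrm_def)
qed (use assms in auto)

lemma limit_ip:
  assumes "\<And>n. F n \<in> carrier H" "x \<in> carrier H" "(\<lambda>n. nrm (F n \<ominus> x)) \<longlonglongrightarrow> 0" "y \<in> carrier H"
  shows "(\<lambda>n. ip H y (F n)) \<longlonglongrightarrow> ip H y x"
proof (rule LIM_zero_cancel, rule Lim_null_comparison)
  show "\<forall>\<^sub>F n in sequentially. cmod (ip H y (F n) - ip H y x) \<le> nrm y * nrm (F n \<ominus> x)"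
    using cauchy_schwarz[OF assms(4), of "F n \<ominus> x" for n] assms by (simp add: g_diff)
  show "(\<lambda>n. nrm y * nrm (F n \<ominus> x)) \<longlonglongrightarrow> 0"
    using tendsto_mult_left[OF assms(3), of "nrm y"] by simp
qed

text \<open>
  The squared distance of two partial sums is a difference of partial sums of the convergent
  series of \<open>(cmod (c i))\<^sup>2\<close>.
\<close>

lemma riesz_fischer:
  assumes e: "quasi_orthonormal e" and c: "\<And>i. ip H (e i) (e i) \<noteq> 1 \<Longrightarrow> c i = 0"
    and bound: "\<And>n. (\<Sum>i<n. (cmod (c i))\<^sup>2) \<le> C"
  obtains x where "x \<in> carrier H" "\<And>i. ip H (e i) x = c i" "(nrm x)\<^sup>2 \<le> C"
    "\<And>y. y \<in> carrier H \<Longrightarrow> (\<lambda>n. \<Sum>i<n. c i * ip H y (e i)) \<longlonglongrightarrow> ip H y x"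
proof -
  define F where "F n = (\<Oplus>i\<in>{..<n}. c i \<odot> e i)" for n
  define S where "S n = (\<Sum>i<n. (cmod (c i))\<^sup>2)" for n
  have ec: "e i \<in> carrier H" for i using e by (simp add: quasi_orthonormal_def)
  have Fc: "F n \<in> carrier H" for n using ec by (simp add: F_def)
  have eF: "ip H (e j) (F n) = (if j < n then c j else 0)" for j n
    unfolding F_def using quasi_orthonormal_comb(1)[OF e, of "{..<n}" c j] c by simp
  have nF: "(nrm (F n))\<^sup>2 = S n" for n
    unfolding F_def S_def using quasi_orthonormal_comb(2)[OF e, of "{..<n}" c] c by simp
  have yF: "ip H y (F n) = (\<Sum>i<n. c i * ip H y (e i))" if "y \<in> carrier H" for y n
    unfolding F_def using ec that by (simp add: g_sum g_smult)
  have dF: "(nrm (F m \<ominus> F n))\<^sup>2 = \<bar>S m - S n\<bar>" for m n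
  proof -
    have *: "Re (ip H (F n) (F m)) = S n" if "n \<le> m" for n m
    proof -
      have "ip H (F n) (F m) = (\<Sum>i<n. cnj (c i) * ip H (e i) (F m))"
        unfolding F_def[of n] using ec Fc by (subst g_sum_left) (auto simp: g_smult_left)
      also have "\<dots> = (\<Sum>i<n. of_real ((cmod (c i))\<^sup>2))"
        using that by (intro sum.cong refl) (simp add: eF complex_norm_square mult.commute del: of_real_power)
      finally show ?thesis by (simp only: of_real_sum[symmetric] Re_complex_of_real S_def)
    qed
    have mono: "S n \<le> S m" if "n \<le> m" for n m
      unfolding S_def using that by (intro sum_mono2) auto
    show ?thesis
    proof (cases "n \<le> m")
      case True
      have "Re (ip H (F m) (F n)) = Re (ip H (F n) (F m))"
        using g_cnj[OF Fc Fc, of n m] by simp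
      then show ?thesis using *[OF True] mono[OF True] Fc by (simp add: nrm_diff_sq nF)
    next
      case False
      then have "m \<le> n" by simp
      then show ?thesis using *[of m n] mono[of m n] Fc by (simp add: nrm_diff_sq nF)
    qed
  qed
  have "Bseq S"
  proof (rule BseqI')
    show "norm (S n) \<le> C" for n
      using bound[of n] by (simp add: S_def abs_of_nonneg sum_nonneg)
  qed
  moreover have "monoseq S"
    unfolding S_def by (intro incseq_imp_monoseq incseq_SucI) simp
  ultimately have conv: "convergent S" by (rule Bseq_monoseq_convergent)
  then have "Cauchy S" by (rule convergent_Cauchy)
  have "\<forall>\<epsilon>>0. \<exists>N. \<forall>m\<ge>N. \<forall>n\<ge>N. hnorm H (F m \<ominus> F n) < \<epsilon>"
  proof (intro allI impI)
    fix \<epsilon> :: real assume "0 < \<epsilon>"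
    then have "0 < \<epsilon>\<^sup>2" by simp
    with \<open>Cauchy S\<close> obtain N where N: "\<And>m n. m \<ge> N \<Longrightarrow> n \<ge> N \<Longrightarrow> \<bar>S m - S n\<bar> < \<epsilon>\<^sup>2"
      unfolding Cauchy_def dist_real_def by metis
    have "hnorm H (F m \<ominus> F n) < \<epsilon>" if "m \<ge> N" "n \<ge> N" for m n
      unfolding hnorm_nrm
      by (rule power2_less_imp_less) (use N[OF that] \<open>0 < \<epsilon>\<close> dF in auto)
    then show "\<exists>N. \<forall>m\<ge>N. \<forall>n\<ge>N. hnorm H (F m \<ominus> F n) < \<epsilon>" by blast
  qed
  with hilbert_complete[of F] Fc obtain x where x: "x \<in> carrier H" "(\<lambda>n. nrm (F n \<ominus> x)) \<longlonglongrightarrow> 0"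
    unfolding hnorm_nrm by blast
  have lim: "(\<lambda>n. ip H y (F n)) \<longlonglongrightarrow> ip H y x" if "y \<in> carrier H" for y
    using limit_ip[OF Fc x that] .
  show thesis
  proof (rule that[of x])
    show "ip H (e i) x = c i" for i
    proof (rule LIMSEQ_unique[OF lim[OF ec]])
      have "\<forall>\<^sub>F n in sequentially. ip H (e i) (F n) = c i"
        using eventually_gt_at_top[of i] by eventually_elim (simp add: eF)
      then show "(\<lambda>n. ip H (e i) (F n)) \<longlonglongrightarrow> c i" by (rule tendsto_eventually)
    qed
    show "(nrm x)\<^sup>2 \<le> C"
    proof -
      have "0 \<le> C" using bound[of 0] by simp
      have "nrm x \<le> sqrt C + nrm (F n \<ominus> x)" for n
      proof -
        have "nrm x \<le> nrm (x \<ominus> F n) + nrm (F n)"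
          using nrm_triangle[of "x \<ominus> F n" "F n"] Fc x(1) by simp
        moreover have "nrm (x \<ominus> F n) = nrm (F n \<ominus> x)" using Fc x(1) by (rule nrm_diff_commute[rotated])
        moreover have "nrm (F n) \<le> sqrt C"
          using nF[of n] bound[of n] by (intro real_le_rsqrt) (simp add: S_def)
        ultimately show ?thesis by linarith
      qed
      then have "nrm x \<le> sqrt C + 0"
        by (intro LIMSEQ_le_const[OF tendsto_add[OF tendsto_const x(2)]]) auto
      then have "(nrm x)\<^sup>2 \<le> (sqrt C)\<^sup>2" using x(1) by (intro power_mono) auto
      then show ?thesis using \<open>0 \<le> C\<close> by simp
    qed
    show "(\<lambda>n. \<Sum>i<n. c i * ip H y (e i)) \<longlonglongrightarrow> ip H y x" if "y \<in> carrier H" for y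
      using lim[OF that] yF[OF that] by simp
  qed (rule x)
qed

text \<open>
  Weak compactness of the unit ball, tested on a countable orthonormal family: a diagonal argument
  makes all coefficients converge, and Bessel's inequality passes to the limit.
\<close>

lemma weak_subsequence:
  assumes e: "quasi_orthonormal e" and v: "\<And>n. v n \<in> carrier H" "\<And>n. nrm (v n) \<le> 1"
  obtains r x where "strict_mono (r :: nat \<Rightarrow> nat)" "x \<in> carrier H" "nrm x \<le> 1"
    "\<And>i. (\<lambda>n. ip H (e i) (v (r n))) \<longlonglongrightarrow> ip H (e i) x"
proof -
  have ec: "e i \<in> carrier H" for i using e by (simp add: quasi_orthonormal_def)
  interpret subseqs "\<lambda>i s. convergent (\<lambda>n. ip H (e i) (v (s n)))"
  proof
    fix i and s :: "nat \<Rightarrow> nat" assume "strict_mono s"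
    have "cmod (ip H (e i) (v (s n))) \<le> nrm (e i)" for n
    proof -
      have "cmod (ip H (e i) (v (s n))) \<le> nrm (e i) * nrm (v (s n))"
        using cauchy_schwarz[OF ec v(1)] .
      also have "\<dots> \<le> nrm (e i) * 1" using v(2) ec by (intro mult_left_mono) auto
      finally show ?thesis by simp
    qed
    then have "bounded (range (\<lambda>n. ip H (e i) (v (s n))))"
      by (intro boundedI[of _ "nrm (e i)"]) auto
    from bounded_imp_convergent_subsequence[OF this] obtain l r where
      "strict_mono r" "((\<lambda>n. ip H (e i) (v (s n))) \<circ> r) \<longlonglongrightarrow> l" by blast
    then show "\<exists>r'. strict_mono r' \<and> convergent (\<lambda>n. ip H (e i) (v ((s \<circ> r') n)))"
      unfolding convergent_def o_def by blast
  qed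
  define r where "r = diagseq"
  have rm: "strict_mono r" unfolding r_def by (rule subseq_diagseq)
  have "convergent (\<lambda>n. ip H (e i) (v (r n)))" for i
  proof -
    have "convergent (\<lambda>n. ip H (e i) (v ((diagseq \<circ> ((+) (Suc i))) n)))"
    proof (rule diagseq_holds)
      fix r s :: "nat \<Rightarrow> nat" and n
      assume "strict_mono r" "convergent (\<lambda>m. ip H (e n) (v (s m)))"
      then show "convergent (\<lambda>m. ip H (e n) (v ((s \<circ> r) m)))"
        using convergent_subseq_convergent[of "\<lambda>m. ip H (e n) (v (s m))" r] by (simp add: o_def)
    qed
    then have "convergent (\<lambda>n. ip H (e i) (v (r (n + Suc i))))"
      by (simp add: o_def r_def add.commute)
    then show ?thesis
      by (rule convergent_ignore_initial_segment[of "\<lambda>n. ip H (e i) (v (r n))" "Suc i", THEN iffD1])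
  qed
  then have lim: "(\<lambda>n. ip H (e i) (v (r n))) \<longlonglongrightarrow> lim (\<lambda>n. ip H (e i) (v (r n)))" for i
    by (simp add: convergent_LIMSEQ_iff)
  define c where "c i = lim (\<lambda>n. ip H (e i) (v (r n)))" for i
  have "(\<Sum>i<n. (cmod (c i))\<^sup>2) \<le> 1" for n
  proof (rule LIMSEQ_le_const2)
    show "(\<lambda>m. \<Sum>i<n. (cmod (ip H (e i) (v (r m))))\<^sup>2) \<longlonglongrightarrow> (\<Sum>i<n. (cmod (c i))\<^sup>2)"
      unfolding c_def by (intro tendsto_sum tendsto_power tendsto_norm lim)
    show "\<exists>N. \<forall>m\<ge>N. (\<Sum>i<n. (cmod (ip H (e i) (v (r m))))\<^sup>2) \<le> 1"
    proof (intro exI allI impI)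
      fix m
      have "(\<Sum>i<n. (cmod (ip H (e i) (v (r m))))\<^sup>2) \<le> (nrm (v (r m)))\<^sup>2"
        by (rule bessel[OF e _ v(1)]) simp
      also have "\<dots> \<le> 1" using v by (simp add: power_le_one)
      finally show "(\<Sum>i<n. (cmod (ip H (e i) (v (r m))))\<^sup>2) \<le> 1" .
    qed
  qed
  moreover have "c i = 0" if "ip H (e i) (e i) \<noteq> 1" for i
    unfolding c_def using quasi_orthonormal_coeff[OF e v(1) that] by (simp add: limI)
  ultimately obtain x where "x \<in> carrier H" "\<And>i. ip H (e i) x = c i" "(nrm x)\<^sup>2 \<le> 1"
    using riesz_fischer[OF e, of c 1] by metis
  then show thesis
    using that[OF rm, of x] lim unfolding c_def by (simp add: power2_le_imp_le[of _ 1])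
qed

end

section \<open>Tensor squares and top singular vectors\<close>

locale tensor_square = H: hilbert_space H + K: hilbert_space K
  for H :: "('v, 'm) hilbert_scheme" and K :: "('w, 'n) hilbert_scheme" +
  fixes t :: "'v \<Rightarrow> 'v \<Rightarrow> 'w"
  assumes tensor: "hilbert_tensor H K t"
begin

lemma t_in [simp]: "u \<in> carrier H \<Longrightarrow> v \<in> carrier H \<Longrightarrow> t u v \<in> carrier K"
  using tensor unfolding hilbert_tensor_def by blast

lemma t_add:
  assumes "u \<in> carrier H" "u' \<in> carrier H" "v \<in> carrier H"
  shows "t (u \<oplus>\<^bsub>H\<^esub> u') v = t u v \<oplus>\<^bsub>K\<^esub> t u' v" "t v (u \<oplus>\<^bsub>H\<^esub> u') = t v u \<oplus>\<^bsub>K\<^esub> t v u'"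
  using tensor assms unfolding hilbert_tensor_def by blast+

lemma t_smult:
  assumes "u \<in> carrier H" "v \<in> carrier H"
  shows "t (c \<odot>\<^bsub>H\<^esub> u) v = c \<odot>\<^bsub>K\<^esub> t u v" "t u (c \<odot>\<^bsub>H\<^esub> v) = c \<odot>\<^bsub>K\<^esub> t u v"
  using tensor assms unfolding hilbert_tensor_def by blast+

lemma ip_t:
  assumes "u \<in> carrier H" "v \<in> carrier H" "u' \<in> carrier H" "v' \<in> carrier H"
  shows "ip K (t u v) (t u' v') = ip H u u' * ip H v v'"
  using tensor assms unfolding hilbert_tensor_def by blast

lemma nrm_t: "u \<in> carrier H \<Longrightarrow> v \<in> carrier H \<Longrightarrow> K.nrm (t u v) = H.nrm u * H.nrm v"
  unfolding K.nrm_def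
  by (subst ip_t) (simp_all add: H.g_self real_sqrt_mult)

lemma tensor_dense:
  assumes "k \<in> carrier K" "0 < (\<epsilon>::real)"
  shows "\<exists>(n::nat) u v. (\<forall>i<n. u i \<in> carrier H \<and> v i \<in> carrier H) \<and>
    K.nrm (k \<ominus>\<^bsub>K\<^esub> (\<Oplus>\<^bsub>K\<^esub>i\<in>{..<n}. t (u i) (v i))) < \<epsilon>"
  using tensor assms unfolding hilbert_tensor_def K.hnorm_nrm by simp

text \<open>
  By this symmetry every result about the left factor also holds for the right one.
\<close>

lemma swapped: "tensor_square H K (\<lambda>u v. t v u)"
proof (unfold_locales)
  show "hilbert_tensor H K (\<lambda>u v. t v u)"
    unfolding hilbert_tensor_def
  proof (intro conjI ballI allI impI)
    fix k and \<epsilon> :: real assume "k \<in> carrier K" "0 < \<epsilon>"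
    from tensor_dense[OF this] obtain n :: nat and u v where "\<forall>i<n. u i \<in> carrier H \<and> v i \<in> carrier H"
      "K.nrm (k \<ominus>\<^bsub>K\<^esub> (\<Oplus>\<^bsub>K\<^esub>i\<in>{..<n}. t (u i) (v i))) < \<epsilon>" by blast
    then show "\<exists>(n::nat) u v. (\<forall>i<n. u i \<in> carrier H \<and> v i \<in> carrier H) \<and>
        hnorm K (k \<ominus>\<^bsub>K\<^esub> (\<Oplus>\<^bsub>K\<^esub>i\<in>{..<n}. t (v i) (u i))) < \<epsilon>"
      unfolding K.hnorm_nrm by (intro exI[of _ n] exI[of _ v] exI[of _ u]) simp
  qed (simp_all add: t_add t_smult ip_t H.hilbert_space_axioms K.hilbert_space_axioms mult.commute)
qed

text \<open>
  Identities on elementary tensors extend to \<open>K\<close> by density.  The statement is for additive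
  functionals, so as to cover linear and antilinear ones alike.
\<close>

lemma bounded_functional_zero:
  assumes add: "\<And>x y. x \<in> carrier K \<Longrightarrow> y \<in> carrier K \<Longrightarrow> phi (x \<oplus>\<^bsub>K\<^esub> y) = phi x + phi y"
    and bound: "\<And>x. x \<in> carrier K \<Longrightarrow> cmod (phi x) \<le> C * K.nrm x"
    and zero: "\<And>u v. u \<in> carrier H \<Longrightarrow> v \<in> carrier H \<Longrightarrow> phi (t u v) = 0"
    and k: "k \<in> carrier K"
  shows "phi k = 0"
proof -
  have fin: "phi (\<Oplus>\<^bsub>K\<^esub>i\<in>{..<n}. t (u i) (v i)) = 0"
    if "\<And>i. i < n \<Longrightarrow> u i \<in> carrier H \<and> v i \<in> carrier H" for n :: nat and u v
    using that
  proof (induction n)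
    case 0
    then show ?case using add[of "\<zero>\<^bsub>K\<^esub>" "\<zero>\<^bsub>K\<^esub>"] by simp
  next
    case (Suc n)
    then have "(\<Oplus>\<^bsub>K\<^esub>i\<in>{..<Suc n}. t (u i) (v i)) =
        t (u n) (v n) \<oplus>\<^bsub>K\<^esub> (\<Oplus>\<^bsub>K\<^esub>i\<in>{..<n}. t (u i) (v i))"
      unfolding lessThan_Suc by (intro K.M.finsum_insert) auto
    then show ?case using Suc add zero by simp
  qed
  have "cmod (phi k) \<le> \<epsilon>" if "0 < \<epsilon>" for \<epsilon>
  proof -
    define C' where "C' = max C 0 + 1"
    have C': "0 < C'" "C \<le> C'" by (auto simp: C'_def)
    then have "0 < \<epsilon> / C'" using that by simp
    from tensor_dense[OF k this] obtain n :: nat and u v where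
      uv: "\<forall>i<n. u i \<in> carrier H \<and> v i \<in> carrier H"
      "K.nrm (k \<ominus>\<^bsub>K\<^esub> (\<Oplus>\<^bsub>K\<^esub>i\<in>{..<n}. t (u i) (v i))) < \<epsilon> / C'"
      by blast
    define S where "S = (\<Oplus>\<^bsub>K\<^esub>i\<in>{..<n}. t (u i) (v i))"
    have S: "S \<in> carrier K" using uv(1) by (simp add: S_def)
    have "phi k = phi (k \<ominus>\<^bsub>K\<^esub> S)"
      using add[of "k \<ominus>\<^bsub>K\<^esub> S" S] fin[of n u v] uv(1) S k by (simp add: S_def[symmetric])
    then have "cmod (phi k) \<le> C * K.nrm (k \<ominus>\<^bsub>K\<^esub> S)" using bound S k by simp
    also have "\<dots> \<le> C' * K.nrm (k \<ominus>\<^bsub>K\<^esub> S)" using C' S k by (intro mult_right_mono) auto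
    also have "\<dots> \<le> C' * (\<epsilon> / C')"
      using uv(2) C' by (intro mult_left_mono) (auto simp: S_def)
    finally show ?thesis using C' by simp
  qed
  then have "cmod (phi k) \<le> 0" using field_le_epsilon[of "cmod (phi k)" 0] by simp
  then show ?thesis by simp
qed

lemma tensor_ext:
  assumes x: "x \<in> carrier K" and y: "y \<in> carrier K"
    and eq: "\<And>u v. u \<in> carrier H \<Longrightarrow> v \<in> carrier H \<Longrightarrow> ip K (t u v) x = ip K (t u v) y"
  shows "x = y"
proof (rule K.ip_ext[OF x y])
  fix w assume w: "w \<in> carrier K"
  have "ip K w x - ip K w y = 0"
  proof (rule bounded_functional_zero[of "\<lambda>w. ip K w x - ip K w y" "K.nrm x + K.nrm y", OF _ _ _ w])
    fix w assume w: "w \<in> carrier K"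
    have "cmod (ip K w x - ip K w y) \<le> cmod (ip K w x) + cmod (ip K w y)"
      by (rule norm_triangle_ineq4)
    also have "\<dots> \<le> (K.nrm x + K.nrm y) * K.nrm w"
      using K.cauchy_schwarz[OF w x] K.cauchy_schwarz[OF w y] by (simp add: algebra_simps)
    finally show "cmod (ip K w x - ip K w y) \<le> (K.nrm x + K.nrm y) * K.nrm w" .
  qed (use x y eq in \<open>simp_all add: K.g_add_left\<close>)
  then show "ip K w x = ip K w y" by simp
qed

text \<open>
  The unit ball of \<open>H\<close> is not norm compact, but \<open>\<langle>u \<otimes> u', z\<rangle>\<close> is weakly continuous on it: \<open>z\<close> is
  a limit of finite sums of elementary tensors, uniformly in \<open>u\<close> and \<open>u'\<close> on the unit ball, and
  for such a sum only the inner products with the finitely many factors matter.  All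
  these factors are combinations of one countable orthonormal family, along which a maximising
  sequence has a weakly convergent subsequence.
\<close>

lemma maximizer:
  assumes z: "z \<in> carrier K"
  obtains v w where "v \<in> carrier H" "w \<in> carrier H" "H.nrm v \<le> 1" "H.nrm w \<le> 1"
    "\<And>u u'. u \<in> carrier H \<Longrightarrow> u' \<in> carrier H \<Longrightarrow> H.nrm u \<le> 1 \<Longrightarrow> H.nrm u' \<le> 1 \<Longrightarrow>
       cmod (ip K (t u u') z) \<le> cmod (ip K (t v w) z)"
proof -
  define U where "U = {u \<in> carrier H. H.nrm u \<le> 1}"
  define f where "f u u' = cmod (ip K (t u u') z)" for u u'
  have nt: "K.nrm (t u u') \<le> 1" if "u \<in> U" "u' \<in> U" for u u'
    using that mult_mono[of "H.nrm u" 1 "H.nrm u'" 1] by (simp add: U_def nrm_t)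
  have UH: "u \<in> carrier H" if "u \<in> U" for u using that by (simp add: U_def)
  have fle: "f u u' \<le> K.nrm z" if "u \<in> U" "u' \<in> U" for u u'
  proof -
    have "f u u' \<le> K.nrm (t u u') * K.nrm z"
      unfolding f_def using K.cauchy_schwarz z UH that by simp
    also have "\<dots> \<le> 1 * K.nrm z" using nt[OF that] z by (intro mult_right_mono) auto
    finally show ?thesis by simp
  qed
  define s where "s = (SUP p\<in>U\<times>U. f (fst p) (snd p))"
  have bdd: "bdd_above ((\<lambda>p. f (fst p) (snd p)) ` (U\<times>U))"
    using fle by (intro bdd_aboveI[of _ "K.nrm z"]) auto
  have "H.nrm \<zero>\<^bsub>H\<^esub> = 0" by (simp add: H.nrm_def)
  then have "U \<noteq> {}" unfolding U_def by (force intro: exI[of _ "\<zero>\<^bsub>H\<^esub>"])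
  have upper: "f u u' \<le> s" if "u \<in> U" "u' \<in> U" for u u'
    unfolding s_def using that cSUP_upper[OF _ bdd, of "(u, u')"] by simp
  have "\<exists>p\<in>U\<times>U. s - 1 / real (Suc n) < f (fst p) (snd p)" for n
  proof -
    have "s - 1 / real (Suc n) < s" by simp
    then show ?thesis
      using less_cSUP_iff[OF _ bdd, of "s - 1 / real (Suc n)"] \<open>U \<noteq> {}\<close>
      by (simp only: s_def[symmetric] Sigma_empty_iff) blast
  qed
  then obtain p where p: "\<And>n. p n \<in> U \<times> U" "\<And>n. s - 1 / real (Suc n) < f (fst (p n)) (snd (p n))"
    by metis
  define V where "V n = fst (p n)" for n
  define W where "W n = snd (p n)" for n
  have VW: "V n \<in> U" "W n \<in> U" "s - 1 / real (Suc n) < f (V n) (W n)" for n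
    using p[of n] by (auto simp: V_def W_def)
  define Q where "Q m n a b \<longleftrightarrow> (\<forall>i<n. a i \<in> carrier H \<and> b i \<in> carrier H) \<and>
      K.nrm (z \<ominus>\<^bsub>K\<^esub> (\<Oplus>\<^bsub>K\<^esub>i\<in>{..<n}. t (a i) (b i))) < 1 / real (Suc m)"
    for m and n :: nat and a b
  have "\<exists>n a b. Q m n a b" for m
    unfolding Q_def by (rule tensor_dense[OF z]) simp
  then obtain N a b where Q: "\<And>m. Q m (N m) (a m) (b m)" by metis
  have ab: "\<And>m i. i < N m \<Longrightarrow> a m i \<in> carrier H \<and> b m i \<in> carrier H"
    "\<And>m. K.nrm (z \<ominus>\<^bsub>K\<^esub> (\<Oplus>\<^bsub>K\<^esub>i\<in>{..<N m}. t (a m i) (b m i))) < 1 / real (Suc m)"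
    using Q unfolding Q_def by blast+
  \<comment> \<open>\<open>sq\<close> lists the factors of all the approximating sums, left factors \<open>a m i\<close> at the even places
    \<open>l = 2 * i\<close> and right factors \<open>b m i\<close> at the odd ones.\<close>
  define sq where "sq k = (case prod_decode k of (m, l) \<Rightarrow>
     if l div 2 < N m then (if even l then a m (l div 2) else b m (l div 2)) else \<zero>\<^bsub>H\<^esub>)" for k
  have sqc: "sq k \<in> carrier H" for k
    using ab(1) by (simp add: sq_def split: prod.split)
  have sqa: "sq (prod_encode (m, 2 * i)) = a m i" "sq (prod_encode (m, 2 * i + 1)) = b m i"
    if "i < N m" for m i using that by (simp_all add: sq_def)
  obtain e where e: "H.quasi_orthonormal e"
    "\<And>n. H.nrm (sq n \<ominus>\<^bsub>H\<^esub> (\<Oplus>\<^bsub>H\<^esub>i\<in>{..n}. ip H (e i) (sq n) \<odot>\<^bsub>H\<^esub> e i)) = 0"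
    by (rule H.gram_schmidt[of sq]) (use sqc in auto)
  have ec: "e i \<in> carrier H" for i using e(1) by (simp add: H.quasi_orthonormal_def)
  have sq: "sq n = (\<Oplus>\<^bsub>H\<^esub>i\<in>{..n}. ip H (e i) (sq n) \<odot>\<^bsub>H\<^esub> e i)" for n
    by (rule H.diff_eq_0D[OF _ _ e(2)]) (use sqc ec in auto)
  obtain r1 v where r1: "strict_mono r1" and v: "v \<in> carrier H" "H.nrm v \<le> 1"
    "\<And>i. (\<lambda>n. ip H (e i) (V (r1 n))) \<longlonglongrightarrow> ip H (e i) v"
    using H.weak_subsequence[OF e(1), of V] VW by (auto simp: U_def)
  obtain r2 w where r2: "strict_mono r2" and w: "w \<in> carrier H" "H.nrm w \<le> 1"
    "\<And>i. (\<lambda>n. ip H (e i) (W (r1 (r2 n)))) \<longlonglongrightarrow> ip H (e i) w"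
    using H.weak_subsequence[OF e(1), of "\<lambda>n. W (r1 n)"] VW by (auto simp: U_def)
  define r where "r n = r1 (r2 n)" for n
  have rm: "strict_mono r" using strict_mono_o[OF r1 r2] by (simp add: r_def[abs_def] o_def)
  have v': "(\<lambda>n. ip H (e i) (V (r n))) \<longlonglongrightarrow> ip H (e i) v" for i
    using LIMSEQ_subseq_LIMSEQ[OF v(3) r2] by (simp add: o_def r_def)
  have lim: "(\<lambda>n. ip H (X n) (sq j)) \<longlonglongrightarrow> ip H x (sq j)"
    if X: "\<And>n. X n \<in> carrier H" "x \<in> carrier H" "\<And>i. (\<lambda>n. ip H (e i) (X n)) \<longlonglongrightarrow> ip H (e i) x" for X x j
  proof -
    have "ip H y (sq j) = (\<Sum>i\<le>j. ip H (e i) (sq j) * cnj (ip H (e i) y))" if y: "y \<in> carrier H" for y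
    proof -
      have "ip H y (sq j) = ip H y (\<Oplus>\<^bsub>H\<^esub>i\<in>{..j}. ip H (e i) (sq j) \<odot>\<^bsub>H\<^esub> e i)"
        using arg_cong[OF sq[of j], of "ip H y"] .
      also have "\<dots> = (\<Sum>i\<le>j. ip H (e i) (sq j) * ip H y (e i))"
        using y ec by (simp add: H.g_sum H.g_smult)
      also have "\<dots> = (\<Sum>i\<le>j. ip H (e i) (sq j) * cnj (ip H (e i) y))"
        by (intro sum.cong refl arg_cong2[where f = "(*)"] H.g_cnj ec y)
      finally show ?thesis .
    qed
    then show ?thesis
      using X by (simp only:) (intro tendsto_intros)
  qed
  define S where "S m = (\<Oplus>\<^bsub>K\<^esub>i\<in>{..<N m}. t (a m i) (b m i))" for m
  have Sc: "S m \<in> carrier K" for m using ab(1) by (simp add: S_def)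
  have vwU: "v \<in> U" "w \<in> U" using v w by (auto simp: U_def)
  have limS: "(\<lambda>n. ip K (t (V (r n)) (W (r n))) (S m)) \<longlonglongrightarrow> ip K (t v w) (S m)" for m
  proof -
    have *: "ip K (t x y) (S m) = (\<Sum>i<N m. ip H x (sq (prod_encode (m, 2 * i))) * ip H y (sq (prod_encode (m, 2 * i + 1))))"
      if "x \<in> carrier H" "y \<in> carrier H" for x y
      unfolding S_def using that ab(1)
      by (subst K.g_sum) (auto intro!: sum.cong simp: ip_t sqa simp del: One_nat_def)
    show ?thesis
      unfolding *[OF v(1) w(1)] *[OF UH UH, OF VW(1) VW(2)]
      by (intro tendsto_sum tendsto_mult lim v' w(3)[folded r_def] v w UH VW)
  qed
  have "(\<lambda>n. ip K (t (V (r n)) (W (r n))) z) \<longlonglongrightarrow> ip K (t v w) z"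
  proof (rule LIMSEQ_I)
    fix \<epsilon> :: real assume "0 < \<epsilon>"
    then obtain m where m: "1 / real (Suc m) < \<epsilon> / 3" using nat_approx_posE[of "\<epsilon> / 3"] by auto
    from LIMSEQ_D[OF limS[of m], of "\<epsilon> / 3"] \<open>0 < \<epsilon>\<close> obtain n0 where
      n0: "\<And>n. n \<ge> n0 \<Longrightarrow> cmod (ip K (t (V (r n)) (W (r n))) (S m) - ip K (t v w) (S m)) < \<epsilon> / 3"
      by auto
    have close: "cmod (ip K (t x y) z - ip K (t x y) (S m)) < \<epsilon> / 3" if "x \<in> U" "y \<in> U" for x y
    proof -
      have "cmod (ip K (t x y) (z \<ominus>\<^bsub>K\<^esub> S m)) \<le> K.nrm (t x y) * K.nrm (z \<ominus>\<^bsub>K\<^esub> S m)"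
        using K.cauchy_schwarz UH that Sc z by simp
      also have "\<dots> \<le> 1 * K.nrm (z \<ominus>\<^bsub>K\<^esub> S m)"
        using nt[OF that] Sc z by (intro mult_right_mono) auto
      finally show ?thesis using ab(2)[of m] m UH that Sc z by (simp add: K.g_diff S_def[symmetric])
    qed
    have "cmod (ip K (t (V (r n)) (W (r n))) z - ip K (t v w) z) < \<epsilon>" if "n \<ge> n0" for n
    proof -
      let ?x = "ip K (t (V (r n)) (W (r n)))" and ?y = "ip K (t v w)"
      have "?x z - ?y z = (?x z - ?x (S m)) + (?x (S m) - ?y (S m)) + - (?y z - ?y (S m))" by simp
      also have "cmod \<dots> \<le> cmod (?x z - ?x (S m)) + cmod (?x (S m) - ?y (S m)) + cmod (?y z - ?y (S m))"
        by (metis norm_minus_cancel norm_triangle_mono norm_triangle_ineq order_refl)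
      also have "\<dots> < \<epsilon> / 3 + \<epsilon> / 3 + \<epsilon> / 3"
        by (intro add_strict_mono close n0 that VW vwU)
      finally show ?thesis by simp
    qed
    then show "\<exists>n0. \<forall>n\<ge>n0. cmod (ip K (t (V (r n)) (W (r n))) z - ip K (t v w) z) < \<epsilon>" by blast
  qed
  then have lim1: "(\<lambda>n. f (V (r n)) (W (r n))) \<longlonglongrightarrow> f v w" unfolding f_def by (rule tendsto_norm)
  have lim2: "(\<lambda>n. s - 1 / real (Suc (r n))) \<longlonglongrightarrow> s - 0"
    using LIMSEQ_subseq_LIMSEQ[OF LIMSEQ_Suc[OF lim_1_over_n] rm] by (intro tendsto_intros) (simp add: o_def)
  have "s - 0 \<le> f v w"
    by (rule LIMSEQ_le[OF lim2 lim1]) (use VW(3) in \<open>auto intro: less_imp_le\<close>)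
  then show thesis
    using that[of v w] v w upper unfolding f_def U_def by fastforce
qed

text \<open>
  At a maximiser both partial functionals attain their norms, so \<open>attained_functional\<close> identifies
  them.  The phase of \<open>v\<close> has to be adjusted to make the maximal value real.
\<close>

lemma top_singular_vectors:
  assumes z: "z \<in> carrier K"
  obtains s v w where "v \<in> carrier H" "w \<in> carrier H" "0 \<le> (s::real)"
    "\<And>u u'. u \<in> carrier H \<Longrightarrow> u' \<in> carrier H \<Longrightarrow> cmod (ip K (t u u') z) \<le> s * H.nrm u * H.nrm u'"
    "0 < s \<Longrightarrow> H.nrm v = 1 \<and> H.nrm w = 1 \<and>
       (\<forall>u\<in>carrier H. ip K (t u w) z = of_real s * ip H u v \<and> ip K (t v u) z = of_real s * ip H u w)"
proof -
  obtain v w where vw: "v \<in> carrier H" "w \<in> carrier H" "H.nrm v \<le> 1" "H.nrm w \<le> 1"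
    and max: "\<And>u u'. u \<in> carrier H \<Longrightarrow> u' \<in> carrier H \<Longrightarrow> H.nrm u \<le> 1 \<Longrightarrow> H.nrm u' \<le> 1 \<Longrightarrow>
       cmod (ip K (t u u') z) \<le> cmod (ip K (t v w) z)"
    using maximizer[OF z] by metis
  define s where "s = cmod (ip K (t v w) z)"
  have bound: "cmod (ip K (t u u') z) \<le> s * H.nrm u * H.nrm u'"
    if u: "u \<in> carrier H" "u' \<in> carrier H" for u u'
  proof (cases "H.nrm u = 0 \<or> H.nrm u' = 0")
    case True
    then have "cmod (ip K (t u u') z) \<le> 0"
      using K.cauchy_schwarz[of "t u u'" z] z u by (auto simp: nrm_t)
    then show ?thesis using True by auto
  next
    case False
    define a where "a = H.nrm u"
    define b where "b = H.nrm u'"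
    have ab: "0 < a" "0 < b" using False H.nrm_nonneg u unfolding a_def b_def by (metis less_le)+
    have "cmod (ip K (t (of_real (1/a) \<odot>\<^bsub>H\<^esub> u) (of_real (1/b) \<odot>\<^bsub>H\<^esub> u')) z) \<le> s"
      unfolding s_def using ab u by (intro max) (auto simp: H.nrm_smult a_def b_def norm_divide)
    then have "cmod (ip K (t u u') z) / (a * b) \<le> s"
      using ab u z by (simp add: t_smult K.g_smult_left norm_mult norm_divide mult.commute)
    then show ?thesis using ab by (simp add: a_def[symmetric] b_def[symmetric] field_simps)
  qed
  show thesis
  proof (cases "s = 0")
    case True
    then show ?thesis using that[of v w 0] vw bound by auto
  next
    case False
    then have s: "0 < s" by (simp add: s_def)
    have "s \<le> s * H.nrm v * H.nrm w" using bound[OF vw(1,2)] by (simp add: s_def)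
    then have prod: "1 \<le> H.nrm v * H.nrm w" using s by (simp add: mult.assoc)
    have nv: "H.nrm v = 1" "H.nrm w = 1"
    proof -
      have "H.nrm v * H.nrm w \<le> H.nrm v * 1" "H.nrm v * H.nrm w \<le> 1 * H.nrm w"
        using vw by (intro mult_left_mono mult_right_mono; simp)+
      then show "H.nrm v = 1" "H.nrm w = 1" using prod vw by auto
    qed
    define c where "c = ip K (t v w) z / of_real s"
    have c: "cmod c = 1" using s by (simp add: c_def norm_divide s_def[symmetric])
    define v' where "v' = c \<odot>\<^bsub>H\<^esub> v"
    have v': "v' \<in> carrier H" "H.nrm v' = 1" using vw c nv by (simp_all add: v'_def H.nrm_smult)
    have "ip K (t v' w) z = cnj c * c * of_real s"
      using vw z s by (simp add: v'_def t_smult K.g_smult_left c_def)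
    also have "cnj c * c = 1" using c complex_norm_square[of c] by (simp add: mult.commute)
    finally have val: "ip K (t v' w) z = of_real s" by simp
    show thesis
    proof (rule that[of v' w s])
      show "0 \<le> s" using s by simp
      assume "0 < s"
      have 1: "ip K (t u w) z = of_real s * ip H u v'" if u: "u \<in> carrier H" for u
        by (rule H.attained_functional[where phi = "\<lambda>u. ip K (t u w) z"])
          (use v' vw z s u val bound[of _ w] nv in \<open>auto simp: t_add t_smult K.g_add_left K.g_smult_left\<close>)
      have 2: "ip K (t v' u) z = of_real s * ip H u w" if u: "u \<in> carrier H" for u
        by (rule H.attained_functional[where phi = "\<lambda>u. ip K (t v' u) z"])
          (use v' vw z s u val bound[of v'] nv in \<open>auto simp: t_add t_smult K.g_add_left K.g_smult_left\<close>)
      show "H.nrm v' = 1 \<and> H.nrm w = 1 \<and>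
       (\<forall>u\<in>carrier H. ip K (t u w) z = of_real s * ip H u v' \<and> ip K (t v' u) z = of_real s * ip H u w)"
        using 1 2 v' nv by blast
    qed (use v' vw bound in auto)
  qed
qed

section \<open>The Schmidt decomposition\<close>

lemma t_sum_left:
  assumes "finite A" "y \<in> carrier H" "\<And>i. i \<in> A \<Longrightarrow> f i \<in> carrier H" "x \<in> carrier K"
  shows "ip K x (t (\<Oplus>\<^bsub>H\<^esub>i\<in>A. f i) y) = (\<Sum>i\<in>A. ip K x (t (f i) y))"
  using assms(1,3)
proof (induction A rule: finite_induct)
  case empty
  have "ip K x (t \<zero>\<^bsub>H\<^esub> y) = ip K x (t (\<zero>\<^bsub>H\<^esub> \<oplus>\<^bsub>H\<^esub> \<zero>\<^bsub>H\<^esub>) y)" by simp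
  also have "\<dots> = ip K x (t \<zero>\<^bsub>H\<^esub> y) + ip K x (t \<zero>\<^bsub>H\<^esub> y)"
    using assms(2,4) by (simp only: t_add H.M.zero_closed K.g_add t_in)
  finally show ?case by simp
next
  case (insert i F)
  then have "(\<Oplus>\<^bsub>H\<^esub>i\<in>insert i F. f i) = f i \<oplus>\<^bsub>H\<^esub> (\<Oplus>\<^bsub>H\<^esub>i\<in>F. f i)"
    by (intro H.M.finsum_insert) auto
  with insert show ?case using assms(2,4) by (simp add: t_add K.g_add)
qed

text \<open>
  A singular value decomposition of \<open>z\<close>, with the series \<open>\<Sum>k. s k (v k \<otimes> w k)\<close> converging to \<open>z\<close> weakly.
  An index with \<open>s k = 0\<close> is a placeholder; its vectors are arbitrary.
\<close>

definition schmidt :: "'w \<Rightarrow> (nat \<Rightarrow> real) \<Rightarrow> (nat \<Rightarrow> 'v) \<Rightarrow> (nat \<Rightarrow> 'v) \<Rightarrow> bool" where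
  "schmidt z s v w \<longleftrightarrow>
     (\<forall>k. 0 \<le> s k \<and> v k \<in> carrier H \<and> w k \<in> carrier H) \<and>
     (\<forall>j k. 0 < s j \<longrightarrow> 0 < s k \<longrightarrow> ip H (v j) (v k) = (if j = k then 1 else 0) \<and>
        ip H (w j) (w k) = (if j = k then 1 else 0)) \<and>
     (\<forall>k. \<forall>u\<in>carrier H. 0 < s k \<longrightarrow> ip K (t u (w k)) z = of_real (s k) * ip H u (v k) \<and>
        ip K (t (v k) u) z = of_real (s k) * ip H u (w k)) \<and>
     (\<forall>y\<in>carrier K. (\<lambda>k. of_real (s k) * ip K (t (v k) (w k)) y) sums ip K z y)"

text \<open>
  Top singular pairs are split off one after the other.  The squared norm of the remainder
  decreases by \<open>(s n)\<^sup>2\<close> in each step, so the remainders converge and \<open>s n\<close> tends to 0; as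
  \<open>s n\<close> bounds the remainder on elementary tensors, the limit is 0.
\<close>

lemma schmidt_decomposition:
  assumes z: "z \<in> carrier K"
  obtains s v w where "schmidt z s v w"
proof -
  define T where "T z s v w \<longleftrightarrow> v \<in> carrier H \<and> w \<in> carrier H \<and> 0 \<le> s \<and>
    (\<forall>u\<in>carrier H. \<forall>u'\<in>carrier H. cmod (ip K (t u u') z) \<le> s * H.nrm u * H.nrm u') \<and>
    (0 < s \<longrightarrow> H.nrm v = 1 \<and> H.nrm w = 1 \<and>
       (\<forall>u\<in>carrier H. ip K (t u w) z = of_real s * ip H u v \<and> ip K (t v u) z = of_real s * ip H u w))"
    for z and s :: real and v w
  have "\<exists>s v w. T z s v w" if "z \<in> carrier K" for z
    using top_singular_vectors[OF that] unfolding T_def by metis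
  then obtain S V W where SVW: "\<And>z. z \<in> carrier K \<Longrightarrow> T z (S z) (V z) (W z)" by metis
  define \<zeta> where "\<zeta> = rec_nat z (\<lambda>_ x. x \<ominus>\<^bsub>K\<^esub> of_real (S x) \<odot>\<^bsub>K\<^esub> t (V x) (W x))"
  have \<zeta>0: "\<zeta> 0 = z" by (simp add: \<zeta>_def)
  define s where "s n = S (\<zeta> n)" for n
  define v where "v n = V (\<zeta> n)" for n
  define w where "w n = W (\<zeta> n)" for n
  have \<zeta>Suc: "\<zeta> (Suc n) = \<zeta> n \<ominus>\<^bsub>K\<^esub> of_real (s n) \<odot>\<^bsub>K\<^esub> t (v n) (w n)" for n
    by (simp add: \<zeta>_def s_def v_def w_def)
  have \<zeta>c: "\<zeta> n \<in> carrier K" for n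
  proof (induction n)
    case (Suc n)
    then have "V (\<zeta> n) \<in> carrier H" "W (\<zeta> n) \<in> carrier H" using SVW[OF Suc] by (simp_all add: T_def)
    then show ?case using Suc by (simp add: \<zeta>Suc v_def w_def)
  qed (simp add: \<zeta>0 z)
  have "T (\<zeta> n) (s n) (v n) (w n)" for n using SVW[OF \<zeta>c] by (simp add: s_def v_def w_def)
  then have vc: "v n \<in> carrier H" and wc: "w n \<in> carrier H" and s0: "0 \<le> s n"
    and bound: "u \<in> carrier H \<Longrightarrow> u' \<in> carrier H \<Longrightarrow> cmod (ip K (t u u') (\<zeta> n)) \<le> s n * H.nrm u * H.nrm u'"
    and unit: "0 < s n \<Longrightarrow> H.nrm (v n) = 1 \<and> H.nrm (w n) = 1"
    and top1: "0 < s n \<Longrightarrow> u \<in> carrier H \<Longrightarrow> ip K (t u (w n)) (\<zeta> n) = of_real (s n) * ip H u (v n)"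
    and top2: "0 < s n \<Longrightarrow> u \<in> carrier H \<Longrightarrow> ip K (t (v n) u) (\<zeta> n) = of_real (s n) * ip H u (w n)"
    for n u u'
    unfolding T_def by blast+
  have \<zeta>_step: "ip K y (\<zeta> (Suc n)) = ip K y (\<zeta> n) - of_real (s n) * ip K y (t (v n) (w n))"
    if "y \<in> carrier K" for y n
    using that \<zeta>c vc wc by (simp add: \<zeta>Suc K.g_diff K.g_smult)
  \<comment> \<open>A pair that has been split off remains orthogonal to all later remainders.\<close>
  have inv: "ip K (t u (w k)) (\<zeta> n) = 0 \<and> ip K (t (v k) u) (\<zeta> n) = 0"
    if "k < n" "0 < s k" "u \<in> carrier H" for k n u
    using that
  proof (induction n arbitrary: u)
    case (Suc n)
    show ?case
    proof (cases "k = n")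
      case True
      have "ip H (v n) (v n) = 1" "ip H (w n) (w n) = 1"
        using unit[of n] Suc.prems True H.g_self[OF vc, of n] H.g_self[OF wc, of n] by simp_all
      then show ?thesis
        using Suc.prems True top1[of n u] top2[of n u] vc wc
        by (simp add: \<zeta>_step ip_t)
    next
      case False
      then have IH: "ip K (t u (w k)) (\<zeta> n) = 0 \<and> ip K (t (v k) u) (\<zeta> n) = 0" if "u \<in> carrier H" for u
        using Suc that by simp
      have "s n = 0 \<or> ip H (w k) (w n) = 0 \<and> ip H (v k) (v n) = 0"
      proof (cases "s n = 0")
        case False
        then have pos: "0 < s n" using s0[of n] by simp
        have "of_real (s n) * ip H (v k) (v n) = 0" "of_real (s n) * ip H (w k) (w n) = 0"
          using IH[OF vc[of n]] IH[OF wc[of n]] top1[OF pos vc[of k]] top2[OF pos wc[of k]] by metis+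
        then show ?thesis using False by simp
      qed simp
      then show ?thesis using IH[OF Suc.prems(3)] Suc.prems vc wc by (auto simp: \<zeta>_step ip_t)
    qed
  qed simp
  have orth: "ip H (v j) (v k) = (if j = k then 1 else 0)" "ip H (w j) (w k) = (if j = k then 1 else 0)"
    if pos: "0 < s j" "0 < s k" for j k
  proof -
    have *: "ip H (v j) (v k) = 0 \<and> ip H (w j) (w k) = 0" if "j < k" "0 < s j" "0 < s k" for j k
    proof -
      have "of_real (s k) * ip H (v j) (v k) = 0" "of_real (s k) * ip H (w j) (w k) = 0"
        using inv[OF that(1,2) vc[of k]] inv[OF that(1,2) wc[of k]]
          top1[OF that(3) vc[of j]] top2[OF that(3) wc[of j]] by metis+
      then show ?thesis using that(3) by simp
    qed
    have "ip H (v j) (v k) = 0 \<and> ip H (w j) (w k) = 0" if ne: "j \<noteq> k"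
    proof (cases "j < k")
      case True
      then show ?thesis using * pos by blast
    next
      case False
      then have "ip H (v k) (v j) = 0 \<and> ip H (w k) (w j) = 0" using *[of k j] pos ne by simp
      then show ?thesis using H.g_cnj[OF vc vc, of k j] H.g_cnj[OF wc wc, of k j] by simp
    qed
    moreover have "ip H (v j) (v j) = 1" "ip H (w j) (w j) = 1"
      using unit[OF pos(1)] H.g_self[OF vc] H.g_self[OF wc] by simp_all
    ultimately show "ip H (v j) (v k) = (if j = k then 1 else 0)" "ip H (w j) (w k) = (if j = k then 1 else 0)"
      by auto
  qed
  have partial: "ip K y (\<zeta> n) = ip K y z - (\<Sum>k<n. of_real (s k) * ip K y (t (v k) (w k)))"
    if "y \<in> carrier K" for y n
    using that by (induction n) (simp_all add: \<zeta>0 \<zeta>_step)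
  have norm_step: "(K.nrm (\<zeta> (Suc n)))\<^sup>2 = (K.nrm (\<zeta> n))\<^sup>2 - (s n)\<^sup>2" for n
  proof (cases "s n = 0")
    case True
    then show ?thesis using \<zeta>c[of n] vc wc by (simp add: \<zeta>Suc)
  next
    case False
    then have pos: "0 < s n" using s0[of n] by simp
    have "ip H (v n) (v n) = 1" using orth(1)[OF pos pos] by simp
    then have "ip K (t (v n) (w n)) (\<zeta> n) = of_real (s n)" using top1[OF pos vc] by simp
    then have "ip K (\<zeta> n) (t (v n) (w n)) = of_real (s n)"
      using K.g_cnj[of "t (v n) (w n)" "\<zeta> n"] \<zeta>c vc wc by simp
    then have "Re (ip K (\<zeta> n) (of_real (s n) \<odot>\<^bsub>K\<^esub> t (v n) (w n))) = (s n)\<^sup>2"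
      using \<zeta>c vc wc by (simp add: K.g_smult power2_eq_square)
    then show ?thesis
      using unit[OF pos] \<zeta>c vc wc
      by (simp add: \<zeta>Suc K.nrm_diff_sq K.nrm_smult nrm_t)
  qed
  \<comment> \<open>Later remainders are orthogonal projections of earlier ones.\<close>
  have nested: "ip K (\<zeta> n) (\<zeta> m) = of_real ((K.nrm (\<zeta> n))\<^sup>2)" if "m \<le> n" for m n
    using that
  proof (induction rule: inc_induct)
    case base
    then show ?case using K.g_self[OF \<zeta>c] by simp
  next
    case (step m)
    have "of_real (s m) * ip K (\<zeta> n) (t (v m) (w m)) = 0"
    proof (cases "s m = 0")
      case False
      then have "ip K (t (v m) (w m)) (\<zeta> n) = 0" using inv[of m n "w m"] step s0[of m] wc by simp
      then show ?thesis using K.g_cnj[of "t (v m) (w m)" "\<zeta> n"] \<zeta>c vc wc by simp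
    qed simp
    then have "ip K (\<zeta> n) (\<zeta> (Suc m)) = ip K (\<zeta> n) (\<zeta> m)"
      by (simp only: \<zeta>_step[OF \<zeta>c] diff_0_right)
    then show ?case using step by simp
  qed
  define N where "N n = (K.nrm (\<zeta> n))\<^sup>2" for n
  have dec: "decseq N" unfolding N_def by (intro decseq_SucI) (simp add: norm_step)
  then obtain l where l: "N \<longlonglongrightarrow> l"
    by (rule decseq_convergent[of N 0]) (simp_all add: N_def)
  then have conv: "convergent N" by (rule convergentI)
  then have "Cauchy N" by (rule convergent_Cauchy)
  have dist: "(K.nrm (\<zeta> m \<ominus>\<^bsub>K\<^esub> \<zeta> n))\<^sup>2 = \<bar>N m - N n\<bar>" for m n
  proof -
    have *: "(K.nrm (\<zeta> n \<ominus>\<^bsub>K\<^esub> \<zeta> m))\<^sup>2 = \<bar>N m - N n\<bar>" if "m \<le> n" for m n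
      using nested[OF that] decseqD[OF dec that] \<zeta>c by (simp add: K.nrm_diff_sq N_def)
    show ?thesis
      using *[of n m] *[of m n] K.nrm_diff_commute[OF \<zeta>c \<zeta>c, of m n] by (cases "m \<le> n") auto
  qed
  have "\<forall>\<epsilon>>0. \<exists>M. \<forall>m\<ge>M. \<forall>n\<ge>M. hnorm K (\<zeta> m \<ominus>\<^bsub>K\<^esub> \<zeta> n) < \<epsilon>"
  proof (intro allI impI)
    fix \<epsilon> :: real assume "0 < \<epsilon>"
    then have "0 < \<epsilon>\<^sup>2" by simp
    with \<open>Cauchy N\<close> obtain M where M: "\<And>m n. m \<ge> M \<Longrightarrow> n \<ge> M \<Longrightarrow> \<bar>N m - N n\<bar> < \<epsilon>\<^sup>2"
      unfolding Cauchy_def dist_real_def by metis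
    have "hnorm K (\<zeta> m \<ominus>\<^bsub>K\<^esub> \<zeta> n) < \<epsilon>" if "m \<ge> M" "n \<ge> M" for m n
      unfolding K.hnorm_nrm
      by (rule power2_less_imp_less) (use M[OF that] \<open>0 < \<epsilon>\<close> dist in auto)
    then show "\<exists>M. \<forall>m\<ge>M. \<forall>n\<ge>M. hnorm K (\<zeta> m \<ominus>\<^bsub>K\<^esub> \<zeta> n) < \<epsilon>" by blast
  qed
  with K.hilbert_complete[of \<zeta>] \<zeta>c obtain x where
    x: "x \<in> carrier K" "(\<lambda>n. K.nrm (\<zeta> n \<ominus>\<^bsub>K\<^esub> x)) \<longlonglongrightarrow> 0"
    unfolding K.hnorm_nrm by blast
  have "s \<longlonglongrightarrow> 0"
  proof -
    from l have "(\<lambda>n. N n - N (Suc n)) \<longlonglongrightarrow> l - l" by (intro tendsto_diff LIMSEQ_Suc)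
    then have "(\<lambda>n. (s n)\<^sup>2) \<longlonglongrightarrow> 0" by (simp add: N_def norm_step)
    then have "(\<lambda>n. sqrt ((s n)\<^sup>2)) \<longlonglongrightarrow> sqrt 0" by (rule tendsto_real_sqrt)
    then show ?thesis using s0 by simp
  qed
  have "x = \<zero>\<^bsub>K\<^esub>"
  proof (rule tensor_ext[OF x(1) K.M.zero_closed])
    fix u u' assume u: "u \<in> carrier H" "u' \<in> carrier H"
    have "(\<lambda>n. ip K (t u u') (\<zeta> n)) \<longlonglongrightarrow> ip K (t u u') x"
      using K.limit_ip[OF \<zeta>c x] u by simp
    moreover have "(\<lambda>n. ip K (t u u') (\<zeta> n)) \<longlonglongrightarrow> 0"
    proof (rule Lim_null_comparison)
      show "\<forall>\<^sub>F n in sequentially. cmod (ip K (t u u') (\<zeta> n)) \<le> s n * (H.nrm u * H.nrm u')"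
        using bound[OF u] by (simp add: mult.assoc)
      show "(\<lambda>n. s n * (H.nrm u * H.nrm u')) \<longlonglongrightarrow> 0"
        using tendsto_mult_right[OF \<open>s \<longlonglongrightarrow> 0\<close>, of "H.nrm u * H.nrm u'"] by simp
    qed
    ultimately have "ip K (t u u') x = 0" by (rule LIMSEQ_unique)
    then show "ip K (t u u') x = ip K (t u u') \<zero>\<^bsub>K\<^esub>" using u by simp
  qed
  have "schmidt z s v w"
    unfolding schmidt_def
  proof (intro conjI allI ballI impI)
    fix j k assume "0 < s j" "0 < s k"
    then show "ip H (v j) (v k) = (if j = k then 1 else 0)" "ip H (w j) (w k) = (if j = k then 1 else 0)"
      using orth by blast+
  next
    fix k u assume u: "u \<in> carrier H" and k: "0 < s k"
    have zero: "(\<Sum>j<k. of_real (s j) * ip K (t a b) (t (v j) (w j))) = 0"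
      if ab: "(a = v k \<and> b = u) \<or> (a = u \<and> b = w k)" for a b
    proof (rule sum.neutral, rule ballI)
      fix j assume "j \<in> {..<k}"
      then have "s j = 0 \<or> ip H (v k) (v j) = 0 \<and> ip H (w k) (w j) = 0"
        using orth[of k j] k s0[of j] by auto
      then show "of_real (s j) * ip K (t a b) (t (v j) (w j)) = 0"
        using ab u vc wc by (auto simp: ip_t)
    qed
    show "ip K (t u (w k)) z = of_real (s k) * ip H u (v k)"
      using partial[of "t u (w k)" k] zero[of u "w k"] top1[OF k u] u wc by simp
    show "ip K (t (v k) u) z = of_real (s k) * ip H u (w k)"
      using partial[of "t (v k) u" k] zero[of "v k" u] top2[OF k u] u vc by simp
  next
    fix y assume y: "y \<in> carrier K"
    have "(\<lambda>n. ip K y (\<zeta> n)) \<longlonglongrightarrow> ip K y x" by (rule K.limit_ip[OF \<zeta>c x y])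
    then have "(\<lambda>n. ip K y z - (\<Sum>k<n. of_real (s k) * ip K y (t (v k) (w k)))) \<longlonglongrightarrow> 0"
      using y by (simp add: partial \<open>x = _\<close>)
    then have "(\<lambda>n. \<Sum>k<n. of_real (s k) * ip K y (t (v k) (w k))) \<longlonglongrightarrow> ip K y z"
      using tendsto_diff[OF tendsto_const[of "ip K y z"]] by fastforce
    then have "(\<lambda>k. of_real (s k) * ip K y (t (v k) (w k))) sums ip K y z"
      unfolding sums_def .
    then have "(\<lambda>k. cnj (of_real (s k) * ip K y (t (v k) (w k)))) sums cnj (ip K y z)"
      by (simp only: sums_cnj)
    moreover have "cnj (of_real (s k) * ip K y (t (v k) (w k))) = of_real (s k) * ip K (t (v k) (w k)) y" for k
      using K.g_cnj[OF y, of "t (v k) (w k)"] vc wc by simp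
    ultimately show "(\<lambda>k. of_real (s k) * ip K (t (v k) (w k)) y) sums ip K z y"
      by (simp only: K.g_cnj[OF y z])
  qed (use vc wc s0 in auto)
  then show thesis by (rule that)
qed

lemma schmidt_swapped:
  assumes "schmidt z s v w"
  shows "tensor_square.schmidt H K (\<lambda>u v. t v u) z s w v"
  using assms unfolding schmidt_def tensor_square.schmidt_def[OF swapped] by blast

lemma schmidt_sums:
  assumes z: "z \<in> carrier K" and sch: "schmidt z s v w"
  shows "(\<lambda>k. (s k)\<^sup>2) sums (K.nrm z)\<^sup>2"
proof -
  have "of_real (s k) * ip K (t (v k) (w k)) z = complex_of_real ((s k)\<^sup>2)" for k
  proof (cases "0 < s k")
    case True
    then have "ip K (t (v k) (w k)) z = of_real (s k) * ip H (v k) (v k)" "ip H (v k) (v k) = 1"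
      using sch unfolding schmidt_def by auto
    then show ?thesis by (simp add: power2_eq_square)
  next
    case False
    moreover have "0 \<le> s k" using sch unfolding schmidt_def by blast
    ultimately show ?thesis by simp
  qed
  moreover have "(\<lambda>k. of_real (s k) * ip K (t (v k) (w k)) z) sums ip K z z"
    using sch z unfolding schmidt_def by blast
  ultimately have "(\<lambda>k. complex_of_real ((s k)\<^sup>2)) sums of_real ((K.nrm z)\<^sup>2)"
    using K.g_self[OF z] by simp
  then show ?thesis by (simp only: sums_of_real_iff)
qed

lemma finite_schmidt_block:
  assumes z: "z \<in> carrier K" and sch: "schmidt z s v w" and c: "0 < c"
  shows "finite {k. (s k)\<^sup>2 = c}"
proof -
  have "(\<lambda>k. (s k)\<^sup>2) \<longlonglongrightarrow> 0"
    using schmidt_sums[OF z sch] sums_summable summable_LIMSEQ_zero by blast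
  then have "\<forall>\<^sub>F k in sequentially. (s k)\<^sup>2 < c" using c order_tendstoD(2) by blast
  then obtain N where "\<And>k. k \<ge> N \<Longrightarrow> (s k)\<^sup>2 < c" by (auto simp: eventually_sequentially)
  then have "{k. (s k)\<^sup>2 = c} \<subseteq> {..<N}" by (force simp: not_less[symmetric])
  then show ?thesis using finite_subset by blast
qed

section \<open>Perfect strategies commute with the reduced state\<close>

text \<open>
  The operator \<open>T\<close> is only known on elementary tensors, where the identity is the symmetry of \<open>P\<close>
  and \<open>Q\<close>; boundedness extends it.
\<close>

lemma op_adjoint:
  assumes P: "projection H P" and Q: "projection H Q" and T: "op_tensor H K t P Q T"
    and u: "u \<in> carrier H" "w \<in> carrier H" and x: "x \<in> carrier K"
  shows "ip K (t u w) (T x) = ip K (t (P u) (Q w)) x"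
proof -
  have Pc: "P u \<in> carrier H" "Q w \<in> carrier H" if "u \<in> carrier H" "w \<in> carrier H" for u w
    using P Q that unfolding projection_def bounded_op_def by blast+
  obtain C where Tc: "\<And>x. x \<in> carrier K \<Longrightarrow> T x \<in> carrier K"
    and Tadd: "\<And>x y. x \<in> carrier K \<Longrightarrow> y \<in> carrier K \<Longrightarrow> T (x \<oplus>\<^bsub>K\<^esub> y) = T x \<oplus>\<^bsub>K\<^esub> T y"
    and C: "\<And>x. x \<in> carrier K \<Longrightarrow> K.nrm (T x) \<le> C * K.nrm x"
    using T unfolding op_tensor_def bounded_op_def K.hnorm_nrm by blast
  have Tt: "T (t a b) = t (P a) (Q b)" if "a \<in> carrier H" "b \<in> carrier H" for a b
    using T that unfolding op_tensor_def by blast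
  let ?y = "t (P u) (Q w)"
  have "ip K (t u w) (T x) - ip K ?y x = 0"
  proof (rule bounded_functional_zero[of "\<lambda>x. ip K (t u w) (T x) - ip K ?y x" "K.nrm (t u w) * C + K.nrm ?y", OF _ _ _ x])
    fix x assume x: "x \<in> carrier K"
    have "cmod (ip K (t u w) (T x)) \<le> K.nrm (t u w) * K.nrm (T x)"
      using K.cauchy_schwarz[OF t_in[OF u] Tc[OF x]] .
    also have "\<dots> \<le> K.nrm (t u w) * (C * K.nrm x)"
      using C[OF x] u by (intro mult_left_mono) auto
    finally have 1: "cmod (ip K (t u w) (T x)) \<le> K.nrm (t u w) * (C * K.nrm x)" .
    have 2: "cmod (ip K ?y x) \<le> K.nrm ?y * K.nrm x"
      using K.cauchy_schwarz[OF t_in[OF Pc[OF u]] x] .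
    have "cmod (ip K (t u w) (T x) - ip K ?y x) \<le> cmod (ip K (t u w) (T x)) + cmod (ip K ?y x)"
      by (rule norm_triangle_ineq4)
    with 1 2 show "cmod (ip K (t u w) (T x) - ip K ?y x) \<le> (K.nrm (t u w) * C + K.nrm ?y) * K.nrm x"
      by (simp add: algebra_simps)
  next
    fix a b assume ab: "a \<in> carrier H" "b \<in> carrier H"
    have "ip H u (P a) = ip H (P u) a" "ip H w (Q b) = ip H (Q w) b"
      using P Q ab u unfolding projection_def by simp_all
    then show "ip K (t u w) (T (t a b)) - ip K ?y (t a b) = 0"
      using ab u Pc by (simp add: Tt ip_t)
  qed (use u Pc Tc in \<open>simp_all add: Tadd K.g_add\<close>)
  then show ?thesis by simp
qed

text \<open>
  \<open>P \<otimes> Q\<close> is a projection.  So a probability that vanishes means that the state vector is killed.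
\<close>

lemma op_ip:
  assumes P: "projection H P" and Q: "projection H Q" and T: "op_tensor H K t P Q T"
    and x: "x \<in> carrier K"
  shows "ip K x (T x) = of_real ((K.nrm (T x))\<^sup>2)"
proof -
  note adj = op_adjoint[OF P Q T]
  have Pc: "P u \<in> carrier H" "Q w \<in> carrier H" if "u \<in> carrier H" "w \<in> carrier H" for u w
    using P Q that unfolding projection_def bounded_op_def by blast+
  obtain C where Tc: "\<And>x. x \<in> carrier K \<Longrightarrow> T x \<in> carrier K"
    and Tadd: "\<And>x y. x \<in> carrier K \<Longrightarrow> y \<in> carrier K \<Longrightarrow> T (x \<oplus>\<^bsub>K\<^esub> y) = T x \<oplus>\<^bsub>K\<^esub> T y"
    and C: "\<And>x. x \<in> carrier K \<Longrightarrow> K.nrm (T x) \<le> C * K.nrm x"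
    using T unfolding op_tensor_def bounded_op_def K.hnorm_nrm by blast
  have Tt: "T (t a b) = t (P a) (Q b)" if "a \<in> carrier H" "b \<in> carrier H" for a b
    using T that unfolding op_tensor_def by blast
  have idem: "T (T x) = T x"
  proof (rule tensor_ext)
    fix u w assume u: "u \<in> carrier H" "w \<in> carrier H"
    have "P (P u) = P u" "Q (Q w) = Q w" using P Q u unfolding projection_def by blast+
    then show "ip K (t u w) (T (T x)) = ip K (t u w) (T x)"
      using adj[OF u Tc[OF x]] adj[OF Pc[OF u] x] adj[OF u x] by simp
  qed (use Tc x in auto)
  let ?y = "T x"
  have yc: "?y \<in> carrier K" using Tc x by simp
  have "ip K (T x) ?y - ip K x (T ?y) = 0"
  proof (rule bounded_functional_zero[of "\<lambda>x. ip K (T x) ?y - ip K x (T ?y)" "C * K.nrm ?y + K.nrm (T ?y)", OF _ _ _ x])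
    fix x assume x: "x \<in> carrier K"
    have "cmod (ip K (T x) ?y) \<le> K.nrm (T x) * K.nrm ?y"
      using K.cauchy_schwarz[OF Tc[OF x] yc] .
    also have "\<dots> \<le> (C * K.nrm x) * K.nrm ?y"
      using C[OF x] yc by (intro mult_right_mono) auto
    finally have 1: "cmod (ip K (T x) ?y) \<le> (C * K.nrm x) * K.nrm ?y" .
    have 2: "cmod (ip K x (T ?y)) \<le> K.nrm x * K.nrm (T ?y)"
      using K.cauchy_schwarz[OF x Tc[OF yc]] .
    have "cmod (ip K (T x) ?y - ip K x (T ?y)) \<le> cmod (ip K (T x) ?y) + cmod (ip K x (T ?y))"
      by (rule norm_triangle_ineq4)
    with 1 2 show "cmod (ip K (T x) ?y - ip K x (T ?y)) \<le> (C * K.nrm ?y + K.nrm (T ?y)) * K.nrm x"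
      by (simp add: algebra_simps)
  next
    fix a b assume "a \<in> carrier H" "b \<in> carrier H"
    then show "ip K (T (t a b)) ?y - ip K (t a b) (T ?y) = 0"
      using adj[OF _ _ yc] by (simp add: Tt)
  qed (use Tc yc in \<open>simp_all add: Tadd K.g_add_left\<close>)
  then have "ip K x (T x) = ip K (T x) (T x)" by (simp add: idem)
  also have "\<dots> = of_real ((K.nrm (T x))\<^sup>2)" by (rule K.g_self[OF yc])
  finally show ?thesis .
qed

text \<open>
  The vector \<open>x\<close> is the contraction of \<open>z\<close> with \<open>u\<close>, called \<open>Z u\<close> below.  Its coefficient along \<open>w k\<close> is
  \<open>s k \<langle>u, v k\<rangle>\<close>, a square summable sequence.
\<close>

lemma schmidt_contraction:
  assumes z: "z \<in> carrier K" and sch: "schmidt z s v w" and u: "u \<in> carrier H"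
  obtains x where "x \<in> carrier H" "\<And>y. y \<in> carrier H \<Longrightarrow> ip H y x = ip K (t u y) z"
proof -
  define e where "e k = (if 0 < s k then w k else \<zero>\<^bsub>H\<^esub>)" for k
  define d where "d k = (if 0 < s k then v k else \<zero>\<^bsub>H\<^esub>)" for k
  have s0: "0 \<le> s k" and vc: "v k \<in> carrier H" and wc: "w k \<in> carrier H" for k
    using sch unfolding schmidt_def by blast+
  have e: "H.quasi_orthonormal e" "H.quasi_orthonormal d"
    using sch unfolding schmidt_def H.quasi_orthonormal_def e_def d_def by auto
  define c where "c k = of_real (s k) * ip H u (d k)" for k
  have bounded: "(\<Sum>k<n. (cmod (c k))\<^sup>2) \<le> (K.nrm z)\<^sup>2 * (H.nrm u)\<^sup>2" for n
  proof -
    have S: "(\<lambda>k. (s k)\<^sup>2) sums (K.nrm z)\<^sup>2" by (rule schmidt_sums[OF z sch])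
    have le: "(s k)\<^sup>2 \<le> (K.nrm z)\<^sup>2" for k
      using sum_le_suminf[OF sums_summable[OF S], of "{k}"] sums_unique[OF S] by simp
    have "(\<Sum>k<n. (cmod (c k))\<^sup>2) = (\<Sum>k<n. (s k)\<^sup>2 * (cmod (ip H (d k) u))\<^sup>2)"
    proof (intro sum.cong refl)
      fix k
      have "d k \<in> carrier H" using vc by (simp add: d_def)
      then have "ip H u (d k) = cnj (ip H (d k) u)" using H.g_cnj u by blast
      then show "(cmod (c k))\<^sup>2 = (s k)\<^sup>2 * (cmod (ip H (d k) u))\<^sup>2"
        by (simp add: c_def norm_mult power_mult_distrib)
    qed
    also have "\<dots> \<le> (\<Sum>k<n. (K.nrm z)\<^sup>2 * (cmod (ip H (d k) u))\<^sup>2)"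
      by (intro sum_mono mult_right_mono le) simp
    also have "\<dots> \<le> (K.nrm z)\<^sup>2 * (H.nrm u)\<^sup>2"
      unfolding sum_distrib_left[symmetric] by (intro mult_left_mono H.bessel e u) auto
    finally show ?thesis .
  qed
  have supp: "c k = 0" if "ip H (e k) (e k) \<noteq> 1" for k
  proof -
    have "\<not> 0 < s k" using that sch unfolding schmidt_def e_def by auto
    then show ?thesis using s0[of k] by (simp add: c_def)
  qed
  obtain x where xc: "x \<in> carrier H"
    and x: "\<And>y. y \<in> carrier H \<Longrightarrow> (\<lambda>n. \<Sum>k<n. c k * ip H y (e k)) \<longlonglongrightarrow> ip H y x"
    using supp bounded by (rule H.riesz_fischer[OF e(1)]) (assumption, rule that, assumption, simp)
  show thesis
  proof (rule that[OF xc])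
    fix y assume y: "y \<in> carrier H"
    have "(\<lambda>k. of_real (s k) * ip K (t (v k) (w k)) (t u y)) sums ip K z (t u y)"
      using sch y u unfolding schmidt_def by simp
    then have "(\<lambda>k. cnj (of_real (s k) * ip K (t (v k) (w k)) (t u y))) sums cnj (ip K z (t u y))"
      by (simp only: sums_cnj)
    moreover have "cnj (of_real (s k) * ip K (t (v k) (w k)) (t u y)) = c k * ip H y (e k)" for k
    proof (cases "0 < s k")
      case True
      have "cnj (of_real (s k) * ip K (t (v k) (w k)) (t u y)) =
          of_real (s k) * (cnj (ip H (v k) u) * cnj (ip H (w k) y))"
        using vc wc u y by (simp add: ip_t)
      also have "\<dots> = c k * ip H y (e k)"
        using True H.g_cnj[OF vc u, of k] H.g_cnj[OF wc y, of k] by (simp add: c_def e_def d_def)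
      finally show ?thesis .
    next
      case False
      then show ?thesis using s0[of k] by (simp add: c_def)
    qed
    ultimately have "(\<lambda>k. c k * ip H y (e k)) sums cnj (ip K z (t u y))" by simp
    then have "(\<lambda>n. \<Sum>k<n. c k * ip H y (e k)) \<longlonglongrightarrow> cnj (ip K z (t u y))" unfolding sums_def .
    then have "ip H y x = cnj (ip K z (t u y))" using x[OF y] LIMSEQ_unique by blast
    then show "ip H y x = ip K (t u y) z" using K.g_cnj[of z "t u y"] z u y by simp
  qed
qed

text \<open>
  Let \<open>R u u' = \<langle>Z u', Z u\<rangle>\<close> be the form of the reduced state.  By \<open>excl\<close> it vanishes between the
  ranges of \<open>P a\<close> and \<open>P a'\<close>, as one sees by inserting \<open>\<Sum>b. Q b = 1\<close>.  Hence \<open>P a\<close> is symmetric for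
  \<open>R\<close> too, that is, it commutes with the reduced state and preserves the eigenspace that
  belongs to \<open>c\<close>, which is spanned by the vectors \<open>v k\<close> with \<open>(s k)\<^sup>2 = c\<close>.
\<close>

lemma schmidt_blocks:
  fixes P :: "'a::finite \<Rightarrow> 'v \<Rightarrow> 'v"
  assumes z: "z \<in> carrier K" and sch: "schmidt z s v w" and P: "pvm H P"
    and excl: "\<And>a a'. a \<noteq> a' \<Longrightarrow> \<exists>Q :: 'b::finite \<Rightarrow> 'v \<Rightarrow> 'v. pvm H Q \<and>
      (\<forall>b. (\<forall>u\<in>carrier H. \<forall>y\<in>carrier H. ip K (t (P a u) (Q b y)) z = 0) \<or>
           (\<forall>u\<in>carrier H. \<forall>y\<in>carrier H. ip K (t (P a' u) (Q b y)) z = 0))"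
    and c: "0 < c"
  shows "mat_pvm {k. (s k)\<^sup>2 = c} (\<lambda>a k l. ip H (v k) (P a (v l)))"
    and "(s l)\<^sup>2 = c \<Longrightarrow> P a (v l) = (\<Oplus>\<^bsub>H\<^esub>k\<in>{k. (s k)\<^sup>2 = c}. ip H (v k) (P a (v l)) \<odot>\<^bsub>H\<^esub> v k)"
proof -
  define B where "B = {k. (s k)\<^sup>2 = c}"
  have s0: "0 \<le> s k" and vc: "v k \<in> carrier H" and wc: "w k \<in> carrier H" for k
    using sch unfolding schmidt_def by blast+
  have spos: "0 < s k" if "k \<in> B" for k
    using that c s0[of k] by (cases "s k = 0") (auto simp: B_def)
  have orth: "ip H (v j) (v k) = (if j = k then 1 else 0)" if "0 < s j" "0 < s k" for j k
    using sch that unfolding schmidt_def by blast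
  have con1: "ip K (t u (w k)) z = of_real (s k) * ip H u (v k)"
    and con2: "ip K (t (v k) u) z = of_real (s k) * ip H u (w k)" if "0 < s k" "u \<in> carrier H" for k u
    using sch that unfolding schmidt_def by blast+
  have finB: "finite B" unfolding B_def by (rule finite_schmidt_block[OF z sch c])
  have Pproj: "projection H (P a)" for a using P unfolding pvm_def by blast
  have Pc: "P a u \<in> carrier H" if "u \<in> carrier H" for a u
    using Pproj[of a] that unfolding projection_def bounded_op_def by blast
  have Psym: "ip H (P a u) y = ip H u (P a y)" if "u \<in> carrier H" "y \<in> carrier H" for a u y
    using Pproj[of a] that unfolding projection_def by blast
  have Pid: "P a (P a u) = P a u" if "u \<in> carrier H" for a u
    using Pproj[of a] that unfolding projection_def by blast
  have Psum: "(\<Oplus>\<^bsub>H\<^esub>a\<in>UNIV. P a u) = u" if "u \<in> carrier H" for u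
    using P that unfolding pvm_def by blast
  have "\<exists>x. x \<in> carrier H \<and> (\<forall>y\<in>carrier H. ip H y x = ip K (t u y) z)" if "u \<in> carrier H" for u
    using schmidt_contraction[OF z sch that] by metis
  then obtain Z where Z: "\<And>u. u \<in> carrier H \<Longrightarrow> Z u \<in> carrier H"
    "\<And>u y. u \<in> carrier H \<Longrightarrow> y \<in> carrier H \<Longrightarrow> ip H y (Z u) = ip K (t u y) z" by metis
  define R where "R u u' = ip H (Z u') (Z u)" for u u'
  have Rt: "R u u' = ip K z (t u' (Z u))" if "u \<in> carrier H" "u' \<in> carrier H" for u u'
  proof -
    have "R u u' = cnj (ip H (Z u) (Z u'))" unfolding R_def using H.g_cnj Z(1) that by blast
    also have "\<dots> = cnj (ip K (t u' (Z u)) z)" using Z that by simp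
    also have "\<dots> = ip K z (t u' (Z u))" using K.g_cnj[of "t u' (Z u)" z] z Z(1) that by simp
    finally show ?thesis .
  qed
  have Rcnj: "R u u' = cnj (R u' u)" if "u \<in> carrier H" "u' \<in> carrier H" for u u'
    unfolding R_def using H.g_cnj Z(1) that by blast
  have Roff: "R (P a u) (P a' u') = 0" if "a \<noteq> a'" and u: "u \<in> carrier H" "u' \<in> carrier H" for a a' u u'
  proof -
    obtain Q :: "'b \<Rightarrow> 'v \<Rightarrow> 'v" where Q: "pvm H Q"
      "\<And>b. (\<forall>u\<in>carrier H. \<forall>y\<in>carrier H. ip K (t (P a u) (Q b y)) z = 0) \<or>
           (\<forall>u\<in>carrier H. \<forall>y\<in>carrier H. ip K (t (P a' u) (Q b y)) z = 0)"
      using excl[OF \<open>a \<noteq> a'\<close>] by blast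
    have Qproj: "projection H (Q b)" for b using Q(1) unfolding pvm_def by blast
    have Qc: "Q b y \<in> carrier H" if "y \<in> carrier H" for b y
      using Qproj[of b] that unfolding projection_def bounded_op_def by blast
    have Qsym: "ip H (Q b y) x = ip H y (Q b x)" if "y \<in> carrier H" "x \<in> carrier H" for b x y
      using Qproj[of b] that unfolding projection_def by blast
    let ?x = "Z (P a u)" and ?x' = "Z (P a' u')"
    have xc: "?x \<in> carrier H" "?x' \<in> carrier H" using Z(1) Pc u by blast+
    have term0: "ip H ?x' (Q b ?x) = 0" for b
      using Q(2)[of b]
    proof
      assume *: "\<forall>u\<in>carrier H. \<forall>y\<in>carrier H. ip K (t (P a u) (Q b y)) z = 0"
      have "ip H ?x' (Q b ?x) = ip H (Q b ?x') ?x" using Qsym xc by simp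
      also have "\<dots> = ip K (t (P a u) (Q b ?x')) z" using Z(2) Pc Qc xc u by simp
      finally show ?thesis using * u xc by simp
    next
      assume *: "\<forall>u\<in>carrier H. \<forall>y\<in>carrier H. ip K (t (P a' u) (Q b y)) z = 0"
      have "ip H (Q b ?x) ?x' = ip K (t (P a' u') (Q b ?x)) z" using Z(2) Pc Qc xc u by simp
      also have "\<dots> = 0" using * u xc by simp
      finally show ?thesis using H.g_cnj[OF Qc[OF xc(1)] xc(2), of b] by simp
    qed
    have "R (P a u) (P a' u') = ip H ?x' (\<Oplus>\<^bsub>H\<^esub>b\<in>UNIV. Q b ?x)"
      using Q(1) xc unfolding R_def pvm_def by simp
    also have "\<dots> = (\<Sum>b\<in>UNIV. ip H ?x' (Q b ?x))" using xc Qc by (intro H.g_sum) auto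
    also have "\<dots> = 0" using term0 by simp
    finally show ?thesis .
  qed
  have Rsum: "R (P a u) u' = R (P a u) (P a u')" if u: "u \<in> carrier H" "u' \<in> carrier H" for a u u'
  proof -
    have "R (P a u) u' = ip K z (t (\<Oplus>\<^bsub>H\<^esub>a'\<in>UNIV. P a' u') (Z (P a u)))"
      using Rt Pc Psum u by simp
    also have "\<dots> = (\<Sum>a'\<in>UNIV. ip K z (t (P a' u') (Z (P a u))))"
      using Pc Z(1) u z by (intro t_sum_left) auto
    also have "\<dots> = (\<Sum>a'\<in>UNIV. R (P a u) (P a' u'))" using Rt Pc u by simp
    also have "\<dots> = (\<Sum>a'\<in>UNIV. if a' = a then R (P a u) (P a u') else 0)"
      using Roff u by (intro sum.cong refl) auto
    finally show ?thesis by simp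
  qed
  have Rcomm: "R (P a u) u' = R u (P a u')" if u: "u \<in> carrier H" "u' \<in> carrier H" for a u u'
  proof -
    have "R u (P a u') = cnj (R (P a u') u)" using Rcnj Pc u by blast
    also have "\<dots> = cnj (R (P a u') (P a u))" using Rsum u by simp
    also have "\<dots> = R (P a u) (P a u')" using Rcnj[of "P a u" "P a u'"] Pc u by simp
    finally show ?thesis using Rsum u by simp
  qed
  have Rv: "R u (v l) = of_real ((s l)\<^sup>2) * ip H u (v l)" if "0 < s l" "u \<in> carrier H" for u l
  proof -
    have "R u (v l) = cnj (ip K (t (v l) (Z u)) z)"
      using Rt[OF that(2) vc] K.g_cnj[of "t (v l) (Z u)" z] z Z(1) vc that by simp
    also have "\<dots> = of_real (s l) * cnj (ip H (Z u) (w l))"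
      using con2[OF that(1)] Z(1) that by simp
    also have "cnj (ip H (Z u) (w l)) = ip H (w l) (Z u)"
      using H.g_cnj[of "Z u" "w l"] Z(1) wc that by simp
    also have "\<dots> = of_real (s l) * ip H u (v l)" using Z(2) con1 wc that by simp
    finally show ?thesis by (simp add: power2_eq_square)
  qed
  have RP: "R u (P a (v l)) = of_real c * ip H u (P a (v l))" if "l \<in> B" "u \<in> carrier H" for a u l
  proof -
    have "R u (P a (v l)) = R (P a u) (v l)" using Rcomm vc that by simp
    also have "\<dots> = of_real ((s l)\<^sup>2) * ip H (P a u) (v l)" using Rv spos Pc that by simp
    also have "(s l)\<^sup>2 = c" using that by (simp add: B_def)
    also have "ip H (P a u) (v l) = ip H u (P a (v l))" using Psym vc that by simp
    finally show ?thesis .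
  qed
  have off: "ip H (v k) (P a (v l)) = 0" if l: "l \<in> B" and k: "0 < s k" "k \<notin> B" for a k l
  proof -
    let ?x = "P a (v l)"
    have xc: "?x \<in> carrier H" using Pc vc by simp
    have "R (v k) ?x = cnj (R ?x (v k))" using Rcnj vc xc by blast
    also have "\<dots> = of_real ((s k)\<^sup>2) * ip H (v k) ?x"
      using Rv[OF k(1) xc] H.g_cnj[OF xc vc, of k] by simp
    finally have "of_real ((s k)\<^sup>2) * ip H (v k) ?x = of_real c * ip H (v k) ?x"
      by (simp only: RP[OF l vc])
    then have "(complex_of_real ((s k)\<^sup>2) - of_real c) * ip H (v k) ?x = 0"
      by (simp add: left_diff_distrib)
    moreover have "complex_of_real ((s k)\<^sup>2) - of_real c \<noteq> 0"
      using k(2) unfolding B_def by (simp del: of_real_power)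
    ultimately show ?thesis by simp
  qed
  have expand: "P a (v l) = (\<Oplus>\<^bsub>H\<^esub>k\<in>B. ip H (v k) (P a (v l)) \<odot>\<^bsub>H\<^esub> v k)" if l: "l \<in> B" for a l
  proof (rule H.diff_eq_0D)
    let ?x = "P a (v l)" and ?y = "\<Oplus>\<^bsub>H\<^esub>k\<in>B. ip H (v k) (P a (v l)) \<odot>\<^bsub>H\<^esub> v k"
    define r where "r = ?x \<ominus>\<^bsub>H\<^esub> ?y"
    show xc: "?x \<in> carrier H" and yc: "?y \<in> carrier H" using Pc vc by simp_all
    have rc: "r \<in> carrier H" using xc yc by (simp add: r_def)
    have vr: "ip H (v k) r = 0" if k: "0 < s k" for k
    proof -
      have "ip H (v k) ?y = (\<Sum>j\<in>B. ip H (v j) ?x * ip H (v k) (v j))"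
        using finB vc by (simp add: H.g_sum H.g_smult)
      also have "\<dots> = (\<Sum>j\<in>B. if j = k then ip H (v k) ?x else 0)"
        using orth[OF k spos] by (intro sum.cong refl) auto
      also have "\<dots> = ip H (v k) ?x" using finB off[OF l k] by simp
      finally show ?thesis using xc yc vc by (simp add: r_def H.g_diff)
    qed
    \<comment> \<open>The remainder \<open>r\<close> of the expansion is orthogonal to all \<open>v k\<close> with \<open>0 < s k\<close>, so it lies in the kernel
      of the reduced state, but also in the eigenspace of \<open>c\<close>.\<close>
    have Zr: "Z r = \<zero>\<^bsub>H\<^esub>"
    proof (rule H.ip_ext)
      fix y assume y: "y \<in> carrier H"
      have "(\<lambda>k. of_real (s k) * ip K (t (v k) (w k)) (t r y)) sums ip K z (t r y)"
        using sch rc y unfolding schmidt_def by simp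
      moreover have "of_real (s k) * ip K (t (v k) (w k)) (t r y) = 0" for k
        using vr[of k] s0[of k] vc wc rc y by (cases "s k = 0") (auto simp: ip_t)
      ultimately have "(\<lambda>k. 0) sums ip K z (t r y)" by simp
      then have "ip K z (t r y) = 0" using sums_unique2 sums_zero by blast
      then show "ip H y (Z r) = ip H y \<zero>\<^bsub>H\<^esub>"
        using Z(2)[OF rc y] K.g_cnj[of z "t r y"] z rc y by simp
    qed (use Z(1) rc in auto)
    have "R r r = of_real c * ip H r r"
    proof -
      have lin: "R u r = R u ?x - (\<Sum>k\<in>B. ip H (v k) ?x * R u (v k))" if u: "u \<in> carrier H" for u
      proof -
        have "R u r + R u ?y = R u ?x"
          using Rt[OF u rc] Rt[OF u yc] Rt[OF u xc] H.diff_add_cancel[OF xc yc] z rc yc Z(1)[OF u]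
          by (simp add: K.g_add[symmetric] t_add(1)[symmetric] r_def)
        moreover have "R u ?y = (\<Sum>k\<in>B. ip H (v k) ?x * R u (v k))"
        proof -
          have "R u ?y = (\<Sum>k\<in>B. ip K z (t (ip H (v k) ?x \<odot>\<^bsub>H\<^esub> v k) (Z u)))"
            unfolding Rt[OF u yc] using finB z vc Z(1)[OF u] by (intro t_sum_left) auto
          also have "\<dots> = (\<Sum>k\<in>B. ip H (v k) ?x * R u (v k))"
            using z vc Z(1)[OF u] by (simp add: t_smult K.g_smult Rt[OF u vc])
          finally show ?thesis .
        qed
        ultimately show ?thesis by (simp add: algebra_simps)
      qed
      have "R r r = of_real c * ip H r ?x - (\<Sum>k\<in>B. ip H (v k) ?x * (of_real c * ip H r (v k)))"
        unfolding lin[OF rc] RP[OF l rc]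
        using Rv[OF spos rc] by (simp add: B_def)
      also have "\<dots> = of_real c * (ip H r ?x - ip H r ?y)"
        using finB rc vc by (simp add: H.g_sum H.g_smult sum_distrib_left right_diff_distrib mult.left_commute)
      also have "ip H r ?x - ip H r ?y = ip H r r" using rc xc yc by (simp add: r_def H.g_diff)
      finally show ?thesis .
    qed
    moreover have "R r r = 0" unfolding R_def Zr by simp
    ultimately have "ip H r r = 0" using c by simp
    then show "H.nrm (?x \<ominus>\<^bsub>H\<^esub> ?y) = 0" by (simp add: H.nrm_def r_def)
  qed
  show "mat_pvm {k. (s k)\<^sup>2 = c} (\<lambda>a k l. ip H (v k) (P a (v l)))"
    unfolding mat_pvm_def B_def[symmetric]
  proof (intro conjI allI ballI)
    fix a i j assume ij: "i \<in> B" "j \<in> B"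
    have "ip H (v j) (P a (v i)) = ip H (P a (v j)) (v i)" using Psym vc by simp
    also have "\<dots> = cnj (ip H (v i) (P a (v j)))" using H.g_cnj vc Pc by blast
    finally show "ip H (v j) (P a (v i)) = cnj (ip H (v i) (P a (v j)))" .
    have "ip H (v i) (P a (v j)) = ip H (v i) (P a (P a (v j)))" using Pid vc by simp
    also have "\<dots> = ip H (P a (v i)) (P a (v j))" using Psym vc Pc by simp
    also have "\<dots> = ip H (P a (v i)) (\<Oplus>\<^bsub>H\<^esub>k\<in>B. ip H (v k) (P a (v j)) \<odot>\<^bsub>H\<^esub> v k)"
      using arg_cong[OF expand[OF ij(2), of a], of "ip H (P a (v i))"] .
    also have "\<dots> = (\<Sum>k\<in>B. ip H (v k) (P a (v j)) * ip H (P a (v i)) (v k))"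
      using finB vc Pc by (simp add: H.g_sum H.g_smult)
    also have "\<dots> = (\<Sum>k\<in>B. ip H (v i) (P a (v k)) * ip H (v k) (P a (v j)))"
      using Psym vc by (intro sum.cong refl) simp
    finally show "(\<Sum>k\<in>B. ip H (v i) (P a (v k)) * ip H (v k) (P a (v j))) = ip H (v i) (P a (v j))" by simp
  next
    fix i j assume ij: "i \<in> B" "j \<in> B"
    have "(\<Sum>a\<in>UNIV. ip H (v i) (P a (v j))) = ip H (v i) (\<Oplus>\<^bsub>H\<^esub>a\<in>UNIV. P a (v j))"
      using vc Pc by (intro H.g_sum[symmetric]) auto
    also have "\<dots> = ip H (v i) (v j)" using Psum vc by simp
    also have "\<dots> = (if i = j then 1 else 0)" using orth spos ij by simp
    finally show "(\<Sum>a\<in>UNIV. ip H (v i) (P a (v j))) = (if i = j then 1 else 0)" .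
  qed
  show "P a (v l) = (\<Oplus>\<^bsub>H\<^esub>k\<in>{k. (s k)\<^sup>2 = c}. ip H (v k) (P a (v l)) \<odot>\<^bsub>H\<^esub> v k)" if "(s l)\<^sup>2 = c"
    using expand[of l a] that by (simp add: B_def)
qed

end

text \<open>
  The weights are the squared Schmidt coefficients.  Within a block the coefficients agree, so
  \<open>\<langle>v l \<otimes> Q w k, z\<rangle> = s k \<langle>Q w k, w l\<rangle>\<close>: this moves the matrix of \<open>Q\<close> from the right factor next to the
  one of \<open>P\<close>, as for a maximally entangled vector.
\<close>

lemma (in tensor_square) tensor_correlation_in_hull:
  fixes p :: "real ^ ('x::finite \<times> 'y::finite \<times> 'a::finite \<times> 'b::finite)"
  assumes z: "z \<in> carrier K" "K.nrm z = 1"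
    and PVM: "\<And>x. pvm H (P x)" "\<And>y. pvm H (Q y)"
    and T: "\<And>x y a b. op_tensor H K t (P x a) (Q y b) (T x y a b)"
    and p: "\<And>x y a b. complex_of_real (p $ (x, y, a, b)) = ip K z (T x y a b z)"
    and excl1: "\<And>x a a'. a \<noteq> a' \<Longrightarrow> \<exists>y. \<forall>b. p $ (x, y, a, b) = 0 \<or> p $ (x, y, a', b) = 0"
    and excl2: "\<And>y b b'. b \<noteq> b' \<Longrightarrow> \<exists>x. \<forall>a. p $ (x, y, a, b) = 0 \<or> p $ (x, y, a, b') = 0"
  shows "p \<in> convex hull tracial_correlations"
proof -
  interpret S: tensor_square H K "\<lambda>u v. t v u" by (rule swapped)
  have Pproj: "projection H (P x a)" "projection H (Q y b)" for x a y b
    using PVM unfolding pvm_def by blast+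
  have Pc: "P x a u \<in> carrier H" "Q y b u \<in> carrier H" if "u \<in> carrier H" for x a y b u
    using Pproj(1)[of x a] Pproj(2)[of y b] that unfolding projection_def bounded_op_def by blast+
  have adj: "ip K (t u u') (T x y a b z) = ip K (t (P x a u) (Q y b u')) z"
    if "u \<in> carrier H" "u' \<in> carrier H" for u u' x y a b
    by (rule op_adjoint[OF Pproj T that z(1)])
  have Tc: "T x y a b z \<in> carrier K" for x y a b
    using T[of x a y b] z(1) unfolding op_tensor_def bounded_op_def by blast
  have kill: "ip K (t (P x a u) (Q y b u')) z = 0"
    if 0: "p $ (x, y, a, b) = 0" and u: "u \<in> carrier H" "u' \<in> carrier H" for x y a b u u'
  proof -
    have "complex_of_real ((K.nrm (T x y a b z))\<^sup>2) = complex_of_real (p $ (x, y, a, b))"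
      unfolding p by (rule op_ip[OF Pproj(1) Pproj(2) T z(1), symmetric])
    then have "complex_of_real ((K.nrm (T x y a b z))\<^sup>2) = 0" by (simp only: 0 of_real_0)
    then have "K.nrm (T x y a b z) = 0" by simp
    then have "T x y a b z = \<zero>\<^bsub>K\<^esub>" by (rule K.nrm_eq_0[OF Tc])
    then show ?thesis using adj[OF u, of x y a b] u by simp
  qed
  obtain s v w where sch: "schmidt z s v w" using schmidt_decomposition[OF z(1)] by metis
  have s0: "0 \<le> s k" and vc: "v k \<in> carrier H" and wc: "w k \<in> carrier H" for k
    using sch unfolding schmidt_def by blast+
  have con2: "ip K (t (v k) u) z = of_real (s k) * ip H u (w k)" if "0 < s k" "u \<in> carrier H" for k u
    using sch that unfolding schmidt_def by blast
  have ex1: "\<exists>Q :: 'b \<Rightarrow> 'v \<Rightarrow> 'v. pvm H Q \<and>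
      (\<forall>b. (\<forall>u\<in>carrier H. \<forall>y\<in>carrier H. ip K (t (P x a u) (Q b y)) z = 0) \<or>
           (\<forall>u\<in>carrier H. \<forall>y\<in>carrier H. ip K (t (P x a' u) (Q b y)) z = 0))"
    if "a \<noteq> a'" for x a a'
  proof -
    obtain y where y: "\<And>b. p $ (x, y, a, b) = 0 \<or> p $ (x, y, a', b) = 0"
      using excl1[OF \<open>a \<noteq> a'\<close>] by blast
    show ?thesis
      by (rule exI[of _ "Q y"]) (use PVM(2) kill y in blast)
  qed
  have ex2: "\<exists>P' :: 'a \<Rightarrow> 'v \<Rightarrow> 'v. pvm H P' \<and>
      (\<forall>a. (\<forall>u\<in>carrier H. \<forall>u'\<in>carrier H. ip K (t (P' a u') (Q y b u)) z = 0) \<or>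
           (\<forall>u\<in>carrier H. \<forall>u'\<in>carrier H. ip K (t (P' a u') (Q y b' u)) z = 0))"
    if "b \<noteq> b'" for y b b'
  proof -
    obtain x where x: "\<And>a. p $ (x, y, a, b) = 0 \<or> p $ (x, y, a, b') = 0"
      using excl2[OF \<open>b \<noteq> b'\<close>] by blast
    show ?thesis
      by (rule exI[of _ "P x"]) (use PVM(1) kill x in blast)
  qed
  show ?thesis
  proof (rule weighted_blocks_in_hull)
    show "0 \<le> (s k)\<^sup>2" for k by simp
    show "(\<lambda>k. (s k)\<^sup>2) sums 1" using schmidt_sums[OF z(1) sch] z(2) by simp
    show "mat_pvm {k. (s k)\<^sup>2 = c} (\<lambda>a k l. ip H (v k) (P x a (v l)))" if "0 < c" for c x
      by (rule schmidt_blocks(1)[OF z(1) sch PVM(1) ex1 that])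
    show "mat_pvm {k. (s k)\<^sup>2 = c} (\<lambda>b k l. ip H (w k) (Q y b (w l)))" if "0 < c" for c y
      by (rule S.schmidt_blocks(1)[OF z(1) schmidt_swapped[OF sch] PVM(2) ex2 that])
    show "(\<lambda>k. of_real ((s k)\<^sup>2) * (\<Sum>l\<in>{l. (s l)\<^sup>2 = (s k)\<^sup>2}. ip H (v k) (P x a (v l)) * ip H (w k) (Q y b (w l))))
        sums complex_of_real (p $ (x, y, a, b))" for x y a b
    proof -
      have "(\<lambda>k. of_real (s k) * ip K (t (v k) (w k)) (T x y a b z)) sums complex_of_real (p $ (x, y, a, b))"
        unfolding p using sch Tc unfolding schmidt_def by blast
      moreover have "of_real (s k) * ip K (t (v k) (w k)) (T x y a b z) =
          of_real ((s k)\<^sup>2) * (\<Sum>l\<in>{l. (s l)\<^sup>2 = (s k)\<^sup>2}. ip H (v k) (P x a (v l)) * ip H (w k) (Q y b (w l)))" for k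
      proof (cases "s k = 0")
        case False
        then have pos: "0 < s k" "0 < (s k)\<^sup>2" using s0[of k] by simp_all
        define B where "B = {l. (s l)\<^sup>2 = (s k)\<^sup>2}"
        have finB: "finite B" unfolding B_def by (rule finite_schmidt_block[OF z(1) sch pos(2)])
        have sB: "s l = s k" if "l \<in> B" for l
          using that s0 unfolding B_def by (simp add: power2_eq_iff_nonneg)
        let ?q = "Q y b (w k)"
        have "P x a (v k) = (\<Oplus>\<^bsub>H\<^esub>l\<in>B. ip H (v l) (P x a (v k)) \<odot>\<^bsub>H\<^esub> v l)"
          unfolding B_def by (rule schmidt_blocks(2)[OF z(1) sch PVM(1) ex1 pos(2) refl])
        then have "ip K z (t (P x a (v k)) ?q) = ip K z (t (\<Oplus>\<^bsub>H\<^esub>l\<in>B. ip H (v l) (P x a (v k)) \<odot>\<^bsub>H\<^esub> v l) ?q)"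
          by (rule arg_cong)
        also have "\<dots> = (\<Sum>l\<in>B. ip K z (t (ip H (v l) (P x a (v k)) \<odot>\<^bsub>H\<^esub> v l) ?q))"
          using finB vc Pc(2)[OF wc] z(1) by (intro t_sum_left) auto
        also have "\<dots> = (\<Sum>l\<in>B. ip H (v l) (P x a (v k)) * ip K z (t (v l) ?q))"
          using vc Pc(2)[OF wc] z(1) by (simp add: t_smult K.g_smult)
        finally have "cnj (ip K z (t (P x a (v k)) ?q)) =
            (\<Sum>l\<in>B. cnj (ip H (v l) (P x a (v k))) * cnj (ip K z (t (v l) ?q)))"
          by simp
        also have "\<dots> = (\<Sum>l\<in>B. of_real (s k) * (ip H (v k) (P x a (v l)) * ip H (w k) (Q y b (w l))))"
        proof (intro sum.cong refl)
          fix l assume l: "l \<in> B"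
          have "cnj (ip H (v l) (P x a (v k))) = ip H (P x a (v k)) (v l)"
            using H.g_cnj[OF vc[of l] Pc(1)[OF vc[of k], of x a]] by simp
          also have "\<dots> = ip H (v k) (P x a (v l))"
            using Pproj(1)[of x a] vc unfolding projection_def by blast
          finally have 1: "cnj (ip H (v l) (P x a (v k))) = ip H (v k) (P x a (v l))" .
          have "cnj (ip K z (t (v l) ?q)) = ip K (t (v l) ?q) z"
            using K.g_cnj[of z "t (v l) ?q"] z(1) vc Pc(2)[OF wc] by simp
          also have "\<dots> = of_real (s k) * ip H ?q (w l)"
            using con2[of l ?q] Pc(2)[OF wc] sB[OF l] pos by simp
          also have "ip H ?q (w l) = ip H (w k) (Q y b (w l))"
            using Pproj(2)[of y b] wc unfolding projection_def by blast
          finally show "cnj (ip H (v l) (P x a (v k))) * cnj (ip K z (t (v l) ?q)) =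
              of_real (s k) * (ip H (v k) (P x a (v l)) * ip H (w k) (Q y b (w l)))"
            by (simp add: 1)
        qed
        also have "cnj (ip K z (t (P x a (v k)) ?q)) = ip K (t (P x a (v k)) ?q) z"
          using K.g_cnj[of z "t (P x a (v k)) ?q"] z(1) Pc vc wc by simp
        finally have "ip K (t (v k) (w k)) (T x y a b z) =
            of_real (s k) * (\<Sum>l\<in>B. ip H (v k) (P x a (v l)) * ip H (w k) (Q y b (w l)))"
          using adj[OF vc[of k] wc[of k], of x y a b] by (simp add: sum_distrib_left)
        then show ?thesis by (simp add: B_def power2_eq_square)
      qed simp
      ultimately show ?thesis by simp
    qed
  qed
qed

lemma imitation_game_exclusive:
  assumes "imitation_game lam"
  shows "a \<noteq> a' \<Longrightarrow> \<exists>y. \<forall>b. lam x y a b = 0 \<or> lam x y a' b = 0"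
    and "b \<noteq> b' \<Longrightarrow> \<exists>x. \<forall>a. lam x y a b = 0 \<or> lam x y a b' = 0"
  using assms unfolding imitation_game_def by (simp_all add: sum_nonneg_eq_0_iff)

theorem perfect_C_qs_in_hull:
  assumes game: "imitation_game lam" and p: "p \<in> perfect lam (C_qs TYPE('v))"
  shows "p \<in> convex hull tracial_correlations"
proof -
  have zero: "lam x y a b = 0 \<Longrightarrow> p $ (x, y, a, b) = 0" for x y a b
    using p unfolding perfect_def by blast
  obtain H K :: "'v hilbert" and t \<xi> P Q where t: "hilbert_tensor H K t" and
    \<xi>: "\<xi> \<in> carrier K" "hnorm K \<xi> = 1" and cor: "tensor_correlation H K t \<xi> P Q p"
    using p unfolding perfect_def C_qs_def by blast
  interpret tensor_square H K t
    using t by (auto simp: tensor_square_def tensor_square_axioms_def hilbert_tensor_def)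
  obtain T where T: "\<And>x y a b. op_tensor H K t (P x a) (Q y b) (T x y a b)"
    "\<And>x y a b. complex_of_real (p $ (x, y, a, b)) = ip K \<xi> (T x y a b \<xi>)"
    using cor unfolding tensor_correlation_def by metis
  show ?thesis
  proof (rule tensor_correlation_in_hull[of \<xi> P Q T])
    show "K.nrm \<xi> = 1" using \<xi>(2) by (simp add: K.hnorm_nrm)
    show "pvm H (P x)" "pvm H (Q y)" for x y
      using cor unfolding tensor_correlation_def by blast+
    show "\<exists>y. \<forall>b. p $ (x, y, a, b) = 0 \<or> p $ (x, y, a', b) = 0" if "a \<noteq> a'" for x a a'
      using imitation_game_exclusive(1)[OF game that, of x] zero by meson
    show "\<exists>x. \<forall>a. p $ (x, y, a, b) = 0 \<or> p $ (x, y, a, b') = 0" if "b \<noteq> b'" for y b b'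
      using imitation_game_exclusive(2)[OF game that, of y] zero by meson
  qed (use \<xi> T in auto)
qed

section \<open>Coordinate spaces and matrix strategies\<close>

definition coord_space :: "'z set \<Rightarrow> ('z \<Rightarrow> complex) hilbert" where
  "coord_space Z = \<lparr>carrier = {f. \<forall>z. z \<notin> Z \<longrightarrow> f z = 0}, monoid.mult = (\<lambda>f h. f), one = (\<lambda>_. 0),
     zero = (\<lambda>_. 0), add = (\<lambda>f h z. f z + h z), smult = (\<lambda>c f z. c * f z),
     ip = (\<lambda>f h. \<Sum>z\<in>Z. cnj (f z) * h z)\<rparr>"

lemma coord_space_simps [simp]:
  "carrier (coord_space Z) = {f. \<forall>z. z \<notin> Z \<longrightarrow> f z = 0}"
  "\<zero>\<^bsub>coord_space Z\<^esub> = (\<lambda>_. 0)"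
  "f \<oplus>\<^bsub>coord_space Z\<^esub> h = (\<lambda>z. f z + h z)"
  "c \<odot>\<^bsub>coord_space Z\<^esub> f = (\<lambda>z. c * f z)"
  "ip (coord_space Z) f h = (\<Sum>z\<in>Z. cnj (f z) * h z)"
  by (simp_all add: coord_space_def)

lemma module_coord_space: "Module.module complex_ring (coord_space Z)"
proof (rule moduleI[OF cring_complex_ring])
  have "\<exists>y\<in>carrier (coord_space Z). y \<oplus>\<^bsub>coord_space Z\<^esub> x = \<zero>\<^bsub>coord_space Z\<^esub>"
    if "x \<in> carrier (coord_space Z)" for x
    using that by (intro bexI[of _ "\<lambda>z. - x z"]) auto
  then show "abelian_group (coord_space Z)"
    by (intro abelian_groupI) (auto simp: algebra_simps)
qed (auto simp: algebra_simps)

lemma coord_space_minus: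
  assumes "f \<in> carrier (coord_space Z)" "h \<in> carrier (coord_space Z)"
  shows "f \<ominus>\<^bsub>coord_space Z\<^esub> h = (\<lambda>z. f z - h z)"
proof -
  interpret Module.module complex_ring "coord_space Z" by (rule module_coord_space)
  have "\<ominus>\<^bsub>coord_space Z\<^esub> h = (\<lambda>z. - h z)"
    by (rule M.minus_equality) (use assms in auto)
  then show ?thesis by (simp add: a_minus_def)
qed

lemma coord_space_sum:
  assumes "finite A" "\<And>i. i \<in> A \<Longrightarrow> f i \<in> carrier (coord_space Z)"
  shows "(\<Oplus>\<^bsub>coord_space Z\<^esub>i\<in>A. f i) = (\<lambda>z. \<Sum>i\<in>A. f i z)"
proof -
  interpret Module.module complex_ring "coord_space Z" by (rule module_coord_space)
  show ?thesis using assms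
  proof (induction A rule: finite_induct)
    case (insert i F)
    then have "(\<Oplus>\<^bsub>coord_space Z\<^esub>i\<in>insert i F. f i) = f i \<oplus>\<^bsub>coord_space Z\<^esub> (\<Oplus>\<^bsub>coord_space Z\<^esub>i\<in>F. f i)"
      by (intro M.finsum_insert) auto
    then show ?case using insert by simp
  qed simp
qed

lemma coord_space_norm: "hnorm (coord_space Z) f = L2_set (\<lambda>z. cmod (f z)) Z"
proof -
  have "(\<Sum>z\<in>Z. cnj (f z) * f z) = of_real (\<Sum>z\<in>Z. (cmod (f z))\<^sup>2)"
    unfolding of_real_sum complex_norm_square by (intro sum.cong refl mult.commute)
  then show ?thesis by (simp add: hnorm_def L2_set_def del: of_real_sum of_real_power)
qed

lemma hilbert_space_coord_space:
  assumes "finite Z"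
  shows "hilbert_space (coord_space Z)"
proof -
  interpret Module.module complex_ring "coord_space Z" by (rule module_coord_space)
  show ?thesis
  proof
    fix v assume v: "v \<in> carrier (coord_space Z)" "v \<noteq> \<zero>\<^bsub>coord_space Z\<^esub>"
    then obtain z where z: "v z \<noteq> 0" by auto
    then have zZ: "z \<in> Z" using v by auto
    have "0 < hnorm (coord_space Z) v"
    proof (rule ccontr)
      assume "\<not> 0 < hnorm (coord_space Z) v"
      then have "L2_set (\<lambda>z. cmod (v z)) Z \<le> 0" by (simp add: coord_space_norm)
      with member_le_L2_set[OF assms zZ, of "\<lambda>z. cmod (v z)"] have "cmod (v z) \<le> 0" by linarith
      then show False using z by simp
    qed
    then show "0 < Re (ip (coord_space Z) v v)" unfolding hnorm_def by simp
  next
    fix F :: "nat \<Rightarrow> 'a \<Rightarrow> complex"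
    assume F: "\<And>n. F n \<in> carrier (coord_space Z)"
      and cauchy: "\<forall>\<epsilon>>0. \<exists>N. \<forall>m\<ge>N. \<forall>n\<ge>N. hnorm (coord_space Z) (F m \<ominus>\<^bsub>coord_space Z\<^esub> F n) < \<epsilon>"
    have "Cauchy (\<lambda>n. F n z)" for z
    proof (cases "z \<in> Z")
      case True
      show ?thesis
        unfolding Cauchy_def dist_norm
      proof (intro allI impI)
        fix \<epsilon> :: real assume "0 < \<epsilon>"
        then obtain N where N: "\<forall>m\<ge>N. \<forall>n\<ge>N. hnorm (coord_space Z) (F m \<ominus>\<^bsub>coord_space Z\<^esub> F n) < \<epsilon>"
          using cauchy by blast
        have "cmod (F m z - F n z) \<le> hnorm (coord_space Z) (F m \<ominus>\<^bsub>coord_space Z\<^esub> F n)" for m n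
          using member_le_L2_set[OF assms True, of "\<lambda>z. cmod (F m z - F n z)"]
          by (simp only: coord_space_norm coord_space_minus[OF F F])
        then show "\<exists>N. \<forall>m\<ge>N. \<forall>n\<ge>N. cmod (F m z - F n z) < \<epsilon>" using N le_less_trans by blast
      qed
    next
      case False
      then have "F n z = 0" for n using F[of n] by simp
      then show ?thesis by (simp add: Cauchy_def)
    qed
    then have "convergent (\<lambda>n. F n z)" for z using Cauchy_convergent by blast
    then obtain l where l: "\<And>z. (\<lambda>n. F n z) \<longlonglongrightarrow> l z" unfolding convergent_def by metis
    have lc: "l \<in> carrier (coord_space Z)"
    proof -
      have "l z = 0" if "z \<notin> Z" for z
      proof -
        have "(\<lambda>n. F n z) = (\<lambda>n. 0)" using F that by auto
        then show ?thesis using l[of z] LIMSEQ_unique tendsto_const by metis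
      qed
      then show ?thesis by simp
    qed
    have "(\<lambda>n. L2_set (\<lambda>z. cmod (F n z - l z)) Z) \<longlonglongrightarrow> L2_set (\<lambda>z. cmod (l z - l z)) Z"
      unfolding L2_set_def
      by (intro tendsto_intros l)
    then have "(\<lambda>n. hnorm (coord_space Z) (F n \<ominus>\<^bsub>coord_space Z\<^esub> l)) \<longlonglongrightarrow> 0"
      by (simp add: coord_space_norm coord_space_minus[OF F lc] L2_set_0' del: coord_space_simps)
    then show "\<exists>l\<in>carrier (coord_space Z). (\<lambda>n. hnorm (coord_space Z) (F n \<ominus>\<^bsub>coord_space Z\<^esub> l)) \<longlonglongrightarrow> 0"
      using lc by blast
  qed (auto simp: algebra_simps sum.distrib sum_distrib_left)
qed

lemma fin_dim_coord_space:
  assumes "finite Z"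
  shows "fin_dim (coord_space Z)"
proof -
  define e :: "'a \<Rightarrow> 'a \<Rightarrow> complex" where "e z y = (if y = z then 1 else 0)" for z y
  have inj: "inj_on e Z" by (rule inj_onI) (metis e_def zero_neq_one)
  have "\<exists>c. v = (\<Oplus>\<^bsub>coord_space Z\<^esub>s\<in>e ` Z. c s \<odot>\<^bsub>coord_space Z\<^esub> s)"
    if v: "v \<in> carrier (coord_space Z)" for v
  proof -
    let ?c = "\<lambda>s. v (the_inv_into Z e s)"
    have "(\<Oplus>\<^bsub>coord_space Z\<^esub>s\<in>e ` Z. ?c s \<odot>\<^bsub>coord_space Z\<^esub> s) = (\<lambda>y. \<Sum>s\<in>e ` Z. ?c s * s y)"
      using assms by (subst coord_space_sum) (auto simp: e_def split: if_splits)
    also have "\<dots> = (\<lambda>y. \<Sum>z\<in>Z. v z * e z y)"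
      by (subst sum.reindex[OF inj]) (simp add: the_inv_into_f_f[OF inj])
    also have "\<dots> = v" using assms v by (auto simp: e_def sum.If_cases if_distrib[of "\<lambda>x. _ * x"] cong: if_cong)
    finally show ?thesis by metis
  qed
  then show ?thesis
    unfolding fin_dim_def using assms by (intro exI[of _ "e ` Z"]) (auto simp: e_def)
qed

definition kernel_op :: "'z set \<Rightarrow> ('z \<Rightarrow> 'z \<Rightarrow> complex) \<Rightarrow> ('z \<Rightarrow> complex) \<Rightarrow> 'z \<Rightarrow> complex" where
  "kernel_op Z A f z = (if z \<in> Z then \<Sum>y\<in>Z. A z y * f y else 0)"

lemma bounded_op_kernel_op:
  assumes "finite Z"
  shows "bounded_op (coord_space Z) (kernel_op Z A)"
proof -
  have "hnorm (coord_space Z) (kernel_op Z A v) \<le> (\<Sum>z\<in>Z. \<Sum>y\<in>Z. cmod (A z y)) * hnorm (coord_space Z) v" for v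
  proof -
    have "hnorm (coord_space Z) (kernel_op Z A v) \<le> (\<Sum>z\<in>Z. cmod (kernel_op Z A v z))"
      unfolding coord_space_norm by (rule L2_set_le_sum) simp
    also have "\<dots> \<le> (\<Sum>z\<in>Z. \<Sum>y\<in>Z. cmod (A z y) * hnorm (coord_space Z) v)"
    proof (rule sum_mono)
      fix z assume z: "z \<in> Z"
      have "cmod (kernel_op Z A v z) \<le> (\<Sum>y\<in>Z. cmod (A z y * v y))"
        using z by (simp add: kernel_op_def norm_sum)
      also have "\<dots> \<le> (\<Sum>y\<in>Z. cmod (A z y) * hnorm (coord_space Z) v)"
        unfolding coord_space_norm norm_mult
        by (intro sum_mono mult_left_mono member_le_L2_set[OF assms]) auto
      finally show "cmod (kernel_op Z A v z) \<le> (\<Sum>y\<in>Z. cmod (A z y) * hnorm (coord_space Z) v)" .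
    qed
    finally show ?thesis by (simp add: sum_distrib_right)
  qed
  then have "\<exists>C. \<forall>v\<in>carrier (coord_space Z). hnorm (coord_space Z) (kernel_op Z A v) \<le> C * hnorm (coord_space Z) v"
    by blast
  then show ?thesis
    unfolding bounded_op_def
    by (auto simp: kernel_op_def fun_eq_iff algebra_simps sum.distrib sum_distrib_left
        simp del: coord_space_simps(5))
qed

lemma projection_kernel_op:
  assumes Z: "finite Z"
    and herm: "\<And>y z. y \<in> Z \<Longrightarrow> z \<in> Z \<Longrightarrow> A z y = cnj (A y z)"
    and idem: "\<And>y z. y \<in> Z \<Longrightarrow> z \<in> Z \<Longrightarrow> (\<Sum>x\<in>Z. A y x * A x z) = A y z"
  shows "projection (coord_space Z) (kernel_op Z A)"
  unfolding projection_def
proof (intro conjI ballI)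
  show "bounded_op (coord_space Z) (kernel_op Z A)" by (rule bounded_op_kernel_op[OF Z])
  fix v assume "v \<in> carrier (coord_space Z)"
  show "kernel_op Z A (kernel_op Z A v) = kernel_op Z A v"
  proof
    fix z
    have "(\<Sum>x\<in>Z. A z x * (\<Sum>y\<in>Z. A x y * v y)) = (\<Sum>y\<in>Z. A z y * v y)" if "z \<in> Z"
    proof -
      have "(\<Sum>x\<in>Z. A z x * (\<Sum>y\<in>Z. A x y * v y)) = (\<Sum>x\<in>Z. \<Sum>y\<in>Z. A z x * A x y * v y)"
        by (simp add: sum_distrib_left mult.assoc)
      also have "\<dots> = (\<Sum>y\<in>Z. \<Sum>x\<in>Z. A z x * A x y * v y)" by (rule sum.swap)
      also have "\<dots> = (\<Sum>y\<in>Z. A z y * v y)"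
        using idem that by (simp add: sum_distrib_right[symmetric])
      finally show ?thesis .
    qed
    then show "kernel_op Z A (kernel_op Z A v) z = kernel_op Z A v z"
      by (simp add: kernel_op_def)
  qed
next
  fix u v
  have "ip (coord_space Z) (kernel_op Z A u) v = (\<Sum>z\<in>Z. \<Sum>y\<in>Z. cnj (A z y) * cnj (u y) * v z)"
    by (simp add: kernel_op_def sum_distrib_right)
  also have "\<dots> = (\<Sum>y\<in>Z. \<Sum>z\<in>Z. cnj (A z y) * cnj (u y) * v z)" by (rule sum.swap)
  also have "\<dots> = (\<Sum>y\<in>Z. \<Sum>z\<in>Z. cnj (u y) * (A y z * v z))"
  proof (intro sum.cong refl)
    fix y z assume "y \<in> Z" "z \<in> Z"
    then show "cnj (A z y) * cnj (u y) * v z = cnj (u y) * (A y z * v z)"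
      using herm[of z y] by simp
  qed
  also have "\<dots> = ip (coord_space Z) u (kernel_op Z A v)"
    by (simp add: kernel_op_def sum_distrib_left)
  finally show "ip (coord_space Z) (kernel_op Z A u) v = ip (coord_space Z) u (kernel_op Z A v)" .
qed

text \<open>
  The tensor square has to live in the type of the space itself.  So pairs of indices are
  coded by single ones.
\<close>

definition pair_index :: "nat set \<Rightarrow> ('i + nat) set" where
  "pair_index B = (\<lambda>(i, j). Inr (prod_encode (i, j))) ` (B \<times> B)"

definition coord_tensor :: "('i + nat \<Rightarrow> complex) \<Rightarrow> ('i + nat \<Rightarrow> complex) \<Rightarrow> 'i + nat \<Rightarrow> complex" where
  "coord_tensor u v z = (case z of Inl _ \<Rightarrow> 0 | Inr n \<Rightarrow>
     u (Inr (fst (prod_decode n))) * v (Inr (snd (prod_decode n))))"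

lemma pair_index_mem [simp]: "Inr (prod_encode (i, j)) \<in> pair_index B \<longleftrightarrow> i \<in> B \<and> j \<in> B"
  by (auto simp: pair_index_def)

lemma finite_pair_index: "finite B \<Longrightarrow> finite (pair_index B)"
  by (simp add: pair_index_def)

lemma pair_indexE:
  assumes "z \<in> pair_index B"
  obtains i j where "i \<in> B" "j \<in> B" "z = Inr (prod_encode (i, j))"
  using assms unfolding pair_index_def by auto

lemma coord_tensor_pair [simp]: "coord_tensor u v (Inr (prod_encode (i, j))) = u (Inr i) * v (Inr j)"
  by (simp add: coord_tensor_def)

lemma sum_pair_index: "(\<Sum>z\<in>pair_index B. f z) = (\<Sum>i\<in>B. \<Sum>j\<in>B. f (Inr (prod_encode (i, j))))"
proof -
  have "inj_on (\<lambda>(i, j). Inr (prod_encode (i, j)) :: 'i + nat) (B \<times> B)"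
    by (auto simp: inj_on_def)
  then have "(\<Sum>z\<in>pair_index B. f z) = (\<Sum>p\<in>B\<times>B. f (Inr (prod_encode p)))"
    unfolding pair_index_def by (subst sum.reindex) (auto intro!: sum.cong)
  also have "\<dots> = (\<Sum>i\<in>B. \<Sum>j\<in>B. f (Inr (prod_encode (i, j))))"
    by (simp add: sum.cartesian_product case_prod_unfold)
  finally show ?thesis .
qed

lemma coord_tensor_in:
  assumes "u \<in> carrier (coord_space (Inr ` B))" "v \<in> carrier (coord_space (Inr ` B))"
  shows "coord_tensor u v \<in> carrier (coord_space (pair_index B))"
proof -
  have "coord_tensor u v z = 0" if "z \<notin> pair_index B" for z
  proof (cases z)
    case (Inr n)
    obtain i j where n: "n = prod_encode (i, j)" by (metis prod.exhaust prod_decode_inverse)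
    then have "i \<notin> B \<or> j \<notin> B" using that Inr by auto
    then have "u (Inr i) = 0 \<or> v (Inr j) = 0" using assms by auto
    then show ?thesis using Inr n by auto
  qed (simp add: coord_tensor_def)
  then show ?thesis by simp
qed

lemma hilbert_tensor_coord:
  assumes B: "finite B"
  shows "hilbert_tensor (coord_space (Inr ` B)) (coord_space (pair_index B :: ('i + nat) set)) coord_tensor"
proof -
  let ?H = "coord_space (Inr ` B :: ('i + nat) set)" and ?K = "coord_space (pair_index B :: ('i + nat) set)"
  have K: "hilbert_space ?K" by (rule hilbert_space_coord_space[OF finite_pair_index[OF B]])
  have ip: "ip ?K (coord_tensor u v) (coord_tensor u' v') = ip ?H u u' * ip ?H v v'" for u v u' v'
    by (simp add: sum_pair_index sum.reindex sum_product algebra_simps)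
  have dense: "\<exists>(n::nat) u v. (\<forall>i<n. u i \<in> carrier ?H \<and> v i \<in> carrier ?H) \<and>
        hnorm ?K (k \<ominus>\<^bsub>?K\<^esub> (\<Oplus>\<^bsub>?K\<^esub>i\<in>{..<n}. coord_tensor (u i) (v i))) < \<epsilon>"
    if k: "k \<in> carrier ?K" and \<epsilon>: "0 < \<epsilon>" for k \<epsilon>
  proof -
    obtain h where h: "bij_betw h {..<card (B \<times> B)} (B \<times> B)"
      using ex_bij_betw_nat_finite[of "B \<times> B"] B by (auto simp: atLeast0LessThan)
    let ?n = "card (B \<times> B)"
    define u where "u m z = (if z = Inr (fst (h m)) then k (Inr (prod_encode (h m))) else 0)"
      for m and z :: "'i + nat"
    define v where "v m z = (if z = Inr (snd (h m)) then 1 :: complex else 0)" for m and z :: "'i + nat"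
    have hB: "fst (h m) \<in> B" "snd (h m) \<in> B" if "m < ?n" for m
      using bij_betw_apply[OF h, of m] that by auto
    have uv: "u m \<in> carrier ?H \<and> v m \<in> carrier ?H" if "m < ?n" for m
      using hB[OF that] by (auto simp: u_def v_def)
    then have tc: "coord_tensor (u m) (v m) \<in> carrier ?K" if "m < ?n" for m
      using that coord_tensor_in by blast
    have sum: "(\<Oplus>\<^bsub>?K\<^esub>m\<in>{..<?n}. coord_tensor (u m) (v m)) = (\<lambda>z. \<Sum>m<?n. coord_tensor (u m) (v m) z)"
      by (rule coord_space_sum) (use tc in auto)
    have "(\<Sum>m<?n. coord_tensor (u m) (v m) z) = k z" for z
    proof (cases "z \<in> pair_index B")
      case True
      then obtain i j where ij: "i \<in> B" "j \<in> B" "z = Inr (prod_encode (i, j))" by (rule pair_indexE)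
      have "(\<Sum>m<?n. coord_tensor (u m) (v m) z) = (\<Sum>m<?n. if h m = (i, j) then k z else 0)"
        by (intro sum.cong refl) (auto simp: ij(3) u_def v_def prod_eq_iff)
      also have "\<dots> = (\<Sum>q\<in>B\<times>B. if q = (i, j) then k z else 0)"
        using sum.reindex_bij_betw[OF h, of "\<lambda>q. if q = (i, j) then k z else 0"] by simp
      also have "\<dots> = k z" using B ij by (simp add: finite_cartesian_product)
      finally show ?thesis .
    next
      case False
      then have "coord_tensor (u m) (v m) z = 0" if "m < ?n" for m using tc[OF that] by simp
      then show ?thesis using k False by simp
    qed
    then have "(\<Oplus>\<^bsub>?K\<^esub>m\<in>{..<?n}. coord_tensor (u m) (v m)) = k" unfolding sum by (rule ext)
    moreover have "hnorm ?K (k \<ominus>\<^bsub>?K\<^esub> k) = 0"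
      using coord_space_minus[OF k k] by (simp add: coord_space_norm L2_set_0' del: coord_space_simps)
    ultimately show ?thesis using \<epsilon> uv by (intro exI[of _ ?n] exI[of _ u] exI[of _ v]) simp
  qed
  have "coord_tensor (\<lambda>z. u z + u' z) v = (\<lambda>z. coord_tensor u v z + coord_tensor u' v z)"
    "coord_tensor v (\<lambda>z. u z + u' z) = (\<lambda>z. coord_tensor v u z + coord_tensor v u' z)"
    "coord_tensor (\<lambda>z. c * u z) v = (\<lambda>z. c * coord_tensor u v z)"
    "coord_tensor v (\<lambda>z. c * u z) = (\<lambda>z. c * coord_tensor v u z)" for u u' v :: "'i + nat \<Rightarrow> complex" and c
    by (auto simp: coord_tensor_def fun_eq_iff algebra_simps split: sum.split)
  moreover have "coord_tensor u v \<in> carrier ?K" if "u \<in> carrier ?H" "v \<in> carrier ?H" for u v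
    using that by (rule coord_tensor_in)
  moreover have "hilbert_space ?H" using B by (intro hilbert_space_coord_space) simp
  ultimately show ?thesis
    unfolding hilbert_tensor_def
    using K ip dense
    by (simp del: coord_space_simps(1,5))
qed

definition mat_op :: "nat set \<Rightarrow> (nat \<Rightarrow> nat \<Rightarrow> complex) \<Rightarrow> ('i + nat \<Rightarrow> complex) \<Rightarrow> 'i + nat \<Rightarrow> complex" where
  "mat_op B M = kernel_op (Inr ` B) (\<lambda>z y. M (projr z) (projr y))"

lemma pvm_mat_op:
  assumes B: "finite B" and P: "mat_pvm B P"
  shows "pvm (coord_space (Inr ` B :: ('i + nat) set)) (\<lambda>a. mat_op B (P a))"
  unfolding pvm_def
proof (intro conjI allI ballI)
  fix a
  show "projection (coord_space (Inr ` B :: ('i + nat) set)) (mat_op B (P a))"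
    unfolding mat_op_def
  proof (rule projection_kernel_op)
    fix y z :: "'i + nat" assume "y \<in> Inr ` B" "z \<in> Inr ` B"
    then show "P a (projr z) (projr y) = cnj (P a (projr y) (projr z))"
      using mat_pvm_herm[OF P] by (metis image_iff sum.sel(2))
    show "(\<Sum>x\<in>Inr ` B. P a (projr y) (projr x) * P a (projr x) (projr z)) = P a (projr y) (projr z)"
      using \<open>y \<in> Inr ` B\<close> \<open>z \<in> Inr ` B\<close> mat_pvm_idem[OF P] by (auto simp: sum.reindex)
  qed (use B in simp)
next
  fix v assume v: "v \<in> carrier (coord_space (Inr ` B :: ('i + nat) set))"
  have "(\<Oplus>\<^bsub>coord_space (Inr ` B)\<^esub>a\<in>UNIV. mat_op B (P a) v) = (\<lambda>z. \<Sum>a\<in>UNIV. mat_op B (P a) v z)"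
    by (rule coord_space_sum) (auto simp: mat_op_def kernel_op_def)
  also have "\<dots> = v"
  proof
    fix z
    show "(\<Sum>a\<in>UNIV. mat_op B (P a) v z) = v z"
    proof (cases "z \<in> Inr ` B")
      case True
      then obtain i where i: "i \<in> B" "z = Inr i" by blast
      have "(\<Sum>a\<in>UNIV. mat_op B (P a) v z) = (\<Sum>a\<in>UNIV. \<Sum>j\<in>B. P a i j * v (Inr j))"
        using i by (simp add: mat_op_def kernel_op_def sum.reindex)
      also have "\<dots> = (\<Sum>j\<in>B. \<Sum>a\<in>UNIV. P a i j * v (Inr j))" by (rule sum.swap)
      also have "\<dots> = (\<Sum>j\<in>B. if i = j then v (Inr j) else 0)"
        using mat_pvm_sum[OF P i(1)] by (intro sum.cong refl) (simp add: sum_distrib_right[symmetric])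
      also have "\<dots> = v z" using B i by simp
      finally show ?thesis .
    qed (use v in \<open>simp add: mat_op_def kernel_op_def\<close>)
  qed
  finally show "(\<Oplus>\<^bsub>coord_space (Inr ` B)\<^esub>a\<in>UNIV. mat_op B (P a) v) = v" .
qed

definition pair_op :: "nat set \<Rightarrow> (nat \<Rightarrow> nat \<Rightarrow> complex) \<Rightarrow> (nat \<Rightarrow> nat \<Rightarrow> complex) \<Rightarrow>
    ('i + nat \<Rightarrow> complex) \<Rightarrow> 'i + nat \<Rightarrow> complex" where
  "pair_op B M N = kernel_op (pair_index B) (\<lambda>z y.
     M (fst (prod_decode (projr z))) (fst (prod_decode (projr y))) *
     N (snd (prod_decode (projr z))) (snd (prod_decode (projr y))))"

lemma op_tensor_pair_op:
  assumes B: "finite B"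
  shows "op_tensor (coord_space (Inr ` B)) (coord_space (pair_index B :: ('i + nat) set)) coord_tensor
    (mat_op B M) (mat_op B N) (pair_op B M N)"
  unfolding op_tensor_def
proof (intro conjI ballI)
  show "bounded_op (coord_space (pair_index B :: ('i + nat) set)) (pair_op B M N)"
    unfolding pair_op_def by (rule bounded_op_kernel_op[OF finite_pair_index[OF B]])
  fix u v :: "'i + nat \<Rightarrow> complex"
  show "pair_op B M N (coord_tensor u v) = coord_tensor (mat_op B M u) (mat_op B N v)"
  proof
    fix z
    show "pair_op B M N (coord_tensor u v) z = coord_tensor (mat_op B M u) (mat_op B N v) z"
    proof (cases "z \<in> pair_index B")
      case True
      then obtain i j where "i \<in> B" "j \<in> B" "z = Inr (prod_encode (i, j))" by (rule pair_indexE)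
      then show ?thesis
        by (simp add: pair_op_def mat_op_def kernel_op_def sum_pair_index sum.reindex sum_product mult_ac)
    next
      case False
      have "coord_tensor (mat_op B M u) (mat_op B N v) \<in> carrier (coord_space (pair_index B))"
        by (rule coord_tensor_in) (simp_all add: mat_op_def kernel_op_def)
      then show ?thesis using False by (simp add: pair_op_def kernel_op_def)
    qed
  qed
qed

text \<open>
  The vector \<open>\<Sum>i\<in>B. sqrt (w i) e\<^sub>i \<otimes> e\<^sub>i\<close>.
\<close>

definition diagonal_vector :: "nat set \<Rightarrow> (nat \<Rightarrow> real) \<Rightarrow> 'i + nat \<Rightarrow> complex" where
  "diagonal_vector B w z = (case z of Inl _ \<Rightarrow> 0 | Inr n \<Rightarrow> (case prod_decode n of (i, j) \<Rightarrow>
     if i = j \<and> i \<in> B then of_real (sqrt (w i)) else 0))"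

lemma diagonal_vector_pair [simp]:
  "diagonal_vector B w (Inr (prod_encode (i, j))) = (if i = j \<and> i \<in> B then of_real (sqrt (w i)) else 0)"
  by (simp add: diagonal_vector_def)

lemma diagonal_vector_in:
  "diagonal_vector B w \<in> carrier (coord_space (pair_index B :: ('i + nat) set))"
proof -
  have "diagonal_vector B w z = 0" if "z \<notin> pair_index B" for z :: "'i + nat"
  proof (cases z)
    case (Inr n)
    obtain i j where n: "n = prod_encode (i, j)" by (metis prod.exhaust prod_decode_inverse)
    then show ?thesis using that Inr by auto
  qed (simp add: diagonal_vector_def)
  then show ?thesis by simp
qed

text \<open>
  A priori the factor \<open>sqrt (w i) * sqrt (w k)\<close> appears in place of \<open>w i\<close>, but \<open>P\<close> vanishes unless
  \<open>w i = w k\<close>.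
\<close>

lemma diagonal_correlation:
  assumes w: "weighted_correlation B w P Q p"
  shows "tensor_correlation (coord_space (Inr ` B)) (coord_space (pair_index B :: ('i + nat) set))
      coord_tensor (diagonal_vector B w) (\<lambda>x a. mat_op B (P x a)) (\<lambda>y b. mat_op B (Q y b)) p"
    and "hnorm (coord_space (pair_index B :: ('i + nat) set)) (diagonal_vector B w) = 1"
proof -
  have B: "finite B" and pos: "\<And>i. i \<in> B \<Longrightarrow> 0 < w i" and one: "sum w B = 1"
    and P: "\<And>x. mat_pvm B (P x)" and Q: "\<And>y. mat_pvm B (Q y)"
    and off: "\<And>i j x a. i \<in> B \<Longrightarrow> j \<in> B \<Longrightarrow> w i \<noteq> w j \<Longrightarrow> P x a i j = 0"
    and p: "\<And>x y a b. complex_of_real (p $ (x, y, a, b)) =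
        (\<Sum>i\<in>B. \<Sum>j\<in>B. of_real (w i) * P x a i j * Q y b i j)"
    using w unfolding weighted_correlation_def by blast+
  have coll: "(\<Sum>i\<in>B. \<Sum>j\<in>B. (if i = j \<and> i \<in> B then f i j else 0)) = (\<Sum>i\<in>B. f i i)"
    for f :: "nat \<Rightarrow> nat \<Rightarrow> complex"
  proof (intro sum.cong refl)
    fix i assume "i \<in> B"
    then have "(\<Sum>j\<in>B. if i = j \<and> i \<in> B then f i j else 0) = (\<Sum>j\<in>B. if i = j then f i j else 0)"
      by (intro sum.cong) auto
    then show "(\<Sum>j\<in>B. if i = j \<and> i \<in> B then f i j else 0) = f i i" using B \<open>i \<in> B\<close> by simp
  qed
  show "tensor_correlation (coord_space (Inr ` B)) (coord_space (pair_index B :: ('i + nat) set))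
      coord_tensor (diagonal_vector B w) (\<lambda>x a. mat_op B (P x a)) (\<lambda>y b. mat_op B (Q y b)) p"
    unfolding tensor_correlation_def
  proof (intro conjI allI exI)
    fix x y a b
    let ?\<xi> = "diagonal_vector B w :: 'i + nat \<Rightarrow> complex"
    have T: "pair_op B (P x a) (Q y b) ?\<xi> (Inr (prod_encode (i, i))) =
        (\<Sum>k\<in>B. P x a i k * Q y b i k * of_real (sqrt (w k)))" if "i \<in> B" for i
    proof -
      have "pair_op B (P x a) (Q y b) ?\<xi> (Inr (prod_encode (i, i))) =
          (\<Sum>k\<in>B. \<Sum>l\<in>B. if k = l \<and> k \<in> B then P x a i k * Q y b i l * of_real (sqrt (w k)) else 0)"
        using that by (simp add: pair_op_def kernel_op_def sum_pair_index
            if_distrib[of "\<lambda>x. _ * x"] cong: if_cong)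
      then show ?thesis by (simp only: coll)
    qed
    have "ip (coord_space (pair_index B)) ?\<xi> (pair_op B (P x a) (Q y b) ?\<xi>) =
        (\<Sum>i\<in>B. \<Sum>j\<in>B. if i = j \<and> i \<in> B then
           of_real (sqrt (w i)) * pair_op B (P x a) (Q y b) ?\<xi> (Inr (prod_encode (i, j))) else 0)"
      unfolding coord_space_simps sum_pair_index by (intro sum.cong refl) simp
    also have "\<dots> = (\<Sum>i\<in>B. of_real (sqrt (w i)) * pair_op B (P x a) (Q y b) ?\<xi> (Inr (prod_encode (i, i))))"
      by (rule coll)
    also have "\<dots> = (\<Sum>i\<in>B. \<Sum>k\<in>B. of_real (w i) * P x a i k * Q y b i k)"
    proof (intro sum.cong refl)
      fix i assume i: "i \<in> B"
      have "of_real (sqrt (w i)) * pair_op B (P x a) (Q y b) ?\<xi> (Inr (prod_encode (i, i))) =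
          (\<Sum>k\<in>B. of_real (sqrt (w i) * sqrt (w k)) * P x a i k * Q y b i k)"
        unfolding T[OF i] sum_distrib_left by (intro sum.cong refl) simp
      also have "\<dots> = (\<Sum>k\<in>B. of_real (w i) * P x a i k * Q y b i k)"
      proof (intro sum.cong refl)
        fix k assume k: "k \<in> B"
        show "of_real (sqrt (w i) * sqrt (w k)) * P x a i k * Q y b i k = of_real (w i) * P x a i k * Q y b i k"
          using off[OF i k, of x a] pos[OF i] by (cases "w i = w k") auto
      qed
      finally show "of_real (sqrt (w i)) * pair_op B (P x a) (Q y b) ?\<xi> (Inr (prod_encode (i, i))) =
          (\<Sum>k\<in>B. of_real (w i) * P x a i k * Q y b i k)" .
    qed
    finally show "complex_of_real (p $ (x, y, a, b)) =
        ip (coord_space (pair_index B)) ?\<xi> (pair_op B (P x a) (Q y b) ?\<xi>)"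
      by (simp only: p)
  qed (use pvm_mat_op[OF B P] pvm_mat_op[OF B Q] op_tensor_pair_op[OF B] in auto)
  have "ip (coord_space (pair_index B :: ('i + nat) set)) (diagonal_vector B w) (diagonal_vector B w) =
      (\<Sum>i\<in>B. \<Sum>j\<in>B. if i = j \<and> i \<in> B then of_real (sqrt (w i)) * of_real (sqrt (w i)) else 0)"
    unfolding coord_space_simps sum_pair_index by (intro sum.cong refl) simp
  also have "\<dots> = (\<Sum>i\<in>B. of_real (sqrt (w i)) * of_real (sqrt (w i)))" by (rule coll)
  also have "\<dots> = (\<Sum>i\<in>B. complex_of_real (w i))"
    using pos by (intro sum.cong refl) (simp add: less_imp_le of_real_mult[symmetric] del: of_real_mult)
  also have "\<dots> = 1" using one by (metis of_real_1 of_real_sum)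
  finally show "hnorm (coord_space (pair_index B :: ('i + nat) set)) (diagonal_vector B w) = 1"
    unfolding hnorm_def by simp
qed

section \<open>Convex combinations of matrix strategies\<close>

definition weighted_correlations ::
  "(real ^ ('x::finite \<times> 'y::finite \<times> 'a::finite \<times> 'b::finite)) set" where
  "weighted_correlations = {p. \<exists>B w P Q. weighted_correlation B w P Q p}"

text \<open>
  The first summand occupies the even indices, the second one the odd indices.
\<close>

definition direct_sum :: "(nat \<Rightarrow> nat \<Rightarrow> complex) \<Rightarrow> (nat \<Rightarrow> nat \<Rightarrow> complex) \<Rightarrow> nat \<Rightarrow> nat \<Rightarrow> complex" where
  "direct_sum M N m n = (if even m \<and> even n then M (m div 2) (n div 2)
     else if odd m \<and> odd n then N (m div 2) (n div 2) else 0)"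

definition interleave :: "nat set \<Rightarrow> nat set \<Rightarrow> nat set" where
  "interleave A B = (\<lambda>i. 2 * i) ` A \<union> (\<lambda>i. 2 * i + 1) ` B"

lemma sum_interleave:
  assumes "finite A" "finite B"
  shows "(\<Sum>n\<in>interleave A B. f n) = (\<Sum>i\<in>A. f (2 * i)) + (\<Sum>i\<in>B. f (2 * i + 1))"
proof -
  have "(\<lambda>i. 2 * i) ` A \<inter> (\<lambda>i. 2 * i + 1) ` B = {}"
    by auto presburger
  then have "(\<Sum>n\<in>interleave A B. f n) = sum f ((\<lambda>i. 2 * i) ` A) + sum f ((\<lambda>i. 2 * i + 1) ` B)"
    unfolding interleave_def using assms by (intro sum.union_disjoint) auto
  also have "sum f ((\<lambda>i. 2 * i) ` A) = (\<Sum>i\<in>A. f (2 * i))"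
    by (subst sum.reindex) (auto simp: inj_on_def)
  also have "sum f ((\<lambda>i. 2 * i + 1) ` B) = (\<Sum>i\<in>B. f (2 * i + 1))"
    by (subst sum.reindex) (auto simp: inj_on_def)
  finally show ?thesis .
qed

lemma direct_sum_simps [simp]:
  "direct_sum M N (2 * i) (2 * j) = M i j"
  "direct_sum M N (Suc (2 * i)) (Suc (2 * j)) = N i j"
  "direct_sum M N (2 * i) (Suc (2 * j)) = 0"
  "direct_sum M N (Suc (2 * i)) (2 * j) = 0"
  by (simp_all add: direct_sum_def)

lemma interleaveE:
  assumes "n \<in> interleave A B"
  obtains i where "i \<in> A" "n = 2 * i" | i where "i \<in> B" "n = Suc (2 * i)"
  using assms unfolding interleave_def by auto

lemma mat_pvm_direct_sum:
  assumes fin: "finite A" "finite B" and P: "mat_pvm A P" and Q: "mat_pvm B Q"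
  shows "mat_pvm (interleave A B) (\<lambda>a. direct_sum (P a) (Q a))"
  unfolding mat_pvm_def
proof (intro conjI allI ballI)
  fix a i j assume ij: "i \<in> interleave A B" "j \<in> interleave A B"
  then show "direct_sum (P a) (Q a) j i = cnj (direct_sum (P a) (Q a) i j)"
    by (elim interleaveE) (auto intro: mat_pvm_herm[OF P] mat_pvm_herm[OF Q])
  from ij show "(\<Sum>k\<in>interleave A B. direct_sum (P a) (Q a) i k * direct_sum (P a) (Q a) k j) =
      direct_sum (P a) (Q a) i j"
    by (elim interleaveE) (simp_all add: sum_interleave[OF fin] mat_pvm_idem[OF P] mat_pvm_idem[OF Q])
next
  fix i j assume ij: "i \<in> interleave A B" "j \<in> interleave A B"
  have parity: "2 * m \<noteq> Suc (2 * n)" "Suc (2 * m) \<noteq> 2 * n" for m n :: nat by presburger+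
  from ij show "(\<Sum>a\<in>UNIV. direct_sum (P a) (Q a) i j) = (if i = j then 1 else 0)"
    by (elim interleaveE) (simp_all add: mat_pvm_sum[OF P] mat_pvm_sum[OF Q] parity)
qed

text \<open>
  The direct sum of the two strategies works, with the weights scaled by \<open>u\<close> and \<open>v\<close>.  Scaled
  weights from different summands may coincide; this does no harm, since there are no
  entries between the summands.
\<close>

lemma convex_weighted_correlations:
  "convex (weighted_correlations :: (real ^ ('x::finite \<times> 'y::finite \<times> 'a::finite \<times> 'b::finite)) set)"
proof (rule convexI)
  fix p q :: "real ^ ('x \<times> 'y \<times> 'a \<times> 'b)" and u v :: real
  assume p: "p \<in> weighted_correlations" and q: "q \<in> weighted_correlations"
    and uv: "0 \<le> u" "0 \<le> v" "u + v = 1"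
  show "u *\<^sub>R p + v *\<^sub>R q \<in> weighted_correlations"
  proof (cases "u = 0 \<or> v = 0")
    case True
    then show ?thesis using p q uv by auto
  next
    case False
    then have pos: "0 < u" "0 < v" using uv by auto
    obtain A f P Q where p: "weighted_correlation A f P Q p"
      using p unfolding weighted_correlations_def by blast
    obtain B h R S where q: "weighted_correlation B h R S q"
      using q unfolding weighted_correlations_def by blast
    have fin: "finite A" "finite B" using p q unfolding weighted_correlation_def by blast+
    define w where "w n = (if even n then u * f (n div 2) else v * h (n div 2))" for n
    have w: "w (2 * i) = u * f i" "w (Suc (2 * i)) = v * h i" for i by (simp_all add: w_def)
    have "weighted_correlation (interleave A B) w
      (\<lambda>x a. direct_sum (P x a) (R x a)) (\<lambda>y b. direct_sum (Q y b) (S y b)) (u *\<^sub>R p + v *\<^sub>R q)"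
      unfolding weighted_correlation_def
    proof (intro conjI allI ballI impI)
      show "finite (interleave A B)" using fin by (simp add: interleave_def)
      show "0 < w i" if "i \<in> interleave A B" for i
        using that p q pos by (elim interleaveE) (simp_all add: w weighted_correlation_def)
      show "sum w (interleave A B) = 1"
        using p q uv fin
        by (simp add: sum_interleave w sum_distrib_left[symmetric] weighted_correlation_def)
      show "mat_pvm (interleave A B) (\<lambda>a. direct_sum (P x a) (R x a))" for x
        using p q fin by (intro mat_pvm_direct_sum) (auto simp: weighted_correlation_def)
      show "mat_pvm (interleave A B) (\<lambda>b. direct_sum (Q y b) (S y b))" for y
        using p q fin by (intro mat_pvm_direct_sum) (auto simp: weighted_correlation_def)
      fix i j assume ij: "i \<in> interleave A B" "j \<in> interleave A B" "w i \<noteq> w j"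
      have pw: "\<And>i j. i \<in> A \<Longrightarrow> j \<in> A \<Longrightarrow> f i \<noteq> f j \<Longrightarrow> (\<forall>x a. P x a i j = 0) \<and> (\<forall>y b. Q y b i j = 0)"
        and qw: "\<And>i j. i \<in> B \<Longrightarrow> j \<in> B \<Longrightarrow> h i \<noteq> h j \<Longrightarrow> (\<forall>x a. R x a i j = 0) \<and> (\<forall>y b. S y b i j = 0)"
        using p q unfolding weighted_correlation_def by blast+
      show "direct_sum (P x a) (R x a) i j = 0" for x a
        using ij pw qw by (elim interleaveE) (auto simp: w)
      show "direct_sum (Q y b) (S y b) i j = 0" for y b
        using ij pw qw by (elim interleaveE) (auto simp: w)
    next
      fix x y a b
      have pp: "complex_of_real (p $ (x, y, a, b)) = (\<Sum>i\<in>A. \<Sum>j\<in>A. of_real (f i) * P x a i j * Q y b i j)"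
        using p unfolding weighted_correlation_def by simp
      have qq: "complex_of_real (q $ (x, y, a, b)) = (\<Sum>i\<in>B. \<Sum>j\<in>B. of_real (h i) * R x a i j * S y b i j)"
        using q unfolding weighted_correlation_def by simp
      have "complex_of_real ((u *\<^sub>R p + v *\<^sub>R q) $ (x, y, a, b)) =
          of_real u * complex_of_real (p $ (x, y, a, b)) + of_real v * complex_of_real (q $ (x, y, a, b))"
        by simp
      also have "\<dots> = (\<Sum>i\<in>interleave A B. \<Sum>j\<in>interleave A B. of_real (w i) *
          direct_sum (P x a) (R x a) i j * direct_sum (Q y b) (S y b) i j)"
        unfolding pp qq sum_interleave[OF fin]
        by (simp add: w sum_distrib_left mult.assoc)
      finally show "complex_of_real ((u *\<^sub>R p + v *\<^sub>R q) $ (x, y, a, b)) =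
          (\<Sum>i\<in>interleave A B. \<Sum>j\<in>interleave A B. of_real (w i) *
            direct_sum (P x a) (R x a) i j * direct_sum (Q y b) (S y b) i j)" .
    qed
    then show ?thesis unfolding weighted_correlations_def by blast
  qed
qed

lemma hull_tracial_subset_weighted: "convex hull tracial_correlations \<subseteq> weighted_correlations"
  by (rule hull_minimal)
    (use convex_weighted_correlations in \<open>auto simp: tracial_correlations_def weighted_correlations_def\<close>)

lemma weighted_subset_C_q: "weighted_correlations \<subseteq> C_q TYPE('i + nat \<Rightarrow> complex)"
proof
  fix p assume "p \<in> weighted_correlations"
  then obtain B w P Q where w: "weighted_correlation B w P Q p"
    unfolding weighted_correlations_def by blast
  then have B: "finite B" unfolding weighted_correlation_def by blast
  show "p \<in> C_q TYPE('i + nat \<Rightarrow> complex)"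
    unfolding C_q_def mem_Collect_eq
    using hilbert_tensor_coord[OF B] fin_dim_coord_space[of "Inr ` B"] B diagonal_vector_in
      diagonal_correlation[OF w] by (metis finite_imageI)
qed

lemma C_q_subset_C_qs: "C_q TYPE('v) \<subseteq> C_qs TYPE('v)"
  unfolding C_q_def C_qs_def by blast

lemma max_entangled_coord:
  assumes B: "finite B" and b: "bij_betw b {..<card B} B"
  defines "e \<equiv> \<lambda>m z. if z = (Inr (b m) :: 'i + nat) then 1 else 0"
  shows "orthonormal_basis (coord_space (Inr ` B)) (card B) e"
    and "max_entangled (coord_space (pair_index B)) coord_tensor (card B) e =
      diagonal_vector B (\<lambda>_. 1 / real (card B))"
proof -
  let ?H = "coord_space (Inr ` B :: ('i + nat) set)" and ?K = "coord_space (pair_index B :: ('i + nat) set)"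
  have bB: "b m \<in> B" if "m < card B" for m using bij_betw_apply[OF b] that by simp
  have inj: "b m = b n \<longleftrightarrow> m = n" if "m < card B" "n < card B" for m n
    using b that unfolding bij_betw_def inj_on_def by auto
  have ec: "e m \<in> carrier ?H" if "m < card B" for m using bB[OF that] by (auto simp: e_def)
  show "orthonormal_basis ?H (card B) e"
    unfolding orthonormal_basis_def
  proof (intro conjI allI ballI impI)
    fix i j assume ij: "i < card B" "j < card B"
    have "ip ?H (e i) (e j) = (\<Sum>k\<in>B. cnj (e i (Inr k)) * e j (Inr k))"
      by (simp add: sum.reindex)
    also have "\<dots> = (\<Sum>k\<in>B. if k = b i then (if b i = b j then 1 else 0) else 0)"
      by (intro sum.cong refl) (auto simp: e_def)
    finally show "ip ?H (e i) (e j) = (if i = j then 1 else 0)"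
      using B bB[OF ij(1)] inj[OF ij] by simp
  next
    fix v assume v: "v \<in> carrier ?H"
    have "(\<Oplus>\<^bsub>?H\<^esub>i\<in>{..<card B}. v (Inr (b i)) \<odot>\<^bsub>?H\<^esub> e i) = (\<lambda>z. \<Sum>i<card B. v (Inr (b i)) * e i z)"
      using ec by (subst coord_space_sum) auto
    also have "\<dots> = v"
    proof
      fix z
      have "(\<Sum>i<card B. v (Inr (b i)) * e i z) = (\<Sum>k\<in>B. v (Inr k) * (if z = Inr k then 1 else 0))"
        unfolding e_def by (rule sum.reindex_bij_betw[OF b])
      also have "\<dots> = v z"
      proof (cases "z \<in> Inr ` B")
        case True
        then obtain i where i: "i \<in> B" "z = Inr i" by blast
        have "(\<Sum>k\<in>B. v (Inr k) * (if z = Inr k then 1 else 0)) = (\<Sum>k\<in>B. if k = i then v z else 0)"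
          using i by (intro sum.cong refl) auto
        then show ?thesis using B i by simp
      next
        case False
        then have "(\<Sum>k\<in>B. v (Inr k) * (if z = Inr k then 1 else 0)) = 0"
          by (intro sum.neutral) auto
        then show ?thesis using False v by simp
      qed
      finally show "(\<Sum>i<card B. v (Inr (b i)) * e i z) = v z" .
    qed
    finally show "\<exists>c. v = (\<Oplus>\<^bsub>?H\<^esub>i\<in>{..<card B}. c i \<odot>\<^bsub>?H\<^esub> e i)"
      by (intro exI[of _ "\<lambda>i. v (Inr (b i))"]) simp
  qed (use ec in auto)
  have "(\<Oplus>\<^bsub>?K\<^esub>i\<in>{..<card B}. coord_tensor (e i) (e i)) = (\<lambda>z. \<Sum>i<card B. coord_tensor (e i) (e i) z)"
    using coord_tensor_in[OF ec ec] by (intro coord_space_sum) auto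
  then have "max_entangled ?K coord_tensor (card B) e =
      (\<lambda>z. of_real (1 / sqrt (real (card B))) * (\<Sum>i<card B. coord_tensor (e i) (e i) z))"
    unfolding max_entangled_def by simp
  also have "\<dots> = diagonal_vector B (\<lambda>_. 1 / real (card B))"
  proof
    fix z
    show "of_real (1 / sqrt (real (card B))) * (\<Sum>i<card B. coord_tensor (e i) (e i) z) =
        diagonal_vector B (\<lambda>_. 1 / real (card B)) z"
    proof (cases z)
      case (Inr n)
      obtain i j where n: "n = prod_encode (i, j)" by (metis prod.exhaust prod_decode_inverse)
      have "(\<Sum>m<card B. coord_tensor (e m) (e m) z) = (\<Sum>m<card B. if b m = i \<and> i = j then 1 else 0)"
        by (intro sum.cong refl) (auto simp: Inr n e_def)
      also have "\<dots> = (\<Sum>k\<in>B. if k = i \<and> i = j then 1 else 0)"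
        by (rule sum.reindex_bij_betw[OF b])
      also have "\<dots> = (if i = j \<and> i \<in> B then 1 else 0)" using B by (cases "i = j") simp_all
      finally show ?thesis using B by (auto simp: Inr n real_sqrt_divide card_eq_0_iff)
    qed (simp add: coord_tensor_def diagonal_vector_def)
  qed
  finally show "max_entangled ?K coord_tensor (card B) e = diagonal_vector B (\<lambda>_. 1 / real (card B))" .
qed

lemma hull_tracial_subset_C_qm: "convex hull tracial_correlations \<subseteq> C_qm TYPE('i + nat \<Rightarrow> complex)"
  unfolding C_qm_def
proof (rule hull_mono, rule subsetI)
  fix p assume "p \<in> tracial_correlations"
  then obtain B P Q where w: "weighted_correlation B (\<lambda>_. 1 / real (card B)) P Q p"
    unfolding tracial_correlations_def by blast
  then have B: "finite B" "card B \<noteq> 0" unfolding weighted_correlation_def by auto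
  obtain b where b: "bij_betw b {..<card B} B"
    using ex_bij_betw_nat_finite[OF B(1)] by (auto simp: atLeast0LessThan)
  note me = max_entangled_coord[OF B(1) b, where ?'i = 'i]
  have tc: "tensor_correlation (coord_space (Inr ` B)) (coord_space (pair_index B :: ('i + nat) set))
      coord_tensor (max_entangled (coord_space (pair_index B)) coord_tensor (card B)
        (\<lambda>m z. if z = (Inr (b m) :: 'i + nat) then 1 else 0))
      (\<lambda>x a. mat_op B (P x a)) (\<lambda>y b. mat_op B (Q y b)) p"
    unfolding me(2) by (rule diagonal_correlation(1)[OF w])
  show "p \<in> {p. \<exists>(H :: ('i + nat \<Rightarrow> complex) hilbert) (K :: ('i + nat \<Rightarrow> complex) hilbert) t d e P Q.
      hilbert_tensor H K t \<and> 0 < d \<and> orthonormal_basis H d e \<and>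
      tensor_correlation H K t (max_entangled K t d e) P Q p}"
    unfolding mem_Collect_eq using hilbert_tensor_coord[OF B(1)] B(2) me(1) tc by blast
qed

lemma (in tensor_square) max_entangled_unit:
  assumes e: "orthonormal_basis H d e" and d: "0 < d"
  shows "max_entangled K t d e \<in> carrier K" "hnorm K (max_entangled K t d e) = 1"
proof -
  have ec: "e i \<in> carrier H" if "i < d" for i using e that unfolding orthonormal_basis_def by blast
  have on: "ip H (e i) (e j) = (if i = j then 1 else 0)" if "i < d" "j < d" for i j
    using e that unfolding orthonormal_basis_def by blast
  let ?S = "\<Oplus>\<^bsub>K\<^esub>i\<in>{..<d}. t (e i) (e i)"
  have S: "?S \<in> carrier K" using ec by simp
  then show "max_entangled K t d e \<in> carrier K" unfolding max_entangled_def by simp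
  have "ip K ?S ?S = (\<Sum>i<d. \<Sum>j<d. ip K (t (e j) (e j)) (t (e i) (e i)))"
    using ec S by (subst K.g_sum) (auto intro!: sum.cong K.g_sum_left)
  also have "\<dots> = (\<Sum>i<d. \<Sum>j<d. if j = i then 1 else 0)"
    using ec on by (intro sum.cong refl) (simp add: ip_t)
  also have "\<dots> = of_nat d" by simp
  finally have "(K.nrm ?S)\<^sup>2 = real d" using S by (simp add: K.nrm_sq)
  then have "K.nrm ?S = sqrt (real d)" using K.nrm_nonneg[OF S] by (metis real_sqrt_unique)
  then show "hnorm K (max_entangled K t d e) = 1"
    unfolding max_entangled_def K.hnorm_nrm using K.nrm_smult[OF S] d by (simp add: norm_divide)
qed

lemma tensor_correlation_nonneg:
  assumes "hilbert_tensor H K t" "\<xi> \<in> carrier K" "tensor_correlation H K t \<xi> P Q p"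
  shows "0 \<le> p $ (x, y, a, b)"
proof -
  interpret tensor_square H K t
    using assms(1) by (auto simp: tensor_square_def tensor_square_axioms_def hilbert_tensor_def)
  obtain T where T: "op_tensor H K t (P x a) (Q y b) T"
    "complex_of_real (p $ (x, y, a, b)) = ip K \<xi> (T \<xi>)"
    using assms(3) unfolding tensor_correlation_def by blast
  have "projection H (P x a)" "projection H (Q y b)"
    using assms(3) unfolding tensor_correlation_def pvm_def by blast+
  from op_ip[OF this T(1) assms(2)] have "p $ (x, y, a, b) = (K.nrm (T \<xi>))\<^sup>2"
    using T(2) by (metis of_real_eq_iff)
  then show ?thesis by simp
qed

text \<open>
  A convex combination of non-negative numbers with positive coefficients vanishes only if
  each of them does.  So the property \<open>N\<close> is stable under convex combinations, and it suffices to
  check it for a single maximally entangled strategy, which belongs to \<open>C_qs\<close>.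
\<close>

theorem perfect_C_qm_in_hull:
  fixes lam :: "'x::finite \<Rightarrow> 'y::finite \<Rightarrow> 'a::finite \<Rightarrow> 'b::finite \<Rightarrow> nat"
  assumes game: "imitation_game lam" and p: "p \<in> perfect lam (C_qm TYPE('v))"
  shows "p \<in> convex hull tracial_correlations"
proof -
  define Z where "Z = {q :: real ^ ('x \<times> 'y \<times> 'a \<times> 'b). \<forall>x y a b. lam x y a b = 0 \<longrightarrow> q $ (x, y, a, b) = 0}"
  define N where "N = {q :: real ^ ('x \<times> 'y \<times> 'a \<times> 'b). (\<forall>i. 0 \<le> q $ i) \<and>
    (q \<in> Z \<longrightarrow> q \<in> convex hull tracial_correlations)}"
  have "C_qm TYPE('v) \<subseteq> N"
    unfolding C_qm_def
  proof (rule hull_minimal)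
    show "convex N"
    proof (rule convexI)
      fix q r :: "real ^ ('x \<times> 'y \<times> 'a \<times> 'b)" and u v :: real
      assume q: "q \<in> N" and r: "r \<in> N" and uv: "0 \<le> u" "0 \<le> v" "u + v = 1"
      have nonneg: "0 \<le> q $ i" "0 \<le> r $ i" for i using q r unfolding N_def by blast+
      show "u *\<^sub>R q + v *\<^sub>R r \<in> N"
      proof (cases "u = 0 \<or> v = 0")
        case True
        then show ?thesis using q r uv by auto
      next
        case False
        then have pos: "0 < u" "0 < v" using uv by auto
        have "u *\<^sub>R q + v *\<^sub>R r \<in> convex hull tracial_correlations" if Z: "u *\<^sub>R q + v *\<^sub>R r \<in> Z"
        proof -
          have "q $ (x, y, a, b) = 0 \<and> r $ (x, y, a, b) = 0" if "lam x y a b = 0" for x y a b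
          proof -
            have "u * q $ (x, y, a, b) + v * r $ (x, y, a, b) = 0" using Z that by (simp add: Z_def)
            moreover have "0 \<le> u * q $ (x, y, a, b)" "0 \<le> v * r $ (x, y, a, b)"
              using nonneg pos by (simp_all add: less_imp_le)
            ultimately have "u * q $ (x, y, a, b) = 0" "v * r $ (x, y, a, b) = 0" by linarith+
            then show ?thesis using pos by simp
          qed
          then have "q \<in> Z" "r \<in> Z" by (auto simp: Z_def)
          then have "q \<in> convex hull tracial_correlations" "r \<in> convex hull tracial_correlations"
            using q r unfolding N_def by blast+
          then show ?thesis by (rule convexD[OF convex_convex_hull _ _ uv])
        qed
        then show ?thesis using nonneg uv by (simp add: N_def)
      qed
    qed
    show "{p. \<exists>(H :: 'v hilbert) (K :: 'v hilbert) t d e P Q. hilbert_tensor H K t \<and>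
        0 < d \<and> orthonormal_basis H d e \<and> tensor_correlation H K t (max_entangled K t d e) P Q p} \<subseteq> N"
    proof (rule subsetI, unfold mem_Collect_eq, elim exE conjE)
      fix q :: "real ^ ('x \<times> 'y \<times> 'a \<times> 'b)" and H K :: "'v hilbert" and t d e P Q
      assume t: "hilbert_tensor H K t" and d: "0 < d" and e: "orthonormal_basis H d e"
        and cor: "tensor_correlation H K t (max_entangled K t d e) P Q q"
      interpret tensor_square H K t
        using t by (auto simp: tensor_square_def tensor_square_axioms_def hilbert_tensor_def)
      note unit = max_entangled_unit[OF e d]
      have "q \<in> C_qs TYPE('v)" unfolding C_qs_def mem_Collect_eq using t unit cor by blast
      then have "q \<in> convex hull tracial_correlations" if "q \<in> Z"
        using that perfect_C_qs_in_hull[OF game, of q] by (auto simp: perfect_def Z_def)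
      moreover have "0 \<le> q $ i" for i
        using tensor_correlation_nonneg[OF t unit(1) cor] by (cases i) auto
      ultimately show "q \<in> N" by (simp add: N_def)
    qed
  qed
  then show ?thesis using p unfolding perfect_def N_def Z_def by blast
qed

section \<open>The free algebra and its C*-seminorms\<close>

lemma free_induct [case_names zero single add]:
  fixes f :: "'g free_alg"
  assumes zero: "P 0" and single: "\<And>w c. P (Poly_Mapping.single w c)"
    and add: "\<And>f h. P f \<Longrightarrow> P h \<Longrightarrow> P (f + h)"
  shows "P f"
proof (induction f rule: update_induct)
  case (update f k v)
  have "Poly_Mapping.update k v f = f + Poly_Mapping.single k v"
    using update(1) by (intro poly_mapping_eqI)
      (auto simp: lookup_update lookup_add lookup_single when_def in_keys_iff)
  then show ?case using add update single by simp
qed (use zero in simp)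

lemma lookup_free_star: "Poly_Mapping.lookup (free_star f) w = cnj (Poly_Mapping.lookup f (Word (rev (letters w))))"
proof -
  have inj: "inj (\<lambda>w :: 'g word. Word (rev (letters w)))"
    by (rule injI) (metis rev_rev_ident word.collapse word.inject)
  then show ?thesis
    by (simp add: free_star_def map_key.rep_eq[OF inj] map.rep_eq when_def)
qed

lemma lookup_free_smult: "Poly_Mapping.lookup (free_smult c f) w = c * Poly_Mapping.lookup f w"
  by (simp add: free_smult_def map.rep_eq when_def)

lemma free_smult_mult: "free_smult c f = Poly_Mapping.single 0 c * f"
  unfolding free_smult_def by (rule mult_map_scale_conv_mult)

lemma free_star_add: "free_star (f + h) = free_star f + free_star h"
  by (intro poly_mapping_eqI) (simp add: lookup_free_star lookup_add)

lemma free_star_diff: "free_star (f - h) = free_star f - free_star h"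
  by (intro poly_mapping_eqI) (simp add: lookup_free_star lookup_minus)

lemma free_star_zero [simp]: "free_star 0 = 0"
  by (intro poly_mapping_eqI) (simp add: lookup_free_star)

lemma free_star_star [simp]: "free_star (free_star f) = f"
  by (intro poly_mapping_eqI) (simp add: lookup_free_star)

lemma free_star_single:
  "free_star (Poly_Mapping.single w c) = Poly_Mapping.single (Word (rev (letters w))) (cnj c)"
proof (rule poly_mapping_eqI)
  fix v :: "'a word"
  have "w = Word (rev (letters v)) \<longleftrightarrow> Word (rev (letters w)) = v"
    by (metis rev_rev_ident word.collapse word.inject word.sel)
  then show "Poly_Mapping.lookup (free_star (Poly_Mapping.single w c)) v =
      Poly_Mapping.lookup (Poly_Mapping.single (Word (rev (letters w))) (cnj c)) v"
    by (simp add: lookup_free_star lookup_single when_def)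
qed

lemma free_star_gen [simp]: "free_star (gen g) = gen g"
  by (simp add: gen_def free_star_single)

lemma free_smult_add: "free_smult c (f + h) = free_smult c f + free_smult c h"
  by (simp add: free_smult_mult distrib_left)

lemma free_smult_diff: "free_smult c (f - h) = free_smult c f - free_smult c h"
  by (simp add: free_smult_mult right_diff_distrib)

lemma free_smult_0 [simp]: "free_smult 0 f = 0"
  by (simp add: free_smult_mult)

lemma free_smult_minus: "free_smult (- 1) f = - f"
  by (intro poly_mapping_eqI) (simp add: lookup_free_smult)

lemma seminorm_facts:
  assumes s: "cstar_seminorm s"
  shows "s 0 = 0" "s (- f) = s f" "0 \<le> s f" "s (f - h) \<le> s f + s h" "s (free_star f) = s f" "s 1 \<le> 1"
proof -
  have add: "s (f + h) \<le> s f + s h" and smult: "s (free_smult c f) = cmod c * s f"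
    and mult: "s (f * h) \<le> s f * s h" and cid: "s (free_star f * f) = (s f)\<^sup>2" for f h c
    using s unfolding cstar_seminorm_def by blast+
  show z: "s 0 = 0" using smult[of 0 0] by simp
  show m: "s (- f) = s f" for f using smult[of "-1" f] by (simp add: free_smult_minus)
  show nn: "0 \<le> s f" for f using add[of f "- f"] z m[of f] by simp
  show "s (f - h) \<le> s f + s h" using add[of f "- h"] m[of h] by simp
  have le: "s f \<le> s (free_star f)" for f
  proof (cases "s f = 0")
    case False
    then have "0 < s f" using nn[of f] by simp
    moreover have "s f * s f \<le> s (free_star f) * s f"
      using cid[of f] mult[of "free_star f" f] by (simp add: power2_eq_square)
    ultimately show ?thesis by (simp add: mult_le_cancel_right)
  qed (use nn in simp)
  show "s (free_star f) = s f" using le[of f] le[of "free_star f"] by simp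
  have "free_star (1 :: 'a free_alg) = 1"
    by (intro poly_mapping_eqI) (auto simp: lookup_free_star lookup_one when_def zero_word_def word.expand)
  then have "s 1 = (s 1)\<^sup>2" using cid[of 1] by simp
  then have "s 1 * (s 1 - 1) = 0" by (simp add: power2_eq_square algebra_simps)
  then show "s 1 \<le> 1" by auto
qed

definition game_seminorms :: "('x::finite \<Rightarrow> 'y::finite \<Rightarrow> 'a::finite \<Rightarrow> 'b::finite \<Rightarrow> nat) \<Rightarrow>
   (('x, 'y, 'a, 'b) generator free_alg \<Rightarrow> real) set" where
  "game_seminorms lam = {s. cstar_seminorm s \<and> (\<forall>r\<in>game_relators lam. s r = 0)}"

text \<open>
  A self-adjoint idempotent \<open>g\<close> satisfies \<open>(s g)\<^sup>2 = s (g * g) = s g\<close>.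
\<close>

lemma seminorm_gen_le_1:
  assumes "s \<in> game_seminorms lam"
  shows "s (gen g) \<le> 1"
proof -
  have s: "cstar_seminorm s" using assms by (simp add: game_seminorms_def)
  have "gen g * gen g - gen g \<in> game_relators lam" unfolding game_relators_def by blast
  then have 0: "s (gen g * gen g - gen g) = 0" using assms by (simp add: game_seminorms_def)
  have "(s (gen g))\<^sup>2 = s (gen g * gen g)"
    using s free_star_gen[of g] unfolding cstar_seminorm_def by metis
  also have "\<dots> \<le> s (gen g * gen g - gen g) + s (gen g)"
    using s unfolding cstar_seminorm_def by (metis diff_add_cancel)
  finally have "s (gen g) * s (gen g) \<le> 1 * s (gen g)" using 0 by (simp add: power2_eq_square)
  then show ?thesis
    using seminorm_facts(3)[OF s, of "gen g"] by (cases "s (gen g) = 0") (auto simp: mult_le_cancel_right)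
qed

text \<open>
  Words are products of generators, so \<open>s f\<close> is at most the sum of the moduli of the coefficients
  of \<open>f\<close>.  This bound gives the supremum that defines \<open>game_seminorm\<close> its meaning.
\<close>

lemma seminorm_bounded:
  fixes f :: "('x::finite, 'y::finite, 'a::finite, 'b::finite) generator free_alg"
  shows "\<exists>C. \<forall>s\<in>game_seminorms lam. s f \<le> C"
proof (induction f rule: free_induct)
  case zero
  show ?case by (intro exI[of _ 0]) (auto simp: game_seminorms_def seminorm_facts(1))
next
  case (single w c)
  have word: "s (Poly_Mapping.single (Word gs) 1) \<le> 1" if s: "s \<in> game_seminorms lam"
    for s and gs :: "('x, 'y, 'a, 'b) generator list"
  proof (induction gs)
    case Nil
    then show ?case using seminorm_facts(6)[of s] s by (simp add: game_seminorms_def zero_word_def[symmetric])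
  next
    case (Cons g gs)
    have "Poly_Mapping.single (Word (g # gs)) 1 = gen g * Poly_Mapping.single (Word gs) (1::complex)"
      by (simp add: gen_def mult_single plus_word_def)
    then have "s (Poly_Mapping.single (Word (g # gs)) 1) \<le> s (gen g) * s (Poly_Mapping.single (Word gs) 1)"
      using s by (simp add: game_seminorms_def cstar_seminorm_def)
    also have "\<dots> \<le> 1 * 1"
      using Cons seminorm_gen_le_1[OF s] seminorm_facts(3)[of s] s
      by (intro mult_mono) (auto simp: game_seminorms_def)
    finally show ?case by simp
  qed
  have "s (Poly_Mapping.single w c) \<le> cmod c" if s: "s \<in> game_seminorms lam" for s
  proof -
    have "Poly_Mapping.single w c = free_smult c (Poly_Mapping.single w 1)"
      by (simp add: free_smult_mult mult_single)
    then have "s (Poly_Mapping.single w c) = cmod c * s (Poly_Mapping.single w 1)"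
      using s by (simp add: game_seminorms_def cstar_seminorm_def)
    also have "\<dots> \<le> cmod c * 1"
      using word[OF s, of "letters w"] by (intro mult_left_mono) auto
    finally show ?thesis by simp
  qed
  then show ?case by blast
next
  case (add f h)
  then obtain C D where "\<forall>s\<in>game_seminorms lam. s f \<le> C" "\<forall>s\<in>game_seminorms lam. s h \<le> D" by blast
  moreover have "s (f + h) \<le> s f + s h" if "s \<in> game_seminorms lam" for s
    using that by (simp add: game_seminorms_def cstar_seminorm_def)
  ultimately show ?case by (intro exI[of _ "C + D"]) (smt (verit))
qed

lemma game_seminorm_SUP: "game_seminorm lam f = (SUP s\<in>game_seminorms lam. s f)"
  by (simp add: game_seminorm_def game_seminorms_def)

lemma zero_in_game_seminorms: "(\<lambda>_. 0) \<in> game_seminorms lam"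
  by (simp add: game_seminorms_def cstar_seminorm_def)

lemma game_seminorm_upper:
  assumes "s \<in> game_seminorms lam"
  shows "s f \<le> game_seminorm lam f"
proof -
  obtain C where "\<forall>s\<in>game_seminorms lam. s f \<le> C" using seminorm_bounded by blast
  then have "bdd_above ((\<lambda>s. s f) ` game_seminorms lam)" by (intro bdd_aboveI[of _ C]) auto
  then show ?thesis unfolding game_seminorm_SUP using assms by (intro cSUP_upper)
qed

lemma game_seminorm_least:
  assumes "\<And>s. s \<in> game_seminorms lam \<Longrightarrow> s f \<le> C"
  shows "game_seminorm lam f \<le> C"
  unfolding game_seminorm_SUP using zero_in_game_seminorms assms by (intro cSUP_least) auto

lemma game_seminorm_nonneg: "0 \<le> game_seminorm lam f"
  using game_seminorm_upper[OF zero_in_game_seminorms] .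

lemma game_seminorm_cstar: "s \<in> game_seminorms lam \<Longrightarrow> cstar_seminorm s"
  by (simp add: game_seminorms_def)

lemma game_seminorm_add: "game_seminorm lam (f + h) \<le> game_seminorm lam f + game_seminorm lam h"
proof (rule game_seminorm_least)
  fix s assume s: "s \<in> game_seminorms lam"
  then have "s (f + h) \<le> s f + s h" by (simp add: game_seminorms_def cstar_seminorm_def)
  then show "s (f + h) \<le> game_seminorm lam f + game_seminorm lam h"
    using game_seminorm_upper[OF s, of f] game_seminorm_upper[OF s, of h] by linarith
qed

lemma game_seminorm_mult: "game_seminorm lam (f * h) \<le> game_seminorm lam f * game_seminorm lam h"
proof (rule game_seminorm_least)
  fix s assume s: "s \<in> game_seminorms lam"
  then have "s (f * h) \<le> s f * s h" by (simp add: game_seminorms_def cstar_seminorm_def)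
  also have "\<dots> \<le> game_seminorm lam f * game_seminorm lam h"
    using s by (intro mult_mono game_seminorm_upper game_seminorm_nonneg
        seminorm_facts(3)[OF game_seminorm_cstar])
  finally show "s (f * h) \<le> game_seminorm lam f * game_seminorm lam h" .
qed

lemma game_seminorm_smult: "game_seminorm lam (free_smult c f) \<le> cmod c * game_seminorm lam f"
proof (rule game_seminorm_least)
  fix s assume s: "s \<in> game_seminorms lam"
  then have "s (free_smult c f) = cmod c * s f" by (simp add: game_seminorms_def cstar_seminorm_def)
  also have "\<dots> \<le> cmod c * game_seminorm lam f"
    using s by (intro mult_left_mono game_seminorm_upper) auto
  finally show "s (free_smult c f) \<le> cmod c * game_seminorm lam f" .
qed

lemma game_seminorm_star: "game_seminorm lam (free_star f) \<le> game_seminorm lam f"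
proof (rule game_seminorm_least)
  fix s assume s: "s \<in> game_seminorms lam"
  then show "s (free_star f) \<le> game_seminorm lam f"
    unfolding seminorm_facts(5)[OF game_seminorm_cstar[OF s]] by (rule game_seminorm_upper)
qed

lemma game_seminorm_zero [simp]: "game_seminorm lam 0 = 0"
proof (rule antisym[OF game_seminorm_least game_seminorm_nonneg])
  fix s assume "s \<in> game_seminorms lam"
  then show "s 0 \<le> 0" using seminorm_facts(1)[OF game_seminorm_cstar] by fastforce
qed

lemma game_seminorm_minus: "game_seminorm lam (f - h) = game_seminorm lam (h - f)"
  using game_seminorm_smult[of lam "-1" "f - h"] game_seminorm_smult[of lam "-1" "h - f"]
  by (simp add: free_smult_minus)

lemma game_seminorm_relator: "r \<in> game_relators lam \<Longrightarrow> game_seminorm lam r = 0"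
  using game_seminorm_least[of lam r 0] game_seminorm_nonneg[of lam r]
  by (fastforce simp: game_seminorms_def)

section \<open>The completion of the free algebra\<close>

lemma game_cauchyD:
  "F \<in> game_cauchy lam \<Longrightarrow> 0 < \<epsilon> \<Longrightarrow> \<exists>N. \<forall>m\<ge>N. \<forall>n\<ge>N. game_seminorm lam (F m - F n) < \<epsilon>"
  by (simp add: game_cauchy_def)

lemma game_cauchy_const: "(\<lambda>_. f) \<in> game_cauchy lam"
  by (simp add: game_cauchy_def)

lemma game_cauchy_bounded:
  assumes "F \<in> game_cauchy lam"
  obtains C where "0 < C" "\<And>n. game_seminorm lam (F n) \<le> C"
proof -
  obtain N where N: "\<And>n. n \<ge> N \<Longrightarrow> game_seminorm lam (F n - F N) < 1"
    using game_cauchyD[OF assms, of 1] by auto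
  define C where "C = (\<Sum>n\<le>N. game_seminorm lam (F n)) + 1"
  have "game_seminorm lam (F n) \<le> C" for n
  proof (cases "n \<le> N")
    case True
    then have "game_seminorm lam (F n) \<le> (\<Sum>n\<le>N. game_seminorm lam (F n))"
      by (intro member_le_sum) (auto simp: game_seminorm_nonneg)
    then show ?thesis by (simp add: C_def)
  next
    case False
    have "game_seminorm lam (F n) \<le> game_seminorm lam (F n - F N) + game_seminorm lam (F N)"
      using game_seminorm_add[of lam "F n - F N" "F N"] by simp
    moreover have "game_seminorm lam (F N) \<le> (\<Sum>n\<le>N. game_seminorm lam (F n))"
      by (intro member_le_sum) (auto simp: game_seminorm_nonneg)
    ultimately show ?thesis using N[of n] False by (simp add: C_def)
  qed
  moreover have "0 < C" unfolding C_def by (simp add: add_nonneg_pos sum_nonneg game_seminorm_nonneg)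
  ultimately show thesis using that by blast
qed

lemma game_cauchyI:
  assumes "F \<in> game_cauchy lam" "G \<in> game_cauchy lam" "0 < C" "0 < D"
    and "\<And>m n. game_seminorm lam (E m - E n) \<le>
       C * game_seminorm lam (F m - F n) + D * game_seminorm lam (G m - G n)"
  shows "E \<in> game_cauchy lam"
  unfolding game_cauchy_def mem_Collect_eq
proof (intro allI impI)
  fix \<epsilon> :: real assume "0 < \<epsilon>"
  then have "0 < \<epsilon> / (2 * C)" "0 < \<epsilon> / (2 * D)" using assms by auto
  with game_cauchyD[OF assms(1)] game_cauchyD[OF assms(2)] obtain M N where
    M: "\<And>m n. m \<ge> M \<Longrightarrow> n \<ge> M \<Longrightarrow> game_seminorm lam (F m - F n) < \<epsilon> / (2 * C)" and
    N: "\<And>m n. m \<ge> N \<Longrightarrow> n \<ge> N \<Longrightarrow> game_seminorm lam (G m - G n) < \<epsilon> / (2 * D)" by metis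
  have "game_seminorm lam (E m - E n) < \<epsilon>" if "m \<ge> max M N" "n \<ge> max M N" for m n
  proof -
    have "C * game_seminorm lam (F m - F n) < \<epsilon> / 2" "D * game_seminorm lam (G m - G n) < \<epsilon> / 2"
      using M[of m n] N[of m n] that assms(3,4) by (simp_all add: pos_less_divide_eq mult_ac)
    then show ?thesis using assms(5)[of m n] by linarith
  qed
  then show "\<exists>N. \<forall>m\<ge>N. \<forall>n\<ge>N. game_seminorm lam (E m - E n) < \<epsilon>" by blast
qed

lemma game_seminorm_mult_diff:
  "game_seminorm lam (f * g - f' * g') \<le>
     game_seminorm lam g * game_seminorm lam (f - f') + game_seminorm lam f' * game_seminorm lam (g - g')"
proof -
  have "f * g - f' * g' = (f - f') * g + f' * (g - g')" by (simp add: algebra_simps)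
  then have "game_seminorm lam (f * g - f' * g') \<le>
      game_seminorm lam ((f - f') * g) + game_seminorm lam (f' * (g - g'))"
    using game_seminorm_add by metis
  also have "\<dots> \<le> game_seminorm lam (f - f') * game_seminorm lam g + game_seminorm lam f' * game_seminorm lam (g - g')"
    by (intro add_mono game_seminorm_mult)
  finally show ?thesis by (simp add: mult.commute)
qed

lemma game_cauchy_add:
  assumes "F \<in> game_cauchy lam" "G \<in> game_cauchy lam"
  shows "(\<lambda>n. F n + G n) \<in> game_cauchy lam"
proof (rule game_cauchyI[OF assms, of 1 1])
  fix m n
  have "F m + G m - (F n + G n) = (F m - F n) + (G m - G n)" by simp
  then show "game_seminorm lam (F m + G m - (F n + G n)) \<le>
      1 * game_seminorm lam (F m - F n) + 1 * game_seminorm lam (G m - G n)"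
    using game_seminorm_add[of lam "F m - F n" "G m - G n"] by (simp only: mult_1)
qed simp_all

lemma game_cauchy_mult:
  assumes "F \<in> game_cauchy lam" "G \<in> game_cauchy lam"
  shows "(\<lambda>n. F n * G n) \<in> game_cauchy lam"
proof -
  obtain C D where C: "0 < C" "\<And>n. game_seminorm lam (F n) \<le> C" and
    D: "0 < D" "\<And>n. game_seminorm lam (G n) \<le> D"
    using game_cauchy_bounded[OF assms(1)] game_cauchy_bounded[OF assms(2)] by metis
  show ?thesis
  proof (rule game_cauchyI[OF assms D(1) C(1)])
    show "game_seminorm lam (F m * G m - F n * G n) \<le>
        D * game_seminorm lam (F m - F n) + C * game_seminorm lam (G m - G n)" for m n
      by (rule order_trans[OF game_seminorm_mult_diff add_mono])
        (intro mult_right_mono C D game_seminorm_nonneg)+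
  qed
qed

lemma game_cauchy_smult:
  assumes "F \<in> game_cauchy lam"
  shows "(\<lambda>n. free_smult c (F n)) \<in> game_cauchy lam"
proof (rule game_cauchyI[OF assms assms, of "cmod c + 1" 1])
  show "game_seminorm lam (free_smult c (F m) - free_smult c (F n)) \<le>
      (cmod c + 1) * game_seminorm lam (F m - F n) + 1 * game_seminorm lam (F m - F n)" for m n
    using game_seminorm_smult[of lam c "F m - F n"] game_seminorm_nonneg[of lam "F m - F n"]
    by (simp add: free_smult_diff distrib_right)
qed (simp_all add: add_nonneg_pos)

lemma game_cauchy_star:
  assumes "F \<in> game_cauchy lam"
  shows "(\<lambda>n. free_star (F n)) \<in> game_cauchy lam"
proof (rule game_cauchyI[OF assms assms, of 1 1])
  show "game_seminorm lam (free_star (F m) - free_star (F n)) \<le>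
      1 * game_seminorm lam (F m - F n) + 1 * game_seminorm lam (F m - F n)" for m n
    using game_seminorm_star[of lam "F m - F n"] game_seminorm_nonneg[of lam "F m - F n"]
    by (simp add: free_star_diff)
qed simp_all

lemma game_relI:
  assumes "F \<in> game_cauchy lam" "F' \<in> game_cauchy lam"
    and "\<And>n. game_seminorm lam (F n - F' n) \<le> e n" "e \<longlonglongrightarrow> 0"
  shows "(F, F') \<in> game_rel lam"
proof -
  have "(\<lambda>n. game_seminorm lam (F n - F' n)) \<longlonglongrightarrow> 0"
    by (rule tendsto_sandwich[OF _ _ tendsto_const assms(4)])
      (use assms(3) in \<open>simp_all add: game_seminorm_nonneg\<close>)
  then show ?thesis using assms(1,2) by (simp add: game_rel_def)
qed

lemma equiv_game_rel: "equiv (game_cauchy lam) (game_rel lam)"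
proof (rule equivI)
  show "game_rel lam \<subseteq> game_cauchy lam \<times> game_cauchy lam" by (auto simp: game_rel_def)
  show "refl_on (game_cauchy lam) (game_rel lam)"
    by (auto simp: refl_on_def game_rel_def)
  show "sym (game_rel lam)"
    unfolding sym_def game_rel_def using game_seminorm_minus[of lam] by auto
  show "trans (game_rel lam)"
  proof (rule transI)
    fix F G E assume FG: "(F, G) \<in> game_rel lam" and GE: "(G, E) \<in> game_rel lam"
    show "(F, E) \<in> game_rel lam"
    proof (rule game_relI)
      show "game_seminorm lam (F n - E n) \<le> game_seminorm lam (F n - G n) + game_seminorm lam (G n - E n)" for n
        using game_seminorm_add[of lam "F n - G n" "G n - E n"] by simp
      show "(\<lambda>n. game_seminorm lam (F n - G n) + game_seminorm lam (G n - E n)) \<longlonglongrightarrow> 0"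
        using FG GE tendsto_add[of _ 0 _ _ 0] unfolding game_rel_def by fastforce
    qed (use FG GE in \<open>auto simp: game_rel_def\<close>)
  qed
qed

definition game_class where
  "game_class lam F = game_rel lam `` {F}"

lemma game_carrier: "carrier (game_cstar lam) = game_class lam ` game_cauchy lam"
  by (auto simp: game_cstar_def game_class_def quotient_def)

lemma game_class_eq_iff:
  assumes "F \<in> game_cauchy lam" "G \<in> game_cauchy lam"
  shows "game_class lam F = game_class lam G \<longleftrightarrow> (F, G) \<in> game_rel lam"
  unfolding game_class_def by (rule eq_equiv_class_iff[OF equiv_game_rel assms])

lemma game_class_self: "F \<in> game_cauchy lam \<Longrightarrow> F \<in> game_class lam F"
  unfolding game_class_def by (rule equiv_class_self[OF equiv_game_rel])

text \<open>
  The operations of \<open>game_cstar\<close> are unions over all representatives.  The next lemmas evaluate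
  them on classes by showing that the choice of representatives does not matter.
\<close>

lemma game_class_add:
  assumes "F \<in> game_cauchy lam" "G \<in> game_cauchy lam"
  shows "game_class lam F \<oplus>\<^bsub>game_cstar lam\<^esub> game_class lam G = game_class lam (\<lambda>n. F n + G n)"
proof -
  have "(\<lambda>F G. game_rel lam `` {\<lambda>n. F n + G n}) respects2 game_rel lam"
  proof (rule congruent2I'[OF _])
    fix F F' G G' assume r: "(F, F') \<in> game_rel lam" "(G, G') \<in> game_rel lam"
    have "((\<lambda>n. F n + G n), (\<lambda>n. F' n + G' n)) \<in> game_rel lam"
    proof (rule game_relI)
      show "game_seminorm lam (F n + G n - (F' n + G' n)) \<le>
          game_seminorm lam (F n - F' n) + game_seminorm lam (G n - G' n)" for n
        using game_seminorm_add[of lam "F n - F' n" "G n - G' n"] by (simp add: algebra_simps)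
      show "(\<lambda>n. game_seminorm lam (F n - F' n) + game_seminorm lam (G n - G' n)) \<longlonglongrightarrow> 0"
        using r tendsto_add[of _ 0 _ _ 0] unfolding game_rel_def by fastforce
    qed (use r in \<open>auto simp: game_rel_def intro: game_cauchy_add\<close>)
    then show "game_rel lam `` {\<lambda>n. F n + G n} = game_rel lam `` {\<lambda>n. F' n + G' n}"
      by (rule equiv_class_eq[OF equiv_game_rel])
  qed
  from UN_equiv_class2[OF equiv_game_rel equiv_game_rel this assms]
  show ?thesis by (simp add: game_cstar_def game_class_def)
qed

lemma game_class_mult:
  assumes "F \<in> game_cauchy lam" "G \<in> game_cauchy lam"
  shows "game_class lam F \<otimes>\<^bsub>game_cstar lam\<^esub> game_class lam G = game_class lam (\<lambda>n. F n * G n)"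
proof -
  have "(\<lambda>F G. game_rel lam `` {\<lambda>n. F n * G n}) respects2 game_rel lam"
  proof (rule congruent2I'[OF _])
    fix F F' G G' assume r: "(F, F') \<in> game_rel lam" "(G, G') \<in> game_rel lam"
    then have c: "F \<in> game_cauchy lam" "F' \<in> game_cauchy lam" "G \<in> game_cauchy lam" "G' \<in> game_cauchy lam"
      by (auto simp: game_rel_def)
    obtain C D where C: "0 < C" "\<And>n. game_seminorm lam (F' n) \<le> C" and
      D: "0 < D" "\<And>n. game_seminorm lam (G n) \<le> D"
      using game_cauchy_bounded[OF c(2)] game_cauchy_bounded[OF c(3)] by metis
    have "((\<lambda>n. F n * G n), (\<lambda>n. F' n * G' n)) \<in> game_rel lam"
    proof (rule game_relI)
      show "game_seminorm lam (F n * G n - F' n * G' n) \<le>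
          D * game_seminorm lam (F n - F' n) + C * game_seminorm lam (G n - G' n)" for n
        by (rule order_trans[OF game_seminorm_mult_diff add_mono])
          (intro mult_right_mono C D game_seminorm_nonneg)+
      have "(\<lambda>n. D * game_seminorm lam (F n - F' n) + C * game_seminorm lam (G n - G' n)) \<longlonglongrightarrow> D * 0 + C * 0"
        using r unfolding game_rel_def by (intro tendsto_intros) auto
      then show "(\<lambda>n. D * game_seminorm lam (F n - F' n) + C * game_seminorm lam (G n - G' n)) \<longlonglongrightarrow> 0"
        by simp
    qed (intro game_cauchy_mult c)+
    then show "game_rel lam `` {\<lambda>n. F n * G n} = game_rel lam `` {\<lambda>n. F' n * G' n}"
      by (rule equiv_class_eq[OF equiv_game_rel])
  qed
  from UN_equiv_class2[OF equiv_game_rel equiv_game_rel this assms]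
  show ?thesis by (simp add: game_cstar_def game_class_def)
qed

lemma game_class_smult:
  assumes "F \<in> game_cauchy lam"
  shows "c \<odot>\<^bsub>game_cstar lam\<^esub> game_class lam F = game_class lam (\<lambda>n. free_smult c (F n))"
proof -
  have "(\<lambda>F. game_rel lam `` {\<lambda>n. free_smult c (F n)}) respects game_rel lam"
  proof (rule congruentI)
    fix F F' assume r: "(F, F') \<in> game_rel lam"
    have "((\<lambda>n. free_smult c (F n)), (\<lambda>n. free_smult c (F' n))) \<in> game_rel lam"
    proof (rule game_relI)
      show "game_seminorm lam (free_smult c (F n) - free_smult c (F' n)) \<le> cmod c * game_seminorm lam (F n - F' n)" for n
        using game_seminorm_smult[of lam c "F n - F' n"] by (simp add: free_smult_diff)
      have "(\<lambda>n. cmod c * game_seminorm lam (F n - F' n)) \<longlonglongrightarrow> cmod c * 0"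
        using r unfolding game_rel_def by (intro tendsto_intros) auto
      then show "(\<lambda>n. cmod c * game_seminorm lam (F n - F' n)) \<longlonglongrightarrow> 0" by simp
    qed (use r in \<open>auto simp: game_rel_def intro: game_cauchy_smult\<close>)
    then show "game_rel lam `` {\<lambda>n. free_smult c (F n)} = game_rel lam `` {\<lambda>n. free_smult c (F' n)}"
      by (rule equiv_class_eq[OF equiv_game_rel])
  qed
  from UN_equiv_class[OF equiv_game_rel this assms]
  show ?thesis by (simp add: game_cstar_def game_class_def)
qed

lemma game_class_star:
  assumes "F \<in> game_cauchy lam"
  shows "star (game_cstar lam) (game_class lam F) = game_class lam (\<lambda>n. free_star (F n))"
proof -
  have "(\<lambda>F. game_rel lam `` {\<lambda>n. free_star (F n)}) respects game_rel lam"
  proof (rule congruentI)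
    fix F F' assume r: "(F, F') \<in> game_rel lam"
    have "((\<lambda>n. free_star (F n)), (\<lambda>n. free_star (F' n))) \<in> game_rel lam"
    proof (rule game_relI)
      show "game_seminorm lam (free_star (F n) - free_star (F' n)) \<le> game_seminorm lam (F n - F' n)" for n
        using game_seminorm_star[of lam "F n - F' n"] by (simp add: free_star_diff)
    qed (use r in \<open>auto simp: game_rel_def intro: game_cauchy_star\<close>)
    then show "game_rel lam `` {\<lambda>n. free_star (F n)} = game_rel lam `` {\<lambda>n. free_star (F' n)}"
      by (rule equiv_class_eq[OF equiv_game_rel])
  qed
  from UN_equiv_class[OF equiv_game_rel this assms]
  show ?thesis by (simp add: game_cstar_def game_class_def)
qed

lemma game_class_one: "\<one>\<^bsub>game_cstar lam\<^esub> = game_class lam (\<lambda>_. 1)"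
  and game_class_zero: "\<zero>\<^bsub>game_cstar lam\<^esub> = game_class lam (\<lambda>_. 0)"
  and game_gen_class: "game_gen lam g = game_class lam (\<lambda>_. gen g)"
  by (simp_all add: game_cstar_def game_class_def game_gen_def)

section \<open>Algebras of block-diagonal matrices\<close>

definition mat_mult :: "nat set \<Rightarrow> (nat \<Rightarrow> nat \<Rightarrow> complex) \<Rightarrow> (nat \<Rightarrow> nat \<Rightarrow> complex) \<Rightarrow> nat \<Rightarrow> nat \<Rightarrow> complex" where
  "mat_mult B m n i j = (\<Sum>k\<in>B. m i k * n k j)"

definition mat_adj :: "(nat \<Rightarrow> nat \<Rightarrow> complex) \<Rightarrow> nat \<Rightarrow> nat \<Rightarrow> complex" where
  "mat_adj m i j = cnj (m j i)"

definition mat_app :: "nat set \<Rightarrow> (nat \<Rightarrow> nat \<Rightarrow> complex) \<Rightarrow> (nat \<Rightarrow> complex) \<Rightarrow> nat \<Rightarrow> complex" where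
  "mat_app B m v i = (\<Sum>j\<in>B. m i j * v j)"

definition vec_norm :: "nat set \<Rightarrow> (nat \<Rightarrow> complex) \<Rightarrow> real" where
  "vec_norm B v = L2_set (\<lambda>i. cmod (v i)) B"

text \<open>
  The operator norm for the Euclidean norm, the one norm that satisfies the C*-identity.
\<close>

definition mat_norm :: "nat set \<Rightarrow> (nat \<Rightarrow> nat \<Rightarrow> complex) \<Rightarrow> real" where
  "mat_norm B m = (SUP v\<in>{v. vec_norm B v \<le> 1}. vec_norm B (mat_app B m v))"

lemma vec_norm_nonneg [simp]: "0 \<le> vec_norm B v"
  by (simp add: vec_norm_def)

lemma vec_norm_smult: "vec_norm B (\<lambda>i. c * v i) = cmod c * vec_norm B v"
  by (simp add: vec_norm_def norm_mult L2_set_right_distrib)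

lemma vec_norm_add: "vec_norm B (\<lambda>i. u i + v i) \<le> vec_norm B u + vec_norm B v"
proof -
  have "vec_norm B (\<lambda>i. u i + v i) \<le> L2_set (\<lambda>i. cmod (u i) + cmod (v i)) B"
    unfolding vec_norm_def by (intro L2_set_mono norm_triangle_ineq) auto
  also have "\<dots> \<le> vec_norm B u + vec_norm B v"
    unfolding vec_norm_def by (rule L2_set_triangle_ineq)
  finally show ?thesis .
qed

lemma vec_norm_entry: "finite B \<Longrightarrow> i \<in> B \<Longrightarrow> cmod (v i) \<le> vec_norm B v"
  unfolding vec_norm_def using member_le_L2_set[of B i "\<lambda>i. cmod (v i)"] by simp

lemma vec_norm_cong: "(\<And>i. i \<in> B \<Longrightarrow> u i = v i) \<Longrightarrow> vec_norm B u = vec_norm B v"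
  unfolding vec_norm_def by (intro L2_set_cong) auto

lemma mat_app_bound:
  assumes "finite B"
  shows "vec_norm B (mat_app B m v) \<le> (\<Sum>i\<in>B. \<Sum>j\<in>B. cmod (m i j)) * vec_norm B v"
proof -
  have "vec_norm B (mat_app B m v) \<le> (\<Sum>i\<in>B. cmod (mat_app B m v i))"
    unfolding vec_norm_def by (rule L2_set_le_sum) simp
  also have "\<dots> \<le> (\<Sum>i\<in>B. \<Sum>j\<in>B. cmod (m i j) * vec_norm B v)"
  proof (rule sum_mono)
    fix i assume "i \<in> B"
    have "cmod (mat_app B m v i) \<le> (\<Sum>j\<in>B. cmod (m i j * v j))"
      unfolding mat_app_def by (rule norm_sum)
    also have "\<dots> \<le> (\<Sum>j\<in>B. cmod (m i j) * vec_norm B v)"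
      unfolding norm_mult by (intro sum_mono mult_left_mono vec_norm_entry assms) auto
    finally show "cmod (mat_app B m v i) \<le> (\<Sum>j\<in>B. cmod (m i j) * vec_norm B v)" .
  qed
  finally show ?thesis by (simp add: sum_distrib_right)
qed

lemma mat_norm_le:
  assumes "0 \<le> C" "\<And>v. vec_norm B (mat_app B m v) \<le> C * vec_norm B v"
  shows "mat_norm B m \<le> C"
  unfolding mat_norm_def
proof (rule cSUP_least)
  have "vec_norm B (\<lambda>_. 0) \<le> 1" by (simp add: vec_norm_def L2_set_0')
  then show "{v. vec_norm B v \<le> 1} \<noteq> {}" by blast
  fix v assume "v \<in> {v. vec_norm B v \<le> 1}"
  then have "C * vec_norm B v \<le> C * 1" using assms(1) by (intro mult_left_mono) auto
  then show "vec_norm B (mat_app B m v) \<le> C" using assms(2)[of v] by linarith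
qed

lemma mat_norm_upper:
  assumes "finite B" "vec_norm B v \<le> 1"
  shows "vec_norm B (mat_app B m v) \<le> mat_norm B m"
  unfolding mat_norm_def
proof (rule cSUP_upper)
  show "bdd_above ((\<lambda>v. vec_norm B (mat_app B m v)) ` {v. vec_norm B v \<le> 1})"
  proof (rule bdd_aboveI2)
    fix v assume "v \<in> {v. vec_norm B v \<le> 1}"
    then have "(\<Sum>i\<in>B. \<Sum>j\<in>B. cmod (m i j)) * vec_norm B v \<le> (\<Sum>i\<in>B. \<Sum>j\<in>B. cmod (m i j)) * 1"
      by (intro mult_left_mono sum_nonneg) auto
    then show "vec_norm B (mat_app B m v) \<le> (\<Sum>i\<in>B. \<Sum>j\<in>B. cmod (m i j))"
      using mat_app_bound[OF assms(1), of m v] by linarith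
  qed
qed (use assms in simp)

lemma vec_norm_zero [simp]: "vec_norm B (\<lambda>_. 0) = 0"
  by (simp add: vec_norm_def L2_set_0')

lemma mat_norm_nonneg: "finite B \<Longrightarrow> 0 \<le> mat_norm B m"
  by (rule order_trans[OF vec_norm_nonneg mat_norm_upper[of B "\<lambda>_. 0"]]) simp_all

lemma mat_app_norm:
  assumes B: "finite B"
  shows "vec_norm B (mat_app B m v) \<le> mat_norm B m * vec_norm B v"
proof (cases "vec_norm B v = 0")
  case True
  then show ?thesis using mat_app_bound[OF B, of m v] by simp
next
  case False
  define c where "c = vec_norm B v"
  have c: "0 < c" using False by (simp add: c_def order.not_eq_order_implies_strict)
  have "vec_norm B (\<lambda>i. of_real (1 / c) * v i) = 1"
    unfolding vec_norm_smult using c by (simp add: norm_divide c_def)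
  then have "vec_norm B (mat_app B m (\<lambda>i. of_real (1 / c) * v i)) \<le> mat_norm B m"
    by (intro mat_norm_upper B) simp
  also have "mat_app B m (\<lambda>i. of_real (1 / c) * v i) = (\<lambda>i. of_real (1 / c) * mat_app B m v i)"
    by (rule ext) (simp add: mat_app_def sum_distrib_left mult.left_commute del: of_real_divide)
  finally have "vec_norm B (mat_app B m v) / c \<le> mat_norm B m"
    unfolding vec_norm_smult using c by (simp add: norm_divide)
  then show ?thesis using c by (simp add: c_def[symmetric] pos_divide_le_eq)
qed

lemma mat_norm_cong:
  assumes "\<And>i j. i \<in> B \<Longrightarrow> j \<in> B \<Longrightarrow> m i j = n i j"
  shows "mat_norm B m = mat_norm B n"
proof -
  have "vec_norm B (mat_app B m v) = vec_norm B (mat_app B n v)" for v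
    using assms by (intro vec_norm_cong) (simp add: mat_app_def)
  then show ?thesis by (simp add: mat_norm_def)
qed

lemma mat_norm_le_sum: "finite B \<Longrightarrow> mat_norm B m \<le> (\<Sum>i\<in>B. \<Sum>j\<in>B. cmod (m i j))"
  by (intro mat_norm_le mat_app_bound sum_nonneg) auto

lemma mat_norm_entry:
  assumes B: "finite B" and ij: "i \<in> B" "j \<in> B"
  shows "cmod (m i j) \<le> mat_norm B m"
proof -
  define v :: "nat \<Rightarrow> complex" where "v k = (if k = j then 1 else 0)" for k
  have "(\<Sum>k\<in>B. (cmod (v k))\<^sup>2) = (\<Sum>k\<in>B. if k = j then 1 else 0)"
    by (intro sum.cong refl) (simp add: v_def)
  then have v: "vec_norm B v = 1" using B ij by (simp add: vec_norm_def L2_set_def)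
  have "mat_app B m v i = (\<Sum>k\<in>B. if k = j then m i j else 0)"
    unfolding mat_app_def by (intro sum.cong refl) (simp add: v_def)
  then have "mat_app B m v i = m i j" using B ij by simp
  then have "cmod (m i j) \<le> vec_norm B (mat_app B m v)"
    using vec_norm_entry[OF B ij(1), of "mat_app B m v"] by simp
  also have "\<dots> \<le> mat_norm B m" using v by (intro mat_norm_upper B) simp
  finally show ?thesis .
qed

lemma mat_norm_add:
  assumes "finite B"
  shows "mat_norm B (\<lambda>i j. m i j + n i j) \<le> mat_norm B m + mat_norm B n"
proof (rule mat_norm_le)
  fix v
  have "mat_app B (\<lambda>i j. m i j + n i j) v = (\<lambda>i. mat_app B m v i + mat_app B n v i)"
    by (rule ext) (simp add: mat_app_def sum.distrib distrib_right)
  then have "vec_norm B (mat_app B (\<lambda>i j. m i j + n i j) v) \<le> vec_norm B (mat_app B m v) + vec_norm B (mat_app B n v)"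
    using vec_norm_add by metis
  also have "\<dots> \<le> (mat_norm B m + mat_norm B n) * vec_norm B v"
    using mat_app_norm[OF assms, of m v] mat_app_norm[OF assms, of n v] by (simp add: distrib_right)
  finally show "vec_norm B (mat_app B (\<lambda>i j. m i j + n i j) v) \<le> (mat_norm B m + mat_norm B n) * vec_norm B v" .
qed (simp add: mat_norm_nonneg assms)

lemma mat_norm_smult:
  assumes B: "finite B"
  shows "mat_norm B (\<lambda>i j. c * m i j) = cmod c * mat_norm B m"
proof -
  have le: "mat_norm B (\<lambda>i j. c * m i j) \<le> cmod c * mat_norm B m" for c m
  proof (rule mat_norm_le)
    fix v
    have "mat_app B (\<lambda>i j. c * m i j) v = (\<lambda>i. c * mat_app B m v i)"
      by (rule ext) (simp add: mat_app_def sum_distrib_left mult.assoc)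
    then have "vec_norm B (mat_app B (\<lambda>i j. c * m i j) v) = cmod c * vec_norm B (mat_app B m v)"
      by (simp only: vec_norm_smult)
    also have "\<dots> \<le> cmod c * (mat_norm B m * vec_norm B v)"
      by (intro mult_left_mono mat_app_norm B) simp
    finally show "vec_norm B (mat_app B (\<lambda>i j. c * m i j) v) \<le> cmod c * mat_norm B m * vec_norm B v"
      by (simp add: mult.assoc)
  qed (simp add: mat_norm_nonneg B)
  show ?thesis
  proof (cases "c = 0")
    case True
    then show ?thesis using le[of c m] mat_norm_nonneg[OF B, of "\<lambda>i j. c * m i j"] by simp
  next
    case False
    have "mat_norm B m \<le> cmod (1 / c) * mat_norm B (\<lambda>i j. c * m i j)"
      using le[of "1 / c" "\<lambda>i j. c * m i j"] False by simp
    then have "cmod c * mat_norm B m \<le> mat_norm B (\<lambda>i j. c * m i j)"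
      using False by (simp add: norm_divide field_simps)
    then show ?thesis using le[of c m] by simp
  qed
qed

lemma mat_app_mult: "mat_app B (mat_mult B m n) v = mat_app B m (mat_app B n v)"
proof
  fix i
  have "mat_app B (mat_mult B m n) v i = (\<Sum>j\<in>B. \<Sum>k\<in>B. m i k * n k j * v j)"
    by (simp add: mat_app_def mat_mult_def sum_distrib_right)
  also have "\<dots> = (\<Sum>k\<in>B. \<Sum>j\<in>B. m i k * n k j * v j)" by (rule sum.swap)
  also have "\<dots> = mat_app B m (mat_app B n v) i"
    by (simp add: mat_app_def sum_distrib_left mult.assoc)
  finally show "mat_app B (mat_mult B m n) v i = mat_app B m (mat_app B n v) i" .
qed

lemma mat_norm_mult:
  assumes B: "finite B"
  shows "mat_norm B (mat_mult B m n) \<le> mat_norm B m * mat_norm B n"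
proof (rule mat_norm_le)
  fix v
  have "vec_norm B (mat_app B (mat_mult B m n) v) \<le> mat_norm B m * vec_norm B (mat_app B n v)"
    unfolding mat_app_mult by (rule mat_app_norm[OF B])
  also have "\<dots> \<le> mat_norm B m * (mat_norm B n * vec_norm B v)"
    by (intro mult_left_mono mat_app_norm mat_norm_nonneg B)
  finally show "vec_norm B (mat_app B (mat_mult B m n) v) \<le> mat_norm B m * mat_norm B n * vec_norm B v"
    by (simp add: mult.assoc)
qed (simp add: mat_norm_nonneg B)

text \<open>
  The inequality from below is \<open>|m v|\<^sup>2 = \<langle>v, m\<^sup>* m v\<rangle> \<le> |m\<^sup>* m| |v|\<^sup>2\<close>.  It implies \<open>|m| \<le> |m\<^sup>*|\<close>, hence
  equality of these norms, and then the inequality from above is submultiplicativity.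
\<close>

lemma mat_norm_cstar:
  assumes B: "finite B"
  shows "mat_norm B (mat_mult B (mat_adj m) m) = (mat_norm B m)\<^sup>2"
proof -
  have le: "(mat_norm B m)\<^sup>2 \<le> mat_norm B (mat_mult B (mat_adj m) m)" for m
  proof -
    let ?n = "mat_mult B (mat_adj m) m"
    have "vec_norm B (mat_app B m v) \<le> sqrt (mat_norm B ?n) * vec_norm B v" for v
    proof -
      let ?u = "mat_app B m v"
      have "of_real ((vec_norm B ?u)\<^sup>2) = (\<Sum>i\<in>B. cnj (?u i) * ?u i)"
        unfolding vec_norm_def L2_set_def
        by (simp add: sum_nonneg complex_norm_square mult.commute del: of_real_power)
      also have "\<dots> = (\<Sum>i\<in>B. \<Sum>j\<in>B. cnj (v j) * (cnj (m i j) * ?u i))"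
      proof (intro sum.cong refl)
        fix i
        have "cnj (?u i) = (\<Sum>j\<in>B. cnj (v j) * cnj (m i j))"
          by (simp add: mat_app_def mult.commute)
        then show "cnj (?u i) * ?u i = (\<Sum>j\<in>B. cnj (v j) * (cnj (m i j) * ?u i))"
          by (simp only: sum_distrib_right mult.assoc)
      qed
      also have "\<dots> = (\<Sum>j\<in>B. \<Sum>i\<in>B. cnj (v j) * (cnj (m i j) * ?u i))" by (rule sum.swap)
      also have "\<dots> = (\<Sum>j\<in>B. cnj (v j) * mat_app B ?n v j)"
        unfolding mat_app_mult by (simp add: mat_app_def[of B "mat_adj m"] mat_adj_def sum_distrib_left)
      finally have "(vec_norm B ?u)\<^sup>2 = cmod (\<Sum>j\<in>B. cnj (v j) * mat_app B ?n v j)"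
        by (metis abs_of_nonneg norm_of_real zero_le_power2)
      also have "\<dots> \<le> (\<Sum>j\<in>B. cmod (cnj (v j) * mat_app B ?n v j))" by (rule norm_sum)
      also have "\<dots> = (\<Sum>j\<in>B. \<bar>cmod (v j)\<bar> * \<bar>cmod (mat_app B ?n v j)\<bar>)" by (simp add: norm_mult)
      also have "\<dots> \<le> vec_norm B v * vec_norm B (mat_app B ?n v)"
        unfolding vec_norm_def by (rule L2_set_mult_ineq)
      also have "\<dots> \<le> vec_norm B v * (mat_norm B ?n * vec_norm B v)"
        by (intro mult_left_mono mat_app_norm B) simp
      also have "\<dots> = (sqrt (mat_norm B ?n) * vec_norm B v)\<^sup>2"
        by (simp add: power_mult_distrib mat_norm_nonneg B power2_eq_square)
      finally show ?thesis by (rule power2_le_imp_le) (simp add: mat_norm_nonneg B)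
    qed
    then have "mat_norm B m \<le> sqrt (mat_norm B ?n)" by (intro mat_norm_le) (simp_all add: mat_norm_nonneg B)
    then have "(mat_norm B m)\<^sup>2 \<le> (sqrt (mat_norm B ?n))\<^sup>2" by (intro power_mono mat_norm_nonneg B)
    then show ?thesis by (simp add: mat_norm_nonneg B)
  qed
  have adj: "mat_norm B m \<le> mat_norm B (mat_adj m)" for m
  proof (cases "mat_norm B m = 0")
    case False
    then have "0 < mat_norm B m" using mat_norm_nonneg[OF B, of m] by simp
    moreover have "mat_norm B m * mat_norm B m \<le> mat_norm B (mat_adj m) * mat_norm B m"
      using le[of m] mat_norm_mult[OF B, of "mat_adj m" m] by (simp add: power2_eq_square)
    ultimately show ?thesis by (simp add: mult_le_cancel_right)
  qed (simp add: mat_norm_nonneg B)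
  have "mat_adj (mat_adj m) = m" by (simp add: mat_adj_def fun_eq_iff)
  then have "mat_norm B (mat_adj m) = mat_norm B m" using adj[of m] adj[of "mat_adj m"] by simp
  then have "mat_norm B (mat_mult B (mat_adj m) m) \<le> (mat_norm B m)\<^sup>2"
    using mat_norm_mult[OF B, of "mat_adj m" m] by (simp add: power2_eq_square)
  then show ?thesis using le[of m] by simp
qed

text \<open>
  Matrices are stored in the type \<open>'j + nat \<Rightarrow> complex\<close>, with index pairs coded by the right summand.
\<close>

definition entry :: "('j + nat \<Rightarrow> complex) \<Rightarrow> nat \<Rightarrow> nat \<Rightarrow> complex" where
  "entry M i j = M (Inr (prod_encode (i, j)))"

definition of_entries :: "nat set \<Rightarrow> (nat \<Rightarrow> nat \<Rightarrow> complex) \<Rightarrow> 'j + nat \<Rightarrow> complex" where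
  "of_entries B f z = (case z of Inl _ \<Rightarrow> 0 | Inr n \<Rightarrow>
     (case prod_decode n of (i, j) \<Rightarrow> if i \<in> B \<and> j \<in> B then f i j else 0))"

text \<open>
  The commutant of \<open>diag w\<close> in the matrices over \<open>B\<close>.
\<close>

definition block_algebra :: "nat set \<Rightarrow> (nat \<Rightarrow> real) \<Rightarrow> ('j + nat \<Rightarrow> complex) cstar" where
  "block_algebra B w = \<lparr>
     carrier = {of_entries B f | f. \<forall>i\<in>B. \<forall>j\<in>B. w i \<noteq> w j \<longrightarrow> f i j = 0},
     monoid.mult = (\<lambda>M N. of_entries B (mat_mult B (entry M) (entry N))),
     one = of_entries B (\<lambda>i j. if i = j then 1 else 0),
     zero = (\<lambda>_. 0),
     add = (\<lambda>M N z. M z + N z),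
     smult = (\<lambda>c M z. c * M z),
     star = (\<lambda>M. of_entries B (mat_adj (entry M))),
     cnorm = (\<lambda>M. mat_norm B (entry M))\<rparr>"

lemma entry_of_entries [simp]: "i \<in> B \<Longrightarrow> j \<in> B \<Longrightarrow> entry (of_entries B f) i j = f i j"
  by (simp add: entry_def of_entries_def)

lemma mat_norm_of_entries [simp]: "mat_norm B (entry (of_entries B f)) = mat_norm B f"
  by (rule mat_norm_cong) simp

lemma of_entries_cong: "(\<And>i j. i \<in> B \<Longrightarrow> j \<in> B \<Longrightarrow> f i j = h i j) \<Longrightarrow> of_entries B f = of_entries B h"
  by (auto simp: of_entries_def fun_eq_iff split: sum.split prod.split)

lemma block_algebra_simps:
  "M \<otimes>\<^bsub>block_algebra B w\<^esub> N = of_entries B (mat_mult B (entry M) (entry N))"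
  "\<one>\<^bsub>block_algebra B w\<^esub> = of_entries B (\<lambda>i j. if i = j then 1 else 0)"
  "\<zero>\<^bsub>block_algebra B w\<^esub> = (\<lambda>_. 0)"
  "M \<oplus>\<^bsub>block_algebra B w\<^esub> N = (\<lambda>z. M z + N z)"
  "c \<odot>\<^bsub>block_algebra B w\<^esub> M = (\<lambda>z. c * M z)"
  "star (block_algebra B w) M = of_entries B (mat_adj (entry M))"
  "cnorm (block_algebra B w) M = mat_norm B (entry M)"
  by (simp_all add: block_algebra_def)

lemma entry_arith [simp]:
  "entry (\<lambda>z. M z + N z) i j = entry M i j + entry N i j"
  "entry (\<lambda>z. c * M z) i j = c * entry M i j"
  "entry (\<lambda>z. M z - N z) i j = entry M i j - entry N i j"
  "entry (\<lambda>z. - M z) i j = - entry M i j"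
  "entry (\<lambda>z. 0) i j = 0"
  by (simp_all add: entry_def)

lemma entry_fun:
  "entry (\<lambda>z. M z + N z) = (\<lambda>i j. entry M i j + entry N i j)"
  "entry (\<lambda>z. c * M z) = (\<lambda>i j. c * entry M i j)"
  "entry (\<lambda>z. M z - N z) = (\<lambda>i j. entry M i j - entry N i j)"
  by (intro ext, simp)+

lemma block_carrierI:
  "(\<And>i j. i \<in> B \<Longrightarrow> j \<in> B \<Longrightarrow> w i \<noteq> w j \<Longrightarrow> f i j = 0) \<Longrightarrow>
    of_entries B f \<in> carrier (block_algebra B w)"
  unfolding block_algebra_def by auto

lemma block_carrier_entries: "M \<in> carrier (block_algebra B w) \<Longrightarrow> of_entries B (entry M) = M"
  unfolding block_algebra_def by (auto intro: of_entries_cong)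

lemma block_carrier_off:
  "M \<in> carrier (block_algebra B w) \<Longrightarrow> i \<in> B \<Longrightarrow> j \<in> B \<Longrightarrow> w i \<noteq> w j \<Longrightarrow> entry M i j = 0"
  unfolding block_algebra_def by auto

lemma block_eqI:
  fixes M N :: "'j + nat \<Rightarrow> complex"
  assumes "M \<in> carrier (block_algebra B w)" "N \<in> carrier (block_algebra B w)"
    and "\<And>i j. i \<in> B \<Longrightarrow> j \<in> B \<Longrightarrow> entry M i j = entry N i j"
  shows "M = N"
proof -
  have "(of_entries B (entry M) :: 'j + nat \<Rightarrow> complex) = of_entries B (entry N)" by (rule of_entries_cong) (rule assms(3))
  then show ?thesis using assms(1,2) by (simp add: block_carrier_entries)
qed

lemma block_pointwise_in:
  assumes "M \<in> carrier (block_algebra B w)" "N \<in> carrier (block_algebra B w)"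
  shows "(\<lambda>z. c * M z + d * N z) \<in> carrier (block_algebra B w)"
proof -
  obtain f h where M: "M = of_entries B f" and f: "\<forall>i\<in>B. \<forall>j\<in>B. w i \<noteq> w j \<longrightarrow> f i j = 0"
    and N: "N = of_entries B h" and h: "\<forall>i\<in>B. \<forall>j\<in>B. w i \<noteq> w j \<longrightarrow> h i j = 0"
    using assms unfolding block_algebra_def by auto
  have "(\<lambda>z. c * M z + d * N z) = of_entries B (\<lambda>i j. c * f i j + d * h i j)"
    unfolding M N by (auto simp: of_entries_def fun_eq_iff split: sum.split prod.split)
  then show ?thesis using f h by (simp add: block_carrierI)
qed

lemma block_closed:
  fixes M N :: "'j + nat \<Rightarrow> complex"
  assumes "M \<in> carrier (block_algebra B w)"
  shows "(\<lambda>z. c * M z) \<in> carrier (block_algebra B w)"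
    "of_entries B (mat_adj (entry M)) \<in> carrier (block_algebra B w :: ('j + nat \<Rightarrow> complex) cstar)"
    "N \<in> carrier (block_algebra B w) \<Longrightarrow> (\<lambda>z. M z + N z) \<in> carrier (block_algebra B w)"
    "N \<in> carrier (block_algebra B w) \<Longrightarrow> (\<lambda>z. M z - N z) \<in> carrier (block_algebra B w)"
    "N \<in> carrier (block_algebra B w) \<Longrightarrow>
      of_entries B (mat_mult B (entry M) (entry N)) \<in> carrier (block_algebra B w :: ('j + nat \<Rightarrow> complex) cstar)"
proof -
  show "(\<lambda>z. c * M z) \<in> carrier (block_algebra B w)"
    using block_pointwise_in[OF assms assms, of c 0] by simp
  show "of_entries B (mat_adj (entry M)) \<in> carrier (block_algebra B w :: ('j + nat \<Rightarrow> complex) cstar)"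
    using block_carrier_off[OF assms] by (intro block_carrierI) (simp add: mat_adj_def)
  assume N: "N \<in> carrier (block_algebra B w)"
  show "(\<lambda>z. M z + N z) \<in> carrier (block_algebra B w)"
    using block_pointwise_in[OF assms N, of 1 1] by simp
  show "(\<lambda>z. M z - N z) \<in> carrier (block_algebra B w)"
    using block_pointwise_in[OF assms N, of 1 "-1"] by simp
  show "of_entries B (mat_mult B (entry M) (entry N)) \<in> carrier (block_algebra B w :: ('j + nat \<Rightarrow> complex) cstar)"
  proof (rule block_carrierI)
    fix i j assume ij: "i \<in> B" "j \<in> B" "w i \<noteq> w j"
    have "entry M i k * entry N k j = 0" if "k \<in> B" for k
      using block_carrier_off[OF assms ij(1) that] block_carrier_off[OF N that ij(2)] ij(3)
      by (cases "w i = w k") auto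
    then show "mat_mult B (entry M) (entry N) i j = 0"
      unfolding mat_mult_def by (intro sum.neutral) blast
  qed
qed

lemma block_zero_in: "(\<lambda>_. 0) \<in> carrier (block_algebra B w :: ('j + nat \<Rightarrow> complex) cstar)"
proof -
  have "(of_entries B (\<lambda>_ _. 0) :: 'j + nat \<Rightarrow> complex) = (\<lambda>_. 0)"
    by (auto simp: of_entries_def fun_eq_iff split: sum.split prod.split)
  moreover have "(of_entries B (\<lambda>_ _. 0) :: 'j + nat \<Rightarrow> complex) \<in> carrier (block_algebra B w)"
    by (rule block_carrierI) simp
  ultimately show ?thesis by simp
qed

lemma block_one_in: "of_entries B (\<lambda>i j. if i = j then 1 else 0) \<in> carrier (block_algebra B w)"
  by (rule block_carrierI) auto

lemma mat_mult_one:
  assumes "finite B" "i \<in> B" "j \<in> B"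
  shows "mat_mult B (\<lambda>i j. if i = j then 1 else 0) m i j = m i j"
    "mat_mult B m (\<lambda>i j. if i = j then 1 else 0) i j = m i j"
proof -
  have "mat_mult B (\<lambda>i j. if i = j then 1 else 0) m i j = (\<Sum>k\<in>B. if k = i then m i j else 0)"
    unfolding mat_mult_def by (intro sum.cong refl) auto
  then show "mat_mult B (\<lambda>i j. if i = j then 1 else 0) m i j = m i j" using assms by simp
  have "mat_mult B m (\<lambda>i j. if i = j then 1 else 0) i j = (\<Sum>k\<in>B. if k = j then m i j else 0)"
    unfolding mat_mult_def by (intro sum.cong refl) auto
  then show "mat_mult B m (\<lambda>i j. if i = j then 1 else 0) i j = m i j" using assms by simp
qed

lemma mat_mult_cong:
  "(\<And>k. k \<in> B \<Longrightarrow> m i k = m' i k) \<Longrightarrow> (\<And>k. k \<in> B \<Longrightarrow> n k j = n' k j) \<Longrightarrow>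
    mat_mult B m n i j = mat_mult B m' n' i j"
  by (simp add: mat_mult_def)

lemma mat_mult_assoc: "mat_mult B (mat_mult B m n) r i j = mat_mult B m (mat_mult B n r) i j"
proof -
  have "mat_mult B (mat_mult B m n) r i j = (\<Sum>l\<in>B. \<Sum>k\<in>B. m i k * n k l * r l j)"
    by (simp add: mat_mult_def sum_distrib_right)
  also have "\<dots> = (\<Sum>k\<in>B. \<Sum>l\<in>B. m i k * n k l * r l j)" by (rule sum.swap)
  finally show ?thesis by (simp add: mat_mult_def sum_distrib_left mult.assoc)
qed

lemma module_block_algebra:
  "Module.module complex_ring (block_algebra B w :: ('j + nat \<Rightarrow> complex) cstar)"
proof (rule moduleI[OF cring_complex_ring])
  let ?F = "block_algebra B w :: ('j + nat \<Rightarrow> complex) cstar"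
  have "\<exists>N\<in>carrier ?F. N \<oplus>\<^bsub>?F\<^esub> M = \<zero>\<^bsub>?F\<^esub>" if "M \<in> carrier ?F" for M
    using block_closed(1)[OF that, of "-1"]
    by (intro bexI[of _ "\<lambda>z. -1 * M z"]) (simp_all add: block_algebra_simps)
  then show "abelian_group ?F"
    by (intro abelian_groupI)
      (auto simp: block_algebra_simps block_closed block_zero_in add.assoc add.commute)
qed (simp_all add: block_algebra_simps block_closed algebra_simps)

lemma block_minus:
  fixes M N :: "'j + nat \<Rightarrow> complex"
  assumes "M \<in> carrier (block_algebra B w)" "N \<in> carrier (block_algebra B w)"
  shows "M \<ominus>\<^bsub>block_algebra B w\<^esub> N = (\<lambda>z. M z - N z)"
proof -
  interpret Module.module complex_ring "block_algebra B w :: ('j + nat \<Rightarrow> complex) cstar"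
    by (rule module_block_algebra)
  have "\<ominus>\<^bsub>block_algebra B w\<^esub> N = (\<lambda>z. -1 * N z)"
    using block_closed(1)[OF assms(2), of "-1"] assms
    by (intro M.minus_equality) (simp_all add: block_algebra_simps)
  then show ?thesis by (simp add: a_minus_def block_algebra_simps)
qed

text \<open>
  Completeness is entrywise convergence: the norm dominates every entry and is dominated by
  the sum of all of them.
\<close>

lemma cstar_block_algebra:
  assumes B: "finite B"
  shows "cstar_algebra (block_algebra B w :: ('j + nat \<Rightarrow> complex) cstar)"
proof -
  let ?F = "block_algebra B w :: ('j + nat \<Rightarrow> complex) cstar"
  interpret Module.module complex_ring ?F by (rule module_block_algebra)
  note simps = block_algebra_simps
  have "ring ?F"
  proof (rule ringI)
    show "abelian_group ?F" by (rule M.abelian_group_axioms)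
    show "Group.monoid ?F"
    proof (rule monoidI)
      fix L M N assume c: "L \<in> carrier ?F" "M \<in> carrier ?F" "N \<in> carrier ?F"
      show "L \<otimes>\<^bsub>?F\<^esub> M \<otimes>\<^bsub>?F\<^esub> N = L \<otimes>\<^bsub>?F\<^esub> (M \<otimes>\<^bsub>?F\<^esub> N)"
        unfolding simps
      proof (rule of_entries_cong)
        fix i j assume ij: "i \<in> B" "j \<in> B"
        have "mat_mult B (entry (of_entries B (mat_mult B (entry L) (entry M)))) (entry N) i j =
            mat_mult B (mat_mult B (entry L) (entry M)) (entry N) i j"
          using ij by (intro mat_mult_cong) auto
        also have "\<dots> = mat_mult B (entry L) (mat_mult B (entry M) (entry N)) i j" by (rule mat_mult_assoc)
        also have "\<dots> = mat_mult B (entry L) (entry (of_entries B (mat_mult B (entry M) (entry N)))) i j"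
          using ij by (intro mat_mult_cong) auto
        finally show "mat_mult B (entry (of_entries B (mat_mult B (entry L) (entry M)))) (entry N) i j =
            mat_mult B (entry L) (entry (of_entries B (mat_mult B (entry M) (entry N)))) i j" .
      qed
    next
      fix M assume c: "M \<in> carrier ?F"
      let ?d = "\<lambda>i j :: nat. if i = j then 1 else 0 :: complex"
      let ?D = "of_entries B ?d :: 'j + nat \<Rightarrow> complex"
      have "(of_entries B (mat_mult B (entry ?D) (entry M)) :: 'j + nat \<Rightarrow> complex) = of_entries B (entry M)"
        "(of_entries B (mat_mult B (entry M) (entry ?D)) :: 'j + nat \<Rightarrow> complex) = of_entries B (entry M)"
      proof (rule_tac [!] of_entries_cong)
        fix i j assume ij: "i \<in> B" "j \<in> B"
        have "mat_mult B (entry ?D) (entry M) i j = mat_mult B ?d (entry M) i j"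
          using ij by (intro mat_mult_cong) auto
        then show "mat_mult B (entry ?D) (entry M) i j = entry M i j"
          using mat_mult_one(1)[OF B ij] by simp
        have "mat_mult B (entry M) (entry ?D) i j = mat_mult B (entry M) ?d i j"
          using ij by (intro mat_mult_cong) auto
        then show "mat_mult B (entry M) (entry ?D) i j = entry M i j"
          using mat_mult_one(2)[OF B ij] by simp
      qed
      then show "\<one>\<^bsub>?F\<^esub> \<otimes>\<^bsub>?F\<^esub> M = M" "M \<otimes>\<^bsub>?F\<^esub> \<one>\<^bsub>?F\<^esub> = M"
        using block_carrier_entries[OF c] by (simp_all add: simps)
    qed (simp_all add: simps block_closed block_one_in)
    fix L M N assume c: "L \<in> carrier ?F" "M \<in> carrier ?F" "N \<in> carrier ?F"
    show "(L \<oplus>\<^bsub>?F\<^esub> M) \<otimes>\<^bsub>?F\<^esub> N = L \<otimes>\<^bsub>?F\<^esub> N \<oplus>\<^bsub>?F\<^esub> M \<otimes>\<^bsub>?F\<^esub> N"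
      by (rule block_eqI[of _ B w])
        (simp_all add: simps block_closed c mat_mult_def sum.distrib distrib_right)
    show "N \<otimes>\<^bsub>?F\<^esub> (L \<oplus>\<^bsub>?F\<^esub> M) = N \<otimes>\<^bsub>?F\<^esub> L \<oplus>\<^bsub>?F\<^esub> N \<otimes>\<^bsub>?F\<^esub> M"
      by (rule block_eqI[of _ B w])
        (simp_all add: simps block_closed c mat_mult_def sum.distrib distrib_left)
  qed
  then interpret ring ?F .
  show ?thesis
  proof
    fix L M c assume c: "L \<in> carrier ?F" "M \<in> carrier ?F"
    show "(c \<odot>\<^bsub>?F\<^esub> L) \<otimes>\<^bsub>?F\<^esub> M = c \<odot>\<^bsub>?F\<^esub> (L \<otimes>\<^bsub>?F\<^esub> M)"
      "L \<otimes>\<^bsub>?F\<^esub> (c \<odot>\<^bsub>?F\<^esub> M) = c \<odot>\<^bsub>?F\<^esub> (L \<otimes>\<^bsub>?F\<^esub> M)"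
      by (rule block_eqI[of _ B w];
        simp add: simps block_closed c mat_mult_def sum_distrib_left mult_ac)+
    show "star ?F (L \<oplus>\<^bsub>?F\<^esub> M) = star ?F L \<oplus>\<^bsub>?F\<^esub> star ?F M"
      by (rule block_eqI[of _ B w]) (simp_all add: simps block_closed c mat_adj_def)
    show "star ?F (L \<otimes>\<^bsub>?F\<^esub> M) = star ?F M \<otimes>\<^bsub>?F\<^esub> star ?F L"
      by (rule block_eqI[of _ B w])
        (simp_all add: simps block_closed c mat_adj_def mat_mult_def mult.commute)
    show "cnorm ?F (L \<oplus>\<^bsub>?F\<^esub> M) \<le> cnorm ?F L + cnorm ?F M"
      using mat_norm_add[OF B, of "entry L" "entry M"] by (simp add: simps entry_fun)
    show "cnorm ?F (L \<otimes>\<^bsub>?F\<^esub> M) \<le> cnorm ?F L * cnorm ?F M"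
      using mat_norm_mult[OF B, of "entry L" "entry M"] by (simp add: simps)
  next
    fix M c assume c: "M \<in> carrier ?F"
    show "star ?F M \<in> carrier ?F" using c by (simp add: simps block_closed)
    show "star ?F (star ?F M) = M"
      by (rule block_eqI[of _ B w]) (simp_all add: simps block_closed c mat_adj_def)
    show "star ?F (c \<odot>\<^bsub>?F\<^esub> M) = cnj c \<odot>\<^bsub>?F\<^esub> star ?F M"
      by (rule block_eqI[of _ B w]) (simp_all add: simps block_closed c mat_adj_def)
    show "cnorm ?F (c \<odot>\<^bsub>?F\<^esub> M) = cmod c * cnorm ?F M"
      using mat_norm_smult[OF B, of c "entry M"] by (simp add: simps entry_fun)
    show "cnorm ?F (star ?F M \<otimes>\<^bsub>?F\<^esub> M) = (cnorm ?F M)\<^sup>2"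
    proof -
      have "mat_norm B (mat_mult B (entry (of_entries B (mat_adj (entry M)) :: 'j + nat \<Rightarrow> complex)) (entry M)) =
          mat_norm B (mat_mult B (mat_adj (entry M)) (entry M))"
        by (rule mat_norm_cong) (auto intro!: mat_mult_cong)
      then show ?thesis using mat_norm_cstar[OF B, of "entry M"] by (simp add: simps)
    qed
    show "0 < cnorm ?F M" if "M \<noteq> \<zero>\<^bsub>?F\<^esub>"
    proof (rule ccontr)
      assume "\<not> 0 < cnorm ?F M"
      then have "mat_norm B (entry M) \<le> 0" by (simp add: simps)
      then have "cmod (entry M i j) \<le> 0" if "i \<in> B" "j \<in> B" for i j
        using mat_norm_entry[OF B that, of "entry M"] by linarith
      then have "entry M i j = 0" if "i \<in> B" "j \<in> B" for i j using that by simp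
      then have "M = (\<lambda>_. 0)" by (intro block_eqI[OF c block_zero_in]) simp
      then show False using that by (simp add: simps)
    qed
  next
    fix f :: "nat \<Rightarrow> 'j + nat \<Rightarrow> complex"
    assume f: "\<And>n. f n \<in> carrier ?F"
      and cauchy: "\<forall>\<epsilon>>0. \<exists>N. \<forall>m\<ge>N. \<forall>n\<ge>N. cnorm ?F (f m \<ominus>\<^bsub>?F\<^esub> f n) < \<epsilon>"
    have "\<exists>l. (\<lambda>n. entry (f n) i j) \<longlonglongrightarrow> l" if ij: "i \<in> B" "j \<in> B" for i j
    proof -
      have "Cauchy (\<lambda>n. entry (f n) i j)"
        unfolding Cauchy_def dist_norm
      proof (intro allI impI)
        fix \<epsilon> :: real assume "0 < \<epsilon>"
        then obtain N where N: "\<And>m n. m \<ge> N \<Longrightarrow> n \<ge> N \<Longrightarrow> cnorm ?F (f m \<ominus>\<^bsub>?F\<^esub> f n) < \<epsilon>"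
          using cauchy by blast
        have "cmod (entry (f m) i j - entry (f n) i j) \<le> cnorm ?F (f m \<ominus>\<^bsub>?F\<^esub> f n)" for m n
          using mat_norm_entry[OF B ij, of "entry (\<lambda>z. f m z - f n z)"]
          by (simp add: simps block_minus[OF f f])
        then show "\<exists>N. \<forall>m\<ge>N. \<forall>n\<ge>N. cmod (entry (f m) i j - entry (f n) i j) < \<epsilon>"
          using N le_less_trans by blast
      qed
      then show ?thesis using Cauchy_convergent unfolding convergent_def by blast
    qed
    then obtain l where l: "\<And>i j. i \<in> B \<Longrightarrow> j \<in> B \<Longrightarrow> (\<lambda>n. entry (f n) i j) \<longlonglongrightarrow> l i j" by metis
    define L :: "'j + nat \<Rightarrow> complex" where "L = of_entries B l"
    have L: "L \<in> carrier ?F"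
      unfolding L_def
    proof (rule block_carrierI)
      fix i j assume ij: "i \<in> B" "j \<in> B" "w i \<noteq> w j"
      then have "(\<lambda>n. entry (f n) i j) = (\<lambda>n. 0)" using block_carrier_off[OF f] by auto
      then show "l i j = 0" using l[OF ij(1,2)] LIMSEQ_unique tendsto_const by metis
    qed
    have "(\<lambda>n. cnorm ?F (f n \<ominus>\<^bsub>?F\<^esub> L)) \<longlonglongrightarrow> 0"
    proof (rule tendsto_sandwich[OF _ _ tendsto_const])
      show "\<forall>\<^sub>F n in sequentially. 0 \<le> cnorm ?F (f n \<ominus>\<^bsub>?F\<^esub> L)"
        by (simp add: simps mat_norm_nonneg B)
      have "cnorm ?F (f n \<ominus>\<^bsub>?F\<^esub> L) \<le> (\<Sum>i\<in>B. \<Sum>j\<in>B. cmod (entry (f n) i j - l i j))" for n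
      proof -
        have "cnorm ?F (f n \<ominus>\<^bsub>?F\<^esub> L) \<le> (\<Sum>i\<in>B. \<Sum>j\<in>B. cmod (entry (\<lambda>z. f n z - L z) i j))"
          unfolding block_minus[OF f L] simps by (rule mat_norm_le_sum[OF B])
        also have "\<dots> = (\<Sum>i\<in>B. \<Sum>j\<in>B. cmod (entry (f n) i j - l i j))"
          by (intro sum.cong refl) (simp add: L_def)
        finally show ?thesis .
      qed
      then show "\<forall>\<^sub>F n in sequentially. cnorm ?F (f n \<ominus>\<^bsub>?F\<^esub> L) \<le> (\<Sum>i\<in>B. \<Sum>j\<in>B. cmod (entry (f n) i j - l i j))"
        by simp
      have "(\<lambda>n. \<Sum>i\<in>B. \<Sum>j\<in>B. cmod (entry (f n) i j - l i j)) \<longlonglongrightarrow> (\<Sum>i\<in>B. \<Sum>j\<in>B. cmod (l i j - l i j))"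
        by (intro tendsto_intros l)
      then show "(\<lambda>n. \<Sum>i\<in>B. \<Sum>j\<in>B. cmod (entry (f n) i j - l i j)) \<longlonglongrightarrow> 0" by simp
    qed
    then show "\<exists>l\<in>carrier ?F. (\<lambda>n. cnorm ?F (f n \<ominus>\<^bsub>?F\<^esub> l)) \<longlonglongrightarrow> 0" using L by blast
  qed
qed

section \<open>Traces on block-diagonal matrices\<close>

definition block_trace :: "nat set \<Rightarrow> (nat \<Rightarrow> real) \<Rightarrow> ('j + nat \<Rightarrow> complex) \<Rightarrow> complex" where
  "block_trace B w M = (\<Sum>i\<in>B. of_real (w i) * entry M i i)"

text \<open>
  A matrix entry between \<open>i\<close> and \<open>k\<close> is nonzero only if \<open>w i = w k\<close>; so the weights can be moved
  from one index to the other.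
\<close>

lemma tracial_state_block_trace:
  assumes B: "finite B" and w: "\<And>i. i \<in> B \<Longrightarrow> 0 < w i" "sum w B = 1"
  shows "tracial_state (block_algebra B w :: ('j + nat \<Rightarrow> complex) cstar) (block_trace B w)"
proof -
  let ?F = "block_algebra B w :: ('j + nat \<Rightarrow> complex) cstar"
  have mult: "block_trace B w (M \<otimes>\<^bsub>?F\<^esub> N) = (\<Sum>i\<in>B. \<Sum>k\<in>B. of_real (w i) * (entry M i k * entry N k i))" for M N
    by (simp add: block_trace_def block_algebra_simps mat_mult_def sum_distrib_left)
  show ?thesis
    unfolding tracial_state_def
  proof (intro conjI ballI allI)
    fix M N assume M: "M \<in> carrier ?F" and N: "N \<in> carrier ?F"
    have "block_trace B w (M \<otimes>\<^bsub>?F\<^esub> N) = (\<Sum>i\<in>B. \<Sum>k\<in>B. of_real (w k) * (entry N k i * entry M i k))"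
      unfolding mult
    proof (intro sum.cong refl)
      fix i k assume ik: "i \<in> B" "k \<in> B"
      show "of_real (w i) * (entry M i k * entry N k i) = of_real (w k) * (entry N k i * entry M i k)"
        using block_carrier_off[OF M ik] by (cases "w i = w k") auto
    qed
    also have "\<dots> = block_trace B w (N \<otimes>\<^bsub>?F\<^esub> M)" unfolding mult by (rule sum.swap)
    finally show "block_trace B w (M \<otimes>\<^bsub>?F\<^esub> N) = block_trace B w (N \<otimes>\<^bsub>?F\<^esub> M)" .
  next
    fix M
    have "block_trace B w (star ?F M \<otimes>\<^bsub>?F\<^esub> M) =
        (\<Sum>i\<in>B. \<Sum>k\<in>B. of_real (w i * (cmod (entry M k i))\<^sup>2))"
      unfolding mult
      by (intro sum.cong refl)
        (simp add: block_algebra_simps mat_adj_def complex_norm_square mult.commute del: of_real_power)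
    also have "\<dots> = of_real (\<Sum>i\<in>B. \<Sum>k\<in>B. w i * (cmod (entry M k i))\<^sup>2)" by simp
    also have "\<dots> \<in> \<real>\<^sub>\<ge>\<^sub>0"
      unfolding nonneg_Reals_of_real_iff
      using w(1) by (intro sum_nonneg mult_nonneg_nonneg) (auto intro: less_imp_le)
    finally show "block_trace B w (star ?F M \<otimes>\<^bsub>?F\<^esub> M) \<in> \<real>\<^sub>\<ge>\<^sub>0" .
  next
    have "(\<Sum>i\<in>B. complex_of_real (w i)) = 1" using w(2) by (metis of_real_1 of_real_sum)
    then show "block_trace B w \<one>\<^bsub>?F\<^esub> = 1"
      by (simp add: block_trace_def block_algebra_simps)
  qed (simp_all add: block_trace_def block_algebra_simps sum.distrib distrib_left sum_distrib_left mult_ac)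
qed

lemma fin_dim_block_algebra:
  assumes B: "finite B"
  shows "fin_dim (block_algebra B w :: ('j + nat \<Rightarrow> complex) cstar)"
proof -
  let ?F = "block_algebra B w :: ('j + nat \<Rightarrow> complex) cstar"
  interpret Module.module complex_ring ?F by (rule module_block_algebra)
  define Z where "Z = {p \<in> B \<times> B. w (fst p) = w (snd p)}"
  define e :: "nat \<times> nat \<Rightarrow> 'j + nat \<Rightarrow> complex"
    where "e p = of_entries B (\<lambda>i j. if (i, j) = p then 1 else 0)" for p
  have Z: "finite Z" using B by (simp add: Z_def)
  have ec: "e p \<in> carrier ?F" if "p \<in> Z" for p
    unfolding e_def using that by (intro block_carrierI) (auto simp: Z_def)
  have ent: "entry (e p) i j = (if (i, j) = p then 1 else 0)" if "i \<in> B" "j \<in> B" for p i j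
    using that by (simp add: e_def)
  have inj: "inj_on e Z"
  proof (rule inj_onI)
    fix p q assume "p \<in> Z" "q \<in> Z" "e p = e q"
    moreover obtain i j where p: "p = (i, j)" by fastforce
    ultimately show "p = q" using ent[of i j p] ent[of i j q] by (auto simp: Z_def split: if_splits)
  qed
  have sum_entry: "entry (\<Oplus>\<^bsub>?F\<^esub>s\<in>S. f s) i j = (\<Sum>s\<in>S. entry (f s) i j)"
    if "finite S" "\<And>s. s \<in> S \<Longrightarrow> f s \<in> carrier ?F" for S and f :: "('j + nat \<Rightarrow> complex) \<Rightarrow> 'j + nat \<Rightarrow> complex" and i j
    using that
  proof (induction S rule: finite_induct)
    case (insert x S)
    then have "(\<Oplus>\<^bsub>?F\<^esub>s\<in>insert x S. f s) = f x \<oplus>\<^bsub>?F\<^esub> (\<Oplus>\<^bsub>?F\<^esub>s\<in>S. f s)"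
      by (intro M.finsum_insert) auto
    then show ?case using insert by (simp add: block_algebra_simps)
  qed (simp add: block_algebra_simps)
  have "\<exists>c. M = (\<Oplus>\<^bsub>?F\<^esub>s\<in>e ` Z. c s \<odot>\<^bsub>?F\<^esub> s)" if M: "M \<in> carrier ?F" for M
  proof -
    define c where "c s = (case the_inv_into Z e s of (i, j) \<Rightarrow> entry M i j)" for s
    have cc: "c s \<odot>\<^bsub>?F\<^esub> s \<in> carrier ?F" if "s \<in> e ` Z" for s
      using that ec by (auto simp: block_algebra_simps block_closed)
    have "M = (\<Oplus>\<^bsub>?F\<^esub>s\<in>e ` Z. c s \<odot>\<^bsub>?F\<^esub> s)"
    proof (rule block_eqI[OF M])
      show "(\<Oplus>\<^bsub>?F\<^esub>s\<in>e ` Z. c s \<odot>\<^bsub>?F\<^esub> s) \<in> carrier ?F"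
        by (rule M.finsum_closed) (use cc in auto)
      fix i j assume ij: "i \<in> B" "j \<in> B"
      have "entry (\<Oplus>\<^bsub>?F\<^esub>s\<in>e ` Z. c s \<odot>\<^bsub>?F\<^esub> s) i j = (\<Sum>s\<in>e ` Z. c s * entry s i j)"
        using Z cc by (subst sum_entry) (auto simp: block_algebra_simps)
      also have "\<dots> = (\<Sum>p\<in>Z. c (e p) * entry (e p) i j)" by (rule sum.reindex[OF inj, unfolded o_def])
      also have "\<dots> = (\<Sum>p\<in>Z. if p = (i, j) then entry M i j else 0)"
        by (intro sum.cong refl) (auto simp: c_def the_inv_into_f_f[OF inj] ent ij)
      also have "\<dots> = entry M i j"
        using Z ij block_carrier_off[OF M ij] by (auto simp: Z_def)
      finally show "entry M i j = entry (\<Oplus>\<^bsub>?F\<^esub>s\<in>e ` Z. c s \<odot>\<^bsub>?F\<^esub> s) i j" by simp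
    qed
    then show ?thesis by blast
  qed
  then show ?thesis
    unfolding fin_dim_def using Z ec by (intro exI[of _ "e ` Z"]) auto
qed

section \<open>Matrix representations of the free algebra\<close>

primrec word_matrix :: "nat set \<Rightarrow> ('g \<Rightarrow> nat \<Rightarrow> nat \<Rightarrow> complex) \<Rightarrow> 'g list \<Rightarrow> nat \<Rightarrow> nat \<Rightarrow> complex" where
  "word_matrix B G [] = (\<lambda>i j. if i = j then 1 else 0)"
| "word_matrix B G (g # gs) = mat_mult B (G g) (word_matrix B G gs)"

definition matrix_rep :: "nat set \<Rightarrow> ('g \<Rightarrow> nat \<Rightarrow> nat \<Rightarrow> complex) \<Rightarrow> 'g free_alg \<Rightarrow> nat \<Rightarrow> nat \<Rightarrow> complex" where
  "matrix_rep B G f i j =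
     (\<Sum>w\<in>Poly_Mapping.keys f. Poly_Mapping.lookup f w * word_matrix B G (letters w) i j)"

lemma matrix_rep_superset:
  assumes "finite A" "Poly_Mapping.keys f \<subseteq> A"
  shows "matrix_rep B G f i j = (\<Sum>w\<in>A. Poly_Mapping.lookup f w * word_matrix B G (letters w) i j)"
  unfolding matrix_rep_def by (rule sum.mono_neutral_left) (use assms in \<open>auto simp: in_keys_iff\<close>)

lemma matrix_rep_add:
  "matrix_rep B G (f + h) i j = matrix_rep B G f i j + matrix_rep B G h i j"
proof -
  let ?A = "Poly_Mapping.keys f \<union> Poly_Mapping.keys h"
  have "matrix_rep B G (f + h) i j = (\<Sum>w\<in>?A. Poly_Mapping.lookup (f + h) w * word_matrix B G (letters w) i j)"
    by (rule matrix_rep_superset) (use Poly_Mapping.keys_add[of f h] in auto)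
  also have "\<dots> = (\<Sum>w\<in>?A. Poly_Mapping.lookup f w * word_matrix B G (letters w) i j) +
      (\<Sum>w\<in>?A. Poly_Mapping.lookup h w * word_matrix B G (letters w) i j)"
    by (simp add: lookup_add distrib_right sum.distrib)
  also have "\<dots> = matrix_rep B G f i j + matrix_rep B G h i j"
    using matrix_rep_superset[of ?A f] matrix_rep_superset[of ?A h] by simp
  finally show ?thesis .
qed

lemma matrix_rep_zero [simp]: "matrix_rep B G 0 i j = 0"
  by (simp add: matrix_rep_def)

lemma matrix_rep_single: "matrix_rep B G (Poly_Mapping.single w c) i j = c * word_matrix B G (letters w) i j"
  by (simp add: matrix_rep_def lookup_single)

lemma matrix_rep_smult: "matrix_rep B G (free_smult c f) i j = c * matrix_rep B G f i j"
proof (induction f rule: free_induct)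
  case (single w d)
  have "free_smult c (Poly_Mapping.single w d) = Poly_Mapping.single w (c * d)"
    by (simp add: free_smult_mult mult_single)
  then show ?case by (simp add: matrix_rep_single)
qed (simp_all add: matrix_rep_add free_smult_add distrib_left free_smult_mult)

lemma matrix_rep_diff:
  "matrix_rep B G (f - h) i j = matrix_rep B G f i j - matrix_rep B G h i j"
  using matrix_rep_add[of B G "f - h" h i j] by simp

lemma matrix_rep_sum:
  "finite A \<Longrightarrow> matrix_rep B G (\<Sum>a\<in>A. f a) i j = (\<Sum>a\<in>A. matrix_rep B G (f a) i j)"
  by (induction A rule: finite_induct) (simp_all add: matrix_rep_add)

lemma matrix_rep_one: "matrix_rep B G 1 i j = (if i = j then 1 else 0)"
proof -
  have "letters (0 :: 'a word) = []" by (simp add: zero_word_def)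
  then show ?thesis using matrix_rep_single[of B G 0 1 i j] by simp
qed

lemma matrix_rep_gen:
  assumes "finite B" "i \<in> B" "j \<in> B"
  shows "matrix_rep B G (gen g) i j = G g i j"
  using mat_mult_one(2)[OF assms] by (simp add: gen_def matrix_rep_single)

lemma word_matrix_append:
  assumes B: "finite B" and ij: "i \<in> B" "j \<in> B"
  shows "word_matrix B G (gs @ hs) i j = mat_mult B (word_matrix B G gs) (word_matrix B G hs) i j"
  using ij(1)
proof (induction gs arbitrary: i)
  case Nil
  then show ?case using mat_mult_one(1)[OF B Nil ij(2)] by simp
next
  case (Cons g gs)
  have "word_matrix B G ((g # gs) @ hs) i j =
      mat_mult B (G g) (mat_mult B (word_matrix B G gs) (word_matrix B G hs)) i j"
    using Cons by (simp add: mat_mult_def)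
  then show ?case by (simp add: mat_mult_assoc)
qed

lemma matrix_rep_mult:
  assumes B: "finite B" and ij: "i \<in> B" "j \<in> B"
  shows "matrix_rep B G (f * h) i j = mat_mult B (matrix_rep B G f) (matrix_rep B G h) i j"
proof (induction f rule: free_induct)
  case zero
  show ?case by (simp add: mat_mult_def)
next
  case (single v c)
  show ?case
  proof (induction h rule: free_induct)
    case zero
    show ?case by (simp add: mat_mult_def)
  next
    case (single w d)
    show ?case
      by (simp add: mult_single matrix_rep_single plus_word_def word_matrix_append[OF B ij]
          mat_mult_def sum_distrib_left mult_ac)
  next
    case (add f h)
    then show ?case by (simp add: distrib_left matrix_rep_add mat_mult_def sum.distrib)
  qed
next
  case (add f h)
  then show ?case by (simp add: distrib_right matrix_rep_add mat_mult_def sum.distrib)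
qed

lemma matrix_rep_star:
  assumes B: "finite B" and ij: "i \<in> B" "j \<in> B"
    and herm: "\<And>g i j. i \<in> B \<Longrightarrow> j \<in> B \<Longrightarrow> G g j i = cnj (G g i j)"
  shows "matrix_rep B G (free_star f) i j = cnj (matrix_rep B G f j i)"
proof (induction f rule: free_induct)
  case (single w c)
  have "word_matrix B G (rev gs) i j = cnj (word_matrix B G gs j i)" for gs
    using ij
  proof (induction gs arbitrary: i j)
    case (Cons g gs)
    have "word_matrix B G (rev (g # gs)) i j = mat_mult B (word_matrix B G (rev gs)) (word_matrix B G [g]) i j"
      using word_matrix_append[OF B Cons.prems, of G "rev gs" "[g]"] by simp
    also have "\<dots> = (\<Sum>k\<in>B. cnj (word_matrix B G gs k i) * G g k j)"
      unfolding mat_mult_def[of B "word_matrix B G (rev gs)"]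
      using Cons.IH Cons.prems mat_mult_one(2)[OF B] by (intro sum.cong refl) simp
    also have "\<dots> = cnj (\<Sum>k\<in>B. G g j k * word_matrix B G gs k i)"
      using Cons.prems herm[of j] by (simp add: mult.commute)
    finally show ?case by (simp add: mat_mult_def)
  qed simp
  then show ?case by (simp add: free_star_single matrix_rep_single)
qed (simp_all add: free_star_add matrix_rep_add)

lemma matrix_rep_off:
  assumes "finite B" "i \<in> B" "j \<in> B" "w i \<noteq> w j"
    and off: "\<And>g i j. i \<in> B \<Longrightarrow> j \<in> B \<Longrightarrow> w i \<noteq> w j \<Longrightarrow> G g i j = (0 :: complex)"
  shows "matrix_rep B G f i j = 0"
proof -
  have "word_matrix B G gs i j = 0" for gs
    using assms(2,4)
  proof (induction gs arbitrary: i)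
    case (Cons g gs)
    have "G g i k * word_matrix B G gs k j = 0" if "k \<in> B" for k
      using Cons.IH[OF that] off[OF Cons.prems(1) that] Cons.prems(2) by (cases "w i = w k") auto
    then show ?case unfolding word_matrix.simps mat_mult_def by (intro sum.neutral) blast
  qed auto
  then show ?thesis by (simp add: matrix_rep_def)
qed

definition is_representation ::
  "('x::finite \<Rightarrow> 'y::finite \<Rightarrow> 'a::finite \<Rightarrow> 'b::finite \<Rightarrow> nat) \<Rightarrow> nat set \<Rightarrow>
   (('x, 'y, 'a, 'b) generator \<Rightarrow> nat \<Rightarrow> nat \<Rightarrow> complex) \<Rightarrow> bool" where
  "is_representation lam B G \<longleftrightarrow> finite B \<and>
     (\<forall>g. \<forall>i\<in>B. \<forall>j\<in>B. G g j i = cnj (G g i j)) \<and>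
     (\<forall>r\<in>game_relators lam. \<forall>i\<in>B. \<forall>j\<in>B. matrix_rep B G r i j = 0)"

text \<open>
  So this seminorm is below the supremum \<open>game_seminorm\<close>.  Consequently the
  entries of a representation are continuous and extend to the completion.
\<close>

lemma matrix_rep_seminorm:
  assumes G: "is_representation lam B G"
  shows "(\<lambda>f. mat_norm B (matrix_rep B G f)) \<in> game_seminorms lam"
proof -
  have B: "finite B" and herm: "\<And>g i j. i \<in> B \<Longrightarrow> j \<in> B \<Longrightarrow> G g j i = cnj (G g i j)"
    using G unfolding is_representation_def by blast+
  have add: "matrix_rep B G (f + h) = (\<lambda>i j. matrix_rep B G f i j + matrix_rep B G h i j)" for f h
    by (intro ext) (rule matrix_rep_add)
  have smult: "matrix_rep B G (free_smult c f) = (\<lambda>i j. c * matrix_rep B G f i j)" for c f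
    by (intro ext) (rule matrix_rep_smult)
  have mult: "mat_norm B (matrix_rep B G (f * h)) =
      mat_norm B (mat_mult B (matrix_rep B G f) (matrix_rep B G h))" for f h
    by (rule mat_norm_cong) (rule matrix_rep_mult[OF B])
  have cid: "mat_norm B (mat_mult B (matrix_rep B G (free_star f)) (matrix_rep B G f)) =
      mat_norm B (mat_mult B (mat_adj (matrix_rep B G f)) (matrix_rep B G f))" for f
    by (rule mat_norm_cong, rule mat_mult_cong)
      (simp_all add: matrix_rep_star[OF B _ _ herm] mat_adj_def)
  have rel: "mat_norm B (matrix_rep B G r) = 0" if "r \<in> game_relators lam" for r
  proof -
    have "mat_norm B (matrix_rep B G r) = mat_norm B (\<lambda>_ _. 0)"
      using G that unfolding is_representation_def by (intro mat_norm_cong) blast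
    also have "\<dots> \<le> 0" using mat_norm_le_sum[OF B, of "\<lambda>_ _. 0"] by simp
    finally show ?thesis using mat_norm_nonneg[OF B, of "matrix_rep B G r"] by simp
  qed
  show ?thesis
    unfolding game_seminorms_def cstar_seminorm_def mem_Collect_eq
    using mat_norm_add[OF B] mat_norm_smult[OF B] mat_norm_mult[OF B] mat_norm_cstar[OF B] rel
    by (simp add: add smult mult cid)
qed

text \<open>
  The choice of a representative sequence is immaterial by \<open>limit_representation_class\<close>.
\<close>

definition limit_representation :: "nat set \<Rightarrow> ('g \<Rightarrow> nat \<Rightarrow> nat \<Rightarrow> complex) \<Rightarrow>
    (nat \<Rightarrow> 'g free_alg) set \<Rightarrow> 'j + nat \<Rightarrow> complex" where
  "limit_representation B G U = of_entries B (\<lambda>i j. lim (\<lambda>n. matrix_rep B G ((SOME F. F \<in> U) n) i j))"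

lemma matrix_rep_entry_le:
  assumes "is_representation lam B G" "i \<in> B" "j \<in> B"
  shows "cmod (matrix_rep B G f i j) \<le> game_seminorm lam f"
proof -
  have "finite B" using assms(1) unfolding is_representation_def by blast
  then have "cmod (matrix_rep B G f i j) \<le> mat_norm B (matrix_rep B G f)"
    using mat_norm_entry assms(2,3) by blast
  also have "\<dots> \<le> game_seminorm lam f"
    using game_seminorm_upper[OF matrix_rep_seminorm[OF assms(1)], of f] .
  finally show ?thesis .
qed

lemma matrix_rep_converges:
  assumes G: "is_representation lam B G" and ij: "i \<in> B" "j \<in> B" and F: "F \<in> game_cauchy lam"
  shows "convergent (\<lambda>n. matrix_rep B G (F n) i j)"
proof -
  have "Cauchy (\<lambda>n. matrix_rep B G (F n) i j)"
    unfolding Cauchy_def dist_norm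
  proof (intro allI impI)
    fix \<epsilon> :: real assume "0 < \<epsilon>"
    with game_cauchyD[OF F] obtain N where
      N: "\<And>m n. m \<ge> N \<Longrightarrow> n \<ge> N \<Longrightarrow> game_seminorm lam (F m - F n) < \<epsilon>" by metis
    have "cmod (matrix_rep B G (F m) i j - matrix_rep B G (F n) i j) \<le> game_seminorm lam (F m - F n)" for m n
      using matrix_rep_entry_le[OF G ij, of "F m - F n"] by (simp add: matrix_rep_diff)
    then show "\<exists>N. \<forall>m\<ge>N. \<forall>n\<ge>N. cmod (matrix_rep B G (F m) i j - matrix_rep B G (F n) i j) < \<epsilon>"
      using N le_less_trans by blast
  qed
  then show ?thesis by (rule Cauchy_convergent)
qed

lemma limit_representation_class:
  assumes G: "is_representation lam B G" and F: "F \<in> game_cauchy lam" and ij: "i \<in> B" "j \<in> B"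
  shows "(\<lambda>n. matrix_rep B G (F n) i j) \<longlonglongrightarrow>
    entry (limit_representation B G (game_class lam F) :: 'j + nat \<Rightarrow> complex) i j"
proof -
  define E where "E = (SOME E. E \<in> game_class lam F)"
  have "E \<in> game_class lam F" unfolding E_def by (rule someI[of _ F]) (rule game_class_self[OF F])
  then have r: "(F, E) \<in> game_rel lam" by (simp add: game_class_def)
  then have E: "E \<in> game_cauchy lam" and z: "(\<lambda>n. game_seminorm lam (F n - E n)) \<longlonglongrightarrow> 0"
    by (auto simp: game_rel_def)
  have limE: "(\<lambda>n. matrix_rep B G (E n) i j) \<longlonglongrightarrow> lim (\<lambda>n. matrix_rep B G (E n) i j)"
    using matrix_rep_converges[OF G ij E] by (simp add: convergent_LIMSEQ_iff)
  have "(\<lambda>n. matrix_rep B G (F n) i j - matrix_rep B G (E n) i j) \<longlonglongrightarrow> 0"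
  proof (rule Lim_null_comparison[OF _ z])
    show "\<forall>\<^sub>F n in sequentially. cmod (matrix_rep B G (F n) i j - matrix_rep B G (E n) i j) \<le> game_seminorm lam (F n - E n)"
      using matrix_rep_entry_le[OF G ij] by (simp add: matrix_rep_diff[symmetric])
  qed
  from tendsto_add[OF this limE] show ?thesis
    using ij by (simp add: limit_representation_def E_def[symmetric])
qed

lemma star_hom_limit_representation:
  assumes G: "is_representation lam B G"
    and off: "\<And>g i j. i \<in> B \<Longrightarrow> j \<in> B \<Longrightarrow> w i \<noteq> w j \<Longrightarrow> G g i j = 0"
  shows "unital_star_hom (game_cstar lam) (block_algebra B w :: ('j + nat \<Rightarrow> complex) cstar)
    (limit_representation B G)"
proof -
  let ?F = "block_algebra B w :: ('j + nat \<Rightarrow> complex) cstar"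
  let ?pi = "limit_representation B G :: _ \<Rightarrow> 'j + nat \<Rightarrow> complex"
  have B: "finite B" and herm: "\<And>g i j. i \<in> B \<Longrightarrow> j \<in> B \<Longrightarrow> G g j i = cnj (G g i j)"
    using G unfolding is_representation_def by blast+
  note lim = limit_representation_class[OF G]
  have pic: "?pi (game_class lam F) \<in> carrier ?F" if F: "F \<in> game_cauchy lam" for F
  proof -
    have "entry (?pi (game_class lam F)) i j = 0" if ij: "i \<in> B" "j \<in> B" "w i \<noteq> w j" for i j
    proof (rule LIMSEQ_unique[OF lim[OF F ij(1,2)]])
      have "matrix_rep B G (F n) i j = 0" for n
        by (rule matrix_rep_off[OF B ij]) (rule off)
      then show "(\<lambda>n. matrix_rep B G (F n) i j) \<longlonglongrightarrow> 0" by simp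
    qed
    then have "of_entries B (entry (?pi (game_class lam F))) \<in> carrier ?F" by (rule block_carrierI)
    moreover have "of_entries B (entry (?pi (game_class lam F))) = ?pi (game_class lam F)"
      unfolding limit_representation_def by (rule of_entries_cong) simp
    ultimately show ?thesis by simp
  qed
  have eqI: "?pi (game_class lam F) = M"
    if F: "F \<in> game_cauchy lam" and M: "M \<in> carrier ?F"
      and conv: "\<And>i j. i \<in> B \<Longrightarrow> j \<in> B \<Longrightarrow> (\<lambda>n. matrix_rep B G (F n) i j) \<longlonglongrightarrow> entry M i j" for F M
  proof (rule block_eqI[OF pic[OF F] M])
    show "entry (?pi (game_class lam F)) i j = entry M i j" if "i \<in> B" "j \<in> B" for i j
      by (rule LIMSEQ_unique[OF lim[OF F that] conv[OF that]])
  qed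
  show ?thesis
    unfolding unital_star_hom_def game_carrier
  proof (intro conjI ballI allI)
    show "?pi \<in> ring_hom (game_cstar lam) ?F"
    proof (rule ring_hom_memI, unfold game_carrier)
      show "?pi U \<in> carrier ?F" if "U \<in> game_class lam ` game_cauchy lam" for U using pic that by auto
      fix U V assume "U \<in> game_class lam ` game_cauchy lam" "V \<in> game_class lam ` game_cauchy lam"
      then obtain F E where F: "F \<in> game_cauchy lam" "U = game_class lam F"
        and E: "E \<in> game_cauchy lam" "V = game_class lam E" by blast
      show "?pi (U \<otimes>\<^bsub>game_cstar lam\<^esub> V) = ?pi U \<otimes>\<^bsub>?F\<^esub> ?pi V"
        unfolding F(2) E(2) game_class_mult[OF F(1) E(1)]
      proof (rule eqI[OF game_cauchy_mult[OF F(1) E(1)]])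
        show "?pi (game_class lam F) \<otimes>\<^bsub>?F\<^esub> ?pi (game_class lam E) \<in> carrier ?F"
          using pic[OF F(1)] pic[OF E(1)] by (simp add: block_algebra_simps block_closed)
        fix i j assume ij: "i \<in> B" "j \<in> B"
        show "(\<lambda>n. matrix_rep B G (F n * E n) i j) \<longlonglongrightarrow>
            entry (?pi (game_class lam F) \<otimes>\<^bsub>?F\<^esub> ?pi (game_class lam E)) i j"
          using ij
          by (simp add: matrix_rep_mult[OF B ij] block_algebra_simps mat_mult_def)
            (intro tendsto_sum tendsto_mult lim F(1) E(1))
      qed
      show "?pi (U \<oplus>\<^bsub>game_cstar lam\<^esub> V) = ?pi U \<oplus>\<^bsub>?F\<^esub> ?pi V"
        unfolding F(2) E(2) game_class_add[OF F(1) E(1)]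
      proof (rule eqI[OF game_cauchy_add[OF F(1) E(1)]])
        show "?pi (game_class lam F) \<oplus>\<^bsub>?F\<^esub> ?pi (game_class lam E) \<in> carrier ?F"
          using pic[OF F(1)] pic[OF E(1)] by (simp add: block_algebra_simps block_closed)
        fix i j assume ij: "i \<in> B" "j \<in> B"
        show "(\<lambda>n. matrix_rep B G (F n + E n) i j) \<longlonglongrightarrow>
            entry (?pi (game_class lam F) \<oplus>\<^bsub>?F\<^esub> ?pi (game_class lam E)) i j"
          by (simp add: matrix_rep_add block_algebra_simps)
            (intro tendsto_add lim F(1) E(1) ij)
      qed
    next
      show "?pi \<one>\<^bsub>game_cstar lam\<^esub> = \<one>\<^bsub>?F\<^esub>"
        unfolding game_class_one
        by (rule eqI[OF game_cauchy_const])
          (simp_all add: block_algebra_simps block_one_in matrix_rep_one)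
    qed
  next
    fix c U assume "U \<in> game_class lam ` game_cauchy lam"
    then obtain F where F: "F \<in> game_cauchy lam" "U = game_class lam F" by blast
    show "?pi (c \<odot>\<^bsub>game_cstar lam\<^esub> U) = c \<odot>\<^bsub>?F\<^esub> ?pi U"
      unfolding F(2) game_class_smult[OF F(1)]
    proof (rule eqI[OF game_cauchy_smult[OF F(1)]])
      show "c \<odot>\<^bsub>?F\<^esub> ?pi (game_class lam F) \<in> carrier ?F"
        using pic[OF F(1)] by (simp add: block_algebra_simps block_closed)
      fix i j assume ij: "i \<in> B" "j \<in> B"
      show "(\<lambda>n. matrix_rep B G (free_smult c (F n)) i j) \<longlonglongrightarrow> entry (c \<odot>\<^bsub>?F\<^esub> ?pi (game_class lam F)) i j"
        by (simp add: matrix_rep_smult block_algebra_simps)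
          (intro tendsto_mult_left lim F(1) ij)
    qed
  next
    fix U assume "U \<in> game_class lam ` game_cauchy lam"
    then obtain F where F: "F \<in> game_cauchy lam" "U = game_class lam F" by blast
    show "?pi (star (game_cstar lam) U) = star ?F (?pi U)"
      unfolding F(2) game_class_star[OF F(1)]
    proof (rule eqI[OF game_cauchy_star[OF F(1)]])
      show "star ?F (?pi (game_class lam F)) \<in> carrier ?F"
        using pic[OF F(1)] by (simp add: block_algebra_simps block_closed)
      fix i j assume ij: "i \<in> B" "j \<in> B"
      show "(\<lambda>n. matrix_rep B G (free_star (F n)) i j) \<longlonglongrightarrow> entry (star ?F (?pi (game_class lam F))) i j"
        using ij
        by (simp add: matrix_rep_star[OF B ij herm] block_algebra_simps mat_adj_def)
          (intro tendsto_cnj lim F(1))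
    qed
  qed
qed

text \<open>
  The transpose makes the pairing \<open>\<Sum>i j. w i P i j Q i j\<close> the weighted trace of a matrix product.
\<close>

definition transposed_strategy where
  "transposed_strategy P Q g = (case g of Pgen x a \<Rightarrow> P x a | Qgen y b \<Rightarrow> (\<lambda>i j. Q y b j i))"

text \<open>
  The relations within \<open>P\<close> and within \<open>Q\<close> hold by definition.  When \<open>lam x y a b = 0\<close>, the matrix
  \<open>m = P Q\<^sup>T\<close> has \<open>\<tau> (m m\<^sup>*) = \<tau> (P Q\<^sup>T) = p = 0\<close> for the weighted trace \<open>\<tau>\<close>, and
  \<open>\<tau>\<close> is faithful because all the weights are positive.
\<close>

lemma transposed_strategy_representation:
  assumes w: "weighted_correlation B w P Q p"
    and perf: "\<And>x y a b. lam x y a b = 0 \<Longrightarrow> p $ (x, y, a, b) = 0"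
  shows "is_representation lam B (transposed_strategy P Q)"
proof -
  let ?G = "transposed_strategy P Q"
  have B: "finite B" and pos: "\<And>i. i \<in> B \<Longrightarrow> 0 < w i"
    and P: "\<And>x. mat_pvm B (P x)" and Q: "\<And>y. mat_pvm B (Q y)"
    and off: "\<And>i j x a. i \<in> B \<Longrightarrow> j \<in> B \<Longrightarrow> w i \<noteq> w j \<Longrightarrow> P x a i j = 0"
    and p: "\<And>x y a b. complex_of_real (p $ (x, y, a, b)) =
        (\<Sum>i\<in>B. \<Sum>j\<in>B. of_real (w i) * P x a i j * Q y b i j)"
    using w unfolding weighted_correlation_def by blast+
  have herm: "?G g j i = cnj (?G g i j)" if "i \<in> B" "j \<in> B" for g i j
    using mat_pvm_herm[OF P that] mat_pvm_herm[OF Q that(2,1)]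
    by (cases g) (simp_all add: transposed_strategy_def)
  have rel: "matrix_rep B ?G r i j = 0" if r: "r \<in> game_relators lam" and ij: "i \<in> B" "j \<in> B" for r i j
    using r unfolding game_relators_def
  proof (elim UnE)
    assume "r \<in> range (\<lambda>g. gen g * gen g - gen g)"
    then obtain g where g: "r = gen g * gen g - gen g" by blast
    have "matrix_rep B ?G r i j = (\<Sum>k\<in>B. ?G g i k * ?G g k j) - ?G g i j"
      using ij by (simp add: g matrix_rep_diff matrix_rep_mult[OF B ij] matrix_rep_gen[OF B] mat_mult_def)
    also have "(\<Sum>k\<in>B. ?G g i k * ?G g k j) = ?G g i j"
    proof (cases g)
      case (Qgen y b)
      then show ?thesis using mat_pvm_idem[OF Q ij(2,1), of y b] by (simp add: transposed_strategy_def mult.commute)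
    qed (simp add: transposed_strategy_def mat_pvm_idem[OF P ij])
    finally show ?thesis by simp
  next
    assume "r \<in> range (\<lambda>x. (\<Sum>a\<in>UNIV. gen (Pgen x a)) - 1)"
    then obtain x where "r = (\<Sum>a\<in>UNIV. gen (Pgen x a)) - 1" by blast
    then show ?thesis
      using mat_pvm_sum[OF P ij]
      by (simp add: matrix_rep_diff matrix_rep_sum matrix_rep_gen[OF B ij] matrix_rep_one
          transposed_strategy_def)
  next
    assume "r \<in> range (\<lambda>y. (\<Sum>b\<in>UNIV. gen (Qgen y b)) - 1)"
    then obtain y where "r = (\<Sum>b\<in>UNIV. gen (Qgen y b)) - 1" by blast
    then show ?thesis
      using mat_pvm_sum[OF Q ij(2,1)]
      by (auto simp: matrix_rep_diff matrix_rep_sum matrix_rep_gen[OF B ij] matrix_rep_one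
          transposed_strategy_def)
  next
    assume "r \<in> {gen (Pgen x a) * gen (Qgen y b) | x y a b. lam x y a b = 0}"
    then obtain x y a b where r: "r = gen (Pgen x a) * gen (Qgen y b)" and l: "lam x y a b = 0" by blast
    define m where "m i j = (\<Sum>k\<in>B. P x a i k * Q y b j k)" for i j
    have "(\<Sum>i\<in>B. \<Sum>j\<in>B. of_real (w i) * (m i j * cnj (m i j))) =
        (\<Sum>i\<in>B. \<Sum>k\<in>B. of_real (w i) * P x a i k * Q y b i k)"
    proof -
      have "(\<Sum>j\<in>B. of_real (w i) * (m i j * cnj (m i j))) =
          (\<Sum>k\<in>B. \<Sum>l\<in>B. of_real (w l) * (P x a l i * P x a i k) * Q y b l k)" if i: "i \<in> B" for i
      proof -
        have "(\<Sum>j\<in>B. of_real (w i) * (m i j * cnj (m i j))) =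
            (\<Sum>j\<in>B. \<Sum>k\<in>B. \<Sum>l\<in>B. of_real (w i) * (P x a l i * P x a i k) * (Q y b l j * Q y b j k))"
        proof (intro sum.cong refl)
          fix j assume j: "j \<in> B"
          have "cnj (m i j) = (\<Sum>l\<in>B. P x a l i * Q y b l j)"
            unfolding m_def cnj_sum complex_cnj_mult
            by (intro sum.cong refl arg_cong2[where f = "(*)"] mat_pvm_herm[OF P, symmetric]
                mat_pvm_herm[OF Q, symmetric] i j)
          then show "of_real (w i) * (m i j * cnj (m i j)) =
              (\<Sum>k\<in>B. \<Sum>l\<in>B. of_real (w i) * (P x a l i * P x a i k) * (Q y b l j * Q y b j k))"
            by (simp add: m_def sum_product sum_distrib_left mult_ac)
        qed
        also have "\<dots> = (\<Sum>k\<in>B. \<Sum>j\<in>B. \<Sum>l\<in>B. of_real (w i) * (P x a l i * P x a i k) * (Q y b l j * Q y b j k))"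
          by (rule sum.swap)
        also have "\<dots> = (\<Sum>k\<in>B. \<Sum>l\<in>B. of_real (w l) * (P x a l i * P x a i k) * Q y b l k)"
        proof (rule sum.cong[OF refl])
          fix k assume k: "k \<in> B"
          have "(\<Sum>j\<in>B. \<Sum>l\<in>B. of_real (w i) * (P x a l i * P x a i k) * (Q y b l j * Q y b j k)) =
              (\<Sum>l\<in>B. \<Sum>j\<in>B. of_real (w i) * (P x a l i * P x a i k) * (Q y b l j * Q y b j k))"
            by (rule sum.swap)
          also have "\<dots> = (\<Sum>l\<in>B. of_real (w l) * (P x a l i * P x a i k) * Q y b l k)"
          proof (intro sum.cong refl)
            fix l assume l: "l \<in> B"
            have "of_real (w i) * (P x a l i * P x a i k) = of_real (w l) * (P x a l i * P x a i k)"
              using off[OF l i, of x a] by (cases "w l = w i") auto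
            then show "(\<Sum>j\<in>B. of_real (w i) * (P x a l i * P x a i k) * (Q y b l j * Q y b j k)) =
                of_real (w l) * (P x a l i * P x a i k) * Q y b l k"
              by (simp only: sum_distrib_left[symmetric] mat_pvm_idem[OF Q l k])
          qed
          finally show "(\<Sum>j\<in>B. \<Sum>l\<in>B. of_real (w i) * (P x a l i * P x a i k) * (Q y b l j * Q y b j k)) =
              (\<Sum>l\<in>B. of_real (w l) * (P x a l i * P x a i k) * Q y b l k)" .
        qed
        finally show ?thesis .
      qed
      then have "(\<Sum>i\<in>B. \<Sum>j\<in>B. of_real (w i) * (m i j * cnj (m i j))) =
          (\<Sum>i\<in>B. \<Sum>k\<in>B. \<Sum>l\<in>B. of_real (w l) * (P x a l i * P x a i k) * Q y b l k)"
        by simp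
      also have "\<dots> = (\<Sum>k\<in>B. \<Sum>i\<in>B. \<Sum>l\<in>B. of_real (w l) * (P x a l i * P x a i k) * Q y b l k)"
        by (rule sum.swap)
      also have "\<dots> = (\<Sum>k\<in>B. \<Sum>l\<in>B. \<Sum>i\<in>B. of_real (w l) * (P x a l i * P x a i k) * Q y b l k)"
        by (rule sum.cong[OF refl]) (rule sum.swap)
      also have "\<dots> = (\<Sum>k\<in>B. \<Sum>l\<in>B. of_real (w l) * P x a l k * Q y b l k)"
        using mat_pvm_idem[OF P]
        by (intro sum.cong refl) (simp add: sum_distrib_left[symmetric] sum_distrib_right[symmetric])
      also have "\<dots> = (\<Sum>l\<in>B. \<Sum>k\<in>B. of_real (w l) * P x a l k * Q y b l k)" by (rule sum.swap)
      finally show ?thesis .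
    qed
    also have "\<dots> = 0" using p[of x y a b] perf[OF l] by simp
    finally have "complex_of_real (\<Sum>i\<in>B. \<Sum>j\<in>B. w i * (cmod (m i j))\<^sup>2) = 0"
      by (simp add: complex_norm_square del: of_real_power)
    then have "(\<Sum>i\<in>B. \<Sum>j\<in>B. w i * (cmod (m i j))\<^sup>2) = 0" by (simp only: of_real_eq_0_iff)
    then have "(\<Sum>j\<in>B. w i * (cmod (m i j))\<^sup>2) = 0"
      using B ij pos by (subst (asm) sum_nonneg_eq_0_iff) (auto intro!: sum_nonneg simp: less_imp_le)
    then have "w i * (cmod (m i j))\<^sup>2 = 0"
      using B ij pos by (subst (asm) sum_nonneg_eq_0_iff) (auto simp: less_imp_le)
    then have "m i j = 0" using pos[OF ij(1)] by simp
    moreover have "matrix_rep B ?G r i j = m i j"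
      using ij by (simp add: r matrix_rep_mult[OF B ij] matrix_rep_gen[OF B] mat_mult_def
          transposed_strategy_def m_def)
    ultimately show ?thesis by simp
  qed
  show ?thesis unfolding is_representation_def using B herm rel by blast
qed

theorem weighted_imp_trace_representation:
  fixes lam :: "'x::finite \<Rightarrow> 'y::finite \<Rightarrow> 'a::finite \<Rightarrow> 'b::finite \<Rightarrow> nat"
  assumes w: "weighted_correlation B w P Q p"
    and perf: "\<And>x y a b. lam x y a b = 0 \<Longrightarrow> p $ (x, y, a, b) = 0"
  shows "carrier (game_cstar lam) \<noteq> {\<zero>\<^bsub>game_cstar lam\<^esub>} \<and>
    (\<exists>(F :: ('j + nat \<Rightarrow> complex) cstar) \<tau> \<pi>.
       cstar_algebra F \<and> fin_dim F \<and> tracial_state F \<tau> \<and> unital_star_hom (game_cstar lam) F \<pi> \<and>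
       (\<forall>x y a b. complex_of_real (p $ (x, y, a, b)) =
          \<tau> (\<pi> (game_gen lam (Pgen x a) \<otimes>\<^bsub>game_cstar lam\<^esub> game_gen lam (Qgen y b)))))"
proof -
  let ?F = "block_algebra B w :: ('j + nat \<Rightarrow> complex) cstar"
  let ?G = "transposed_strategy P Q"
  let ?pi = "limit_representation B ?G :: _ \<Rightarrow> 'j + nat \<Rightarrow> complex"
  have B: "finite B" and pos: "\<And>i. i \<in> B \<Longrightarrow> 0 < w i" and one: "sum w B = 1"
    and off: "\<And>i j x a. i \<in> B \<Longrightarrow> j \<in> B \<Longrightarrow> w i \<noteq> w j \<Longrightarrow> P x a i j = 0"
    and offQ: "\<And>i j y b. i \<in> B \<Longrightarrow> j \<in> B \<Longrightarrow> w i \<noteq> w j \<Longrightarrow> Q y b i j = 0"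
    and p: "\<And>x y a b. complex_of_real (p $ (x, y, a, b)) =
        (\<Sum>i\<in>B. \<Sum>j\<in>B. of_real (w i) * P x a i j * Q y b i j)"
    using w unfolding weighted_correlation_def by blast+
  have G: "is_representation lam B ?G" by (rule transposed_strategy_representation[OF w perf])
  have offG: "?G g i j = 0" if "i \<in> B" "j \<in> B" "w i \<noteq> w j" for g i j
    using off[OF that] offQ[OF that(2,1)] that(3) by (cases g) (simp_all add: transposed_strategy_def)
  have hom: "unital_star_hom (game_cstar lam) ?F ?pi"
    by (rule star_hom_limit_representation[OF G offG])
  have const: "entry (?pi (game_class lam (\<lambda>_. f))) i j = matrix_rep B ?G f i j" if "i \<in> B" "j \<in> B" for f i j
    by (rule LIMSEQ_unique[OF limit_representation_class[OF G game_cauchy_const that] tendsto_const])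
  have "game_class lam (\<lambda>_. 1) \<noteq> game_class lam (\<lambda>_. 0)"
  proof
    assume eq: "game_class lam (\<lambda>_. 1) = game_class lam (\<lambda>_. 0)"
    have "B \<noteq> {}" using one by auto
    then obtain i where i: "i \<in> B" by blast
    have "matrix_rep B ?G 1 i i = matrix_rep B ?G 0 i i"
      using const[OF i i, of 1] const[OF i i, of 0] eq by simp
    then show False by (simp add: matrix_rep_one)
  qed
  moreover have "game_class lam (\<lambda>_. 1) \<in> carrier (game_cstar lam)"
    unfolding game_carrier using game_cauchy_const by blast
  ultimately have nonzero: "carrier (game_cstar lam) \<noteq> {\<zero>\<^bsub>game_cstar lam\<^esub>}"
    unfolding game_class_zero by blast
  have val: "complex_of_real (p $ (x, y, a, b)) =
      block_trace B w (?pi (game_gen lam (Pgen x a) \<otimes>\<^bsub>game_cstar lam\<^esub> game_gen lam (Qgen y b)))" for x y a b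
    unfolding game_gen_class game_class_mult[OF game_cauchy_const game_cauchy_const] block_trace_def
    by (simp add: const matrix_rep_mult[OF B] matrix_rep_gen[OF B] mat_mult_def
        transposed_strategy_def p sum_distrib_left mult.assoc)
  show ?thesis
    using nonzero cstar_block_algebra[OF B] fin_dim_block_algebra[OF B]
      tracial_state_block_trace[OF B pos one] hom val by blast
qed

section \<open>Traces given by a positive matrix\<close>

text \<open>
  The entries of \<open>C\<close> are the coordinates of a vector whose Schmidt decomposition satisfies
  \<open>C w\<^sub>k = s\<^sub>k v\<^sub>k\<close> and \<open>C v\<^sub>k = s\<^sub>k w\<^sub>k\<close>, with the complex conjugate of the
  second family.  So \<open>v\<^sub>k - w\<^sub>k\<close> would be an eigenvector for \<open>- s\<^sub>k\<close> unless it is 0, and \<open>ge_one\<close> excludes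
  negative eigenvalues.  It also gives \<open>s\<^sub>k \<ge> 1\<close>, hence finiteness, and the injectivity of \<open>C\<close>, hence
  completeness of the eigenvectors.
\<close>

lemma positive_matrix_eigenbasis:
  fixes B :: "nat set"
  assumes B: "finite B" and herm: "\<And>i j. i \<in> B \<Longrightarrow> j \<in> B \<Longrightarrow> C j i = cnj (C i j)"
    and ge_one: "\<And>u. (\<Sum>i\<in>B. (cmod (u i))\<^sup>2) \<le> Re (\<Sum>i\<in>B. \<Sum>j\<in>B. cnj (u i) * C i j * u j)"
  obtains I :: "nat set" and s v where "finite I" "\<And>k. k \<in> I \<Longrightarrow> 0 < (s k :: real)"
    "\<And>k l. k \<in> I \<Longrightarrow> l \<in> I \<Longrightarrow> (\<Sum>i\<in>B. cnj (v k i) * v l i) = (if k = l then 1 else 0)"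
    "\<And>i j. i \<in> B \<Longrightarrow> j \<in> B \<Longrightarrow> (\<Sum>k\<in>I. v k i * cnj (v k j)) = (if i = j then 1 else 0)"
    "\<And>k i. k \<in> I \<Longrightarrow> i \<in> B \<Longrightarrow> (\<Sum>j\<in>B. C i j * v k j) = of_real (s k) * v k i"
proof -
  let ?H = "coord_space (Inr ` B :: (unit + nat) set)" and ?K = "coord_space (pair_index B :: (unit + nat) set)"
  have ht: "hilbert_tensor ?H ?K coord_tensor" by (rule hilbert_tensor_coord[OF B])
  interpret tensor_square ?H ?K coord_tensor
    using ht by (auto simp: tensor_square_def tensor_square_axioms_def hilbert_tensor_def)
  define \<xi> where "\<xi> = (of_entries B C :: unit + nat \<Rightarrow> complex)"
  have \<xi>: "\<xi> \<in> carrier ?K"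
  proof -
    have "of_entries B C z = 0" if "z \<notin> pair_index B" for z :: "unit + nat"
    proof (cases z)
      case (Inr n)
      obtain i j where n: "n = prod_encode (i, j)" by (metis prod.exhaust prod_decode_inverse)
      then show ?thesis using that Inr by (auto simp: of_entries_def)
    qed (simp add: of_entries_def)
    then show ?thesis by (simp add: \<xi>_def)
  qed
  have ipH: "ip ?H u y = (\<Sum>i\<in>B. cnj (u (Inr i)) * y (Inr i))" for u y
    by (simp add: sum.reindex)
  have ipK: "ip ?K (coord_tensor u y) \<xi> = (\<Sum>i\<in>B. \<Sum>j\<in>B. cnj (u (Inr i)) * cnj (y (Inr j)) * C i j)" for u y
    unfolding coord_space_simps sum_pair_index
    by (intro sum.cong refl) (simp add: \<xi>_def of_entries_def)
  define \<delta> :: "nat \<Rightarrow> unit + nat \<Rightarrow> complex" where "\<delta> i z = (if z = Inr i then 1 else 0)" for i z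
  have \<delta>c: "\<delta> i \<in> carrier ?H" if "i \<in> B" for i using that by (auto simp: \<delta>_def)
  have \<delta>sum: "(\<Sum>a\<in>B. cnj (\<delta> i (Inr a)) * f a) = f i" if "i \<in> B" for i and f :: "nat \<Rightarrow> complex"
  proof -
    have "(\<Sum>a\<in>B. cnj (\<delta> i (Inr a)) * f a) = (\<Sum>a\<in>B. if a = i then f i else 0)"
      by (intro sum.cong refl) (auto simp: \<delta>_def)
    then show ?thesis using B that by simp
  qed
  obtain s v w where sch: "schmidt \<xi> s v w" by (rule schmidt_decomposition[OF \<xi>])
  have s0: "0 \<le> s k" and vc: "v k \<in> carrier ?H" and wc: "w k \<in> carrier ?H" for k
    using sch unfolding schmidt_def by blast+
  have orth: "ip ?H (v j) (v k) = (if j = k then 1 else 0)" if "0 < s j" "0 < s k" for j k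
    using sch that unfolding schmidt_def by blast
  have con1: "ip ?K (coord_tensor u (w k)) \<xi> = of_real (s k) * ip ?H u (v k)"
    and con2: "ip ?K (coord_tensor (v k) u) \<xi> = of_real (s k) * ip ?H u (w k)"
    if "0 < s k" "u \<in> carrier ?H" for k u
    using sch that unfolding schmidt_def by blast+
  define I where "I = {k. 0 < s k}"
  define V where "V k i = v k (Inr i)" for k i
  define W where "W k i = cnj (w k (Inr i))" for k i
  have CW: "(\<Sum>j\<in>B. C i j * W k j) = of_real (s k) * V k i" if "0 < s k" "i \<in> B" for k i
  proof -
    have "ip ?K (coord_tensor (\<delta> i) (w k)) \<xi> = (\<Sum>a\<in>B. cnj (\<delta> i (Inr a)) * (\<Sum>j\<in>B. C a j * W k j))"
      unfolding ipK by (simp add: sum_distrib_left W_def mult_ac)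
    also have "\<dots> = (\<Sum>j\<in>B. C i j * W k j)" by (rule \<delta>sum[OF that(2)])
    finally show ?thesis
      using con1[OF that(1) \<delta>c[OF that(2)]] \<delta>sum[OF that(2)] by (simp only: ipH V_def)
  qed
  have CV: "(\<Sum>j\<in>B. C i j * V k j) = of_real (s k) * W k i" if "0 < s k" "i \<in> B" for k i
  proof -
    have "ip ?K (coord_tensor (v k) (\<delta> i)) \<xi> = (\<Sum>a\<in>B. \<Sum>b\<in>B. cnj (\<delta> i (Inr b)) * (cnj (V k a) * C a b))"
      unfolding ipK by (simp add: V_def mult_ac)
    also have "\<dots> = (\<Sum>a\<in>B. cnj (V k a) * C a i)" by (simp only: \<delta>sum[OF that(2)])
    finally have "(\<Sum>a\<in>B. cnj (V k a) * C a i) = of_real (s k) * w k (Inr i)"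
      using con2[OF that(1) \<delta>c[OF that(2)]] \<delta>sum[OF that(2)] by (simp only: ipH)
    then have "cnj (\<Sum>a\<in>B. cnj (V k a) * C a i) = cnj (of_real (s k) * w k (Inr i))" by (rule arg_cong)
    then have "(\<Sum>a\<in>B. cnj (cnj (V k a) * C a i)) = of_real (s k) * W k i" by (simp add: W_def)
    moreover have "(\<Sum>a\<in>B. cnj (cnj (V k a) * C a i)) = (\<Sum>j\<in>B. C i j * V k j)"
    proof (intro sum.cong refl)
      fix a assume "a \<in> B"
      then show "cnj (cnj (V k a) * C a i) = C i a * V k a"
        using herm[of a i] that(2) by (simp add: mult.commute)
    qed
    ultimately show ?thesis by simp
  qed
  have form: "(\<Sum>i\<in>B. \<Sum>j\<in>B. cnj (u i) * C i j * u j) = (\<Sum>i\<in>B. cnj (u i) * (\<Sum>j\<in>B. C i j * u j))" for u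
    by (simp add: sum_distrib_left mult.assoc)
  have sq: "(\<Sum>i\<in>B. cnj (u i) * (c * u i)) = c * of_real (\<Sum>i\<in>B. (cmod (u i))\<^sup>2)" for u and c
    unfolding of_real_sum complex_norm_square by (simp add: sum_distrib_left mult_ac)
  have VW: "W k i = V k i" if k: "0 < s k" and i: "i \<in> B" for k i
  proof -
    define d where "d i = V k i - W k i" for i
    have "(\<Sum>i\<in>B. \<Sum>j\<in>B. cnj (d i) * C i j * d j) = (\<Sum>i\<in>B. cnj (d i) * (of_real (- s k) * d i))"
      unfolding form
    proof (intro sum.cong refl)
      fix i assume "i \<in> B"
      then have "(\<Sum>j\<in>B. C i j * d j) = of_real (- s k) * d i"
        using CV[OF k] CW[OF k] by (simp add: d_def right_diff_distrib sum_subtractf)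
      then show "cnj (d i) * (\<Sum>j\<in>B. C i j * d j) = cnj (d i) * (of_real (- s k) * d i)" by simp
    qed
    also have "\<dots> = of_real (- s k * (\<Sum>i\<in>B. (cmod (d i))\<^sup>2))" unfolding sq by simp
    finally have "(\<Sum>i\<in>B. (cmod (d i))\<^sup>2) \<le> - s k * (\<Sum>i\<in>B. (cmod (d i))\<^sup>2)"
      using ge_one[of d] by (simp only: Re_complex_of_real)
    moreover have "0 \<le> s k * (\<Sum>i\<in>B. (cmod (d i))\<^sup>2)" using k by (simp add: sum_nonneg)
    ultimately have "(\<Sum>i\<in>B. (cmod (d i))\<^sup>2) \<le> 0" by simp
    then have "(\<Sum>i\<in>B. (cmod (d i))\<^sup>2) = 0" by (simp add: sum_nonneg antisym)
    then have "d i = 0" using B i by (simp add: sum_nonneg_eq_0_iff)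
    then show ?thesis by (simp add: d_def)
  qed
  have eig: "(\<Sum>j\<in>B. C i j * V k j) = of_real (s k) * V k i" if "0 < s k" "i \<in> B" for k i
    using CV[OF that] VW[OF that] by simp
  have on: "(\<Sum>i\<in>B. cnj (V k i) * V l i) = (if k = l then 1 else 0)" if "0 < s k" "0 < s l" for k l
    using orth[OF that] by (simp only: ipH V_def)
  have big: "1 \<le> s k" if k: "0 < s k" for k
  proof -
    have one: "(\<Sum>i\<in>B. (cmod (V k i))\<^sup>2) = 1"
      using on[OF k k] sq[of "V k" 1] by (simp del: of_real_sum)
    have "(\<Sum>i\<in>B. \<Sum>j\<in>B. cnj (V k i) * C i j * V k j) = (\<Sum>i\<in>B. cnj (V k i) * (of_real (s k) * V k i))"
      unfolding form using eig[OF k] by (intro sum.cong refl) simp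
    also have "\<dots> = of_real (s k)" unfolding sq one by simp
    finally show ?thesis using ge_one[of "V k"] one by simp
  qed
  have finI: "finite I"
  proof -
    have "(\<lambda>k. (s k)\<^sup>2) \<longlonglongrightarrow> 0"
      using schmidt_sums[OF \<xi> sch] sums_summable summable_LIMSEQ_zero by blast
    then have "\<forall>\<^sub>F k in sequentially. (s k)\<^sup>2 < 1" using order_tendstoD(2) zero_less_one by blast
    then obtain N where N: "\<And>k. k \<ge> N \<Longrightarrow> (s k)\<^sup>2 < 1" by (auto simp: eventually_sequentially)
    have "k < N" if "k \<in> I" for k
      using N[of k] big[of k] one_le_power[of "s k" 2] that by (force simp: I_def not_less[symmetric])
    then have "I \<subseteq> {..<N}" by auto
    then show ?thesis using finite_subset by blast
  qed
  have complete: "y i = 0" if y: "\<And>k. k \<in> I \<Longrightarrow> (\<Sum>i\<in>B. cnj (V k i) * y i) = 0" and i: "i \<in> B" for y i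
  proof -
    define Y :: "unit + nat \<Rightarrow> complex" where
      "Y z = (case z of Inl _ \<Rightarrow> 0 | Inr j \<Rightarrow> if j \<in> B then cnj (y j) else 0)" for z
    have Yc: "Y \<in> carrier ?H" by (auto simp: Y_def split: sum.split)
    have Cy: "(\<Sum>b\<in>B. C i b * y b) = 0" if i: "i \<in> B" for i
    proof -
      have "(\<lambda>k. of_real (s k) * ip ?K (coord_tensor (v k) (w k)) (coord_tensor (\<delta> i) Y)) sums
          ip ?K \<xi> (coord_tensor (\<delta> i) Y)"
        using sch t_in[OF \<delta>c[OF i] Yc] unfolding schmidt_def by blast
      moreover have "of_real (s k) * ip ?K (coord_tensor (v k) (w k)) (coord_tensor (\<delta> i) Y) = 0" for k
      proof (cases "0 < s k")
        case True
        have "ip ?H (w k) Y = cnj (\<Sum>j\<in>B. cnj (W k j) * y j)"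
          unfolding ipH by (simp add: W_def Y_def)
        also have "(\<Sum>j\<in>B. cnj (W k j) * y j) = (\<Sum>j\<in>B. cnj (V k j) * y j)"
          using VW[OF True] by (intro sum.cong refl) simp
        also have "\<dots> = 0" using y True by (simp add: I_def)
        finally have "ip ?H (w k) Y = 0" by simp
        then show ?thesis using ip_t[OF vc wc \<delta>c[OF i] Yc, of k k] by (simp only: mult_zero_right)
      next
        case False
        then show ?thesis using s0[of k] by simp
      qed
      ultimately have "(\<lambda>k. 0) sums ip ?K \<xi> (coord_tensor (\<delta> i) Y)" by (simp only:)
      then have "ip ?K \<xi> (coord_tensor (\<delta> i) Y) = 0" using sums_unique2 sums_zero by blast
      then have "ip ?K (coord_tensor (\<delta> i) Y) \<xi> = 0"
        using K.g_cnj[OF \<xi> t_in[OF \<delta>c[OF i] Yc]] by (simp only: complex_cnj_zero)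
      moreover have "ip ?K (coord_tensor (\<delta> i) Y) \<xi> =
          (\<Sum>a\<in>B. cnj (\<delta> i (Inr a)) * (\<Sum>b\<in>B. C a b * y b))"
        unfolding ipK by (simp add: sum_distrib_left Y_def mult_ac)
      ultimately show ?thesis by (simp only: \<delta>sum[OF i])
    qed
    have "(\<Sum>i\<in>B. \<Sum>j\<in>B. cnj (y i) * C i j * y j) = 0"
      unfolding form using Cy by simp
    then have "(\<Sum>i\<in>B. (cmod (y i))\<^sup>2) \<le> 0" using ge_one[of y] by simp
    then have "(\<Sum>i\<in>B. (cmod (y i))\<^sup>2) = 0" by (simp add: sum_nonneg antisym)
    then show "y i = 0" using B i by (simp add: sum_nonneg_eq_0_iff)
  qed
  have resolution: "(\<Sum>k\<in>I. V k i * cnj (V k j)) = (if i = j then 1 else 0)" if ij: "i \<in> B" "j \<in> B" for i j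
  proof -
    define y where "y i = (if i = j then 1 else 0) - (\<Sum>k\<in>I. V k i * cnj (V k j))" for i
    have "y i = 0"
    proof (rule complete[OF _ ij(1)])
      fix l assume l: "l \<in> I"
      have "(\<Sum>i\<in>B. cnj (V l i) * (\<Sum>k\<in>I. V k i * cnj (V k j))) =
          (\<Sum>i\<in>B. \<Sum>k\<in>I. cnj (V l i) * V k i * cnj (V k j))"
        by (simp add: sum_distrib_left mult.assoc)
      also have "\<dots> = (\<Sum>k\<in>I. \<Sum>i\<in>B. cnj (V l i) * V k i * cnj (V k j))" by (rule sum.swap)
      also have "\<dots> = (\<Sum>k\<in>I. (if l = k then 1 else 0) * cnj (V k j))"
        unfolding sum_distrib_right[symmetric] using on l by (intro sum.cong refl) (simp add: I_def)
      also have "\<dots> = (\<Sum>k\<in>I. if k = l then cnj (V l j) else 0)" by (intro sum.cong refl) auto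
      also have "\<dots> = cnj (V l j)" using finI l by simp
      finally have 1: "(\<Sum>i\<in>B. cnj (V l i) * (\<Sum>k\<in>I. V k i * cnj (V k j))) = cnj (V l j)" .
      have "(\<Sum>i\<in>B. cnj (V l i) * (if i = j then 1 else 0)) = (\<Sum>i\<in>B. if i = j then cnj (V l j) else 0)"
        by (intro sum.cong refl) auto
      then have 2: "(\<Sum>i\<in>B. cnj (V l i) * (if i = j then 1 else 0)) = cnj (V l j)" using B ij by simp
      show "(\<Sum>i\<in>B. cnj (V l i) * y i) = 0"
        unfolding y_def right_diff_distrib sum_subtractf 1 2 by simp
    qed
    then show ?thesis by (simp add: y_def)
  qed
  show thesis
    using finI on resolution eig by (intro that[of I s V]) (auto simp: I_def)
qed

text \<open>
  The right-hand side of \<open>p\<close> is \<open>tr (C\<^sup>-\<^sup>1 P Q)\<close> for the matrix \<open>C\<close> with eigenvectors \<open>v k\<close> and eigenvalues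
  \<open>s k\<close>, and \<open>commP\<close> and \<open>commQ\<close> say that \<open>P\<close> and \<open>Q\<close> commute with \<open>C\<close>.  In the basis \<open>v\<close> this
  is a trace with weights \<open>1 / s k\<close>, and \<open>Q\<close> has to be transposed.
\<close>

lemma matrix_trace_in_hull:
  fixes p :: "real ^ ('x::finite \<times> 'y::finite \<times> 'a::finite \<times> 'b::finite)"
  assumes B: "finite B" and I: "finite (I :: nat set)" "\<And>k. k \<in> I \<Longrightarrow> 0 < s k"
    and on: "\<And>k l. k \<in> I \<Longrightarrow> l \<in> I \<Longrightarrow> (\<Sum>i\<in>B. cnj (v k i) * v l i) = (if k = l then 1 else 0)"
    and res: "\<And>i j. i \<in> B \<Longrightarrow> j \<in> B \<Longrightarrow> (\<Sum>k\<in>I. v k i * cnj (v k j)) = (if i = j then 1 else 0)"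
    and P: "\<And>x. mat_pvm B (P x)" and Q: "\<And>y. mat_pvm B (Q y)"
    and commP: "\<And>x a k l. k \<in> I \<Longrightarrow> l \<in> I \<Longrightarrow> s k \<noteq> s l \<Longrightarrow> (\<Sum>i\<in>B. \<Sum>j\<in>B. cnj (v k i) * P x a i j * v l j) = 0"
    and commQ: "\<And>y b k l. k \<in> I \<Longrightarrow> l \<in> I \<Longrightarrow> s k \<noteq> s l \<Longrightarrow> (\<Sum>i\<in>B. \<Sum>j\<in>B. cnj (v k i) * Q y b i j * v l j) = 0"
    and total: "(\<Sum>k\<in>I. 1 / s k) = 1"
    and p: "\<And>x y a b. complex_of_real (p $ (x, y, a, b)) =
      (\<Sum>k\<in>I. of_real (1 / s k) * (\<Sum>i\<in>B. \<Sum>j\<in>B. cnj (v k i) * mat_mult B (P x a) (Q y b) i j * v k j))"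
  shows "p \<in> convex hull tracial_correlations"
proof -
  define comp where "comp M k l = (\<Sum>i\<in>B. \<Sum>j\<in>B. cnj (v k i) * M i j * v l j)" for M k l
  define w where "w k = (if k \<in> I then 1 / s k else 0)" for k
  have comp_mult: "comp (mat_mult B M N) k l = (\<Sum>r\<in>I. comp M k r * comp N r l)" for M N k l
  proof -
    define A where "A m = (\<Sum>i\<in>B. cnj (v k i) * M i m)" for m
    define D where "D m = (\<Sum>j\<in>B. N m j * v l j)" for m
    have left: "comp M k r = (\<Sum>m\<in>B. A m * v r m)" for r
      unfolding comp_def A_def sum_distrib_right by (rule sum.swap)
    have right: "comp N r l = (\<Sum>m\<in>B. cnj (v r m) * D m)" for r
      by (simp add: comp_def D_def sum_distrib_left mult.assoc)
    have "comp (mat_mult B M N) k l = (\<Sum>i\<in>B. \<Sum>j\<in>B. \<Sum>m\<in>B. (cnj (v k i) * M i m) * (N m j * v l j))"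
      by (simp add: comp_def mat_mult_def sum_distrib_left sum_distrib_right mult.assoc)
    also have "\<dots> = (\<Sum>i\<in>B. \<Sum>m\<in>B. \<Sum>j\<in>B. (cnj (v k i) * M i m) * (N m j * v l j))"
      by (rule sum.cong[OF refl]) (rule sum.swap)
    also have "\<dots> = (\<Sum>m\<in>B. \<Sum>i\<in>B. \<Sum>j\<in>B. (cnj (v k i) * M i m) * (N m j * v l j))"
      by (rule sum.swap)
    also have "\<dots> = (\<Sum>m\<in>B. A m * D m)" by (simp add: A_def D_def sum_product)
    also have "\<dots> = (\<Sum>m\<in>B. \<Sum>m'\<in>B. (A m * D m') * (if m = m' then 1 else 0))"
      using B by (simp add: if_distrib[of "\<lambda>x. _ * x"] cong: if_cong)
    also have "\<dots> = (\<Sum>m\<in>B. \<Sum>m'\<in>B. \<Sum>r\<in>I. (A m * D m') * (v r m * cnj (v r m')))"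
      by (simp add: sum_distrib_left[symmetric] res)
    also have "\<dots> = (\<Sum>m\<in>B. \<Sum>r\<in>I. \<Sum>m'\<in>B. (A m * D m') * (v r m * cnj (v r m')))"
      by (rule sum.cong[OF refl]) (rule sum.swap)
    also have "\<dots> = (\<Sum>r\<in>I. \<Sum>m\<in>B. \<Sum>m'\<in>B. (A m * D m') * (v r m * cnj (v r m')))"
      by (rule sum.swap)
    also have "\<dots> = (\<Sum>r\<in>I. comp M k r * comp N r l)"
      by (simp add: left right sum_product mult_ac)
    finally show ?thesis .
  qed
  have comp_herm: "comp M l k = cnj (comp M k l)"
    if "\<And>i j. i \<in> B \<Longrightarrow> j \<in> B \<Longrightarrow> M j i = cnj (M i j)" for M k l
  proof -
    have "cnj (comp M k l) = (\<Sum>i\<in>B. \<Sum>j\<in>B. cnj (v l j) * M j i * v k i)"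
      unfolding comp_def cnj_sum
    proof (intro sum.cong refl)
      fix i j assume "i \<in> B" "j \<in> B"
      then show "cnj (cnj (v k i) * M i j * v l j) = cnj (v l j) * M j i * v k i"
        using that[of i j] by (simp add: mult_ac)
    qed
    also have "\<dots> = comp M l k" unfolding comp_def by (rule sum.swap)
    finally show ?thesis by simp
  qed
  have block: "{k. w k = c} = {k \<in> I. s k = 1 / c}" if "0 < c" for c
  proof -
    have "1 / s k = c \<longleftrightarrow> s k = 1 / c" if "k \<in> I" for k
      using I(2)[OF that] \<open>0 < c\<close> by (auto simp: divide_simps mult.commute)
    then show ?thesis using that by (auto simp: w_def)
  qed
  have pvm: "mat_pvm {k. w k = c} (\<lambda>a. comp (M a))"
    if c: "0 < c" and M: "mat_pvm B M"
      and off: "\<And>a k l. k \<in> I \<Longrightarrow> l \<in> I \<Longrightarrow> s k \<noteq> s l \<Longrightarrow> comp (M a) k l = 0"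
    for c and M :: "'c::finite \<Rightarrow> nat \<Rightarrow> nat \<Rightarrow> complex"
    unfolding mat_pvm_def block[OF c]
  proof (intro conjI allI ballI)
    fix a k l assume kl: "k \<in> {k \<in> I. s k = 1 / c}" "l \<in> {k \<in> I. s k = 1 / c}"
    show "comp (M a) l k = cnj (comp (M a) k l)"
      by (rule comp_herm) (rule mat_pvm_herm[OF M])
    have "(\<Sum>r\<in>{k \<in> I. s k = 1 / c}. comp (M a) k r * comp (M a) r l) = (\<Sum>r\<in>I. comp (M a) k r * comp (M a) r l)"
      by (rule sum.mono_neutral_left) (use I(1) kl off in auto)
    also have "\<dots> = comp (mat_mult B (M a) (M a)) k l" by (simp only: comp_mult)
    also have "\<dots> = comp (M a) k l"
      unfolding comp_def mat_mult_def using mat_pvm_idem[OF M] by (intro sum.cong refl) simp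
    finally show "(\<Sum>r\<in>{k \<in> I. s k = 1 / c}. comp (M a) k r * comp (M a) r l) = comp (M a) k l" .
  next
    fix k l assume kl: "k \<in> {k \<in> I. s k = 1 / c}" "l \<in> {k \<in> I. s k = 1 / c}"
    have "(\<Sum>a\<in>UNIV. comp (M a) k l) = (\<Sum>i\<in>B. \<Sum>a\<in>UNIV. \<Sum>j\<in>B. cnj (v k i) * M a i j * v l j)"
      unfolding comp_def by (rule sum.swap)
    also have "\<dots> = (\<Sum>i\<in>B. \<Sum>j\<in>B. \<Sum>a\<in>UNIV. cnj (v k i) * M a i j * v l j)"
      by (rule sum.cong[OF refl]) (rule sum.swap)
    also have "\<dots> = (\<Sum>i\<in>B. \<Sum>j\<in>B. if i = j then cnj (v k i) * v l i else 0)"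
      using mat_pvm_sum[OF M]
      by (intro sum.cong refl) (simp add: sum_distrib_left[symmetric] sum_distrib_right[symmetric])
    also have "\<dots> = (\<Sum>i\<in>B. cnj (v k i) * v l i)" using B by simp
    also have "\<dots> = (if k = l then 1 else 0)" using on kl by simp
    finally show "(\<Sum>a\<in>UNIV. comp (M a) k l) = (if k = l then 1 else 0)" .
  qed
  show ?thesis
  proof (rule weighted_blocks_in_hull[where w = w and P = "\<lambda>x a. comp (P x a)" and Q = "\<lambda>y b k l. comp (Q y b) l k"])
    show "0 \<le> w k" for k using I(2) by (simp add: w_def less_imp_le)
    have "(\<Sum>k\<in>I. w k) = 1" using total by (simp add: w_def)
    moreover have "w sums (\<Sum>k\<in>I. w k)" by (rule sums_finite[OF I(1)]) (simp add: w_def)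
    ultimately show "w sums 1" by simp
    show "mat_pvm {k. w k = c} (\<lambda>a. comp (P x a))" if "0 < c" for c x
      by (rule pvm[OF that P]) (simp add: comp_def commP)
    have Qpvm: "mat_pvm {k. w k = c} (\<lambda>b. comp (Q y b))" if "0 < c" for c y
      by (rule pvm[OF that Q]) (simp add: comp_def commQ)
    show "mat_pvm {k. w k = c} (\<lambda>b k l. comp (Q y b) l k)" if "0 < c" for c y
    proof -
      note m = Qpvm[OF that, of y]
      show ?thesis
        unfolding mat_pvm_def
      proof (intro conjI allI ballI)
        fix b i j assume ij: "i \<in> {k. w k = c}" "j \<in> {k. w k = c}"
        show "comp (Q y b) i j = cnj (comp (Q y b) j i)" by (rule mat_pvm_herm[OF m ij(2,1)])
        show "(\<Sum>k\<in>{k. w k = c}. comp (Q y b) k i * comp (Q y b) j k) = comp (Q y b) j i"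
          using mat_pvm_idem[OF m ij(2,1), of b] by (simp add: mult.commute)
      next
        fix i j assume ij: "i \<in> {k. w k = c}" "j \<in> {k. w k = c}"
        show "(\<Sum>b\<in>UNIV. comp (Q y b) j i) = (if i = j then 1 else 0)"
          using mat_pvm_sum[OF m ij(2,1)] by auto
      qed
    qed
    show "(\<lambda>k. of_real (w k) * (\<Sum>l\<in>{l. w l = w k}. comp (P x a) k l * comp (Q y b) l k)) sums
        complex_of_real (p $ (x, y, a, b))" for x y a b
    proof -
      let ?f = "\<lambda>k. of_real (w k) * (\<Sum>l\<in>{l. w l = w k}. comp (P x a) k l * comp (Q y b) l k)"
      have "?f k = of_real (1 / s k) * comp (mat_mult B (P x a) (Q y b)) k k" if k: "k \<in> I" for k
      proof -
        have wk: "w k = 1 / s k" using k by (simp add: w_def)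
        have eq: "{l. w l = w k} = {l \<in> I. s l = s k}"
          using block[of "w k"] wk I(2)[OF k] by simp
        have "(\<Sum>l\<in>{l. w l = w k}. comp (P x a) k l * comp (Q y b) l k) =
            (\<Sum>l\<in>I. comp (P x a) k l * comp (Q y b) l k)"
          unfolding eq
        proof (rule sum.mono_neutral_left)
          show "\<forall>l\<in>I - {l \<in> I. s l = s k}. comp (P x a) k l * comp (Q y b) l k = 0"
          proof
            fix l assume l: "l \<in> I - {l \<in> I. s l = s k}"
            then have "comp (P x a) k l = 0" using commP[OF k, of l x a] unfolding comp_def by force
            then show "comp (P x a) k l * comp (Q y b) l k = 0" by simp
          qed
        qed (use I(1) in auto)
        then show ?thesis by (simp only: comp_mult wk)
      qed
      then have "(\<Sum>k\<in>I. ?f k) = complex_of_real (p $ (x, y, a, b))"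
        unfolding p comp_def by (intro sum.cong refl) blast
      moreover have "?f sums (\<Sum>k\<in>I. ?f k)" by (rule sums_finite[OF I(1)]) (simp add: w_def)
      ultimately show ?thesis by simp
    qed
  qed
qed

section \<open>Finite-dimensional algebras with a trace\<close>

locale trace_algebra = cstar_algebra F for F (structure) +
  fixes \<tau>
  assumes tracial: "tracial_state F \<tau>"
begin

text \<open>
  Inside \<open>cstar_algebra\<close> the plain names of the ring laws denote those of the scalars, so the
  laws of \<open>F\<close> get names of their own.
\<close>

lemmas F_ring = cstar_algebra.axioms(1)[OF cstar_algebra_axioms]

lemmas F_abelian = abelian_group.axioms(1)[OF ring.is_abelian_group[OF F_ring]]
lemmas F_finsum_insert = abelian_monoid.finsum_insert[OF F_abelian]
lemmas F_finsum_closed = abelian_monoid.finsum_closed[OF F_abelian]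

lemma F_m_assoc: "u \<in> carrier F \<Longrightarrow> v \<in> carrier F \<Longrightarrow> w \<in> carrier F \<Longrightarrow> (u \<otimes> v) \<otimes> w = u \<otimes> (v \<otimes> w)"
  and F_r_distr: "u \<in> carrier F \<Longrightarrow> v \<in> carrier F \<Longrightarrow> w \<in> carrier F \<Longrightarrow> w \<otimes> (u \<oplus> v) = w \<otimes> u \<oplus> w \<otimes> v"
  and F_l_distr: "u \<in> carrier F \<Longrightarrow> v \<in> carrier F \<Longrightarrow> w \<in> carrier F \<Longrightarrow> (u \<oplus> v) \<otimes> w = u \<otimes> w \<oplus> v \<otimes> w"
  and F_one_closed: "\<one> \<in> carrier F"
  using F_ring by (simp_all add: ring.ring_simprules)

lemma \<tau>_add: "u \<in> carrier F \<Longrightarrow> v \<in> carrier F \<Longrightarrow> \<tau> (u \<oplus> v) = \<tau> u + \<tau> v"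
  and \<tau>_smult: "u \<in> carrier F \<Longrightarrow> \<tau> (c \<odot> u) = c * \<tau> u"
  and \<tau>_nonneg: "u \<in> carrier F \<Longrightarrow> \<tau> (star F u \<otimes> u) \<in> \<real>\<^sub>\<ge>\<^sub>0"
  and \<tau>_one: "\<tau> \<one> = 1"
  and \<tau>_comm: "u \<in> carrier F \<Longrightarrow> v \<in> carrier F \<Longrightarrow> \<tau> (u \<otimes> v) = \<tau> (v \<otimes> u)"
  using tracial unfolding tracial_state_def by blast+

lemma scale_in [simp]: "u \<in> carrier F \<Longrightarrow> c \<odot> u \<in> carrier F"
  by (rule smult_closed) simp_all

definition form :: "'a \<Rightarrow> 'a \<Rightarrow> complex" where
  "form u v = \<tau> (star F u \<otimes> v)"

lemma form_add: "u \<in> carrier F \<Longrightarrow> v \<in> carrier F \<Longrightarrow> w \<in> carrier F \<Longrightarrow> form u (v \<oplus> w) = form u v + form u w"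
  by (simp add: form_def F_r_distr star_closed \<tau>_add)

lemma form_smult: "u \<in> carrier F \<Longrightarrow> v \<in> carrier F \<Longrightarrow> form u (c \<odot> v) = c * form u v"
  by (simp add: form_def smult_mult_right star_closed \<tau>_smult)

lemma form_add_left: "u \<in> carrier F \<Longrightarrow> v \<in> carrier F \<Longrightarrow> w \<in> carrier F \<Longrightarrow> form (v \<oplus> w) u = form v u + form w u"
  by (simp add: form_def F_l_distr star_closed \<tau>_add star_add)

lemma form_smult_left: "u \<in> carrier F \<Longrightarrow> v \<in> carrier F \<Longrightarrow> form (c \<odot> v) u = cnj c * form v u"
  by (simp add: form_def smult_mult_left star_closed \<tau>_smult star_smult)

lemma form_real: "u \<in> carrier F \<Longrightarrow> Im (form u u) = 0 \<and> 0 \<le> Re (form u u)"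
  using \<tau>_nonneg[of u] by (simp add: form_def complex_nonneg_Reals_iff)

text \<open>
  Polarisation: the form is real on the diagonal, in particular at \<open>u + v\<close> and at \<open>u + \<i> v\<close>.
\<close>

lemma form_cnj:
  assumes u: "u \<in> carrier F" and v: "v \<in> carrier F"
  shows "form v u = cnj (form u v)"
proof -
  have "form (u \<oplus> v) (u \<oplus> v) = form u u + form u v + form v u + form v v"
    using u v by (simp add: form_add form_add_left)
  then have "Im (form u v) + Im (form v u) = 0"
    using form_real[of "u \<oplus> v"] form_real[OF u] form_real[OF v] u v by simp
  moreover have "form (u \<oplus> \<i> \<odot> v) (u \<oplus> \<i> \<odot> v) = form u u + \<i> * form u v - \<i> * form v u + form v v"
    using u v by (simp add: form_add form_add_left form_smult form_smult_left algebra_simps)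
  then have "Re (form u v) - Re (form v u) = 0"
    using form_real[of "u \<oplus> \<i> \<odot> v"] form_real[OF u] form_real[OF v] u v by simp
  ultimately show ?thesis by (simp add: complex_eq_iff)
qed

sublocale GNS: semi_inner F form
  by unfold_locales (simp_all add: form_add form_smult form_cnj[symmetric] form_real)

lemma form_mult: "a \<in> carrier F \<Longrightarrow> u \<in> carrier F \<Longrightarrow> v \<in> carrier F \<Longrightarrow> form u (a \<otimes> v) = form (star F a \<otimes> u) v"
  by (simp add: form_def star_mult star_star star_closed F_m_assoc)

lemma star_one: "star F \<one> = \<one>"
proof -
  have "star F (star F \<one> \<otimes> \<one>) = star F \<one> \<otimes> \<one>"
    using F_one_closed by (simp only: star_mult star_star star_closed)
  moreover have "star F \<one> \<otimes> \<one> = star F \<one>"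
    using F_ring F_one_closed by (simp add: star_closed ring.ring_simprules)
  ultimately show ?thesis using F_one_closed by (simp add: star_star)
qed

lemma form_one: "v \<in> carrier F \<Longrightarrow> form \<one> v = \<tau> v"
  by (simp add: form_def star_one)

text \<open>
  Orthogonalise the unit followed by a finite spanning family, and discard the null vectors.  The
  form may be degenerate, so the basis property is stated as Parseval's identity.
\<close>

lemma parseval_basis:
  assumes "fin_dim F"
  obtains e :: "nat \<Rightarrow> 'a" and B where "finite B" "0 \<in> B" "e 0 = \<one>" "\<And>i. e i \<in> carrier F"
    "\<And>i j. i \<in> B \<Longrightarrow> j \<in> B \<Longrightarrow> form (e i) (e j) = (if i = j then 1 else 0)"
    "\<And>u v. u \<in> carrier F \<Longrightarrow> v \<in> carrier F \<Longrightarrow> form u v = (\<Sum>i\<in>B. form u (e i) * form (e i) v)"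
proof -
  obtain S where S: "finite S" "S \<subseteq> carrier F"
    "\<And>v. v \<in> carrier F \<Longrightarrow> \<exists>c. v = (\<Oplus>s\<in>S. c s \<odot> s)"
    using assms unfolding fin_dim_def by blast
  obtain xs where xs: "set xs = S" using S(1) finite_list by blast
  define s where "s n = (if n = 0 then \<one> else if n \<le> length xs then xs ! (n - 1) else \<zero>)" for n
  have sc: "s n \<in> carrier F" for n
  proof -
    have "xs ! (n - 1) \<in> carrier F" if "n \<noteq> 0" "n \<le> length xs"
      using S(2) xs that nth_mem[of "n - 1" xs] by force
    then show ?thesis using F_one_closed by (simp add: s_def)
  qed
  obtain e where e: "GNS.quasi_orthonormal e"
    "\<And>n. GNS.nrm (s n \<ominus> (\<Oplus>i\<in>{..n}. form (e i) (s n) \<odot> e i)) = 0"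
    "form (s 0) (s 0) = 1 \<Longrightarrow> e 0 = s 0"
    by (rule GNS.gram_schmidt[of s]) (rule sc, rule that)
  have ec: "e i \<in> carrier F" for i using e(1) by (simp add: GNS.quasi_orthonormal_def)
  have orth: "form (e i) (e j) = 0" if "i \<noteq> j" for i j
    using e(1) that by (simp add: GNS.quasi_orthonormal_def)
  have "form (s 0) (s 0) = 1" by (simp add: s_def form_one \<tau>_one)
  then have e0: "e 0 = \<one>" using e(3) by (simp add: s_def)
  define N where "N = length xs"
  define B where "B = {i \<in> {..N}. form (e i) (e i) = 1}"
  have null: "form u (e i) = 0" if "form (e i) (e i) \<noteq> 1" "u \<in> carrier F" for i u
    using GNS.quasi_orthonormal_coeff[OF e(1) that(2,1)] form_cnj[OF ec that(2), of i] by simp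
  have ps: "form u (s n) = (\<Sum>i\<in>B. form u (e i) * form (e i) (s n))" if u: "u \<in> carrier F" and n: "n \<le> N" for u n
  proof -
    let ?x = "\<Oplus>i\<in>{..n}. form (e i) (s n) \<odot> e i"
    have xc: "?x \<in> carrier F" using ec by simp
    have expand: "form y (s n) = (\<Sum>i\<le>n. form (e i) (s n) * form y (e i))" if y: "y \<in> carrier F" for y
    proof -
      have "form y (s n \<ominus> ?x) = 0"
        using GNS.g_null[of "s n \<ominus> ?x" y] e(2)[of n] sc xc y by simp
      then have "form y (s n) = form y ?x"
        using sc xc y by (simp add: GNS.g_diff)
      also have "form y ?x = (\<Sum>i\<le>n. form y (form (e i) (s n) \<odot> e i))"
        using y ec by (intro GNS.g_sum) auto
      also have "\<dots> = (\<Sum>i\<le>n. form (e i) (s n) * form y (e i))"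
        by (rule sum.cong[OF refl], rule form_smult[OF y ec])
      finally show ?thesis .
    qed
    have "form u (s n) = (\<Sum>i\<le>N. form (e i) (s n) * form u (e i))"
      unfolding expand[OF u]
    proof (rule sum.mono_neutral_left)
      show "\<forall>i\<in>{..N} - {..n}. form (e i) (s n) * form u (e i) = 0"
      proof
        fix i assume "i \<in> {..N} - {..n}"
        then have "form (e i) (s n) = 0"
          by (subst expand[OF ec], intro sum.neutral) (auto simp: orth)
        then show "form (e i) (s n) * form u (e i) = 0" by simp
      qed
    qed (use n in auto)
    also have "\<dots> = (\<Sum>i\<in>B. form (e i) (s n) * form u (e i))"
      by (rule sum.mono_neutral_right) (use null u in \<open>auto simp: B_def\<close>)
    finally show ?thesis by (simp add: mult.commute)
  qed
  show thesis
  proof (rule that[of B e])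
    show "form u v = (\<Sum>i\<in>B. form u (e i) * form (e i) v)" if u: "u \<in> carrier F" and v: "v \<in> carrier F" for u v
    proof -
      obtain c where c: "v = (\<Oplus>t\<in>S. c t \<odot> t)" using S(3)[OF v] by blast
      have lin: "form y v = (\<Sum>t\<in>S. c t * form y t)" if y: "y \<in> carrier F" for y
      proof -
        have "form y v = (\<Sum>t\<in>S. form y (c t \<odot> t))"
          unfolding c using S(1,2) y by (intro GNS.g_sum) auto
        also have "\<dots> = (\<Sum>t\<in>S. c t * form y t)"
          using S(2) y by (intro sum.cong refl form_smult) auto
        finally show ?thesis .
      qed
      have "form u t = (\<Sum>i\<in>B. form u (e i) * form (e i) t)" if t: "t \<in> S" for t
      proof -
        obtain m where m: "m < length xs" "xs ! m = t" using t xs by (metis in_set_conv_nth)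
        then have "s (Suc m) = t" by (simp add: s_def)
        then show ?thesis using ps[OF u, of "Suc m"] m by (simp add: N_def)
      qed
      then have "form u v = (\<Sum>t\<in>S. \<Sum>i\<in>B. c t * (form u (e i) * form (e i) t))"
        unfolding lin[OF u] by (simp add: sum_distrib_left)
      also have "\<dots> = (\<Sum>i\<in>B. \<Sum>t\<in>S. c t * (form u (e i) * form (e i) t))" by (rule sum.swap)
      also have "\<dots> = (\<Sum>i\<in>B. form u (e i) * form (e i) v)"
        unfolding lin[OF ec] by (simp add: sum_distrib_left mult_ac)
      finally show ?thesis .
    qed
    have "form (e 0) (e 0) = 1" by (simp add: e0 form_one \<tau>_one F_one_closed)
    then show "0 \<in> B" "finite B" by (simp_all add: B_def)
    show "e 0 = \<one>" by (rule e0)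
    show "e i \<in> carrier F" for i by (rule ec)
    show "form (e i) (e j) = (if i = j then 1 else 0)" if "i \<in> B" "j \<in> B" for i j
      using that orth[of i j] by (simp add: B_def)
  qed
qed

text \<open>
  The matrices \<open>L a\<close> of left multiplication in the basis \<open>e\<close> represent \<open>F\<close>, and the
  element \<open>c = \<Sum>i\<in>B. e\<^sub>i e\<^sub>i\<^sup>*\<close> relates their trace to \<open>\<tau>\<close> by \<open>tr (L a) = \<tau> (a c)\<close>.  From
  \<open>tr (L (a b)) = tr (L (b a))\<close> it follows that \<open>c\<close> is central up to null vectors, and \<open>c\<close> is at least
  \<open>e\<^sub>0 e\<^sub>0\<^sup>* = 1\<close>.  So \<open>\<tau> a = tr (L a (L c)\<^sup>-\<^sup>1)\<close>, which is the situation of \<open>matrix_trace_in_hull\<close>.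
\<close>

lemma tracial_projections_in_hull:
  fixes E :: "'x::finite \<Rightarrow> 'c::finite \<Rightarrow> 'a" and D :: "'y::finite \<Rightarrow> 'd::finite \<Rightarrow> 'a"
    and p :: "real ^ ('x \<times> 'y \<times> 'c \<times> 'd)"
  assumes fd: "fin_dim F"
    and E: "\<And>x a. E x a \<in> carrier F" "\<And>x a. star F (E x a) = E x a" "\<And>x a. E x a \<otimes> E x a = E x a"
      "\<And>x. (\<Oplus>a\<in>UNIV. E x a) = \<one>"
    and D: "\<And>y b. D y b \<in> carrier F" "\<And>y b. star F (D y b) = D y b" "\<And>y b. D y b \<otimes> D y b = D y b"
      "\<And>y. (\<Oplus>b\<in>UNIV. D y b) = \<one>"
    and p: "\<And>x y a b. complex_of_real (p $ (x, y, a, b)) = \<tau> (E x a \<otimes> D y b)"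
  shows "p \<in> convex hull tracial_correlations"
proof -
  obtain e :: "nat \<Rightarrow> 'a" and B where B: "finite B" "0 \<in> B" and e0: "e 0 = \<one>" and ec: "\<And>i. e i \<in> carrier F"
    and on: "\<And>i j. i \<in> B \<Longrightarrow> j \<in> B \<Longrightarrow> form (e i) (e j) = (if i = j then 1 else 0)"
    and pars: "\<And>u v. u \<in> carrier F \<Longrightarrow> v \<in> carrier F \<Longrightarrow> form u v = (\<Sum>i\<in>B. form u (e i) * form (e i) v)"
    by (rule parseval_basis[OF fd]) (rule that)
  define L where "L a i j = form (e i) (a \<otimes> e j)" for a i j
  have Lmult: "L (a \<otimes> b) i j = mat_mult B (L a) (L b) i j" if "a \<in> carrier F" "b \<in> carrier F" for a b i j
  proof -
    have "L (a \<otimes> b) i j = form (star F a \<otimes> e i) (b \<otimes> e j)"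
      using that ec by (simp add: L_def form_mult[symmetric] F_m_assoc)
    also have "\<dots> = (\<Sum>k\<in>B. form (star F a \<otimes> e i) (e k) * form (e k) (b \<otimes> e j))"
      using that ec by (intro pars) (simp_all add: star_closed)
    also have "\<dots> = mat_mult B (L a) (L b) i j"
      using that ec by (simp add: mat_mult_def L_def form_mult[symmetric])
    finally show ?thesis .
  qed
  have Lstar: "L (star F a) i j = cnj (L a j i)" if "a \<in> carrier F" for a i j
  proof -
    have "L (star F a) i j = form (a \<otimes> e i) (e j)"
      using that ec by (simp add: L_def form_mult star_closed star_star)
    also have "\<dots> = cnj (form (e j) (a \<otimes> e i))" using that ec by (intro form_cnj) auto
    finally show ?thesis by (simp add: L_def)
  qed
  have Lone: "L \<one> i j = (if i = j then 1 else 0)" if "i \<in> B" "j \<in> B" for i j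
    using on[OF that] ec by (simp add: L_def)
  have Lsum: "L (\<Oplus>t\<in>T. f t) i j = (\<Sum>t\<in>T. L (f t) i j)" if "finite T" "\<And>t. t \<in> T \<Longrightarrow> f t \<in> carrier F"
    for T :: "'t set" and f i j
    using that
  proof (induction T rule: finite_induct)
    case empty
    then show ?case using ec by (simp add: L_def)
  next
    case (insert t T)
    then have "(\<Oplus>t\<in>insert t T. f t) = f t \<oplus> (\<Oplus>t\<in>T. f t)" by (intro F_finsum_insert) auto
    then show ?case using insert ec by (simp add: L_def F_l_distr form_add)
  qed
  have Ltau: "L a 0 0 = \<tau> a" if "a \<in> carrier F" for a
    using that by (simp add: L_def e0 form_one)
  \<comment> \<open>The element \<open>c\<close> turns the trace of the left regular representation into \<open>\<tau>\<close>.\<close>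
  define c where "c = (\<Oplus>i\<in>B. e i \<otimes> star F (e i))"
  have cc: "c \<in> carrier F" using ec unfolding c_def by (intro F_finsum_closed) (auto simp: star_closed)
  have form_c: "form u (c \<otimes> v) = (\<Sum>i\<in>B. form u ((e i \<otimes> star F (e i)) \<otimes> v))"
    if u: "u \<in> carrier F" and v: "v \<in> carrier F" for u v
  proof -
    have "form u ((\<Oplus>i\<in>T. e i \<otimes> star F (e i)) \<otimes> v) = (\<Sum>i\<in>T. form u ((e i \<otimes> star F (e i)) \<otimes> v))"
      if "finite T" for T :: "nat set"
      using that
    proof (induction T rule: finite_induct)
      case empty
      then show ?case using u v by simp
    next
      case (insert t T)
      then have "(\<Oplus>i\<in>insert t T. e i \<otimes> star F (e i)) = e t \<otimes> star F (e t) \<oplus> (\<Oplus>i\<in>T. e i \<otimes> star F (e i))"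
        using ec by (intro F_finsum_insert) (auto simp: star_closed)
      moreover have "(\<Oplus>i\<in>T. e i \<otimes> star F (e i)) \<in> carrier F"
        using ec by (intro F_finsum_closed) (auto simp: star_closed)
      ultimately show ?case using insert u v ec by (simp add: star_closed F_l_distr form_add)
    qed
    then show ?thesis unfolding c_def using B(1) by blast
  qed
  have trace: "(\<Sum>i\<in>B. L a i i) = \<tau> (a \<otimes> c)" if a: "a \<in> carrier F" for a
  proof -
    have "\<tau> (a \<otimes> c) = form (star F a) (c \<otimes> \<one>)" using a cc by (simp add: form_def star_star)
    also have "\<dots> = (\<Sum>i\<in>B. form (star F a) ((e i \<otimes> star F (e i)) \<otimes> \<one>))"
      using a by (intro form_c) (simp_all add: star_closed)
    also have "\<dots> = (\<Sum>i\<in>B. L a i i)"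
    proof (intro sum.cong refl)
      fix i
      have "form (star F a) ((e i \<otimes> star F (e i)) \<otimes> \<one>) = \<tau> ((a \<otimes> e i) \<otimes> star F (e i))"
        using a ec by (simp add: form_def star_star star_closed F_m_assoc)
      also have "\<dots> = \<tau> (star F (e i) \<otimes> (a \<otimes> e i))" using a ec by (intro \<tau>_comm) (auto simp: star_closed)
      finally show "form (star F a) ((e i \<otimes> star F (e i)) \<otimes> \<one>) = L a i i" by (simp add: L_def form_def)
    qed
    finally show ?thesis by simp
  qed
  have cyc: "(\<Sum>i\<in>B. mat_mult B (L a) (L b) i i) = (\<Sum>i\<in>B. mat_mult B (L b) (L a) i i)" for a b
    unfolding mat_mult_def by (subst sum.swap) (simp add: mult.commute)
  \<comment> \<open>Both sides are values \<open>\<tau> (b x)\<close> for \<open>b = e\<^sub>j e\<^sub>i\<^sup>*\<close>, and \<open>\<tau> (b a c) = tr L\<^bsub>b a\<^esub>\<close> is symmetric in \<open>a\<close> and \<open>b\<close>.\<close>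
  have comm: "L (c \<otimes> a) i j = L (a \<otimes> c) i j" if a: "a \<in> carrier F" for a i j
  proof -
    let ?b = "e j \<otimes> star F (e i)"
    have bc: "?b \<in> carrier F" using ec by (simp add: star_closed)
    have 1: "L (u \<otimes> v) i j = \<tau> (?b \<otimes> (u \<otimes> v))" if "u \<in> carrier F" "v \<in> carrier F" for u v
    proof -
      have "L (u \<otimes> v) i j = \<tau> ((star F (e i) \<otimes> (u \<otimes> v)) \<otimes> e j)"
        using that ec by (simp add: L_def form_def star_closed F_m_assoc)
      also have "\<dots> = \<tau> (e j \<otimes> (star F (e i) \<otimes> (u \<otimes> v)))"
        using that ec by (intro \<tau>_comm) (auto simp: star_closed)
      finally show ?thesis using that ec by (simp add: star_closed F_m_assoc)
    qed
    have "L (c \<otimes> a) i j = \<tau> (?b \<otimes> (c \<otimes> a))" using 1 cc a by blast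
    also have "\<dots> = \<tau> ((?b \<otimes> c) \<otimes> a)" using bc cc a by (simp add: F_m_assoc)
    also have "\<dots> = \<tau> (a \<otimes> (?b \<otimes> c))" using bc cc a by (intro \<tau>_comm) auto
    also have "\<dots> = \<tau> ((a \<otimes> ?b) \<otimes> c)" using bc cc a by (simp add: F_m_assoc)
    also have "\<dots> = (\<Sum>i\<in>B. L (a \<otimes> ?b) i i)" using trace bc a by simp
    also have "\<dots> = (\<Sum>i\<in>B. L (?b \<otimes> a) i i)"
      using cyc[of a ?b] by (simp only: Lmult[OF a bc] Lmult[OF bc a])
    also have "\<dots> = \<tau> ((?b \<otimes> a) \<otimes> c)" using trace bc a by simp
    also have "\<dots> = \<tau> (?b \<otimes> (a \<otimes> c))" using bc cc a by (simp add: F_m_assoc)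
    also have "\<dots> = L (a \<otimes> c) i j" using 1 cc a by simp
    finally show ?thesis .
  qed
  have herm_c: "form u (c \<otimes> v) = form (c \<otimes> u) v" if u: "u \<in> carrier F" and v: "v \<in> carrier F" for u v
  proof -
    have "form (c \<otimes> u) v = cnj (form v (c \<otimes> u))" using u v cc by (intro form_cnj) auto
    also have "\<dots> = (\<Sum>i\<in>B. cnj (form v ((e i \<otimes> star F (e i)) \<otimes> u)))"
      using form_c[OF v u] by simp
    also have "\<dots> = (\<Sum>i\<in>B. form u ((e i \<otimes> star F (e i)) \<otimes> v))"
    proof (intro sum.cong refl)
      fix i
      let ?b = "e i \<otimes> star F (e i)"
      have bc: "?b \<in> carrier F" "star F ?b = ?b" using ec by (simp_all add: star_closed star_mult star_star)
      have "form u (?b \<otimes> v) = form (?b \<otimes> u) v" using form_mult[OF bc(1) u v] bc(2) by simp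
      also have "\<dots> = cnj (form v (?b \<otimes> u))" using u v bc(1) by (intro form_cnj) auto
      finally show "cnj (form v (?b \<otimes> u)) = form u (?b \<otimes> v)" by simp
    qed
    finally show ?thesis using form_c[OF u v] by simp
  qed
  \<comment> \<open>All summands of \<open>c\<close> are positive, and the one for \<open>e\<^sub>0\<close> is the unit.\<close>
  have c_ge_one: "(\<Sum>i\<in>B. (cmod (u i))\<^sup>2) \<le> Re (\<Sum>i\<in>B. \<Sum>j\<in>B. cnj (u i) * L c i j * u j)" for u
  proof -
    define x where "x = (\<Oplus>i\<in>B. u i \<odot> e i)"
    have xc: "x \<in> carrier F" using ec by (simp add: x_def)
    have right: "form y x = (\<Sum>j\<in>B. u j * form y (e j))" if "y \<in> carrier F" for y
      unfolding x_def using B(1) ec that by (simp add: GNS.g_sum form_smult)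
    have left: "form x y = (\<Sum>i\<in>B. cnj (u i) * form (e i) y)" if "y \<in> carrier F" for y
      unfolding x_def using B(1) ec that by (simp add: GNS.g_sum_left form_smult_left)
    have "form x (c \<otimes> x) = (\<Sum>i\<in>B. cnj (u i) * (\<Sum>j\<in>B. u j * L c i j))"
    proof -
      have "form (e i) (c \<otimes> x) = (\<Sum>j\<in>B. u j * L c i j)" for i
        using right[of "c \<otimes> e i"] herm_c ec xc cc by (simp add: L_def)
      then show ?thesis using left[of "c \<otimes> x"] xc cc by simp
    qed
    also have "\<dots> = (\<Sum>i\<in>B. \<Sum>j\<in>B. cnj (u i) * L c i j * u j)"
      by (simp add: sum_distrib_left mult_ac)
    finally have form_eq: "(\<Sum>i\<in>B. \<Sum>j\<in>B. cnj (u i) * L c i j * u j) = form x (c \<otimes> x)" by simp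
    have "form x ((e i \<otimes> star F (e i)) \<otimes> x) = form (star F (e i) \<otimes> x) (star F (e i) \<otimes> x)" for i
      using ec xc by (simp add: F_m_assoc star_closed form_mult)
    then have "Re (form x (c \<otimes> x)) = (\<Sum>i\<in>B. Re (form (star F (e i) \<otimes> x) (star F (e i) \<otimes> x)))"
      using form_c[OF xc xc] by simp
    moreover have "Re (form (star F (e 0) \<otimes> x) (star F (e 0) \<otimes> x)) \<le>
        (\<Sum>i\<in>B. Re (form (star F (e i) \<otimes> x) (star F (e i) \<otimes> x)))"
    proof (rule member_le_sum[OF B(2) _ B(1)])
      fix i
      show "0 \<le> Re (form (star F (e i) \<otimes> x) (star F (e i) \<otimes> x))"
        using form_real[of "star F (e i) \<otimes> x"] ec xc by (simp add: star_closed)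
    qed
    moreover have "form x x = of_real (\<Sum>i\<in>B. (cmod (u i))\<^sup>2)"
    proof -
      have "form (e i) x = u i" if "i \<in> B" for i
      proof -
        have "form (e i) x = (\<Sum>j\<in>B. if j = i then u i else 0)"
          unfolding right[OF ec] using on[OF that] by (intro sum.cong refl) auto
        then show ?thesis using B that by simp
      qed
      then have "form x x = (\<Sum>i\<in>B. cnj (u i) * u i)" using left[OF xc] by simp
      also have "\<dots> = of_real (\<Sum>i\<in>B. (cmod (u i))\<^sup>2)"
        unfolding of_real_sum complex_norm_square by (intro sum.cong refl mult.commute)
      finally show ?thesis .
    qed
    ultimately show ?thesis unfolding form_eq using xc by (simp add: e0 star_one)
  qed
  have Cherm: "L c j i = cnj (L c i j)" for i j
    using herm_c[OF ec ec, of j i] form_cnj[OF ec, of "c \<otimes> e j" i] ec cc by (simp add: L_def)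
  obtain I :: "nat set" and s v where I: "finite I" "\<And>k. k \<in> I \<Longrightarrow> 0 < (s k :: real)"
    and von: "\<And>k l. k \<in> I \<Longrightarrow> l \<in> I \<Longrightarrow> (\<Sum>i\<in>B. cnj (v k i) * v l i) = (if k = l then 1 else 0)"
    and res: "\<And>i j. i \<in> B \<Longrightarrow> j \<in> B \<Longrightarrow> (\<Sum>k\<in>I. v k i * cnj (v k j)) = (if i = j then 1 else 0)"
    and eig: "\<And>k i. k \<in> I \<Longrightarrow> i \<in> B \<Longrightarrow> (\<Sum>j\<in>B. L c i j * v k j) = of_real (s k) * v k i"
    by (rule positive_matrix_eigenbasis[OF B(1) Cherm c_ge_one]) (rule that)
  define N where "N i j = (\<Sum>k\<in>I. of_real (1 / s k) * v k i * cnj (v k j))" for i j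
  have CN: "mat_mult B (L c) N i j = (if i = j then 1 else 0)" if ij: "i \<in> B" "j \<in> B" for i j
  proof -
    have "mat_mult B (L c) N i j = (\<Sum>m\<in>B. \<Sum>k\<in>I. of_real (1 / s k) * cnj (v k j) * (L c i m * v k m))"
      by (simp add: mat_mult_def N_def sum_distrib_left mult_ac)
    also have "\<dots> = (\<Sum>k\<in>I. \<Sum>m\<in>B. of_real (1 / s k) * cnj (v k j) * (L c i m * v k m))" by (rule sum.swap)
    also have "\<dots> = (\<Sum>k\<in>I. v k i * cnj (v k j))"
    proof (intro sum.cong refl)
      fix k assume k: "k \<in> I"
      have "(\<Sum>m\<in>B. of_real (1 / s k) * cnj (v k j) * (L c i m * v k m)) =
          of_real (1 / s k) * cnj (v k j) * (of_real (s k) * v k i)"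
        unfolding sum_distrib_left[symmetric] eig[OF k ij(1)] ..
      then show "(\<Sum>m\<in>B. of_real (1 / s k) * cnj (v k j) * (L c i m * v k m)) = v k i * cnj (v k j)"
        using I(2)[OF k] by simp
    qed
    finally show ?thesis using res ij by simp
  qed
  have Nherm: "N j i = cnj (N i j)" for i j by (simp add: N_def mult_ac)
  have NC: "mat_mult B N (L c) i j = (if i = j then 1 else 0)" if ij: "i \<in> B" "j \<in> B" for i j
  proof -
    have "mat_mult B N (L c) i j = cnj (mat_mult B (L c) N j i)"
      unfolding mat_mult_def cnj_sum complex_cnj_mult
      by (intro sum.cong refl) (simp add: Nherm[of i] Cherm[of _ j] mult.commute)
    then show ?thesis using CN[OF ij(2,1)] by auto
  qed
  \<comment> \<open>The inverse of the central element exists in the algebra itself, up to null vectors.\<close>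
  define c' where "c' = (\<Oplus>i\<in>B. N i 0 \<odot> e i)"
  have c'c: "c' \<in> carrier F" using ec by (simp add: c'_def)
  have inv: "form u (c \<otimes> c') = form u \<one>" if u: "u \<in> carrier F" for u
  proof -
    have "form (e i) (c \<otimes> c') = form (e i) \<one>" if i: "i \<in> B" for i
    proof -
      have "form (e i) (c \<otimes> c') = form (c \<otimes> e i) c'" using herm_c ec c'c by simp
      also have "\<dots> = (\<Sum>j\<in>B. N j 0 * form (c \<otimes> e i) (e j))"
        unfolding c'_def using B(1) ec cc by (simp add: GNS.g_sum form_smult)
      also have "\<dots> = (\<Sum>j\<in>B. L c i j * N j 0)"
        using herm_c ec by (simp add: L_def mult.commute)
      also have "\<dots> = form (e i) \<one>" using CN[OF i B(2)] on[OF i B(2)] by (simp add: mat_mult_def e0)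
      finally show ?thesis .
    qed
    then show ?thesis using pars[OF u, of "c \<otimes> c'"] pars[OF u F_one_closed] cc c'c by simp
  qed
  have Lcc': "mat_mult B (L c) (L c') i j = (if i = j then 1 else 0)" if ij: "i \<in> B" "j \<in> B" for i j
  proof -
    have "L (c \<otimes> c') i j = \<tau> ((star F (e i) \<otimes> (c \<otimes> c')) \<otimes> e j)"
      using cc c'c ec by (simp add: L_def form_def star_closed F_m_assoc)
    also have "\<dots> = \<tau> (e j \<otimes> (star F (e i) \<otimes> (c \<otimes> c')))"
      using cc c'c ec by (intro \<tau>_comm) (auto simp: star_closed)
    also have "\<dots> = form (e i \<otimes> star F (e j)) (c \<otimes> c')"
      using cc c'c ec by (simp add: form_def star_mult star_star star_closed F_m_assoc)
    also have "\<dots> = form (e i \<otimes> star F (e j)) \<one>" using inv ec by (simp add: star_closed)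
    also have "\<dots> = \<tau> (e j \<otimes> star F (e i))"
      using ec by (simp add: form_def star_mult star_star star_closed)
    also have "\<dots> = \<tau> (star F (e i) \<otimes> e j)" using ec by (intro \<tau>_comm) (auto simp: star_closed)
    also have "\<dots> = (if i = j then 1 else 0)" using on[OF ij] by (simp add: form_def)
    finally show ?thesis using Lmult[OF cc c'c] by simp
  qed
  have LN: "L c' i j = N i j" if ij: "i \<in> B" "j \<in> B" for i j
  proof -
    have "L c' i j = mat_mult B (\<lambda>i j. if i = j then 1 else 0) (L c') i j"
      using mat_mult_one(1)[OF B(1) ij] by simp
    also have "\<dots> = mat_mult B (mat_mult B N (L c)) (L c') i j"
      using NC ij by (intro mat_mult_cong) auto
    also have "\<dots> = mat_mult B N (mat_mult B (L c) (L c')) i j" by (rule mat_mult_assoc)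
    also have "\<dots> = mat_mult B N (\<lambda>i j. if i = j then 1 else 0) i j"
      using Lcc' ij by (intro mat_mult_cong) auto
    finally show ?thesis using mat_mult_one(2)[OF B(1) ij] by simp
  qed
  have tau: "\<tau> a = (\<Sum>k\<in>I. of_real (1 / s k) * (\<Sum>i\<in>B. \<Sum>j\<in>B. cnj (v k i) * L a i j * v k j))"
    if a: "a \<in> carrier F" for a
  proof -
    have "(\<Sum>k\<in>I. of_real (1 / s k) * (\<Sum>i\<in>B. \<Sum>j\<in>B. cnj (v k i) * L a i j * v k j)) =
        (\<Sum>k\<in>I. \<Sum>i\<in>B. \<Sum>j\<in>B. L a i j * (of_real (1 / s k) * v k j * cnj (v k i)))"
      by (simp add: sum_distrib_left mult_ac)
    also have "\<dots> = (\<Sum>i\<in>B. \<Sum>k\<in>I. \<Sum>j\<in>B. L a i j * (of_real (1 / s k) * v k j * cnj (v k i)))"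
      by (rule sum.swap)
    also have "\<dots> = (\<Sum>i\<in>B. \<Sum>j\<in>B. \<Sum>k\<in>I. L a i j * (of_real (1 / s k) * v k j * cnj (v k i)))"
      by (rule sum.cong[OF refl]) (rule sum.swap)
    also have "\<dots> = (\<Sum>i\<in>B. mat_mult B (L a) (L c') i i)"
      unfolding mat_mult_def using LN by (intro sum.cong refl) (simp add: N_def sum_distrib_left)
    also have "\<dots> = (\<Sum>i\<in>B. L (a \<otimes> c') i i)" by (simp only: Lmult[OF a c'c])
    also have "\<dots> = \<tau> ((a \<otimes> c') \<otimes> c)" using trace a c'c by simp
    also have "\<dots> = L (a \<otimes> c' \<otimes> c) 0 0" using Ltau a c'c cc by simp
    also have "\<dots> = mat_mult B (L (a \<otimes> c')) (L c) 0 0" using Lmult a c'c cc by simp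
    also have "\<dots> = mat_mult B (mat_mult B (L a) (L c')) (L c) 0 0"
      by (rule mat_mult_cong) (simp_all add: Lmult[OF a c'c])
    also have "\<dots> = mat_mult B (L a) (mat_mult B (L c') (L c)) 0 0" by (rule mat_mult_assoc)
    also have "\<dots> = mat_mult B (L a) (\<lambda>i j. if i = j then 1 else 0) 0 0"
    proof (rule mat_mult_cong)
      fix k assume k: "k \<in> B"
      have "mat_mult B (L c') (L c) k 0 = mat_mult B N (L c) k 0"
        using LN k by (intro mat_mult_cong) auto
      then show "mat_mult B (L c') (L c) k 0 = (if k = 0 then 1 else 0)" using NC[OF k B(2)] by simp
    qed simp
    also have "\<dots> = \<tau> a" using mat_mult_one(2)[OF B(1,2,2)] Ltau[OF a] by simp
    finally show ?thesis by simp
  qed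
  have block: "(\<Sum>i\<in>B. \<Sum>j\<in>B. cnj (v k i) * L a i j * v l j) = 0"
    if a: "a \<in> carrier F" and kl: "k \<in> I" "l \<in> I" "s k \<noteq> s l" for a k l
  proof -
    define X where "X = (\<Sum>i\<in>B. \<Sum>j\<in>B. cnj (v k i) * L a i j * v l j)"
    have CL: "mat_mult B (L c) (L a) i j = mat_mult B (L a) (L c) i j" for i j
      using comm[OF a] Lmult[OF cc a] Lmult[OF a cc] by simp
    have "(\<Sum>i\<in>B. \<Sum>j\<in>B. cnj (v k i) * mat_mult B (L a) (L c) i j * v l j) = of_real (s l) * X"
    proof -
      have "(\<Sum>j\<in>B. cnj (v k i) * mat_mult B (L a) (L c) i j * v l j) =
          of_real (s l) * (\<Sum>m\<in>B. cnj (v k i) * L a i m * v l m)" for i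
      proof -
        have "(\<Sum>j\<in>B. cnj (v k i) * mat_mult B (L a) (L c) i j * v l j) =
            (\<Sum>j\<in>B. \<Sum>m\<in>B. cnj (v k i) * L a i m * (L c m j * v l j))"
          by (simp add: mat_mult_def sum_distrib_left sum_distrib_right mult.assoc)
        also have "\<dots> = (\<Sum>m\<in>B. \<Sum>j\<in>B. cnj (v k i) * L a i m * (L c m j * v l j))" by (rule sum.swap)
        also have "\<dots> = (\<Sum>m\<in>B. cnj (v k i) * L a i m * (of_real (s l) * v l m))"
          using eig[OF kl(2)] by (intro sum.cong refl) (simp add: sum_distrib_left[symmetric])
        finally show ?thesis by (simp add: sum_distrib_left mult_ac)
      qed
      then show ?thesis by (simp add: X_def sum_distrib_left)
    qed
    moreover have "(\<Sum>i\<in>B. \<Sum>j\<in>B. cnj (v k i) * mat_mult B (L c) (L a) i j * v l j) = of_real (s k) * X"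
    proof -
      have eig': "(\<Sum>i\<in>B. cnj (v k i) * L c i m) = of_real (s k) * cnj (v k m)" if m: "m \<in> B" for m
      proof -
        have "(\<Sum>i\<in>B. cnj (v k i) * L c i m) = cnj (\<Sum>i\<in>B. L c m i * v k i)"
          unfolding cnj_sum complex_cnj_mult
          by (intro sum.cong refl) (simp add: Cherm[of m] mult.commute)
        then show ?thesis using eig[OF kl(1) m] by simp
      qed
      have "(\<Sum>i\<in>B. \<Sum>j\<in>B. cnj (v k i) * mat_mult B (L c) (L a) i j * v l j) =
          (\<Sum>i\<in>B. \<Sum>j\<in>B. \<Sum>m\<in>B. (cnj (v k i) * L c i m) * (L a m j * v l j))"
        by (simp add: mat_mult_def sum_distrib_left sum_distrib_right mult.assoc)
      also have "\<dots> = (\<Sum>i\<in>B. \<Sum>m\<in>B. \<Sum>j\<in>B. (cnj (v k i) * L c i m) * (L a m j * v l j))"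
        by (rule sum.cong[OF refl]) (rule sum.swap)
      also have "\<dots> = (\<Sum>m\<in>B. \<Sum>i\<in>B. \<Sum>j\<in>B. (cnj (v k i) * L c i m) * (L a m j * v l j))"
        by (rule sum.swap)
      also have "\<dots> = (\<Sum>m\<in>B. (\<Sum>i\<in>B. cnj (v k i) * L c i m) * (\<Sum>j\<in>B. L a m j * v l j))"
        by (simp add: sum_product)
      also have "\<dots> = (\<Sum>m\<in>B. of_real (s k) * (\<Sum>j\<in>B. cnj (v k m) * L a m j * v l j))"
        using eig' by (intro sum.cong refl) (simp add: sum_distrib_left mult.assoc)
      finally show ?thesis by (simp add: X_def sum_distrib_left)
    qed
    ultimately have "of_real (s k) * X = of_real (s l) * X" by (simp only: CL)
    then have "X = 0 \<or> s k = s l" by simp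
    then show ?thesis using kl(3) by (simp add: X_def)
  qed
  have pvm: "mat_pvm B (\<lambda>a. L (Q a))"
    if Q: "\<And>a. Q a \<in> carrier F" "\<And>a. star F (Q a) = Q a" "\<And>a. Q a \<otimes> Q a = Q a" "(\<Oplus>a\<in>UNIV. Q a) = \<one>"
    for Q :: "'t::finite \<Rightarrow> 'a"
    unfolding mat_pvm_def
  proof (intro conjI allI ballI)
    fix a i j
    show "L (Q a) j i = cnj (L (Q a) i j)" using Lstar[OF Q(1), of a j i] Q(2) by simp
    show "(\<Sum>k\<in>B. L (Q a) i k * L (Q a) k j) = L (Q a) i j"
      using Lmult[OF Q(1) Q(1), of a a i j] Q(3) by (simp add: mat_mult_def)
  next
    fix i j assume "i \<in> B" "j \<in> B"
    then show "(\<Sum>a\<in>UNIV. L (Q a) i j) = (if i = j then 1 else 0)"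
      using Lsum[of UNIV Q i j] Q(1,4) Lone by simp
  qed
  show ?thesis
  proof (rule matrix_trace_in_hull[OF B(1) I von res, where P = "\<lambda>x a. L (E x a)" and Q = "\<lambda>y b. L (D y b)"])
    show "mat_pvm B (\<lambda>a. L (E x a))" for x by (rule pvm) (rule E)+
    show "mat_pvm B (\<lambda>b. L (D y b))" for y by (rule pvm) (rule D)+
    show "(\<Sum>i\<in>B. \<Sum>j\<in>B. cnj (v k i) * L (E x a) i j * v l j) = 0"
      if "k \<in> I" "l \<in> I" "s k \<noteq> s l" for x a k l by (rule block[OF E(1) that])
    show "(\<Sum>i\<in>B. \<Sum>j\<in>B. cnj (v k i) * L (D y b) i j * v l j) = 0"
      if "k \<in> I" "l \<in> I" "s k \<noteq> s l" for y b k l by (rule block[OF D(1) that])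
    show "(\<Sum>k\<in>I. 1 / s k) = 1"
    proof -
      have "(\<Sum>i\<in>B. \<Sum>j\<in>B. cnj (v k i) * L \<one> i j * v k j) = 1" if k: "k \<in> I" for k
      proof -
        have "(\<Sum>i\<in>B. \<Sum>j\<in>B. cnj (v k i) * L \<one> i j * v k j) = (\<Sum>i\<in>B. \<Sum>j\<in>B. if i = j then cnj (v k i) * v k i else 0)"
          using Lone by (intro sum.cong refl) auto
        also have "\<dots> = (\<Sum>i\<in>B. cnj (v k i) * v k i)" using B(1) by simp
        finally show ?thesis using von[OF k k] by simp
      qed
      then have "complex_of_real (\<Sum>k\<in>I. 1 / s k) = of_real 1" using tau[OF F_one_closed] \<tau>_one by simp
      then show ?thesis by (simp only: of_real_eq_iff)
    qed
    show "complex_of_real (p $ (x, y, a, b)) =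
      (\<Sum>k\<in>I. of_real (1 / s k) * (\<Sum>i\<in>B. \<Sum>j\<in>B. cnj (v k i) * mat_mult B (L (E x a)) (L (D y b)) i j * v k j))"
      for x y a b
      using tau[of "E x a \<otimes> D y b"] E(1) D(1) by (simp add: p Lmult)
  qed (use I in auto)
qed

end

section \<open>Equivalence of the correlation classes\<close>

lemma game_class_const_eqI:
  assumes "f - h \<in> game_relators lam"
  shows "game_class lam (\<lambda>_. f) = game_class lam (\<lambda>_. h)"
  using game_relI[of "\<lambda>_. f" lam "\<lambda>_. h" "\<lambda>_. 0"] game_seminorm_relator[OF assms]
  by (simp add: game_class_eq_iff game_cauchy_const)

text \<open>
  The images of the generators are projections that satisfy the relations of the game; those
  for losing answers give the zeros of \<open>p\<close>.
\<close>

lemma trace_representation_imp_hull: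
  fixes lam :: "'x::finite \<Rightarrow> 'y::finite \<Rightarrow> 'a::finite \<Rightarrow> 'b::finite \<Rightarrow> nat"
    and p :: "real ^ ('x \<times> 'y \<times> 'a \<times> 'b)"
  assumes F: "cstar_algebra F" "fin_dim F" "tracial_state F \<tau>"
    and hom: "unital_star_hom (game_cstar lam) F \<pi>"
    and p: "\<And>x y a b. complex_of_real (p $ (x, y, a, b)) =
      \<tau> (\<pi> (game_gen lam (Pgen x a) \<otimes>\<^bsub>game_cstar lam\<^esub> game_gen lam (Qgen y b)))"
  shows "p \<in> perfect lam (convex hull tracial_correlations)"
proof -
  interpret trace_algebra F \<tau>
    by (intro trace_algebra.intro trace_algebra_axioms.intro F)
  let ?K = "\<lambda>f. game_class lam (\<lambda>_. f)"
  have K_in: "?K f \<in> carrier (game_cstar lam)" for f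
    unfolding game_carrier using game_cauchy_const by blast
  have ring: "\<pi> \<in> ring_hom (game_cstar lam) F"
    and star: "\<And>u. u \<in> carrier (game_cstar lam) \<Longrightarrow> \<pi> (star (game_cstar lam) u) = star F (\<pi> u)"
    using hom unfolding unital_star_hom_def by blast+
  define \<rho> where "\<rho> f = \<pi> (?K f)" for f
  have closed: "\<rho> f \<in> carrier F" for f
    unfolding \<rho>_def by (rule ring_hom_closed[OF ring K_in])
  have \<rho>_mult: "\<rho> (f * h) = \<rho> f \<otimes>\<^bsub>F\<^esub> \<rho> h" for f h
    using ring_hom_mult[OF ring K_in K_in, of f h]
    by (simp add: \<rho>_def game_class_mult game_cauchy_const)
  have \<rho>_add: "\<rho> (f + h) = \<rho> f \<oplus>\<^bsub>F\<^esub> \<rho> h" for f h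
    using ring_hom_add[OF ring K_in K_in, of f h]
    by (simp add: \<rho>_def game_class_add game_cauchy_const)
  have \<rho>_one: "\<rho> 1 = \<one>\<^bsub>F\<^esub>"
    using ring_hom_one[OF ring] by (simp add: \<rho>_def game_class_one)
  have \<rho>_star: "\<rho> (free_star f) = star F (\<rho> f)" for f
    using star[OF K_in, of f] by (simp add: \<rho>_def game_class_star game_cauchy_const)
  have \<rho>_zero: "\<rho> 0 = \<zero>\<^bsub>F\<^esub>"
    using \<rho>_add[of 0 0] closed[of 0] by simp
  have \<rho>_sum: "\<rho> (\<Sum>t\<in>T. f t) = (\<Oplus>\<^bsub>F\<^esub>t\<in>T. \<rho> (f t))" if "finite T" for T :: "'t set" and f
    using that
  proof (induction T rule: finite_induct)
    case empty
    then show ?case by (simp add: \<rho>_zero)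
  next
    case (insert t T)
    have "(\<Oplus>\<^bsub>F\<^esub>t\<in>insert t T. \<rho> (f t)) = \<rho> (f t) \<oplus>\<^bsub>F\<^esub> (\<Oplus>\<^bsub>F\<^esub>t\<in>T. \<rho> (f t))"
      by (rule F_finsum_insert) (use insert closed in auto)
    then show ?case using insert by (simp add: \<rho>_add)
  qed
  have rel: "\<rho> f = \<rho> h" if "f - h \<in> game_relators lam" for f h
    unfolding \<rho>_def by (simp only: game_class_const_eqI[OF that])
  have idem: "\<rho> (gen g) \<otimes>\<^bsub>F\<^esub> \<rho> (gen g) = \<rho> (gen g)" for g
    unfolding \<rho>_mult[symmetric] by (rule rel) (auto simp: game_relators_def)
  have self: "star F (\<rho> (gen g)) = \<rho> (gen g)" for g
    using \<rho>_star[of "gen g"] by simp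
  have sumP: "(\<Oplus>\<^bsub>F\<^esub>a\<in>UNIV. \<rho> (gen (Pgen x a))) = \<one>\<^bsub>F\<^esub>" for x
    unfolding \<rho>_one[symmetric] \<rho>_sum[OF finite, symmetric] by (rule rel) (auto simp: game_relators_def)
  have sumQ: "(\<Oplus>\<^bsub>F\<^esub>b\<in>UNIV. \<rho> (gen (Qgen y b))) = \<one>\<^bsub>F\<^esub>" for y
    unfolding \<rho>_one[symmetric] \<rho>_sum[OF finite, symmetric] by (rule rel) (auto simp: game_relators_def)
  have val: "complex_of_real (p $ (x, y, a, b)) = \<tau> (\<rho> (gen (Pgen x a)) \<otimes>\<^bsub>F\<^esub> \<rho> (gen (Qgen y b)))" for x y a b
    unfolding p \<rho>_mult[symmetric] by (simp add: \<rho>_def game_gen_class game_class_mult game_cauchy_const)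
  have "p \<in> convex hull tracial_correlations"
    by (rule tracial_projections_in_hull[OF F(2),
          where E = "\<lambda>x a. \<rho> (gen (Pgen x a))" and D = "\<lambda>y b. \<rho> (gen (Qgen y b))"])
      (simp_all add: closed self idem sumP sumQ val)
  moreover have "p $ (x, y, a, b) = 0" if "lam x y a b = 0" for x y a b
  proof -
    have "\<rho> (gen (Pgen x a) * gen (Qgen y b)) = \<rho> 0"
    proof (rule rel)
      have "gen (Pgen x a) * gen (Qgen y b) \<in> game_relators lam"
        using that unfolding game_relators_def by blast
      then show "gen (Pgen x a) * gen (Qgen y b) - 0 \<in> game_relators lam" by simp
    qed
    then have "complex_of_real (p $ (x, y, a, b)) = \<tau> \<zero>\<^bsub>F\<^esub>"
      unfolding val \<rho>_mult[symmetric] \<rho>_zero by simp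
    also have "\<dots> = 0" using \<tau>_smult[of "\<zero>\<^bsub>F\<^esub>" 0] by simp
    finally show ?thesis by simp
  qed
  ultimately show ?thesis unfolding perfect_def by blast
qed

theorem theorem5p3:
  fixes lam :: "'x::finite \<Rightarrow> 'y::finite \<Rightarrow> 'a::finite \<Rightarrow> 'b::finite \<Rightarrow> nat"
    and p :: "real ^ ('x \<times> 'y \<times> 'a \<times> 'b)"
  assumes "imitation_game lam" and "nonsignalling p"
  shows "(p \<in> perfect lam (C_qs TYPE('i + nat \<Rightarrow> complex)) \<longleftrightarrow>
          p \<in> perfect lam (C_q TYPE('i + nat \<Rightarrow> complex))) \<and>
         (p \<in> perfect lam (C_q TYPE('i + nat \<Rightarrow> complex)) \<longleftrightarrow>
          p \<in> perfect lam (C_qm TYPE('i + nat \<Rightarrow> complex))) \<and>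
         (p \<in> perfect lam (C_qm TYPE('i + nat \<Rightarrow> complex)) \<longleftrightarrow>
          carrier (game_cstar lam) \<noteq> {\<zero>\<^bsub>game_cstar lam\<^esub>} \<and>
          (\<exists>(F :: ('j + nat \<Rightarrow> complex) cstar) \<tau> \<pi>.
             cstar_algebra F \<and> fin_dim F \<and> tracial_state F \<tau> \<and>
             unital_star_hom (game_cstar lam) F \<pi> \<and>
             (\<forall>x y a b. complex_of_real (p $ (x, y, a, b)) =
                \<tau> (\<pi> (game_gen lam (Pgen x a) \<otimes>\<^bsub>game_cstar lam\<^esub> game_gen lam (Qgen y b))))))"
    (is "(?qs \<longleftrightarrow> ?q) \<and> (?q \<longleftrightarrow> ?qm) \<and> (?qm \<longleftrightarrow> ?trace)")
proof -
  let ?hull = "p \<in> perfect lam (convex hull tracial_correlations)"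
  have mono: "C \<subseteq> D \<Longrightarrow> p \<in> perfect lam C \<Longrightarrow> p \<in> perfect lam D" for C D
    unfolding perfect_def by blast
  have zero: "p \<in> perfect lam C \<Longrightarrow> lam x y a b = 0 \<Longrightarrow> p $ (x, y, a, b) = 0" for C x y a b
    unfolding perfect_def by blast
  have "?q \<Longrightarrow> ?qs" by (rule mono[OF C_q_subset_C_qs])
  moreover have "?qs \<Longrightarrow> ?hull"
    using perfect_C_qs_in_hull[OF assms(1)] unfolding perfect_def by blast
  moreover have "?qm \<Longrightarrow> ?hull"
    using perfect_C_qm_in_hull[OF assms(1)] unfolding perfect_def by blast
  moreover have "?hull \<Longrightarrow> ?qm" by (rule mono[OF hull_tracial_subset_C_qm])
  moreover have "?hull \<Longrightarrow> ?q"
    by (rule mono[OF subset_trans[OF hull_tracial_subset_weighted weighted_subset_C_q]])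
  moreover have ?trace if h: ?hull
  proof -
    have "p \<in> weighted_correlations"
      using h hull_tracial_subset_weighted unfolding perfect_def by blast
    then obtain B w P Q where "weighted_correlation B w P Q p"
      unfolding weighted_correlations_def by blast
    then show ?thesis by (rule weighted_imp_trace_representation) (rule zero[OF h])
  qed
  moreover have ?hull if t: ?trace
    using t by (elim conjE exE) (rule trace_representation_imp_hull, blast+)
  ultimately show ?thesis by blast
qed

end
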